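(* Assume conditions (A.1), (A.2), (A.3) stated in the context. Then for any positive sequence $(\epsilon(n))$ in $(0,1)$ with $\epsilon(n)\to 0$ there exists a subsequence $(\epsilon'(n))$ of $(\epsilon(n))$ such that $\mu_{\epsilon'(n)}$ converges weakly on $F_{b,0}(X)$ as $n\to\infty$ (i.e. $\mu_{\epsilon'(n)}(f)$ converges for every $f\in F_{b,0}(X)$), and the limit has the form $\sum_{k=1}^{m_0}\delta(k)\,\mu(U(k),\cdot)$ for some numbers $\delta(1),\dots,\delta(m_0)$ with $\sum_{k=1}^{m_0}\delta(k)\le 1$.
   Context: **Shift space.** $S$ is a countable set, $A=(A(ij))_{i,j\in S}$ a zero-one matrix, $X=X_A=\{\omega=\omega_0\omega_1\cdots\in\prod_{n\ge 0}S: A(\omega_k\omega_{k+1})=1\ \forall k\ge 0\}$ with the product topology ($S$ discrete), and $\sigma:X\to X$ the left shift. A word $w_1\cdots w_n\in S^n$ is $A$-admissible if $A(w_iw_{i+1})=1$ for $1\le i<n$; $[w]=\{\omega\in X:\omega_0\cdots\omega_{n-1}=w\}$. $A$ is assumed irreducible: for all $a,b\in S$ there is an $A$-admissible word starting with $a$ and ending with $b$. Fix $\theta\in(0,1)$ and let $d_\theta(\omega,\upsilon)=\theta^{\min\{n:\omega_n\ne\upsilon_n\}}$ for $\omega\neq\upsilon$, $d_\theta(\omega,\omega)=0$. For $k\ge1$, $[f]_k=\sup\{|f(\omega)-f(\upsilon)|/d_\theta(\omega,\upsilon):\omega\ne\upsilon,\ \omega_0\cdots\omega_{k-1}=\upsilon_0\cdots\upsilon_{k-1}\}$.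 $F_b(X)$ is the Banach space of continuous $f:X\to\mathbb C$ with $\|f\|_1:=\|f\|_\infty+[f]_1<\infty$. For $Q\subset S$, $\Sigma_Q=\bigcup_{a\in Q}[a]$. $F_{b,0}(X)$ is the set of $f\in F_b(X)$ vanishing at infinity: for every $\eta>0$ there is a finite $Q\subset S$ with $|f|<\eta$ on $\Sigma_{S\setminus Q}$. $S_n\psi=\sum_{k=0}^{n-1}\psi\circ\sigma^k$. The topological pressure is $P(\psi)=\lim_{n\to\infty}\frac1n\log\sum_{w\in S^n:[w]\neq\emptyset}\exp(\sup_{[w]}S_n\psi)$, with $e^{-\infty}=0$; for a subshift $X_M\subset X$, $P(\psi|X_M)$ is defined in the same way on $X_M$. **Conditions** on functions $\varphi(\epsilon,\cdot):X\to\mathbb R$, $\epsilon\in(0,1)$: (A.1) $\sup_{\epsilon}[\varphi(\epsilon,\cdot)]_2<\infty$. (A.2) $\sum_{a\in S}\exp(\sup_{\epsilon>0}\sup_{\omega\in[a]}\varphi(\epsilon,\omega))<\infty$. (A.3) There is $\varphi:X\to\mathbb R\cup\{-\infty\}$ such that for each $a\in S$, $\sup_{\omega\in[a]}|e^{\varphi(\epsilon,\omega)}-e^{\varphi(\omega)}|\to0$ as $\epsilon\to0$, and $P(\varphi)$ is finite. **Components.** By (A.1), $\varphi$ is either finite on all of $[ij]$ or $-\infty$ on all of $[ij]$. Let $B(ij)=1$ if $[ij]\neq\emptyset$ and $\varphi$ is finite on $[ij]$, and $B(ij)=0$ otherwise. Write $a\leftrightarrow b$ if $a=b$ or there are words $w_1,w_2$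 with $a\cdot w_1\cdot b$ and $b\cdot w_2\cdot a$ $B$-admissible. For $U\in S/\!\!\leftrightarrow$, $B[U]$ is the submatrix of $B$ indexed by $U\times U$ and $X_{B[U]}\subset X$ the subshift with states $U$ and transition matrix $B[U]$. Put $\mathscr S_0=\{U\in S/\!\!\leftrightarrow: P(\varphi|X_{B[U]})=P(\varphi)\}$; this set is nonempty and finite, and is written $\{U(1),\dots,U(m_0)\}$. **RPF measures.** For a zero-one matrix $M\le A$ indexed by $S_0\subset S$ (extended by $0$), $\mathcal L_{M,\psi}f(\omega)=\sum_{a:M(a\omega_0)=1}e^{\psi(a\omega)}f(a\omega)$. If $M$ is irreducible and $X_M$ has a periodic point, let $\lambda=\exp P(\psi|X_M)$, $h\ge0$ and $\nu$ (a Borel probability measure on $X$ supported on $X_M$) be the Perron eigenvalue, eigenfunction and dual eigenvector: $\mathcal L_{M,\psi}h=\lambda h$, $\mathcal L_{M,\psi}^*\nu=\lambda\nu$, $\nu(h)=1$. The measure $h\nu$ is the Ruelle–Perron–Frobenius (RPF) measure of $\psi|X_M$. $\mu_\epsilon$ is the RPF measure for $M=A$, $\psi=\varphi(\epsilon,\cdot)$; $\mu(U,\cdot)$ is the RPF measure for $M=B[U]$, $\psi=\varphi$ ($U\in\mathscr S_0$). *)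

theory Defs
  imports "HOL-Analysis.Analysis"
begin

text \<open>
  The countable state set \<open>S\<close> is a type of class \<open>countable\<close> carrying the discrete topology, so that
  \<open>nat \<Rightarrow> 's\<close> has the product topology of the library.  Zero-one matrices are binary predicates; a
  matrix indexed by a subset of \<open>S\<close> is identified with its extension by zero.  Functions on a shift
  space are total functions of which only the values on that space are ever used.
\<close>

type_synonym 's word_seq = "nat \<Rightarrow> 's"

definition shift_space :: "('s \<Rightarrow> 's \<Rightarrow> bool) \<Rightarrow> 's word_seq set" where
  "shift_space M = {\<omega>. \<forall>k. M (\<omega> k) (\<omega> (Suc k))}"

definition shift :: "'s word_seq \<Rightarrow> 's word_seq" where
  "shift \<omega> = (\<lambda>n. \<omega> (Suc n))"

definition cylinder :: "('s \<Rightarrow> 's \<Rightarrow> bool) \<Rightarrow> 's list \<Rightarrow> 's word_seq set" where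
  "cylinder M w = {\<omega> \<in> shift_space M. \<forall>i < length w. \<omega> i = w ! i}"

definition irreducible_matrix :: "('s \<Rightarrow> 's \<Rightarrow> bool) \<Rightarrow> bool" where
  "irreducible_matrix M \<longleftrightarrow>
     (\<forall>a b. \<exists>w. w \<noteq> [] \<and> successively M w \<and> hd w = a \<and> last w = b)"

definition d_theta :: "real \<Rightarrow> 's word_seq \<Rightarrow> 's word_seq \<Rightarrow> real" where
  "d_theta \<theta> \<omega> \<upsilon> = (if \<omega> = \<upsilon> then 0 else \<theta> ^ (LEAST n. \<omega> n \<noteq> \<upsilon> n))"

text \<open>The seminorm \<open>[f]\<^sub>k\<close>, with values in \<open>[0,\<infinity>]\<close>.\<close>

definition lip_seminorm ::
  "real \<Rightarrow> 's word_seq set \<Rightarrow> nat \<Rightarrow> ('s word_seq \<Rightarrow> 'b::real_normed_vector) \<Rightarrow> ennreal" where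
  "lip_seminorm \<theta> X k f =
     (SUP (\<omega>, \<upsilon>) \<in> {(\<omega>, \<upsilon>). \<omega> \<in> X \<and> \<upsilon> \<in> X \<and> \<omega> \<noteq> \<upsilon> \<and> (\<forall>i<k. \<omega> i = \<upsilon> i)}.
        ennreal (norm (f \<omega> - f \<upsilon>) / d_theta \<theta> \<omega> \<upsilon>))"

definition sup_norm :: "'s word_seq set \<Rightarrow> ('s word_seq \<Rightarrow> 'b::real_normed_vector) \<Rightarrow> ennreal" where
  "sup_norm X f = (SUP \<omega>\<in>X. ennreal (norm (f \<omega>)))"

definition Fb ::
  "real \<Rightarrow> 's::discrete_topology word_seq set \<Rightarrow> ('s word_seq \<Rightarrow> complex) set" where
  "Fb \<theta> X = {f. continuous_on X f \<and> sup_norm X f + lip_seminorm \<theta> X 1 f < \<infinity>}"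

definition Fb0 ::
  "real \<Rightarrow> 's::discrete_topology word_seq set \<Rightarrow> ('s word_seq \<Rightarrow> complex) set" where
  "Fb0 \<theta> X = {f \<in> Fb \<theta> X. \<forall>\<eta>>0. \<exists>Q. finite Q \<and> (\<forall>\<omega>\<in>X. \<omega> 0 \<notin> Q \<longrightarrow> norm (f \<omega>) < \<eta>)}"

text \<open>Exponential and logarithm with the usual conventions at \<open>\<plusminus>\<infinity>\<close> and at \<open>0\<close>.\<close>

definition eexp :: "ereal \<Rightarrow> ennreal" where
  "eexp x = (if x = -\<infinity> then 0 else if x = \<infinity> then \<infinity> else ennreal (exp (real_of_ereal x)))"

definition elog :: "ennreal \<Rightarrow> ereal" where
  "elog z = (if z = 0 then -\<infinity> else if z = \<infinity> then \<infinity> else ereal (ln (enn2real z)))"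

definition birkhoff_sum :: "('s word_seq \<Rightarrow> ereal) \<Rightarrow> nat \<Rightarrow> 's word_seq \<Rightarrow> ereal" where
  "birkhoff_sum \<psi> n \<omega> = (\<Sum>k<n. \<psi> ((shift ^^ k) \<omega>))"

text \<open>\<open>pressure M \<psi>\<close> is \<open>P(\<psi>|X\<^sub>M)\<close>: words and suprema refer to cylinders of \<open>X\<^sub>M\<close> itself.\<close>

definition pressure :: "('s \<Rightarrow> 's \<Rightarrow> bool) \<Rightarrow> ('s word_seq \<Rightarrow> ereal) \<Rightarrow> ereal" where
  "pressure M \<psi> = lim (\<lambda>n. ereal (1 / real n) *
     elog (\<Sum>\<^sub>\<infinity>w\<in>{w. length w = n \<and> cylinder M w \<noteq> {}}.
             eexp (SUP \<omega>\<in>cylinder M w. birkhoff_sum \<psi> n \<omega>)))"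

definition cond_A1 :: "real \<Rightarrow> ('s \<Rightarrow> 's \<Rightarrow> bool) \<Rightarrow> (real \<Rightarrow> 's word_seq \<Rightarrow> real) \<Rightarrow> bool" where
  "cond_A1 \<theta> A \<phi>e \<longleftrightarrow> (SUP \<epsilon>\<in>{0<..<1}. lip_seminorm \<theta> (shift_space A) 2 (\<phi>e \<epsilon>)) < \<infinity>"

definition cond_A2 :: "('s \<Rightarrow> 's \<Rightarrow> bool) \<Rightarrow> (real \<Rightarrow> 's word_seq \<Rightarrow> real) \<Rightarrow> bool" where
  "cond_A2 A \<phi>e \<longleftrightarrow>
     (\<Sum>\<^sub>\<infinity>a\<in>UNIV. eexp (SUP \<epsilon>\<in>{0<..<1}. SUP \<omega>\<in>cylinder A [a]. ereal (\<phi>e \<epsilon> \<omega>))) < \<infinity>"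

definition cond_A3 ::
  "('s \<Rightarrow> 's \<Rightarrow> bool) \<Rightarrow> (real \<Rightarrow> 's word_seq \<Rightarrow> real) \<Rightarrow> ('s word_seq \<Rightarrow> ereal) \<Rightarrow> bool" where
  "cond_A3 A \<phi>e \<phi> \<longleftrightarrow>
     (\<forall>\<omega>\<in>shift_space A. \<phi> \<omega> \<noteq> \<infinity>) \<and>
     (\<forall>a. ((\<lambda>\<epsilon>. SUP \<omega>\<in>cylinder A [a]. ennreal \<bar>exp (\<phi>e \<epsilon> \<omega>) - enn2real (eexp (\<phi> \<omega>))\<bar>)
             \<longlongrightarrow> 0) (at_right 0)) \<and>
     \<bar>pressure A \<phi>\<bar> \<noteq> \<infinity>"

definition B_matrix ::
  "('s \<Rightarrow> 's \<Rightarrow> bool) \<Rightarrow> ('s word_seq \<Rightarrow> ereal) \<Rightarrow> 's \<Rightarrow> 's \<Rightarrow> bool" where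
  "B_matrix A \<phi> i j \<longleftrightarrow>
     cylinder A [i, j] \<noteq> {} \<and> (\<forall>\<omega>\<in>cylinder A [i, j]. \<bar>\<phi> \<omega>\<bar> \<noteq> \<infinity>)"

definition communicating :: "('s \<Rightarrow> 's \<Rightarrow> bool) \<Rightarrow> ('s \<times> 's) set" where
  "communicating B = {(a, b). a = b \<or>
     (\<exists>w1 w2. successively B (a # w1 @ [b]) \<and> successively B (b # w2 @ [a]))}"

definition submatrix_on :: "('s \<Rightarrow> 's \<Rightarrow> bool) \<Rightarrow> 's set \<Rightarrow> 's \<Rightarrow> 's \<Rightarrow> bool" where
  "submatrix_on B U i j \<longleftrightarrow> i \<in> U \<and> j \<in> U \<and> B i j"

definition max_components :: "('s \<Rightarrow> 's \<Rightarrow> bool) \<Rightarrow> ('s word_seq \<Rightarrow> ereal) \<Rightarrow> 's set set" where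
  "max_components A \<phi> = {U \<in> UNIV // communicating (B_matrix A \<phi>).
     pressure (submatrix_on (B_matrix A \<phi>) U) \<phi> = pressure A \<phi>}"

text \<open>In \<open>\<L>\<^sub>M\<^sub>,\<^sub>\<psi>\<close>, the sequence \<open>a\<omega>\<close> is \<open>case_nat a \<omega>\<close>.\<close>

definition ruelle_op ::
  "('s \<Rightarrow> 's \<Rightarrow> bool) \<Rightarrow> ('s word_seq \<Rightarrow> ereal) \<Rightarrow> ('s word_seq \<Rightarrow> complex) \<Rightarrow> 's word_seq \<Rightarrow> complex"
  where
  "ruelle_op M \<psi> f \<omega> =
     (\<Sum>\<^sub>\<infinity>a\<in>{a. M a (\<omega> 0)}. of_real (enn2real (eexp (\<psi> (case_nat a \<omega>)))) * f (case_nat a \<omega>))"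

text \<open>
  \<open>is_RPF_measure \<theta> A M \<psi> \<mu>\<close>: \<open>\<mu>\<close> is the Ruelle--Perron--Frobenius measure \<open>h\<nu>\<close> of \<open>\<psi>|X\<^sub>M\<close>, as a Borel
  measure on \<open>X = X\<^sub>A\<close>.  The Ruelle operator acts on \<open>F\<^sub>b(X)\<close>; accordingly the eigenfunction is taken
  in \<open>F\<^sub>b(X)\<close> and the dual equation \<open>\<L>\<^sup>*\<nu> = \<lambda>\<nu>\<close> is tested against \<open>F\<^sub>b(X)\<close>.
\<close>

definition is_RPF_measure ::
  "real \<Rightarrow> ('s::{countable,discrete_topology} \<Rightarrow> 's \<Rightarrow> bool) \<Rightarrow> ('s \<Rightarrow> 's \<Rightarrow> bool) \<Rightarrow>
   ('s word_seq \<Rightarrow> ereal) \<Rightarrow> 's word_seq measure \<Rightarrow> bool" where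
  "is_RPF_measure \<theta> A M \<psi> \<mu> \<longleftrightarrow>
     (\<exists>(h :: 's word_seq \<Rightarrow> real) \<nu>.
        let X = shift_space A; l = enn2real (eexp (pressure M \<psi>)) in
          (\<forall>\<omega>\<in>X. 0 \<le> h \<omega>) \<and> (\<lambda>\<omega>. complex_of_real (h \<omega>)) \<in> Fb \<theta> X \<and>
          (\<forall>\<omega>\<in>X. ruelle_op M \<psi> (\<lambda>\<omega>. complex_of_real (h \<omega>)) \<omega> = of_real l * of_real (h \<omega>)) \<and>
          sets \<nu> = sets (restrict_space borel X) \<and> emeasure \<nu> X = 1 \<and>
          (AE \<omega> in \<nu>. \<omega> \<in> shift_space M) \<and>
          (\<forall>f\<in>Fb \<theta> X. (LINT \<omega>|\<nu>. ruelle_op M \<psi> f \<omega>) = of_real l * (LINT \<omega>|\<nu>. f \<omega>)) \<and>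
          (LINT \<omega>|\<nu>. h \<omega>) = 1 \<and>
          \<mu> = density \<nu> (\<lambda>\<omega>. ennreal (h \<omega>)))"

end

theory Submission
  imports Defs "HOL-Library.Diagonal_Subsequence"
begin

text \<open>
  Write \<open>p = e\<^sup>\<phi>\<close>, so that \<open>p = 0\<close> where \<open>\<phi> = -\<infinity>\<close>, and let \<open>L\<close> be the transfer operator of \<open>p\<close> on \<open>X\<close>.
  Everything is read off from operators acting on positive functions with bounded distortion
  (\<open>f \<omega> \<le> exp (c \<theta>\<^sup>k) f \<upsilon>\<close> when \<open>\<omega>, \<upsilon>\<close> agree in their first \<open>k\<close> letters), a cone preserved by \<open>L\<close>.
  The pressure is the logarithm of the exponential growth rate of \<open>L\<^sup>n 1\<close>. Cutting words at their first
  and last visit of a state shows that this rate is attained by the loops at some state, and loops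
  bound the eigenvalues \<open>\<lambda>\<^sub>\<epsilon>\<close> from below; hence \<open>\<lambda>\<^sub>\<epsilon> \<rightarrow> exp P(\<phi>)\<close>.
  An exponential moment estimate for the occupation time of far away states gives tightness of \<open>\<mu>\<^sub>\<epsilon>\<close>,
  uniformly in \<open>\<epsilon>\<close>. By recurrence, a cylinder keeps mass in the limit only if the loops through it
  grow at the full rate, that is, only if it meets \<open>X\<close> restricted to some \<open>U\<close> in \<open>\<S>\<^sub>0\<close>.
  On such a component a positive superharmonic function is a multiple of the Perron eigenfunction
  (truncate it and integrate against the invariant measure), so the eigenfunctions of the perturbed
  operators, suitably rescaled, converge there, and Cesaro means of the normalised operators of
  the component tend to its Perron measure. Fatou's lemma carries this over to small \<open>\<epsilon>\<close>:
  \<open>\<mu>\<^sub>\<epsilon>(f)\<close> is asymptotic to the sum of \<open>\<mu>\<^sub>\<epsilon>(\<Sigma>\<^sub>U) \<mu>(U, f)\<close> over \<open>U\<close>, and it remains to extract a subsequence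
  along which the finitely many weights \<open>\<mu>\<^sub>\<epsilon>(\<Sigma>\<^sub>U)\<close> converge.
\<close>

section \<open>Transfer operators and distortion\<close>

text \<open>Neither a spectral gap nor convergence of the full perturbed eigenvectors is available:
  \<open>p\<close> may vanish on whole cylinders, the limit operator may be reducible with several
  components of the same maximal rate, and the sizes of a perturbed eigenfunction on two components
  need not stay comparable. What survives is compactness: (A.1) and (A.2) give one distortion
  constant and one summable majorant for all \<epsilon> and for the limit, so all positive functions
  involved lie in one cone, whose pointwise bounded sequences have convergent subsequences. Each
  eigenfunction is therefore normalised at a point of one component, and its limit is identified
  there by uniqueness of positive superharmonic functions. Components may be periodic, hence the
  Cesaro means. The means keep the integral against the perturbed dual measure, which turns
  convergence of functions on a component into an asymptotic formula for measures. Applied to the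
  constant 1, this formula shows that no mass escapes, so the weights found add up to exactly
  1.\<close>

definition agree :: "nat \<Rightarrow> (nat \<Rightarrow> 's) \<Rightarrow> (nat \<Rightarrow> 's) \<Rightarrow> bool" where
  "agree k \<omega> \<upsilon> \<longleftrightarrow> (\<forall>i<k. \<omega> i = \<upsilon> i)"

lemma agree_refl [simp]: "agree k \<omega> \<omega>"
  by (simp add: agree_def)

lemma agree_sym: "agree k \<omega> \<upsilon> \<Longrightarrow> agree k \<upsilon> \<omega>"
  by (simp add: agree_def)

lemma agree_mono: "agree k \<omega> \<upsilon> \<Longrightarrow> j \<le> k \<Longrightarrow> agree j \<omega> \<upsilon>"
  by (simp add: agree_def)

lemma agree_trans: "agree k \<omega> \<upsilon> \<Longrightarrow> agree k \<upsilon> \<xi> \<Longrightarrow> agree k \<omega> \<xi>"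
  by (simp add: agree_def)

lemma agree_zeroth: "agree k \<omega> \<upsilon> \<Longrightarrow> 1 \<le> k \<Longrightarrow> \<omega> 0 = \<upsilon> 0"
  by (simp add: agree_def)

lemma agree_Cons: "agree k \<omega> \<upsilon> \<Longrightarrow> agree (Suc k) (case_nat a \<omega>) (case_nat a \<upsilon>)"
  by (auto simp: agree_def split: nat.split)

lemma agree_Suc_iff: "agree (Suc k) \<omega> \<upsilon> \<longleftrightarrow> \<omega> 0 = \<upsilon> 0 \<and> agree k (shift \<omega>) (shift \<upsilon>)"
  by (auto simp: agree_def shift_def less_Suc_eq_0_disj)

lemma agree_one [simp]: "agree (Suc 0) \<omega> \<upsilon> \<longleftrightarrow> \<omega> 0 = \<upsilon> 0"
  by (simp add: agree_def)

lemma shift_Cons [simp]: "shift (case_nat a \<omega>) = \<omega>"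
  by (simp add: shift_def)

lemma Cons_shift [simp]: "case_nat (\<omega> 0) (shift \<omega>) = \<omega>"
  by (auto simp: shift_def fun_eq_iff split: nat.split)

lemma funpow_shift: "(shift ^^ k) \<omega> = (\<lambda>i. \<omega> (i + k))"
  by (induction k) (auto simp: shift_def)

lemma Cons_in_shift_space:
  "\<omega> \<in> shift_space M \<Longrightarrow> M a (\<omega> 0) \<Longrightarrow> case_nat a \<omega> \<in> shift_space M"
  by (auto simp: shift_space_def split: nat.split)

lemma shift_in_shift_space: "\<omega> \<in> shift_space M \<Longrightarrow> shift \<omega> \<in> shift_space M"
  by (auto simp: shift_space_def shift_def)

lemma shift_space_0: "\<omega> \<in> shift_space M \<Longrightarrow> M (\<omega> 0) (shift \<omega> 0)"
  by (auto simp: shift_space_def shift_def)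

lemma shift_space_mono: "M \<le> A \<Longrightarrow> shift_space M \<subseteq> shift_space A"
  by (auto simp: shift_space_def le_fun_def)

definition transfer ::
  "('s \<Rightarrow> 's \<Rightarrow> bool) \<Rightarrow> ((nat \<Rightarrow> 's) \<Rightarrow> real) \<Rightarrow> ((nat \<Rightarrow> 's) \<Rightarrow> real) \<Rightarrow> (nat \<Rightarrow> 's) \<Rightarrow> real" where
  "transfer M p f \<omega> = (\<Sum>\<^sub>\<infinity>a\<in>{a. M a (\<omega> 0)}. p (case_nat a \<omega>) * f (case_nat a \<omega>))"

definition ind :: "nat \<Rightarrow> (nat \<Rightarrow> 's) \<Rightarrow> (nat \<Rightarrow> 's) \<Rightarrow> real" where
  "ind k \<upsilon> \<omega> = (if agree k \<upsilon> \<omega> then 1 else 0)"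

definition state_ind :: "'s \<Rightarrow> (nat \<Rightarrow> 's) \<Rightarrow> real" where
  "state_ind a \<omega> = (if \<omega> 0 = a then 1 else 0)"

text \<open>The constant \<open>K\<close> bounds both the supremum and \<open>[f]\<^sub>1\<close>; in terms of \<open>agree\<close>, \<open>d\<^sub>\<theta>\<close> is replaced by
  all the powers \<open>\<theta>\<^sup>k\<close> above it.\<close>

definition lip_on ::
  "real \<Rightarrow> (nat \<Rightarrow> 's) set \<Rightarrow> real \<Rightarrow> ((nat \<Rightarrow> 's) \<Rightarrow> 'b::real_normed_vector) \<Rightarrow> bool" where
  "lip_on \<theta> X K f \<longleftrightarrow> (\<forall>\<omega>\<in>X. norm (f \<omega>) \<le> K) \<and>
     (\<forall>k\<ge>1. \<forall>\<omega>\<in>X. \<forall>\<upsilon>\<in>X. agree k \<omega> \<upsilon> \<longrightarrow> norm (f \<omega> - f \<upsilon>) \<le> K * \<theta> ^ k)"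

text \<open>The index \<open>m\<close> is the number of letters that must agree before a comparison
  is demanded: the indicator of a cylinder of length \<open>k\<close> qualifies for
  \<open>m = k\<close>, and each application of a transfer operator lowers \<open>m\<close> by one,
  down to 1.\<close>

definition cone_on ::
  "real \<Rightarrow> (nat \<Rightarrow> 's) set \<Rightarrow> nat \<Rightarrow> real \<Rightarrow> ((nat \<Rightarrow> 's) \<Rightarrow> real) \<Rightarrow> bool" where
  "cone_on \<theta> X m c f \<longleftrightarrow> (\<forall>\<omega>\<in>X. 0 \<le> f \<omega>) \<and>
     (\<forall>k\<ge>m. \<forall>\<omega>\<in>X. \<forall>\<upsilon>\<in>X. agree k \<omega> \<upsilon> \<longrightarrow> f \<omega> \<le> exp (c * \<theta> ^ k) * f \<upsilon>)"

text \<open>\<open>C\<close> comes from (A.1) and \<open>q\<close> from (A.2), so both serve all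
  perturbed potentials and the limit at once. The distortion bound is multiplicative, hence passes
  to limits and allows \<open>p\<close> to vanish; it starts at two agreeing letters because the
  seminorm in (A.1) does.\<close>

locale potential =
  fixes \<theta> :: real and A :: "'s::{countable,discrete_topology} \<Rightarrow> 's \<Rightarrow> bool"
    and p :: "(nat \<Rightarrow> 's) \<Rightarrow> real" and C :: real and q :: "'s \<Rightarrow> real"
  assumes theta: "0 < \<theta>" "\<theta> < 1" and C_nonneg: "0 \<le> C"
    and p_nonneg: "\<omega> \<in> shift_space A \<Longrightarrow> 0 \<le> p \<omega>"
    and p_le: "\<omega> \<in> shift_space A \<Longrightarrow> p \<omega> \<le> q (\<omega> 0)"
    and q_nonneg: "0 \<le> q a" and q_summable: "q summable_on UNIV"
    and p_dist: "\<omega> \<in> shift_space A \<Longrightarrow> \<upsilon> \<in> shift_space A \<Longrightarrow> 2 \<le> k \<Longrightarrow> agree k \<omega> \<upsilon> \<Longrightarrow>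
      p \<omega> \<le> exp (C * \<theta> ^ k) * p \<upsilon>"
begin

abbreviation X where "X \<equiv> shift_space A"
abbreviation cone where "cone \<equiv> cone_on \<theta> X"
abbreviation lip :: "real \<Rightarrow> ((nat \<Rightarrow> 's) \<Rightarrow> real) \<Rightarrow> bool" where "lip \<equiv> lip_on \<theta> X"

definition bdd :: "((nat \<Rightarrow> 's) \<Rightarrow> real) \<Rightarrow> bool" where
  "bdd f \<longleftrightarrow> (\<exists>K. \<forall>\<omega>\<in>X. \<bar>f \<omega>\<bar> \<le> K)"

definition qsum where "qsum = (\<Sum>\<^sub>\<infinity>a. q a)"

lemma qsum_nonneg: "0 \<le> qsum"
  unfolding qsum_def by (rule infsum_nonneg) (use q_nonneg in auto)

lemma bddI: "(\<And>\<omega>. \<omega> \<in> X \<Longrightarrow> \<bar>f \<omega>\<bar> \<le> K) \<Longrightarrow> bdd f"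
  by (auto simp: bdd_def)

lemma bddE: assumes "bdd f" obtains K where "0 \<le> K" "\<And>\<omega>. \<omega> \<in> X \<Longrightarrow> \<bar>f \<omega>\<bar> \<le> K"
proof -
  obtain K where "\<forall>\<omega>\<in>X. \<bar>f \<omega>\<bar> \<le> K" using assms by (auto simp: bdd_def)
  then show ?thesis by (intro that[of "max 0 K"]) auto
qed

lemma bdd_const [simp]: "bdd (\<lambda>_. c)"
  by (rule bddI[of _ "\<bar>c\<bar>"]) auto

lemma bdd_add: assumes "bdd f" "bdd g" shows "bdd (\<lambda>\<omega>. f \<omega> + g \<omega>)"
proof -
  obtain K where "0 \<le> K" "\<And>\<omega>. \<omega> \<in> X \<Longrightarrow> \<bar>f \<omega>\<bar> \<le> K" using bddE[OF assms(1)] by blast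
  moreover obtain K' where "0 \<le> K'" "\<And>\<omega>. \<omega> \<in> X \<Longrightarrow> \<bar>g \<omega>\<bar> \<le> K'" using bddE[OF assms(2)] by blast
  ultimately show ?thesis by (intro bddI[of _ "K + K'"]) (smt (verit))
qed

lemma bdd_mult: assumes "bdd f" "bdd g" shows "bdd (\<lambda>\<omega>. f \<omega> * g \<omega>)"
proof -
  obtain K where "0 \<le> K" "\<And>\<omega>. \<omega> \<in> X \<Longrightarrow> \<bar>f \<omega>\<bar> \<le> K" using bddE[OF assms(1)] by blast
  moreover obtain K' where "0 \<le> K'" "\<And>\<omega>. \<omega> \<in> X \<Longrightarrow> \<bar>g \<omega>\<bar> \<le> K'" using bddE[OF assms(2)] by blast
  ultimately show ?thesis by (intro bddI[of _ "K * K'"]) (simp add: abs_mult mult_mono)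
qed

lemma bdd_cmult: "bdd f \<Longrightarrow> bdd (\<lambda>\<omega>. c * f \<omega>)"
  by (rule bdd_mult) auto

lemma bdd_diff: assumes "bdd f" "bdd g" shows "bdd (\<lambda>\<omega>. f \<omega> - g \<omega>)"
  using bdd_add[OF assms(1) bdd_cmult[OF assms(2), of "-1"]] by simp

lemma bdd_le: "bdd g \<Longrightarrow> (\<And>\<omega>. \<omega> \<in> X \<Longrightarrow> \<bar>f \<omega>\<bar> \<le> g \<omega>) \<Longrightarrow> bdd f"
  by (metis abs_ge_self bddE bddI order_trans)

lemma lip_bdd: "lip K f \<Longrightarrow> bdd f"
  by (rule bddI[of _ K]) (auto simp: lip_on_def)

lemma Cons_in_X: "M \<le> A \<Longrightarrow> \<omega> \<in> X \<Longrightarrow> M a (\<omega> 0) \<Longrightarrow> case_nat a \<omega> \<in> X"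
  by (auto intro: Cons_in_shift_space simp: le_fun_def)

section \<open>Summability, positivity and monotonicity of transfer operators and their
  iterates\<close>

lemma transfer_summable:
  assumes "M \<le> A" "bdd f" "\<omega> \<in> X"
  shows "(\<lambda>a. p (case_nat a \<omega>) * f (case_nat a \<omega>)) summable_on {a. M a (\<omega> 0)}"
proof -
  obtain K where K: "0 \<le> K" "\<And>\<omega>. \<omega> \<in> X \<Longrightarrow> \<bar>f \<omega>\<bar> \<le> K" using bddE[OF assms(2)] by blast
  have "(\<lambda>a. K * q a) summable_on {a. M a (\<omega> 0)}"
    by (intro summable_on_cmult_right summable_on_subset_banach[OF q_summable]) auto
  then have "(\<lambda>a. norm (p (case_nat a \<omega>) * f (case_nat a \<omega>))) summable_on {a. M a (\<omega> 0)}"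
  proof (rule Infinite_Sum.abs_summable_on_comparison_test'[where g = "\<lambda>a. K * q a"])
    fix a assume "a \<in> {a. M a (\<omega> 0)}"
    then have "case_nat a \<omega> \<in> X" using Cons_in_X assms by blast
    then show "norm (p (case_nat a \<omega>) * f (case_nat a \<omega>)) \<le> K * q a"
      using K(2) p_le[of "case_nat a \<omega>"] p_nonneg[of "case_nat a \<omega>"] K(1) q_nonneg
      by (subst mult.commute) (auto simp: abs_mult intro!: mult_mono)
  qed
  then show ?thesis by (rule abs_summable_summable)
qed

lemma transfer_has_sum:
  assumes "M \<le> A" "bdd f" "\<omega> \<in> X"
  shows "((\<lambda>a. p (case_nat a \<omega>) * f (case_nat a \<omega>)) has_sum transfer M p f \<omega>) {a. M a (\<omega> 0)}"
  unfolding transfer_def by (rule has_sum_infsum[OF transfer_summable[OF assms]])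

lemma transfer_cong:
  assumes "M \<le> A" "\<And>\<omega>. \<omega> \<in> X \<Longrightarrow> f \<omega> = g \<omega>" "\<omega> \<in> X"
  shows "transfer M p f \<omega> = transfer M p g \<omega>"
  unfolding transfer_def
  by (rule infsum_cong) (use assms Cons_in_X in auto)

lemma transfer_nonneg:
  assumes "M \<le> A" "\<And>\<omega>. \<omega> \<in> X \<Longrightarrow> 0 \<le> f \<omega>" "\<omega> \<in> X"
  shows "0 \<le> transfer M p f \<omega>"
  unfolding transfer_def
  by (rule infsum_nonneg) (use assms Cons_in_X p_nonneg in auto)

lemma transfer_mono:
  assumes "M \<le> A" "bdd f" "bdd g" "\<And>\<omega>. \<omega> \<in> X \<Longrightarrow> f \<omega> \<le> g \<omega>" "\<omega> \<in> X"
  shows "transfer M p f \<omega> \<le> transfer M p g \<omega>"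
  unfolding transfer_def
  by (rule infsum_mono) (use assms Cons_in_X p_nonneg transfer_summable in \<open>auto intro!: mult_left_mono\<close>)

lemma transfer_mono_matrix:
  assumes "M \<le> M'" "M' \<le> A" "bdd f" "\<And>\<omega>. \<omega> \<in> X \<Longrightarrow> 0 \<le> f \<omega>" "\<omega> \<in> X"
  shows "transfer M p f \<omega> \<le> transfer M' p f \<omega>"
proof -
  have MA: "M \<le> A" using assms by auto
  have X: "case_nat a \<omega> \<in> X" if "M' a (\<omega> 0)" for a
    using Cons_in_X[OF assms(2) assms(5)] that by blast
  show ?thesis
    unfolding transfer_def
    by (rule infsum_mono_neutral[OF transfer_summable[OF MA assms(3,5)] transfer_summable[OF assms(2,3,5)]])
      (use assms(1) p_nonneg assms(4) X in \<open>auto simp: le_fun_def\<close>)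
qed

lemma transfer_add:
  assumes "M \<le> A" "bdd f" "bdd g" "\<omega> \<in> X"
  shows "transfer M p (\<lambda>\<omega>. f \<omega> + g \<omega>) \<omega> = transfer M p f \<omega> + transfer M p g \<omega>"
  unfolding transfer_def using assms
  by (subst infsum_add[symmetric]) (auto simp: transfer_summable distrib_left)

lemma transfer_cmult: "transfer M p (\<lambda>\<omega>. c * f \<omega>) \<omega> = c * transfer M p f \<omega>"
  unfolding transfer_def
  by (subst infsum_cmult_right'[symmetric]) (simp add: algebra_simps)

text \<open>Shifting undoes prepending, so the factor \<open>g (shift _)\<close> is constant along
  the sum. Invariance of the Perron measure and the moment bound for occupation times rest on
  this.\<close>

lemma transfer_shift: "transfer M p (\<lambda>\<omega>. g (shift \<omega>) * f \<omega>) \<omega> = g \<omega> * transfer M p f \<omega>"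
  unfolding transfer_def
  by (subst infsum_cmult_right'[symmetric]) (simp add: algebra_simps)

lemma transfer_diff:
  assumes "M \<le> A" "bdd f" "bdd g" "\<omega> \<in> X"
  shows "transfer M p (\<lambda>\<omega>. f \<omega> - g \<omega>) \<omega> = transfer M p f \<omega> - transfer M p g \<omega>"
  using transfer_add[OF assms(1,2) bdd_cmult[OF assms(3), of "-1"] assms(4)]
    transfer_cmult[of M "-1" g \<omega>] by simp

lemma transfer_sum_le:
  assumes "M \<le> A" "bdd f" "\<And>\<omega>. \<omega> \<in> X \<Longrightarrow> 0 \<le> f \<omega>" "\<omega> \<in> X" "finite T" "\<And>a. a \<in> T \<Longrightarrow> M a (\<omega> 0)"
  shows "(\<Sum>a\<in>T. p (case_nat a \<omega>) * f (case_nat a \<omega>)) \<le> transfer M p f \<omega>"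
  unfolding transfer_def
  by (rule finite_sum_le_infsum[OF transfer_summable[OF assms(1,2,4)]])
    (use assms Cons_in_X p_nonneg in auto)

lemma transfer_ge_term:
  assumes "M \<le> A" "bdd f" "\<And>\<omega>. \<omega> \<in> X \<Longrightarrow> 0 \<le> f \<omega>" "\<omega> \<in> X" "M a (\<omega> 0)"
  shows "p (case_nat a \<omega>) * f (case_nat a \<omega>) \<le> transfer M p f \<omega>"
  using transfer_sum_le[of M f \<omega> "{a}"] assms by auto

text \<open>A bound by the first letter only; the free weights \<open>K\<close> later tilt the
  operator for the occupation time estimate.\<close>

lemma transfer_le_states:
  assumes "M \<le> A" "\<And>\<omega>. \<omega> \<in> X \<Longrightarrow> \<bar>f \<omega>\<bar> \<le> K (\<omega> 0)" "\<omega> \<in> X"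
    "(\<lambda>a. q a * K a) summable_on UNIV" "bdd f"
  shows "\<bar>transfer M p f \<omega>\<bar> \<le> (\<Sum>\<^sub>\<infinity>a\<in>{a. M a (\<omega> 0)}. q a * K a)"
proof -
  let ?D = "{a. M a (\<omega> 0)}"
  have t: "\<bar>p (case_nat a \<omega>) * f (case_nat a \<omega>)\<bar> \<le> q a * K a" if "a \<in> ?D" for a
  proof -
    have "case_nat a \<omega> \<in> X" using Cons_in_X assms that by blast
    then show ?thesis
      using assms(2)[of "case_nat a \<omega>"] p_le[of "case_nat a \<omega>"] p_nonneg[of "case_nat a \<omega>"] q_nonneg
      by (auto simp: abs_mult intro!: mult_mono)
  qed
  have s: "(\<lambda>a. q a * K a) summable_on ?D"
    by (rule summable_on_subset_banach[OF assms(4)]) auto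
  note f = transfer_summable[OF assms(1,5,3)]
  have "transfer M p f \<omega> \<le> (\<Sum>\<^sub>\<infinity>a\<in>?D. q a * K a)"
    unfolding transfer_def by (rule infsum_mono[OF f s]) (use t in fastforce)
  moreover have "(\<Sum>\<^sub>\<infinity>a\<in>?D. - (q a * K a)) \<le> transfer M p f \<omega>"
    unfolding transfer_def by (rule infsum_mono) (use t f s in \<open>fastforce simp: summable_on_uminus\<close>)+
  ultimately show ?thesis by (simp add: infsum_uminus)
qed

lemma transfer_le:
  assumes "M \<le> A" "\<And>\<omega>. \<omega> \<in> X \<Longrightarrow> \<bar>f \<omega>\<bar> \<le> K" "\<omega> \<in> X"
  shows "\<bar>transfer M p f \<omega>\<bar> \<le> qsum * K"
proof -
  have K: "0 \<le> K" using assms by force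
  have s: "(\<lambda>a. q a * K) summable_on UNIV"
    by (rule summable_on_cmult_left[OF q_summable])
  have "\<bar>transfer M p f \<omega>\<bar> \<le> (\<Sum>\<^sub>\<infinity>a\<in>{a. M a (\<omega> 0)}. q a * K)"
    by (rule transfer_le_states) (use assms s in \<open>auto intro: bddI\<close>)
  also have "\<dots> \<le> (\<Sum>\<^sub>\<infinity>a. q a * K)"
    by (rule infsum_mono_neutral) (use s K q_nonneg in \<open>auto intro: summable_on_subset_banach\<close>)
  also have "\<dots> = qsum * K" unfolding qsum_def by (rule infsum_cmult_left')
  finally show ?thesis .
qed

lemma transfer_bdd: assumes "M \<le> A" "bdd f" shows "bdd (transfer M p f)"
proof -
  obtain K where "0 \<le> K" "\<And>\<omega>. \<omega> \<in> X \<Longrightarrow> \<bar>f \<omega>\<bar> \<le> K" using bddE[OF assms(2)] by blast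
  then show ?thesis using transfer_le[OF assms(1)] by (intro bddI[of _ "qsum * K"]) auto
qed

lemma iter_bdd: assumes "M \<le> A" "bdd f" shows "bdd ((transfer M p ^^ n) f)"
  by (induction n) (simp_all add: assms(2) transfer_bdd[OF assms(1)])

lemma iter_nonneg:
  assumes "M \<le> A" "\<And>\<omega>. \<omega> \<in> X \<Longrightarrow> 0 \<le> f \<omega>" "\<omega> \<in> X"
  shows "0 \<le> (transfer M p ^^ n) f \<omega>"
  using assms(3) by (induction n arbitrary: \<omega>) (auto intro!: transfer_nonneg[OF assms(1)] assms(2))

lemma iter_mono:
  assumes "M \<le> A" "bdd f" "bdd g" "\<And>\<omega>. \<omega> \<in> X \<Longrightarrow> f \<omega> \<le> g \<omega>" "\<omega> \<in> X"
  shows "(transfer M p ^^ n) f \<omega> \<le> (transfer M p ^^ n) g \<omega>"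
  using assms(5) by (induction n arbitrary: \<omega>) (auto intro!: transfer_mono assms iter_bdd)

lemma iter_cong:
  assumes "M \<le> A" "\<And>\<omega>. \<omega> \<in> X \<Longrightarrow> f \<omega> = g \<omega>" "\<omega> \<in> X"
  shows "(transfer M p ^^ n) f \<omega> = (transfer M p ^^ n) g \<omega>"
  using assms(3) by (induction n arbitrary: \<omega>) (auto intro!: transfer_cong assms)

lemma iter_add:
  assumes "M \<le> A" "bdd f" "bdd g" "\<omega> \<in> X"
  shows "(transfer M p ^^ n) (\<lambda>\<omega>. f \<omega> + g \<omega>) \<omega> = (transfer M p ^^ n) f \<omega> + (transfer M p ^^ n) g \<omega>"
  using assms(4)
proof (induction n arbitrary: \<omega>)
  case (Suc n)
  have "(transfer M p ^^ Suc n) (\<lambda>\<omega>. f \<omega> + g \<omega>) \<omega>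
      = transfer M p (\<lambda>\<omega>. (transfer M p ^^ n) f \<omega> + (transfer M p ^^ n) g \<omega>) \<omega>"
    using Suc by (auto intro!: transfer_cong assms)
  then show ?case using Suc.prems assms by (simp add: transfer_add iter_bdd)
qed auto

lemma iter_cmult:
  "(transfer M p ^^ n) (\<lambda>\<omega>. c * f \<omega>) \<omega> = c * (transfer M p ^^ n) f \<omega>"
proof (induction n arbitrary: \<omega>)
  case (Suc n)
  then have "(transfer M p ^^ n) (\<lambda>\<omega>. c * f \<omega>) = (\<lambda>\<omega>. c * (transfer M p ^^ n) f \<omega>)" by auto
  then show ?case by (simp add: transfer_cmult)
qed auto

lemma iter_diff:
  assumes "M \<le> A" "bdd f" "bdd g" "\<omega> \<in> X"
  shows "(transfer M p ^^ n) (\<lambda>\<omega>. f \<omega> - g \<omega>) \<omega> = (transfer M p ^^ n) f \<omega> - (transfer M p ^^ n) g \<omega>"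
  using iter_add[OF assms(1,2) bdd_cmult[OF assms(3), of "-1"] assms(4)]
    iter_cmult[of n M "-1" g \<omega>] by simp

lemma iter_mono_matrix:
  assumes "M \<le> M'" "M' \<le> A" "bdd f" "\<And>\<omega>. \<omega> \<in> X \<Longrightarrow> 0 \<le> f \<omega>" "\<omega> \<in> X"
  shows "(transfer M p ^^ n) f \<omega> \<le> (transfer M' p ^^ n) f \<omega>"
  using assms(5)
proof (induction n arbitrary: \<omega>)
  case (Suc n)
  have MA: "M \<le> A" using assms by auto
  have "(transfer M p ^^ Suc n) f \<omega> \<le> transfer M p ((transfer M' p ^^ n) f) \<omega>"
    using Suc assms MA by (auto intro!: transfer_mono iter_bdd)
  also have "\<dots> \<le> transfer M' p ((transfer M' p ^^ n) f) \<omega>"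
    using Suc.prems assms by (intro transfer_mono_matrix iter_bdd iter_nonneg) auto
  finally show ?case by simp
qed auto

lemma iter_le:
  assumes "M \<le> A" "\<And>\<omega>. \<omega> \<in> X \<Longrightarrow> \<bar>f \<omega>\<bar> \<le> K" "\<omega> \<in> X"
  shows "\<bar>(transfer M p ^^ n) f \<omega>\<bar> \<le> qsum ^ n * K"
  using assms(3)
proof (induction n arbitrary: \<omega>)
  case (Suc n)
  then have "\<bar>transfer M p ((transfer M p ^^ n) f) \<omega>\<bar> \<le> qsum * (qsum ^ n * K)"
    by (intro transfer_le assms) auto
  then show ?case by (simp add: mult.assoc)
qed (use assms in auto)

text \<open>A sum of nonnegative products is positive only if some word has all its factors
  positive; this converts positivity of an iterate into a path along which \<open>p\<close> does not
  vanish.\<close>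

lemma iter_pos_path:
  assumes "M \<le> A" "\<And>\<omega>. \<omega> \<in> X \<Longrightarrow> 0 \<le> f \<omega>" "\<omega> \<in> X" "0 < (transfer M p ^^ k) f \<omega>"
  shows "\<exists>\<upsilon>\<in>X. (shift ^^ k) \<upsilon> = \<omega> \<and> 0 < f \<upsilon> \<and> (\<forall>i<k. 0 < p ((shift ^^ i) \<upsilon>) \<and> M (\<upsilon> i) (\<upsilon> (Suc i)))"
  using assms(3,4)
proof (induction k arbitrary: \<omega>)
  case 0
  then show ?case by auto
next
  case (Suc k)
  let ?g = "(transfer M p ^^ k) f"
  have "\<exists>a. M a (\<omega> 0) \<and> p (case_nat a \<omega>) * ?g (case_nat a \<omega>) \<noteq> 0"
  proof (rule ccontr)
    assume "\<not> ?thesis"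
    then have "transfer M p ?g \<omega> = 0" unfolding transfer_def by (intro infsum_0) auto
    then show False using Suc.prems by simp
  qed
  then obtain a where a: "M a (\<omega> 0)" "p (case_nat a \<omega>) \<noteq> 0" "?g (case_nat a \<omega>) \<noteq> 0" by auto
  have X: "case_nat a \<omega> \<in> X" using a Suc.prems assms Cons_in_X by blast
  have "0 < p (case_nat a \<omega>)" using p_nonneg[OF X] a by simp
  moreover have "0 < ?g (case_nat a \<omega>)" using iter_nonneg[OF assms(1), of f "case_nat a \<omega>" k] assms(2) X a by fastforce
  ultimately obtain \<upsilon> where \<upsilon>: "\<upsilon> \<in> X" "(shift ^^ k) \<upsilon> = case_nat a \<omega>" "0 < f \<upsilon>"
    "\<forall>i<k. 0 < p ((shift ^^ i) \<upsilon>) \<and> M (\<upsilon> i) (\<upsilon> (Suc i))"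
    using Suc.IH[OF X] by blast
  have "(shift ^^ Suc k) \<upsilon> = \<omega>" using \<upsilon>(2) by simp
  moreover have "M (\<upsilon> k) (\<upsilon> (Suc k))"
    using arg_cong[OF \<upsilon>(2), of "\<lambda>\<xi>. \<xi> 0"] arg_cong[OF \<upsilon>(2), of "\<lambda>\<xi>. \<xi> 1"] a
    by (simp add: funpow_shift)
  ultimately show ?case
    using \<upsilon> \<open>0 < p _\<close> by (intro bexI[of _ \<upsilon>] conjI allI impI) (auto simp: less_Suc_eq)
qed

text \<open>This is C(\<theta> + \<theta>^2 + ...), the total distortion along an inverse branch,
  and the smallest \<open>c\<close> with \<open>(C + c) * \<theta> \<le> c\<close>, which is what
  invariance of the cone requires.\<close>

definition c0 where "c0 = C * \<theta> / (1 - \<theta>)"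

lemma c0_nonneg: "0 \<le> c0"
  using theta C_nonneg by (auto simp: c0_def)

lemma c0_step: "c0 \<le> c \<Longrightarrow> C * \<theta> ^ Suc k + c * \<theta> ^ Suc k \<le> c * \<theta> ^ k"
proof -
  assume "c0 \<le> c"
  then have "C * \<theta> \<le> c * (1 - \<theta>)" using theta by (simp add: c0_def field_simps)
  then have "(C + c) * \<theta> \<le> c" by (simp add: algebra_simps)
  then have "(C + c) * \<theta> * \<theta> ^ k \<le> c * \<theta> ^ k" using theta by (intro mult_right_mono) auto
  then show ?thesis by (simp add: algebra_simps)
qed

text \<open>The additive term \<open>g\<close> carries an error that is not yet multiplicative. With
  \<open>g = 0\<close> this is invariance of the cone; with nonzero \<open>g\<close> it lets the
  eigenfunction, known only to be Lipschitz, be improved by iteration.\<close>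

lemma transfer_dist:
  assumes "M \<le> A" "bdd f" "bdd g" "c0 \<le> c" "1 \<le> k"
    and fg: "\<And>\<omega> \<upsilon>. \<omega> \<in> X \<Longrightarrow> \<upsilon> \<in> X \<Longrightarrow> agree (Suc k) \<omega> \<upsilon> \<Longrightarrow>
       f \<omega> \<le> exp (c * \<theta> ^ Suc k) * (f \<upsilon> + \<theta> ^ Suc k * g \<upsilon>)"
    and nn: "\<And>\<upsilon>. \<upsilon> \<in> X \<Longrightarrow> 0 \<le> f \<upsilon> + \<theta> ^ Suc k * g \<upsilon>"
    and "\<omega> \<in> X" "\<upsilon> \<in> X" "agree k \<omega> \<upsilon>"
  shows "transfer M p f \<omega> \<le>
    exp (c * \<theta> ^ k) * (transfer M p f \<upsilon> + \<theta> ^ Suc k * transfer M p g \<upsilon>)"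
proof -
  define F where "F = (\<lambda>\<upsilon>. exp (c * \<theta> ^ k) * (f \<upsilon> + \<theta> ^ Suc k * g \<upsilon>))"
  have F: "bdd F" unfolding F_def by (intro bdd_cmult bdd_add assms)
  have 0: "\<omega> 0 = \<upsilon> 0" using assms(5,10) agree_zeroth by blast
  have "transfer M p f \<omega> \<le> transfer M p F \<upsilon>"
    unfolding transfer_def 0
  proof (rule infsum_mono)
    show "(\<lambda>a. p (case_nat a \<omega>) * f (case_nat a \<omega>)) summable_on {a. M a (\<upsilon> 0)}"
      using transfer_summable[OF assms(1,2,8)] by (simp add: 0)
    show "(\<lambda>a. p (case_nat a \<upsilon>) * F (case_nat a \<upsilon>)) summable_on {a. M a (\<upsilon> 0)}"
      by (rule transfer_summable[OF assms(1) F assms(9)])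
    fix a assume "a \<in> {a. M a (\<upsilon> 0)}"
    then have X: "case_nat a \<omega> \<in> X" "case_nat a \<upsilon> \<in> X"
      using Cons_in_X[OF assms(1)] assms(8,9) 0 by auto
    have ag: "agree (Suc k) (case_nat a \<omega>) (case_nat a \<upsilon>)" by (rule agree_Cons[OF assms(10)])
    have "p (case_nat a \<omega>) * f (case_nat a \<omega>) \<le> p (case_nat a \<omega>) *
       (exp (c * \<theta> ^ Suc k) * (f (case_nat a \<upsilon>) + \<theta> ^ Suc k * g (case_nat a \<upsilon>)))"
      by (intro mult_left_mono fg ag X p_nonneg)
    also have "\<dots> \<le> (exp (C * \<theta> ^ Suc k) * p (case_nat a \<upsilon>)) *
       (exp (c * \<theta> ^ Suc k) * (f (case_nat a \<upsilon>) + \<theta> ^ Suc k * g (case_nat a \<upsilon>)))"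
      using assms(5) by (intro mult_right_mono p_dist ag X mult_nonneg_nonneg nn) auto
    also have "\<dots> = exp (C * \<theta> ^ Suc k + c * \<theta> ^ Suc k) *
        (p (case_nat a \<upsilon>) * (f (case_nat a \<upsilon>) + \<theta> ^ Suc k * g (case_nat a \<upsilon>)))"
      by (simp add: exp_add)
    also have "\<dots> \<le> exp (c * \<theta> ^ k) *
        (p (case_nat a \<upsilon>) * (f (case_nat a \<upsilon>) + \<theta> ^ Suc k * g (case_nat a \<upsilon>)))"
      using c0_step[OF assms(4), of k] p_nonneg[OF X(2)] nn[OF X(2)]
      by (intro mult_right_mono) auto
    finally show "p (case_nat a \<omega>) * f (case_nat a \<omega>) \<le> p (case_nat a \<upsilon>) * F (case_nat a \<upsilon>)"
      by (simp add: F_def algebra_simps)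
  qed
  also have "transfer M p F \<upsilon>
      = exp (c * \<theta> ^ k) * (transfer M p f \<upsilon> + \<theta> ^ Suc k * transfer M p g \<upsilon>)"
    unfolding F_def
    by (subst transfer_cmult, subst transfer_add) (auto simp: transfer_cmult assms bdd_cmult)
  finally show ?thesis .
qed

section \<open>Invariance and closure properties of the cone\<close>

lemma cone_nonneg: "cone m c f \<Longrightarrow> \<omega> \<in> X \<Longrightarrow> 0 \<le> f \<omega>"
  by (auto simp: cone_on_def)

lemma cone_le:
  "cone m c f \<Longrightarrow> m \<le> k \<Longrightarrow> \<omega> \<in> X \<Longrightarrow> \<upsilon> \<in> X \<Longrightarrow> agree k \<omega> \<upsilon> \<Longrightarrow> f \<omega> \<le> exp (c * \<theta> ^ k) * f \<upsilon>"
  by (auto simp: cone_on_def)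

lemma cone_le':
  assumes "cone 1 c f" "0 \<le> c" "\<omega> \<in> X" "\<upsilon> \<in> X" "\<omega> 0 = \<upsilon> 0"
  shows "f \<omega> \<le> exp c * f \<upsilon>"
proof -
  have "f \<omega> \<le> exp (c * \<theta> ^ 1) * f \<upsilon>"
    using assms(5) by (intro cone_le[OF assms(1) order_refl assms(3,4)]) (simp add: agree_def)
  also have "\<dots> \<le> exp c * f \<upsilon>"
    using theta assms cone_nonneg by (intro mult_right_mono) (auto simp: mult_left_le)
  finally show ?thesis .
qed

lemma cone_weaken: "cone m c f \<Longrightarrow> m \<le> m' \<Longrightarrow> c \<le> c' \<Longrightarrow> cone m' c' f"
  unfolding cone_on_def
proof (intro conjI ballI allI impI)
  fix k \<omega> \<upsilon> assume *: "m' \<le> k" "\<omega> \<in> X" "\<upsilon> \<in> X" "agree k \<omega> \<upsilon>"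
    and f: "(\<forall>\<omega>\<in>X. 0 \<le> f \<omega>) \<and>
      (\<forall>k\<ge>m. \<forall>\<omega>\<in>X. \<forall>\<upsilon>\<in>X. agree k \<omega> \<upsilon> \<longrightarrow> f \<omega> \<le> exp (c * \<theta> ^ k) * f \<upsilon>)"
    and mc: "m \<le> m'" "c \<le> c'"
  have "f \<omega> \<le> exp (c * \<theta> ^ k) * f \<upsilon>" using f * mc by (meson order_trans)
  also have "\<dots> \<le> exp (c' * \<theta> ^ k) * f \<upsilon>"
    using f * mc theta by (intro mult_right_mono) (auto intro: mult_right_mono)
  finally show "f \<omega> \<le> exp (c' * \<theta> ^ k) * f \<upsilon>" .
qed auto

lemma cone_transfer:
  assumes "M \<le> A" "bdd f" "c0 \<le> c" "cone (Suc m) c f" "1 \<le> m"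
  shows "cone m c (transfer M p f)"
  unfolding cone_on_def
proof (safe)
  fix \<omega> assume "\<omega> \<in> X" then show "0 \<le> transfer M p f \<omega>"
    using assms cone_nonneg by (intro transfer_nonneg) auto
next
  fix k \<omega> \<upsilon> assume *: "m \<le> k" "\<omega> \<in> X" "\<upsilon> \<in> X" "agree k \<omega> \<upsilon>"
  have "transfer M p f \<omega> \<le>
    exp (c * \<theta> ^ k) * (transfer M p f \<upsilon> + \<theta> ^ Suc k * transfer M p (\<lambda>_. 0) \<upsilon>)"
  proof (rule transfer_dist[OF assms(1,2) bdd_const assms(3)])
    fix \<omega> \<upsilon> assume X: "\<omega> \<in> X" "\<upsilon> \<in> X" "agree (Suc k) \<omega> \<upsilon>"
    show "f \<omega> \<le> exp (c * \<theta> ^ Suc k) * (f \<upsilon> + \<theta> ^ Suc k * 0)"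
      using cone_le[OF assms(4) _ X] *(1) by simp
  qed (use * assms cone_nonneg in auto)
  then show "transfer M p f \<omega> \<le> exp (c * \<theta> ^ k) * transfer M p f \<upsilon>"
    by (simp add: transfer_def)
qed

lemma cone_iter:
  assumes "M \<le> A" "bdd f" "c0 \<le> c" "cone (Suc m) c f" "m \<le> n"
  shows "cone 1 c ((transfer M p ^^ n) f)"
proof -
  have *: "cone (max 1 (Suc m - n)) c ((transfer M p ^^ n) f)" for n
  proof (induction n)
    case 0 then show ?case using assms by simp
  next
    case (Suc n)
    have "cone (Suc (max 1 (Suc m - Suc n))) c ((transfer M p ^^ n) f)"
      by (rule cone_weaken[OF Suc]) auto
    then show ?case using assms by (auto intro!: cone_transfer iter_bdd)
  qed
  have "max 1 (Suc m - n) = 1" using assms(5) by simp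
  then show ?thesis using *[of n] by simp
qed

lemma cone_iter_1:
  "M \<le> A \<Longrightarrow> bdd f \<Longrightarrow> c0 \<le> c \<Longrightarrow> cone 1 c f \<Longrightarrow> cone 1 c ((transfer M p ^^ n) f)"
  using cone_iter[of M f c 0 n] by simp

lemma cone_const: "0 \<le> c \<Longrightarrow> 0 \<le> t \<Longrightarrow> cone m c (\<lambda>_. t)"
  using theta by (auto simp: cone_on_def mult_le_cancel_right1)

lemma cone_cmult: "cone m c f \<Longrightarrow> 0 \<le> t \<Longrightarrow> cone m c (\<lambda>\<omega>. t * f \<omega>)"
  unfolding cone_on_def by (auto simp: mult.left_commute mult_left_mono)

lemma cone_add: "cone m c f \<Longrightarrow> cone m c g \<Longrightarrow> cone m c (\<lambda>\<omega>. f \<omega> + g \<omega>)"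
  unfolding cone_on_def by (auto simp: distrib_left intro!: add_mono)

lemma cone_sum: "finite I \<Longrightarrow> 0 \<le> c \<Longrightarrow> (\<And>i. i \<in> I \<Longrightarrow> cone m c (f i)) \<Longrightarrow> cone m c (\<lambda>\<omega>. \<Sum>i\<in>I. f i \<omega>)"
  by (induction rule: finite_induct) (auto intro: cone_const cone_add)

lemma cone_mult:
  assumes "cone m c f" "cone m d g"
  shows "cone m (c + d) (\<lambda>\<omega>. f \<omega> * g \<omega>)"
  unfolding cone_on_def
proof safe
  fix k \<omega> \<upsilon> assume *: "m \<le> k" "\<omega> \<in> X" "\<upsilon> \<in> X" "agree k \<omega> \<upsilon>"
  have "f \<omega> * g \<omega> \<le> (exp (c * \<theta> ^ k) * f \<upsilon>) * (exp (d * \<theta> ^ k) * g \<upsilon>)"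
    using cone_le[OF assms(1) *] cone_le[OF assms(2) *] cone_nonneg assms * by (intro mult_mono) auto
  then show "f \<omega> * g \<omega> \<le> exp ((c + d) * \<theta> ^ k) * (f \<upsilon> * g \<upsilon>)"
    by (simp add: distrib_right exp_add algebra_simps)
qed (use assms cone_nonneg in auto)

lemma cone_min:
  assumes "cone m c f" "cone m c g"
  shows "cone m c (\<lambda>\<omega>. min (f \<omega>) (g \<omega>))"
  using assms unfolding cone_on_def by (auto simp: min_mult_distrib_left min_le_iff_disj)

lemma cone_lip:
  assumes "cone 1 c f" "0 \<le> c" "\<And>\<omega>. \<omega> \<in> X \<Longrightarrow> f \<omega> \<le> K"
  shows "lip (K * (1 + c * exp c)) f"
proof -
  have nn: "0 \<le> f \<omega>" if "\<omega> \<in> X" for \<omega> using cone_nonneg assms that by blast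
  have K: "0 \<le> K" if "\<omega> \<in> X" for \<omega> using assms(3)[OF that] nn[OF that] by linarith
  have le: "f \<omega> - f \<upsilon> \<le> K * (c * exp c) * \<theta> ^ k" if "1 \<le> k" "\<omega> \<in> X" "\<upsilon> \<in> X" "agree k \<omega> \<upsilon>" for k \<omega> \<upsilon>
  proof -
    let ?x = "c * \<theta> ^ k"
    have x: "0 \<le> ?x" "?x \<le> c" using assms(2) theta by (auto simp: mult_left_le power_le_one)
    have "f \<omega> - f \<upsilon> \<le> (exp ?x - 1) * f \<upsilon>" using cone_le[OF assms(1) that] by (simp add: algebra_simps)
    \<comment> \<open>This is 1 - x \<le> exp (- x), multiplied by exp x.\<close>
    also have "exp ?x - 1 \<le> ?x * exp ?x"
      using exp_ge_add_one_self[of "- ?x"] by (simp add: exp_minus field_simps)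
    then have "(exp ?x - 1) * f \<upsilon> \<le> (?x * exp ?x) * f \<upsilon>" using nn that by (intro mult_right_mono) auto
    also have "\<dots> \<le> (?x * exp c) * K"
      using x nn that assms(3) theta by (intro mult_mono) auto
    finally show ?thesis by (simp add: algebra_simps)
  qed
  have 2: "0 \<le> c * exp c" using assms(2) by simp
  show ?thesis
    unfolding lip_on_def
  proof safe
    fix \<omega> assume "\<omega> \<in> X"
    have "f \<omega> \<le> K * 1" using assms(3) \<open>\<omega> \<in> X\<close> by simp
    also have "\<dots> \<le> K * (1 + c * exp c)" using K[OF \<open>\<omega> \<in> X\<close>] 2 by (intro mult_left_mono) auto
    finally show "norm (f \<omega>) \<le> K * (1 + c * exp c)" using nn \<open>\<omega> \<in> X\<close> by simp
  next
    fix k \<omega> \<upsilon> assume *: "1 \<le> k" "\<omega> \<in> X" "\<upsilon> \<in> X" "agree k \<omega> \<upsilon>"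
    have "norm (f \<omega> - f \<upsilon>) \<le> K * (c * exp c) * \<theta> ^ k"
      using le[OF *] le[OF *(1,3,2) agree_sym[OF *(4)]] by auto
    also have "\<dots> \<le> K * (1 + c * exp c) * \<theta> ^ k"
      using K[OF *(2)] theta by (intro mult_right_mono mult_left_mono) auto
    finally show "norm (f \<omega> - f \<upsilon>) \<le> K * (1 + c * exp c) * \<theta> ^ k" .
  qed
qed

end

section \<open>Calculus of bounded Lipschitz functions\<close>

lemma lip_onD: "lip_on \<theta> X K f \<Longrightarrow> \<omega> \<in> X \<Longrightarrow> norm (f \<omega>) \<le> K"
  by (auto simp: lip_on_def)

lemma lip_onD2: "lip_on \<theta> X K f \<Longrightarrow> 1 \<le> k \<Longrightarrow> \<omega> \<in> X \<Longrightarrow> \<upsilon> \<in> X \<Longrightarrow> agree k \<omega> \<upsilon> \<Longrightarrow>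
    norm (f \<omega> - f \<upsilon>) \<le> K * \<theta> ^ k"
  by (auto simp: lip_on_def)

lemma lip_on_add:
  assumes "lip_on \<theta> X K f" "lip_on \<theta> X J g"
  shows "lip_on \<theta> X (K + J) (\<lambda>\<omega>. f \<omega> + g \<omega>)"
  unfolding lip_on_def
proof safe
  fix \<omega> assume "\<omega> \<in> X" then show "norm (f \<omega> + g \<omega>) \<le> K + J"
    using assms by (intro norm_triangle_mono lip_onD)
next
  fix k \<omega> \<upsilon> assume *: "1 \<le> k" "\<omega> \<in> X" "\<upsilon> \<in> X" "agree k \<omega> \<upsilon>"
  have "norm ((f \<omega> - f \<upsilon>) + (g \<omega> - g \<upsilon>)) \<le> K * \<theta> ^ k + J * \<theta> ^ k"
    by (intro norm_triangle_mono lip_onD2[OF assms(1) *] lip_onD2[OF assms(2) *])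
  then show "norm (f \<omega> + g \<omega> - (f \<upsilon> + g \<upsilon>)) \<le> (K + J) * \<theta> ^ k" by (simp add: algebra_simps)
qed

lemma lip_on_mult:
  fixes f g :: "_ \<Rightarrow> real"
  assumes "lip_on \<theta> X K f" "lip_on \<theta> X J g" "0 < \<theta>"
  shows "lip_on \<theta> X (2 * (K * J)) (\<lambda>\<omega>. f \<omega> * g \<omega>)"
  unfolding lip_on_def
proof safe
  fix \<omega> assume "\<omega> \<in> X"
  then have "norm (f \<omega>) \<le> K" "norm (g \<omega>) \<le> J" using assms lip_onD by blast+
  then have "norm (f \<omega>) * norm (g \<omega>) \<le> K * J" and "0 \<le> K * J" by (auto intro: mult_mono)
  then show "norm (f \<omega> * g \<omega>) \<le> 2 * (K * J)" by (simp add: abs_mult)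
next
  fix k \<omega> \<upsilon> assume *: "1 \<le> k" "\<omega> \<in> X" "\<upsilon> \<in> X" "agree k \<omega> \<upsilon>"
  have f: "norm (f \<omega> - f \<upsilon>) \<le> K * \<theta> ^ k" and g: "norm (g \<omega> - g \<upsilon>) \<le> J * \<theta> ^ k"
    using assms * lip_onD2 by blast+
  have b: "norm (f \<upsilon>) \<le> K" "norm (g \<omega>) \<le> J" using assms * lip_onD by blast+
  have 0: "0 \<le> K * \<theta> ^ k" "0 \<le> K" using f b norm_ge_zero order_trans by blast+
  have "f \<omega> * g \<omega> - f \<upsilon> * g \<upsilon> = (f \<omega> - f \<upsilon>) * g \<omega> + f \<upsilon> * (g \<omega> - g \<upsilon>)"
    by (simp add: algebra_simps)
  moreover have "norm ((f \<omega> - f \<upsilon>) * g \<omega> + f \<upsilon> * (g \<omega> - g \<upsilon>)) \<le> (K * \<theta> ^ k) * J + K * (J * \<theta> ^ k)"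
    using f g b 0 by (intro norm_triangle_mono) (auto simp: abs_mult intro!: mult_mono)
  ultimately show "norm (f \<omega> * g \<omega> - f \<upsilon> * g \<upsilon>) \<le> 2 * (K * J) * \<theta> ^ k"
    by (simp add: algebra_simps)
qed

lemma lip_on_const: "0 < \<theta> \<Longrightarrow> lip_on \<theta> X (norm c) (\<lambda>_. c)"
  by (auto simp: lip_on_def)

lemma lip_on_cmult: "lip_on \<theta> X K f \<Longrightarrow> 0 < \<theta> \<Longrightarrow> lip_on \<theta> X (2 * (\<bar>c\<bar> * K)) (\<lambda>\<omega>. c * f \<omega> :: real)"
  using lip_on_mult[OF lip_on_const[of \<theta> X c]] by auto

lemma lip_on_mono: "lip_on \<theta> X K f \<Longrightarrow> K \<le> J \<Longrightarrow> 0 < \<theta> \<Longrightarrow> lip_on \<theta> X J f"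
  unfolding lip_on_def by (meson mult_right_mono order_trans zero_le_power less_imp_le)

lemma lip_on_shift:
  assumes "lip_on \<theta> (shift_space M) K f" "0 < \<theta>" "\<theta> < 1"
  shows "lip_on \<theta> (shift_space M) (2 * K / \<theta>) (\<lambda>\<omega>. f (shift \<omega>))"
  unfolding lip_on_def
proof safe
  fix \<omega> assume "\<omega> \<in> shift_space M"
  then have 1: "norm (f (shift \<omega>)) \<le> K" using assms lip_onD shift_in_shift_space by blast
  then have "0 \<le> K" using norm_ge_zero order_trans by blast
  then have "K \<le> K / \<theta>" "0 \<le> K / \<theta>"
    using assms by (auto simp: field_simps mult_left_le)
  then show "norm (f (shift \<omega>)) \<le> 2 * K / \<theta>" using 1 by simp
next
  fix k \<omega> \<upsilon> assume *: "1 \<le> k" "\<omega> \<in> shift_space M" "\<upsilon> \<in> shift_space M" "agree k \<omega> \<upsilon>"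
  have X: "shift \<omega> \<in> shift_space M" "shift \<upsilon> \<in> shift_space M" using * shift_in_shift_space by auto
  have K: "0 \<le> K" using lip_onD[OF assms(1) X(1)] norm_ge_zero order_trans by blast
  obtain j where j: "k = Suc j" using *(1) by (cases k) auto
  have ag: "agree j (shift \<omega>) (shift \<upsilon>)" using * j agree_Suc_iff by blast
  have "norm (f (shift \<omega>) - f (shift \<upsilon>)) \<le> 2 * K * \<theta> ^ j"
  proof (cases "j = 0")
    case True
    have "norm (f (shift \<omega>) - f (shift \<upsilon>)) \<le> norm (f (shift \<omega>)) + norm (f (shift \<upsilon>))"
      by (rule norm_triangle_ineq4)
    also have "\<dots> \<le> K + K" by (intro add_mono lip_onD[OF assms(1)] X)
    finally show ?thesis using True by simp
  next
    case False
    then have "norm (f (shift \<omega>) - f (shift \<upsilon>)) \<le> K * \<theta> ^ j"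
      by (intro lip_onD2[OF assms(1) _ X ag]) auto
    also have "\<dots> \<le> 2 * K * \<theta> ^ j" using K assms by (intro mult_right_mono) auto
    finally show ?thesis .
  qed
  then show "norm (f (shift \<omega>) - f (shift \<upsilon>)) \<le> 2 * K / \<theta> * \<theta> ^ k" using j assms by simp
qed

lemma lip_on_locally_const:
  assumes "\<And>\<omega>. \<omega> \<in> X \<Longrightarrow> norm (f \<omega>) \<le> K" "0 < \<theta>" "\<theta> < 1"
    "\<And>\<omega> \<upsilon>. \<omega> \<in> X \<Longrightarrow> \<upsilon> \<in> X \<Longrightarrow> agree n \<omega> \<upsilon> \<Longrightarrow> f \<omega> = f \<upsilon>"
  shows "lip_on \<theta> X (2 * K / \<theta> ^ n) f"
  unfolding lip_on_def
proof safe
  fix \<omega> assume "\<omega> \<in> X"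
  then have 1: "norm (f \<omega>) \<le> K" using assms by blast
  then have "0 \<le> K" using norm_ge_zero order_trans by blast
  moreover have "\<theta> ^ n \<le> 1" "0 < \<theta> ^ n" using assms(2,3) by (auto intro: power_le_one)
  ultimately have "K \<le> K / \<theta> ^ n" "0 \<le> K / \<theta> ^ n"
    by (simp_all add: pos_le_divide_eq mult_left_le)
  then show "norm (f \<omega>) \<le> 2 * K / \<theta> ^ n" using 1 by simp
next
  fix k \<omega> \<upsilon> assume *: "1 \<le> k" "\<omega> \<in> X" "\<upsilon> \<in> X" "agree k \<omega> \<upsilon>"
  have K: "0 \<le> K" using assms(1)[OF *(2)] norm_ge_zero order_trans by blast
  show "norm (f \<omega> - f \<upsilon>) \<le> 2 * K / \<theta> ^ n * \<theta> ^ k"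
  proof (cases "n \<le> k")
    case True
    then have "f \<omega> = f \<upsilon>" using assms(4) * agree_mono by blast
    then show ?thesis using K assms(2) by simp
  next
    case False
    have "norm (f \<omega> - f \<upsilon>) \<le> norm (f \<omega>) + norm (f \<upsilon>)" by (rule norm_triangle_ineq4)
    also have "\<dots> \<le> 2 * K" using assms(1)[OF *(2)] assms(1)[OF *(3)] by simp
    also have "1 \<le> \<theta> ^ k / \<theta> ^ n" using assms(2,3) False power_decreasing[of k n \<theta>] by simp
    then have "2 * K * 1 \<le> 2 * K * (\<theta> ^ k / \<theta> ^ n)" using K by (intro mult_left_mono) auto
    finally show ?thesis by simp
  qed
qed

context potential
begin

text \<open>Adding \<open>2 * K\<close> makes the function at least \<open>K\<close>, so the
  additive error \<open>K * \<theta> ^ k\<close> is at most \<theta>^k times the function and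
  becomes multiplicative. Statements about the cone carry over in this way to all Lipschitz
  functions.\<close>

lemma lip_cone:
  assumes "lip K f" "0 < K"
  shows "cone 1 1 (\<lambda>\<omega>. f \<omega> + 2 * K)"
  unfolding cone_on_def
proof safe
  fix \<omega> assume "\<omega> \<in> X" then show "0 \<le> f \<omega> + 2 * K" using lip_onD[OF assms(1)] assms(2) by force
next
  fix k \<omega> \<upsilon> assume *: "1 \<le> k" "\<omega> \<in> X" "\<upsilon> \<in> X" "agree k \<omega> \<upsilon>"
  have u: "K \<le> f \<upsilon> + 2 * K" using lip_onD[OF assms(1) *(3)] by simp
  have "f \<omega> + 2 * K \<le> (f \<upsilon> + 2 * K) + \<theta> ^ k * K" using lip_onD2[OF assms(1) *] by (simp add: mult.commute)
  also have "\<dots> \<le> (f \<upsilon> + 2 * K) + \<theta> ^ k * (f \<upsilon> + 2 * K)"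
    using u theta by (intro add_left_mono mult_left_mono) auto
  also have "\<dots> = (1 + \<theta> ^ k) * (f \<upsilon> + 2 * K)" by (simp add: algebra_simps)
  also have "\<dots> \<le> exp (\<theta> ^ k) * (f \<upsilon> + 2 * K)"
    using u assms by (intro mult_right_mono exp_ge_add_one_self) linarith
  finally show "f \<omega> + 2 * K \<le> exp (1 * \<theta> ^ k) * (f \<upsilon> + 2 * K)" by simp
qed

lemma cone_bdd_lip:
  assumes "cone 1 c f" "0 \<le> c" "bdd f"
  shows "\<exists>K. lip K f"
proof -
  obtain K where "\<And>\<omega>. \<omega> \<in> X \<Longrightarrow> \<bar>f \<omega>\<bar> \<le> K" using bddE[OF assms(3)] by blast
  then show ?thesis using cone_lip[OF assms(1,2)] abs_ge_self order_trans by metis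
qed

text \<open>Cone invariance applies to nonnegative functions only; so \<open>f\<close> is written as
  the difference of \<open>f + 2 * J\<close> and a constant, both in the cone with constant
  \<open>c0 + 1\<close>.\<close>

lemma lip_transfer:
  assumes "M \<le> A" "lip K f"
  shows "\<exists>K'. lip K' (transfer M p f)"
proof -
  define J where "J = \<bar>K\<bar> + 1"
  have J: "lip J f" "0 < J" using lip_on_mono[OF assms(2), of J] theta by (auto simp: J_def)
  define c where "c = c0 + 1"
  have c: "c0 \<le> c" "1 \<le> c" "0 \<le> c" using c0_nonneg by (auto simp: c_def)
  have "cone 1 c (\<lambda>\<omega>. f \<omega> + 2 * J)" using lip_cone[OF J] cone_weaken c by blast
  moreover have b: "bdd (\<lambda>\<omega>. f \<omega> + 2 * J)" using lip_bdd[OF J(1)] by (intro bdd_add) auto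
  ultimately have "cone 1 c ((transfer M p ^^ 1) (\<lambda>\<omega>. f \<omega> + 2 * J))"
    using assms c by (intro cone_iter_1)
  then have "\<exists>K. lip K (transfer M p (\<lambda>\<omega>. f \<omega> + 2 * J))"
    using c transfer_bdd[OF assms(1) b] by (intro cone_bdd_lip) auto
  then obtain K1 where K1: "lip K1 (transfer M p (\<lambda>\<omega>. f \<omega> + 2 * J))" by blast
  have "cone 1 c (\<lambda>\<omega>. 2 * J)" using c J by (intro cone_const) auto
  then have "cone 1 c ((transfer M p ^^ 1) (\<lambda>\<omega>. 2 * J))"
    using assms c by (intro cone_iter_1) auto
  then have "\<exists>K. lip K (transfer M p (\<lambda>\<omega>. 2 * J))"
    using c transfer_bdd[OF assms(1)] by (intro cone_bdd_lip) auto
  then obtain K2 where K2: "lip K2 (transfer M p (\<lambda>\<omega>. 2 * J))" by blast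
  have "lip (K1 + 2 * (\<bar>-1\<bar> * K2))
     (\<lambda>\<omega>. transfer M p (\<lambda>\<omega>. f \<omega> + 2 * J) \<omega> + (-1) * transfer M p (\<lambda>\<omega>. 2 * J) \<omega>)"
    using theta by (intro lip_on_add lip_on_cmult K1 K2)
  moreover have "transfer M p (\<lambda>\<omega>. f \<omega> + 2 * J) \<omega> + (-1) * transfer M p (\<lambda>\<omega>. 2 * J) \<omega> = transfer M p f \<omega>"
    if "\<omega> \<in> X" for \<omega>
    using transfer_add[OF assms(1) lip_bdd[OF J(1)] bdd_const that, of "2 * J"] by simp
  ultimately have "lip (K1 + 2 * (\<bar>-1\<bar> * K2)) (transfer M p f)" unfolding lip_on_def by simp
  then show ?thesis by blast
qed

lemma lip_iter: "M \<le> A \<Longrightarrow> lip K f \<Longrightarrow> \<exists>K'. lip K' ((transfer M p ^^ n) f)"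
  by (induction n) (auto dest: lip_transfer)

lemma ind_lip: "lip (2 / \<theta> ^ k) (ind k \<upsilon>)"
proof -
  have "ind k \<upsilon> \<omega> = ind k \<upsilon> \<xi>" if "agree k \<omega> \<xi>" for \<omega> \<xi>
    using that by (simp add: ind_def agree_def)
  then show ?thesis
    using lip_on_locally_const[of X "ind k \<upsilon>" 1 \<theta> k] theta by (simp add: ind_def)
qed

lemma ind_range: "0 \<le> ind k \<upsilon> \<omega>" "ind k \<upsilon> \<omega> \<le> 1"
  by (auto simp: ind_def)

lemma ind_bdd: "bdd (ind k \<upsilon>)"
  by (rule bddI[of _ 1]) (auto simp: ind_def)

lemma state_ind_lip: "lip (2 / \<theta>) (state_ind a)"
  using lip_on_locally_const[of X "state_ind a" 1 \<theta> 1] theta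
  by (auto simp: state_ind_def)

lemma state_ind_nonneg: "0 \<le> state_ind a \<omega>"
  by (simp add: state_ind_def)

lemma state_ind_bdd: "bdd (state_ind a)"
  by (rule bddI[of _ 1]) (auto simp: state_ind_def)

lemma ind_cone: "cone k c0 (ind k \<upsilon>)"
proof -
  have 1: "1 \<le> exp (c0 * \<theta> ^ j)" for j using c0_nonneg theta by simp
  have "ind k \<upsilon> \<omega> \<le> exp (c0 * \<theta> ^ j) * ind k \<upsilon> \<xi>" if "k \<le> j" "agree j \<omega> \<xi>" for j \<omega> \<xi>
  proof -
    have "agree k \<upsilon> \<omega> \<longleftrightarrow> agree k \<upsilon> \<xi>" using agree_mono[OF that(2,1)] by (auto simp: agree_def)
    then show ?thesis using 1[of j] by (simp add: ind_def)
  qed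
  then show ?thesis unfolding cone_on_def by (auto simp: ind_range)
qed

end

section \<open>Pressure as a growth rate\<close>

text \<open>\<open>eexp\<close> and \<open>elog\<close> are adjoint monotone maps; hence
  \<open>eexp\<close> commutes with arbitrary suprema, including empty ones.\<close>

lemma eexp_le_iff: "eexp x \<le> z \<longleftrightarrow> x \<le> elog z"
proof (cases x)
  case (real r)
  show ?thesis
  proof (cases "z = \<infinity>")
    case False
    then have z: "z = ennreal (enn2real z)" by (simp add: ennreal_enn2real_if)
    show ?thesis
    proof (cases "z = 0")
      case False
      then have "0 < enn2real z" using z by (metis enn2real_nonneg ennreal_0 order_le_less)
      then show ?thesis
        using real False \<open>z \<noteq> \<infinity>\<close> by (subst z) (auto simp: eexp_def elog_def ln_ge_iff)
    qed (use real in \<open>auto simp: eexp_def elog_def\<close>)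
  qed (use real in \<open>auto simp: eexp_def elog_def\<close>)
qed (auto simp: eexp_def elog_def top_unique)

lemma eexp_elog: "eexp (elog z) = z"
proof (cases "z = \<infinity> \<or> z = 0")
  case False
  then have "z = ennreal (enn2real z)" "0 < enn2real z"
    by (auto simp: ennreal_enn2real_if less_top enn2real_positive_iff zero_less_iff_neq_zero)
  then show ?thesis using False by (simp add: eexp_def elog_def)
qed (auto simp: eexp_def elog_def)

lemma elog_le_iff: "elog z \<le> x \<longleftrightarrow> z \<le> eexp x"
proof
  assume "elog z \<le> x"
  then show "z \<le> eexp x" using eexp_le_iff[of "elog z" "eexp x"] eexp_le_iff[of x "eexp x"]
    by (simp add: eexp_elog)
next
  assume *: "z \<le> eexp x"
  have "elog (eexp x) \<le> x"
    by (cases x) (auto simp: eexp_def elog_def)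
  moreover have "elog z \<le> elog (eexp x)" using * eexp_le_iff[of "elog z" "eexp x"] by (simp add: eexp_elog)
  ultimately show "elog z \<le> x" by (rule order_trans[rotated])
qed

lemma eexp_mono: "x \<le> y \<Longrightarrow> eexp x \<le> eexp y"
  using eexp_le_iff[of y "eexp y"] by (simp add: eexp_le_iff)

lemma eexp_SUP: "eexp (SUP x\<in>S. f x) = (SUP x\<in>S. eexp (f x))"
proof (rule antisym)
  have "(SUP x\<in>S. f x) \<le> elog (SUP x\<in>S. eexp (f x))"
    by (rule SUP_least) (auto simp: eexp_le_iff[symmetric] intro: SUP_upper)
  then show "eexp (SUP x\<in>S. f x) \<le> (SUP x\<in>S. eexp (f x))" by (simp add: eexp_le_iff)
qed (auto intro!: SUP_least eexp_mono SUP_upper)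

lemma eexp_0 [simp]: "eexp 0 = 1"
  by (simp add: eexp_def)

lemma eexp_ereal [simp]: "eexp (ereal x) = ennreal (exp x)"
  by (simp add: eexp_def)

lemma eexp_add: "x \<noteq> \<infinity> \<Longrightarrow> y \<noteq> \<infinity> \<Longrightarrow> eexp (x + y) = eexp x * eexp y"
  by (cases x; cases y) (auto simp: eexp_def exp_add ennreal_mult)

lemma eexp_sum:
  "finite I \<Longrightarrow> (\<And>i. i \<in> I \<Longrightarrow> f i \<noteq> \<infinity>) \<Longrightarrow> eexp (\<Sum>i\<in>I. f i) = (\<Prod>i\<in>I. eexp (f i)) \<and> (\<Sum>i\<in>I. f i) \<noteq> \<infinity>"
  by (induction rule: finite_induct) (auto simp: eexp_add)

lemma shift_funpow_in: "\<omega> \<in> shift_space M \<Longrightarrow> (shift ^^ k) \<omega> \<in> shift_space M"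
  by (induction k) (auto intro: shift_in_shift_space)

text \<open>Words are prepended letter by letter, so here a word is stored as the reversed list of its letters.\<close>

fun prepend :: "'s list \<Rightarrow> (nat \<Rightarrow> 's) \<Rightarrow> (nat \<Rightarrow> 's)" where
  "prepend [] \<omega> = \<omega>"
| "prepend (a # w) \<omega> = prepend w (case_nat a \<omega>)"

fun admissible :: "('s \<Rightarrow> 's \<Rightarrow> bool) \<Rightarrow> 's list \<Rightarrow> (nat \<Rightarrow> 's) \<Rightarrow> bool" where
  "admissible M [] \<omega> = True"
| "admissible M (a # w) \<omega> \<longleftrightarrow> M a (\<omega> 0) \<and> admissible M w (case_nat a \<omega>)"

lemma shift_prepend: "(shift ^^ length w) (prepend w \<omega>) = \<omega>"
  by (induction w arbitrary: \<omega>) auto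

lemma prepend_in: "admissible M w \<omega> \<Longrightarrow> \<omega> \<in> shift_space M \<Longrightarrow> prepend w \<omega> \<in> shift_space M"
  by (induction w arbitrary: \<omega>) (auto intro: Cons_in_shift_space)

lemma prepend_nth:
  "i < length w \<Longrightarrow> prepend w \<omega> i = rev w ! i"
proof (induction w arbitrary: \<omega>)
  case (Cons a w)
  show ?case
  proof (cases "i = length w")
    case True
    then show ?thesis
      using arg_cong[OF shift_prepend[of w "case_nat a \<omega>"], of "\<lambda>\<xi>. \<xi> 0"]
      by (simp add: funpow_shift nth_append)
  qed (use Cons in \<open>auto simp: nth_append\<close>)
qed auto

lemma prepend_shift:
  assumes "\<omega> \<in> shift_space M" "\<And>i. i < length w \<Longrightarrow> \<omega> i = rev w ! i"
  shows "prepend w ((shift ^^ length w) \<omega>) = \<omega> \<and> admissible M w ((shift ^^ length w) \<omega>)"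
  using assms(2)
proof (induction w)
  case (Cons a w)
  have a: "\<omega> (length w) = a" using Cons.prems[of "length w"] by (simp add: nth_append)
  have *: "case_nat a (shift ((shift ^^ length w) \<omega>)) = (shift ^^ length w) \<omega>"
    using Cons_shift[of "(shift ^^ length w) \<omega>"] a by (simp add: funpow_shift)
  have "M (\<omega> (length w)) (\<omega> (Suc (length w)))" using assms(1) by (auto simp: shift_space_def)
  then have "M a (shift ((shift ^^ length w) \<omega>) 0)"
    by (simp add: a funpow_shift shift_def)
  moreover have "prepend w ((shift ^^ length w) \<omega>) = \<omega> \<and> admissible M w ((shift ^^ length w) \<omega>)"
    using Cons.prems by (intro Cons.IH) (auto simp: nth_append dest: less_SucI)
  ultimately show ?case using * by simp
qed auto

context potential
begin

text \<open>The summand of the iterate of the constant 1 that belongs to prepending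
  \<open>w\<close>: the product of \<open>p\<close> along this inverse branch, or 0 if
  \<open>w\<close> cannot be prepended.\<close>

fun weight :: "'s list \<Rightarrow> (nat \<Rightarrow> 's) \<Rightarrow> real" where
  "weight [] \<omega> = 1"
| "weight (a # w) \<omega> = (if A a (\<omega> 0) then p (case_nat a \<omega>) * weight w (case_nat a \<omega>) else 0)"

lemma weight_nonneg: "\<omega> \<in> X \<Longrightarrow> 0 \<le> weight w \<omega>"
  by (induction w arbitrary: \<omega>) (auto intro!: mult_nonneg_nonneg p_nonneg Cons_in_shift_space)

lemma weight_admissible: "weight w \<omega> \<noteq> 0 \<Longrightarrow> admissible A w \<omega>"
  by (induction w arbitrary: \<omega>) (auto split: if_splits)

lemma weight_eq:
  "admissible A w \<omega> \<Longrightarrow> weight w \<omega> = (\<Prod>k<length w. p ((shift ^^ k) (prepend w \<omega>)))"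
  by (induction w arbitrary: \<omega>) (auto simp: shift_prepend)

text \<open>The distortions of the letters add up to at most a geometric series, so the bound does
  not depend on the length of the word.\<close>

lemma weight_dist:
  assumes "\<omega> \<in> X" "\<upsilon> \<in> X" "1 \<le> k" "agree k \<omega> \<upsilon>"
  shows "weight w \<omega> \<le> exp (c0 * \<theta> ^ k) * weight w \<upsilon>"
  using assms
proof (induction w arbitrary: \<omega> \<upsilon> k)
  case Nil
  then show ?case using c0_nonneg theta by simp
next
  case (Cons a w)
  have 0: "\<omega> 0 = \<upsilon> 0" using Cons.prems agree_zeroth by blast
  show ?case
  proof (cases "A a (\<upsilon> 0)")
    case True
    have X: "case_nat a \<omega> \<in> X" "case_nat a \<upsilon> \<in> X"
      using True 0 by (simp_all add: Cons_in_shift_space Cons.prems)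
    have ag: "agree (Suc k) (case_nat a \<omega>) (case_nat a \<upsilon>)" by (rule agree_Cons[OF Cons.prems(4)])
    have "p (case_nat a \<omega>) * weight w (case_nat a \<omega>) \<le>
      (exp (C * \<theta> ^ Suc k) * p (case_nat a \<upsilon>)) * (exp (c0 * \<theta> ^ Suc k) * weight w (case_nat a \<upsilon>))"
      using Cons.prems(3) by (intro mult_mono p_dist X ag Cons.IH weight_nonneg p_nonneg mult_nonneg_nonneg) auto
    also have "\<dots> = exp (C * \<theta> ^ Suc k + c0 * \<theta> ^ Suc k) * (p (case_nat a \<upsilon>) * weight w (case_nat a \<upsilon>))"
      by (simp add: exp_add)
    also have "\<dots> \<le> exp (c0 * \<theta> ^ k) * (p (case_nat a \<upsilon>) * weight w (case_nat a \<upsilon>))"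
      using c0_step[OF order_refl, of k] p_nonneg[OF X(2)] weight_nonneg[OF X(2)]
      by (intro mult_right_mono) auto
    finally show ?thesis using True 0 by simp
  qed (use 0 in auto)
qed

text \<open>Splitting off the letter adjacent to \<omega>, the head of the stored word, turns the
  induction step into a double sum of nonnegative terms.\<close>

lemma weight_has_sum:
  assumes "\<omega> \<in> X"
  shows "((\<lambda>w. weight w \<omega>) has_sum (transfer A p ^^ n) (\<lambda>_. 1) \<omega>) {w. length w = n}"
  using assms
proof (induction n arbitrary: \<omega>)
  case 0
  then show ?case using has_sum_finite[of "{[]}" "\<lambda>w. weight w \<omega>"] by simp
next
  case (Suc n)
  let ?L = "(transfer A p ^^ n) (\<lambda>_. 1)"
  let ?g = "\<lambda>a. if A a (\<omega> 0) then p (case_nat a \<omega>) * ?L (case_nat a \<omega>) else 0"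
  have f: "((\<lambda>w. weight (a # w) \<omega>) has_sum ?g a) {w. length w = n}" for a
  proof (cases "A a (\<omega> 0)")
    case True
    then have "case_nat a \<omega> \<in> X" by (rule Cons_in_shift_space[OF Suc.prems])
    from has_sum_cmult_right[OF Suc.IH[OF this]] True show ?thesis by simp
  qed auto
  have "((\<lambda>a. p (case_nat a \<omega>) * ?L (case_nat a \<omega>)) has_sum transfer A p ?L \<omega>) {a. A a (\<omega> 0)}"
    using Suc.prems by (intro transfer_has_sum iter_bdd) auto
  then have g: "(?g has_sum transfer A p ?L \<omega>) UNIV"
    by (rule has_sum_cong_neutral[THEN iffD1, rotated -1]) auto
  have s: "(\<lambda>(a, w). weight (a # w) \<omega>) summable_on Sigma UNIV (\<lambda>_. {w. length w = n})"
    by (rule summable_on_SigmaI[where g = ?g])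
      (simp_all del: weight.simps add: f has_sum_imp_summable[OF g] weight_nonneg[OF Suc.prems])
  have "((\<lambda>(a, w). weight (a # w) \<omega>) has_sum transfer A p ?L \<omega>) (Sigma UNIV (\<lambda>_. {w. length w = n}))"
    by (rule has_sum_SigmaI[OF _ g s]) (use f in auto)
  moreover have "bij_betw (\<lambda>(a, w). a # w) (Sigma UNIV (\<lambda>_. {w. length w = n})) {w::'s list. length w = Suc n}"
    by (rule bij_betw_byWitness[where f' = "\<lambda>w. (hd w, tl w)"]) (auto simp: length_Suc_conv)
  ultimately have "((\<lambda>w. weight w \<omega>) has_sum transfer A p ?L \<omega>) {w. length w = Suc n}"
    by (subst has_sum_reindex_bij_betw[symmetric]) (auto simp: case_prod_unfold simp del: weight.simps)
  then show ?case by simp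
qed

text \<open>An upward closed set of rates whose infimum plays the role of a spectral radius. Working
  with rates avoids presupposing that the limit defining the pressure exists.\<close>

definition growth :: "('s \<Rightarrow> 's \<Rightarrow> bool) \<Rightarrow> real set" where
  "growth M = {\<rho>. 0 < \<rho> \<and> (\<exists>K. \<forall>k. \<forall>\<omega>\<in>X. (transfer M p ^^ k) (\<lambda>_. 1) \<omega> \<le> K * \<rho> ^ k)}"

lemma growthI: "0 < \<rho> \<Longrightarrow> (\<And>k \<omega>. \<omega> \<in> X \<Longrightarrow> (transfer M p ^^ k) (\<lambda>_. 1) \<omega> \<le> K * \<rho> ^ k) \<Longrightarrow> \<rho> \<in> growth M"
  by (auto simp: growth_def)

lemma growthE:
  assumes "\<rho> \<in> growth M"
  obtains K where "0 < K" "\<And>k \<omega>. \<omega> \<in> X \<Longrightarrow> (transfer M p ^^ k) (\<lambda>_. 1) \<omega> \<le> K * \<rho> ^ k" "0 < \<rho>"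
proof -
  obtain K where K: "\<And>k \<omega>. \<omega> \<in> X \<Longrightarrow> (transfer M p ^^ k) (\<lambda>_. 1) \<omega> \<le> K * \<rho> ^ k" and r: "0 < \<rho>"
    using assms by (auto simp: growth_def)
  show ?thesis
  proof (rule that[of "\<bar>K\<bar> + 1"])
    fix k \<omega> assume "\<omega> \<in> X"
    then have "(transfer M p ^^ k) (\<lambda>_. 1) \<omega> \<le> K * \<rho> ^ k" by (rule K)
    also have "\<dots> \<le> (\<bar>K\<bar> + 1) * \<rho> ^ k" using r by (intro mult_right_mono) auto
    finally show "(transfer M p ^^ k) (\<lambda>_. 1) \<omega> \<le> (\<bar>K\<bar> + 1) * \<rho> ^ k" .
  qed (use r in auto)
qed

lemma growthD: "\<rho> \<in> growth M \<Longrightarrow> \<exists>K>0. \<forall>k. \<forall>\<omega>\<in>X. (transfer M p ^^ k) (\<lambda>_. 1) \<omega> \<le> K * \<rho> ^ k"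
  by (rule growthE) auto

lemma growth_upward: assumes "\<rho> \<in> growth M" "\<rho> \<le> \<rho>'" shows "\<rho>' \<in> growth M"
proof -
  obtain K where K: "0 < K" "\<And>k \<omega>. \<omega> \<in> X \<Longrightarrow> (transfer M p ^^ k) (\<lambda>_. 1) \<omega> \<le> K * \<rho> ^ k" "0 < \<rho>"
    using growthE[OF assms(1)] by blast
  show ?thesis
  proof (rule growthI[of _ M K])
    fix k \<omega> assume "\<omega> \<in> X"
    then have "(transfer M p ^^ k) (\<lambda>_. 1) \<omega> \<le> K * \<rho> ^ k" by (rule K)
    also have "\<dots> \<le> K * \<rho>' ^ k" using K assms by (intro mult_left_mono power_mono) auto
    finally show "(transfer M p ^^ k) (\<lambda>_. 1) \<omega> \<le> K * \<rho>' ^ k" .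
  qed (use K assms in auto)
qed

text \<open>Submultiplicativity: a bound on one power controls all multiples of \<open>n\<close>,
  and the fewer than \<open>n\<close> remaining factors cost only a constant.\<close>

lemma growth_one_step:
  assumes M: "M \<le> A" and n: "1 \<le> n" and r: "0 < \<rho>"
    and le: "\<And>\<omega>. \<omega> \<in> X \<Longrightarrow> (transfer M p ^^ n) (\<lambda>_. 1) \<omega> \<le> \<rho> ^ n"
  shows "\<rho> \<in> growth M"
proof (rule growthI[OF r])
  fix k \<omega> assume "\<omega> \<in> X"
  \<comment> \<open>\<open>B * \<rho>\<close> is at least \<open>qsum\<close>, so
    \<open>B ^ n\<close> absorbs the first \<open>n\<close> iterates; \<open>B \<ge> 1\<close>
    allows the exponent to be raised to \<open>n\<close>.\<close>
  define B where "B = 1 + qsum / \<rho>"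
  have B: "1 \<le> B" using qsum_nonneg r by (simp add: B_def)
  show "(transfer M p ^^ k) (\<lambda>_. 1) \<omega> \<le> B ^ n * \<rho> ^ k"
    using \<open>\<omega> \<in> X\<close>
  proof (induction k arbitrary: \<omega> rule: less_induct)
    case (less k)
    show ?case
    proof (cases "k < n")
      case True
      have "(transfer M p ^^ k) (\<lambda>_. 1) \<omega> \<le> qsum ^ k * 1"
        using iter_le[OF M, of "\<lambda>_. 1" 1 \<omega> k] less.prems by simp
      also have "\<dots> \<le> (B * \<rho>) ^ k * 1"
        using qsum_nonneg r by (intro mult_right_mono power_mono) (auto simp: B_def field_simps)
      also have "\<dots> \<le> B ^ n * \<rho> ^ k"
        using B r True by (simp add: power_mult_distrib mult_right_mono power_increasing)
      finally show ?thesis .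
    next
      case False
      then have k: "k = (k - n) + n" by simp
      have "(transfer M p ^^ k) (\<lambda>_. 1) \<omega> = (transfer M p ^^ (k - n)) ((transfer M p ^^ n) (\<lambda>_. 1)) \<omega>"
        by (subst k) (simp only: funpow_add comp_def)
      also have "\<dots> \<le> (transfer M p ^^ (k - n)) (\<lambda>_. \<rho> ^ n * 1) \<omega>"
        using M less.prems le by (intro iter_mono iter_bdd) auto
      also have "\<dots> = \<rho> ^ n * (transfer M p ^^ (k - n)) (\<lambda>_. 1) \<omega>" by (rule iter_cmult)
      also have "\<dots> \<le> \<rho> ^ n * (B ^ n * \<rho> ^ (k - n))"
        using False n r by (intro mult_left_mono less.IH less.prems) auto
      also have "\<dots> = B ^ n * \<rho> ^ k" using False by (simp add: power_add[symmetric])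
      finally show ?thesis .
    qed
  qed
qed

lemma eexp_SUP_birkhoff:
  assumes \<phi>: "\<And>\<omega>. \<omega> \<in> X \<Longrightarrow> \<phi> \<omega> \<noteq> \<infinity>" "\<And>\<omega>. \<omega> \<in> X \<Longrightarrow> eexp (\<phi> \<omega>) = ennreal (p \<omega>)"
  shows "eexp (SUP \<omega>\<in>cylinder A w. birkhoff_sum \<phi> n \<omega>) =
    (SUP \<omega>\<in>cylinder A w. ennreal (\<Prod>k<n. p ((shift ^^ k) \<omega>)))"
  unfolding eexp_SUP
proof (rule SUP_cong)
  fix \<omega> assume "\<omega> \<in> cylinder A w"
  then have X: "(shift ^^ k) \<omega> \<in> X" for k by (auto simp: cylinder_def intro: shift_funpow_in)
  then have "eexp (birkhoff_sum \<phi> n \<omega>) = (\<Prod>k<n. eexp (\<phi> ((shift ^^ k) \<omega>)))"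
    unfolding birkhoff_sum_def using \<phi> by (intro eexp_sum[THEN conjunct1]) auto
  also have "\<dots> = (\<Prod>k<n. ennreal (p ((shift ^^ k) \<omega>)))" using \<phi> X by simp
  also have "\<dots> = ennreal (\<Prod>k<n. p ((shift ^^ k) \<omega>))" using X p_nonneg by (intro prod_ennreal) auto
  finally show "eexp (birkhoff_sum \<phi> n \<omega>) = ennreal (\<Prod>k<n. p ((shift ^^ k) \<omega>))" .
qed auto

definition partition_sum :: "nat \<Rightarrow> ennreal" where
  "partition_sum n = (\<Sum>\<^sub>\<infinity>w\<in>{w. length w = n \<and> cylinder A w \<noteq> {}}.
     (SUP \<omega>\<in>cylinder A w. ennreal (\<Prod>k<n. p ((shift ^^ k) \<omega>))))"

text \<open>Each nonzero weight is the value of the Birkhoff product at one point of the cylinder of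
  the reversed word, hence at most the supremum over it.\<close>

lemma transfer_le_partition_sum:
  assumes "\<omega> \<in> X"
  shows "ennreal ((transfer A p ^^ n) (\<lambda>_. 1) \<omega>) \<le> partition_sum n"
proof -
  let ?W = "{w :: 's list. length w = n}"
  let ?s = "\<lambda>w. SUP \<omega>\<in>cylinder A w. ennreal (\<Prod>k<n. p ((shift ^^ k) \<omega>))"
  note hs = weight_has_sum[OF assms, of n]
  have "ennreal ((transfer A p ^^ n) (\<lambda>_. 1) \<omega>) = ennreal (infsum (\<lambda>w. weight w \<omega>) ?W)"
    using hs by (simp add: infsumI)
  also have "\<dots> = (SUP F\<in>{F. finite F \<and> F \<subseteq> ?W}. ennreal (sum (\<lambda>w. weight w \<omega>) F))"
    using hs weight_nonneg[OF assms] by (intro infsum_nonneg_is_SUPREMUM_ennreal) (auto simp: summable_on_def)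
  also have "\<dots> \<le> partition_sum n"
  proof (rule SUP_least)
    fix F assume F: "F \<in> {F. finite F \<and> F \<subseteq> ?W}"
    \<comment> \<open>Words of weight 0 may have an empty cylinder, and these do not occur in the
      partition sum.\<close>
    define G where "G = {w \<in> F. weight w \<omega> \<noteq> 0}"
    have G: "finite G" "G \<subseteq> F" using F by (auto simp: G_def)
    have *: "rev w \<in> {w. length w = n \<and> cylinder A w \<noteq> {}} \<and> ennreal (weight w \<omega>) \<le> ?s (rev w)" if "w \<in> G" for w
    proof -
      have adm: "admissible A w \<omega>" using that weight_admissible by (auto simp: G_def)
      have n: "length w = n" using that F G by auto
      have c: "prepend w \<omega> \<in> cylinder A (rev w)"
        using prepend_in[OF adm assms] prepend_nth[of _ w \<omega>] by (auto simp: cylinder_def)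
      have "ennreal (weight w \<omega>) \<le> ?s (rev w)"
        unfolding weight_eq[OF adm] n by (rule SUP_upper[OF c])
      then show ?thesis using c n by auto
    qed
    have "ennreal (sum (\<lambda>w. weight w \<omega>) F) = ennreal (sum (\<lambda>w. weight w \<omega>) G)"
      using F by (intro arg_cong[where f = ennreal] sum.mono_neutral_right) (auto simp: G_def)
    also have "\<dots> = (\<Sum>w\<in>G. ennreal (weight w \<omega>))" using weight_nonneg[OF assms] by (simp add: sum_ennreal)
    also have "\<dots> \<le> (\<Sum>w\<in>G. ?s (rev w))" using * by (intro sum_mono) auto
    also have "\<dots> = (\<Sum>w\<in>rev ` G. ?s w)" by (subst sum.reindex) (auto intro: inj_onI)
    also have "\<dots> \<le> partition_sum n"
      unfolding partition_sum_def
      by (subst nonneg_infsum_complete, simp, rule SUP_upper) (use G * in auto)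
    finally show "ennreal (sum (\<lambda>w. weight w \<omega>) F) \<le> partition_sum n" .
  qed
  finally show ?thesis .
qed

text \<open>The last of the \<open>Suc m\<close> letters, \<open>b\<close>, contributes at most
  \<open>q b\<close>, whatever letter follows it; the first \<open>m\<close> letters form a weight
  at a point starting with \<open>b\<close>, comparable to the weight at a fixed point
  \<open>x b\<close>. Hence the index drops by one and the sum over \<open>b\<close> costs
  \<open>qsum\<close>.\<close>

lemma partition_sum_le:
  assumes N: "\<And>\<omega>. \<omega> \<in> X \<Longrightarrow> (transfer A p ^^ m) (\<lambda>_. 1) \<omega> \<le> N" and N0: "0 \<le> N"
  shows "partition_sum (Suc m) \<le> ennreal (exp c0 * qsum * N)"
proof -
  let ?W = "{w. length w = Suc m \<and> cylinder A w \<noteq> {}}"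
  let ?s = "\<lambda>w. SUP \<omega>\<in>cylinder A w. ennreal (\<Prod>k<Suc m. p ((shift ^^ k) \<omega>))"
  define x where "x b = (SOME \<omega>. \<omega> \<in> X \<and> \<omega> 0 = b)" for b
  define S where "S = {b. \<exists>\<omega>\<in>X. \<omega> 0 = b}"
  have x: "x b \<in> X \<and> x b 0 = b" if "b \<in> S" for b
    using someI_ex[of "\<lambda>\<omega>. \<omega> \<in> X \<and> \<omega> 0 = b"] that by (auto simp: S_def x_def)
  define t where "t = (\<lambda>(b, v). exp c0 * (q b * weight v (x b)))"
  have t0: "0 \<le> t (b, v)" if "b \<in> S" for b v
    using q_nonneg weight_nonneg x[OF that] by (auto simp: t_def)
  define dec where "dec w = (hd (rev w), tl (rev w))" for w :: "'s list"
  have w: "?s w \<le> ennreal (t (dec w)) \<and> fst (dec w) \<in> S \<and> length (snd (dec w)) = m" if wW: "w \<in> ?W" for w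
  proof -
    obtain b v where bv: "rev w = b # v" using wW by (metis (mono_tags, lifting) length_Suc_conv length_rev mem_Collect_eq)
    then have w_eq: "w = rev v @ [b]" by (metis rev.simps(2) rev_swap)
    have len: "length v = m" using wW w_eq by simp
    have cyl: "\<omega> \<in> X \<and> ((shift ^^ m) \<omega>) 0 = b \<and> (\<Prod>k<m. p ((shift ^^ k) \<omega>)) = weight v ((shift ^^ m) \<omega>)" if "\<omega> \<in> cylinder A w" for \<omega>
    proof -
      have "\<omega> \<in> X" and nth: "\<And>i. i < Suc m \<Longrightarrow> \<omega> i = (rev v @ [b]) ! i" using that w_eq len by (auto simp: cylinder_def)
      moreover have "\<omega> i = rev v ! i" if "i < length v" for i using nth[of i] that len by (simp add: nth_append)
      ultimately have "prepend v ((shift ^^ m) \<omega>) = \<omega> \<and> admissible A v ((shift ^^ m) \<omega>)"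
        using prepend_shift[of \<omega> A v] len by auto
      then show ?thesis
        using weight_eq[of v "(shift ^^ m) \<omega>"] nth[of m] \<open>\<omega> \<in> X\<close> len by (auto simp: funpow_shift nth_append)
    qed
    obtain \<omega>0 where \<omega>0: "\<omega>0 \<in> cylinder A w" using wW by blast
    have b: "b \<in> S" unfolding S_def using cyl[OF \<omega>0] shift_funpow_in[of \<omega>0 A m] by blast
    have "?s w \<le> ennreal (t (b, v))"
    proof (rule SUP_least)
      fix \<omega> assume \<omega>: "\<omega> \<in> cylinder A w"
      let ?\<upsilon> = "(shift ^^ m) \<omega>"
      have \<upsilon>: "?\<upsilon> \<in> X" "?\<upsilon> 0 = b" using cyl[OF \<omega>] shift_funpow_in by blast+
      have "(\<Prod>k<Suc m. p ((shift ^^ k) \<omega>)) = weight v ?\<upsilon> * p ?\<upsilon>" using cyl[OF \<omega>] by simp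
      also have "\<dots> \<le> (exp (c0 * \<theta> ^ 1) * weight v (x b)) * q b"
        using x[OF b] \<upsilon> p_le[OF \<upsilon>(1)] p_nonneg[OF \<upsilon>(1)] weight_nonneg[OF \<upsilon>(1)] weight_nonneg[of "x b"]
        by (intro mult_mono weight_dist) auto
      also have "\<dots> \<le> (exp c0 * weight v (x b)) * q b"
        using c0_nonneg theta weight_nonneg[of "x b"] x[OF b] q_nonneg
        by (intro mult_right_mono) (auto simp: mult_left_le)
      finally show "ennreal (\<Prod>k<Suc m. p ((shift ^^ k) \<omega>)) \<le> ennreal (t (b, v))"
        by (intro ennreal_leI) (simp add: t_def algebra_simps)
    qed
    then show ?thesis using b len bv by (simp add: dec_def)
  qed
  have "partition_sum (Suc m) = (SUP F\<in>{F. finite F \<and> F \<subseteq> ?W}. sum ?s F)"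
    unfolding partition_sum_def by (rule nonneg_infsum_complete) auto
  also have "\<dots> \<le> ennreal (exp c0 * qsum * N)"
  proof (rule SUP_least)
    fix F assume F: "F \<in> {F. finite F \<and> F \<subseteq> ?W}"
    have wF: "?s w \<le> ennreal (t (dec w)) \<and> fst (dec w) \<in> S \<and> length (snd (dec w)) = m" if "w \<in> F" for w
      using F that by (intro w) auto
    have inj: "inj_on dec F"
    proof (rule inj_onI)
      fix u w assume "u \<in> F" "w \<in> F" "dec u = dec w"
      then have "rev u \<noteq> []" "rev w \<noteq> []" using F by auto
      then have "rev u = rev w" using \<open>dec u = dec w\<close> by (metis dec_def list.collapse prod.inject)
      then show "u = w" by simp
    qed
    define B where "B = fst ` dec ` F"
    define V where "V = snd ` dec ` F"
    have fin: "finite B" "finite V" "B \<subseteq> S" "V \<subseteq> {v. length v = m}" using F wF by (auto simp: B_def V_def)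
    have "sum ?s F \<le> (\<Sum>w\<in>F. ennreal (t (dec w)))" using wF by (intro sum_mono) auto
    also have "\<dots> = (\<Sum>z\<in>dec ` F. ennreal (t z))" using inj by (simp add: sum.reindex)
    \<comment> \<open>Enlarging to a rectangle makes the sums over the last letter and over the
      preceding word independent.\<close>
    also have "\<dots> \<le> (\<Sum>z\<in>B \<times> V. ennreal (t z))"
    proof (rule sum_mono2)
      show "dec ` F \<subseteq> B \<times> V"
        unfolding B_def V_def by (metis image_eqI mem_Times_iff subsetI)
    qed (use fin in auto)
    also have "\<dots> = ennreal (\<Sum>z\<in>B \<times> V. t z)"
      using fin t0 by (intro sum_ennreal) auto
    also have "(\<Sum>z\<in>B \<times> V. t z) = (\<Sum>b\<in>B. exp c0 * (q b * (\<Sum>v\<in>V. weight v (x b))))"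
      by (simp add: sum.cartesian_product[symmetric] t_def sum_distrib_left)
    also have "\<dots> \<le> (\<Sum>b\<in>B. exp c0 * (q b * N))"
    proof (intro sum_mono mult_left_mono)
      fix b assume "b \<in> B"
      then have xb: "x b \<in> X" using x fin by auto
      have "(\<Sum>v\<in>V. weight v (x b)) \<le> infsum (\<lambda>v. weight v (x b)) {v. length v = m}"
        using weight_has_sum[OF xb, of m] weight_nonneg[OF xb] fin
        by (intro finite_sum_le_infsum) (auto simp: summable_on_def)
      also have "\<dots> = (transfer A p ^^ m) (\<lambda>_. 1) (x b)" using weight_has_sum[OF xb] by (rule infsumI)
      also have "\<dots> \<le> N" by (rule N[OF xb])
      finally show "(\<Sum>v\<in>V. weight v (x b)) \<le> N" .
    qed (use q_nonneg in auto)
    also have "\<dots> = exp c0 * N * (\<Sum>b\<in>B. q b)"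
      by (simp add: sum_distrib_left sum_distrib_right mult_ac)
    also have "\<dots> \<le> exp c0 * N * qsum"
      unfolding qsum_def using N0 q_nonneg fin q_summable
      by (intro mult_left_mono finite_sum_le_infsum) auto
    finally show "sum ?s F \<le> ennreal (exp c0 * qsum * N)" by (simp add: algebra_simps ennreal_leI)
  qed
  finally show ?thesis .
qed

text \<open>The lower bound holds for every \<open>n \<ge> 1\<close>, since one small partition sum
  would already put too small a rate into \<open>growth A\<close>. The upper bound loses a constant
  factor \<open>J\<close>, which disappears after division by \<open>n\<close>. Together they also
  show that the limit exists.\<close>

theorem pressure_eq:
  assumes \<phi>: "\<And>\<omega>. \<omega> \<in> X \<Longrightarrow> \<phi> \<omega> \<noteq> \<infinity>" "\<And>\<omega>. \<omega> \<in> X \<Longrightarrow> eexp (\<phi> \<omega>) = ennreal (p \<omega>)"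
  shows "pressure A \<phi> = (INF \<rho>\<in>growth A. ereal (ln \<rho>))"
proof -
  let ?I = "INF \<rho>\<in>growth A. ereal (ln \<rho>)"
  let ?e = "\<lambda>n. ereal (1 / real n) * elog (partition_sum n)"
  have e_le: "partition_sum n \<le> ennreal (exp (real n * y))" if "?e n \<le> ereal y" "1 \<le> n" for n y
  proof -
    have "elog (partition_sum n) \<le> ereal (real n * y)"
      using that by (cases "elog (partition_sum n)") (auto simp: field_simps split: if_splits)
    then show ?thesis by (simp add: elog_le_iff)
  qed
  have "?e \<longlonglongrightarrow> ?I"
  proof (rule order_tendstoI)
    fix a assume "a < ?I"
    then obtain y where y: "a < ereal y" "ereal y < ?I" using ereal_dense2 by blast
    have "a < ?e n" if "1 \<le> n" for n
    proof (rule ccontr)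
      assume "\<not> a < ?e n"
      then have "?e n \<le> ereal y" using y by (meson less_imp_le not_le order_trans)
      then have "partition_sum n \<le> ennreal (exp (real n * y))" using that by (rule e_le)
      then have "partition_sum n \<le> ennreal (exp y ^ n)" by (simp add: exp_of_nat_mult)
      then have "(transfer A p ^^ n) (\<lambda>_. 1) \<omega> \<le> exp y ^ n" if "\<omega> \<in> X" for \<omega>
        using order_trans[OF transfer_le_partition_sum[OF that, of n], of "ennreal (exp y ^ n)"]
        by (simp add: ennreal_le_iff)
      then have "exp y \<in> growth A" by (intro growth_one_step[OF _ \<open>1 \<le> n\<close>]) auto
      then have "?I \<le> ereal (ln (exp y))" by (intro INF_lower)
      then show False using y by simp
    qed
    then show "\<forall>\<^sub>F n in sequentially. a < ?e n" by (auto simp: eventually_sequentially)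
  next
    fix a assume "?I < a"
    then obtain \<rho> where \<rho>: "\<rho> \<in> growth A" "ereal (ln \<rho>) < a" by (auto simp: INF_less_iff)
    obtain K where K: "0 < K" "\<And>k \<omega>. \<omega> \<in> X \<Longrightarrow> (transfer A p ^^ k) (\<lambda>_. 1) \<omega> \<le> K * \<rho> ^ k" "0 < \<rho>"
      using growthE[OF \<rho>(1)] by blast
    \<comment> \<open>Division by \<rho> compensates the index shift \<open>n = Suc m\<close>; the
      summand 1 keeps \<open>J\<close> positive, so that its logarithm is meaningful.\<close>
    define J where "J = exp c0 * qsum * K / \<rho> + 1"
    have J: "0 < J" using K qsum_nonneg by (auto simp: J_def intro!: add_nonneg_pos)
    have up: "?e n \<le> ereal (ln J / n + ln \<rho>)" if "1 \<le> n" for n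
    proof -
      obtain m where m: "n = Suc m" using \<open>1 \<le> n\<close> by (cases n) auto
      have "partition_sum n \<le> ennreal (exp c0 * qsum * (K * \<rho> ^ m))"
        unfolding m using K by (intro partition_sum_le) auto
      also have "exp c0 * qsum * (K * \<rho> ^ m) \<le> J * \<rho> ^ n"
        using K by (simp add: J_def m field_simps)
      finally have "partition_sum n \<le> ennreal (J * \<rho> ^ n)" by (simp add: ennreal_leI)
      also have "\<dots> = eexp (ereal (ln J + real n * ln \<rho>))"
        using J K by (simp add: exp_add exp_of_nat_mult)
      finally have "elog (partition_sum n) \<le> ereal (ln J + real n * ln \<rho>)" by (simp only: elog_le_iff)
      then have "?e n \<le> ereal (1 / real n) * ereal (ln J + real n * ln \<rho>)"
        by (intro ereal_mult_left_mono) auto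
      then show ?thesis using that by (simp add: field_simps)
    qed
    have "(\<lambda>n. ereal (ln J / real n + ln \<rho>)) \<longlonglongrightarrow> ereal (0 + ln \<rho>)"
      by (intro tendsto_ereal tendsto_add lim_const_over_n tendsto_const)
    then have "\<forall>\<^sub>F n in sequentially. ereal (ln J / real n + ln \<rho>) < a"
      using \<rho>(2) by (intro order_tendstoD) auto
    then show "\<forall>\<^sub>F n in sequentially. ?e n < a"
      using eventually_ge_at_top[of 1] by eventually_elim (use up in \<open>auto intro: le_less_trans\<close>)
  qed
  moreover have "(\<Sum>\<^sub>\<infinity>w\<in>{w. length w = n \<and> cylinder A w \<noteq> {}}.
      eexp (SUP \<omega>\<in>cylinder A w. birkhoff_sum \<phi> n \<omega>)) = partition_sum n" for n
    unfolding partition_sum_def by (simp add: eexp_SUP_birkhoff[OF \<phi>])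
  ultimately show ?thesis unfolding pressure_def by (simp add: limI)
qed

end

section \<open>Perron data of an irreducible component\<close>

lemma open_agree: "open {\<upsilon> :: nat \<Rightarrow> 's::discrete_topology. agree k \<omega> \<upsilon>}"
proof -
  have "open (\<Inter>i<k. (\<lambda>\<upsilon> :: nat \<Rightarrow> 's. \<upsilon> i) -` {\<omega> i})"
    by (intro open_INT ballI open_vimage open_discrete continuous_on_product_coordinates) auto
  also have "(\<Inter>i<k. (\<lambda>\<upsilon> :: nat \<Rightarrow> 's. \<upsilon> i) -` {\<omega> i}) = {\<upsilon>. agree k \<omega> \<upsilon>}" by (auto simp: agree_def)
  finally show ?thesis .
qed

lemma lip_on_continuous:
  fixes f :: "(nat \<Rightarrow> 's::discrete_topology) \<Rightarrow> 'b::real_normed_vector"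
  assumes "lip_on \<theta> X K f" "0 < \<theta>" "\<theta> < 1"
  shows "continuous_on X f"
  unfolding continuous_on_def
proof (intro ballI tendstoI)
  fix \<omega> and e :: real assume \<omega>: "\<omega> \<in> X" "0 < e"
  have "(\<lambda>k. K * \<theta> ^ k) \<longlonglongrightarrow> K * 0"
    using assms by (intro tendsto_mult tendsto_const LIMSEQ_power_zero) auto
  then have "\<forall>\<^sub>F k in sequentially. K * \<theta> ^ k < e" using \<omega> by (intro order_tendstoD) auto
  then have "\<exists>k. K * \<theta> ^ k < e \<and> 1 \<le> k"
    by (intro eventually_happens'[OF sequentially_bot] eventually_conj eventually_ge_at_top)
  then obtain k where k: "1 \<le> k" "K * \<theta> ^ k < e" by blast
  have "dist (f \<upsilon>) (f \<omega>) < e" if "\<upsilon> \<in> X" "agree k \<omega> \<upsilon>" for \<upsilon>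
    using lip_onD2[OF assms(1) k(1) that(1) \<omega>(1) agree_sym[OF that(2)]] k(2) by (simp add: dist_norm)
  then show "\<forall>\<^sub>F \<upsilon> in at \<omega> within X. dist (f \<upsilon>) (f \<omega>) < e"
    unfolding eventually_at_topological
    by (intro exI[of _ "{\<upsilon>. agree k \<omega> \<upsilon>}"]) (auto simp: open_agree)
qed

lemma d_theta_le:
  assumes "0 < \<theta>" "\<theta> < 1" "agree k \<omega> \<upsilon>"
  shows "d_theta \<theta> \<omega> \<upsilon> \<le> \<theta> ^ k"
proof (cases "\<omega> = \<upsilon>")
  case False
  then have "\<exists>n. \<omega> n \<noteq> \<upsilon> n" by (auto simp: fun_eq_iff)
  then have "\<omega> (LEAST n. \<omega> n \<noteq> \<upsilon> n) \<noteq> \<upsilon> (LEAST n. \<omega> n \<noteq> \<upsilon> n)" by (rule LeastI_ex)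
  then have "k \<le> (LEAST n. \<omega> n \<noteq> \<upsilon> n)" using assms(3) by (meson agree_def not_le)
  then show ?thesis using assms False by (auto simp: d_theta_def intro: power_decreasing)
qed (use assms in \<open>auto simp: d_theta_def\<close>)

lemma agree_LEAST: "agree (LEAST n. \<omega> n \<noteq> \<upsilon> n) \<omega> \<upsilon>"
  unfolding agree_def using not_less_Least by blast

lemma d_theta_pos: "0 < \<theta> \<Longrightarrow> \<omega> \<noteq> \<upsilon> \<Longrightarrow> 0 < d_theta \<theta> \<omega> \<upsilon>"
  by (auto simp: d_theta_def)

lemma lip_seminorm_bound:
  assumes "0 < \<theta>" "\<theta> < 1" "lip_seminorm \<theta> X j f \<le> ennreal L" "0 \<le> L"
    "\<omega> \<in> X" "\<upsilon> \<in> X" "j \<le> k" "agree k \<omega> \<upsilon>"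
  shows "norm (f \<omega> - f \<upsilon>) \<le> L * \<theta> ^ k"
proof (cases "\<omega> = \<upsilon>")
  case False
  have "ennreal (norm (f \<omega> - f \<upsilon>) / d_theta \<theta> \<omega> \<upsilon>) \<le> lip_seminorm \<theta> X j f"
    unfolding lip_seminorm_def
    by (rule SUP_upper2[of "(\<omega>, \<upsilon>)"]) (use False assms(5-8) in \<open>auto simp: agree_def\<close>)
  then have "ennreal (norm (f \<omega> - f \<upsilon>) / d_theta \<theta> \<omega> \<upsilon>) \<le> ennreal L"
    using assms(3) by (rule order_trans)
  then have "norm (f \<omega> - f \<upsilon>) / d_theta \<theta> \<omega> \<upsilon> \<le> L" using assms(4) by (simp add: ennreal_le_iff)
  then have "norm (f \<omega> - f \<upsilon>) \<le> L * d_theta \<theta> \<omega> \<upsilon>"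
    using d_theta_pos[OF assms(1) False] by (simp add: pos_divide_le_eq)
  also have "\<dots> \<le> L * \<theta> ^ k" using assms by (intro mult_left_mono d_theta_le) auto
  finally show ?thesis .
qed (use assms in auto)

text \<open>The two parts of the norm are merged into one constant. Conversely the seminorm is
  tested at the first disagreement, where \<open>d_theta\<close> equals the power of \<theta>;
  continuity follows because cylinders are open.\<close>

lemma Fb_iff_lip:
  fixes X :: "(nat \<Rightarrow> 's::discrete_topology) set"
  assumes "0 < \<theta>" "\<theta> < 1"
  shows "f \<in> Fb \<theta> X \<longleftrightarrow> (\<exists>K. lip_on \<theta> X K f)"
proof
  assume "f \<in> Fb \<theta> X"
  then have fin: "sup_norm X f + lip_seminorm \<theta> X 1 f < \<infinity>" by (simp add: Fb_def)
  define S where "S = enn2real (sup_norm X f)"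
  define L where "L = enn2real (lip_seminorm \<theta> X 1 f)"
  have S: "sup_norm X f = ennreal S" and L: "lip_seminorm \<theta> X 1 f = ennreal L"
    using fin by (auto simp: S_def L_def ennreal_enn2real_if less_top)
  have 0: "0 \<le> S" "0 \<le> L" by (auto simp: S_def L_def)
  have "lip_on \<theta> X (S + L) f"
    unfolding lip_on_def
  proof safe
    fix \<omega> assume "\<omega> \<in> X"
    then have "ennreal (norm (f \<omega>)) \<le> ennreal S" unfolding S[symmetric] sup_norm_def by (intro SUP_upper)
    then show "norm (f \<omega>) \<le> S + L" using 0 by (simp add: ennreal_le_iff)
  next
    fix k \<omega> \<upsilon> assume *: "1 \<le> k" "\<omega> \<in> X" "\<upsilon> \<in> X" "agree k \<omega> \<upsilon>"
    have "norm (f \<omega> - f \<upsilon>) \<le> L * \<theta> ^ k"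
      by (rule lip_seminorm_bound[OF assms eq_refl[OF L] 0(2) *(2,3,1,4)])
    also have "\<dots> \<le> (S + L) * \<theta> ^ k" using 0 assms by (intro mult_right_mono) auto
    finally show "norm (f \<omega> - f \<upsilon>) \<le> (S + L) * \<theta> ^ k" .
  qed
  then show "\<exists>K. lip_on \<theta> X K f" by blast
next
  assume "\<exists>K. lip_on \<theta> X K f"
  then obtain K where K: "lip_on \<theta> X K f" by blast
  have "sup_norm X f \<le> ennreal K"
    unfolding sup_norm_def by (rule SUP_least) (use lip_onD[OF K] in \<open>auto intro: ennreal_leI\<close>)
  moreover have "lip_seminorm \<theta> X 1 f \<le> ennreal K"
    unfolding lip_seminorm_def
  proof (rule SUP_least, safe)
    fix \<omega> \<upsilon> assume *: "\<omega> \<in> X" "\<upsilon> \<in> X" "\<omega> \<noteq> \<upsilon>" "\<forall>i<1. \<omega> i = \<upsilon> i"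
    define n where "n = (LEAST n. \<omega> n \<noteq> \<upsilon> n)"
    have ag: "agree n \<omega> \<upsilon>" unfolding n_def by (rule agree_LEAST)
    have "\<omega> n \<noteq> \<upsilon> n" unfolding n_def by (rule LeastI_ex) (use * in \<open>auto simp: fun_eq_iff\<close>)
    then have "1 \<le> n" using *(4) by (cases n) auto
    from lip_onD2[OF K this *(1,2) ag] have "norm (f \<omega> - f \<upsilon>) / \<theta> ^ n \<le> K"
      using assms by (simp add: pos_divide_le_eq)
    then show "ennreal (norm (f \<omega> - f \<upsilon>) / d_theta \<theta> \<omega> \<upsilon>) \<le> ennreal K"
      using * by (intro ennreal_leI) (simp add: d_theta_def n_def)
  qed
  ultimately have "sup_norm X f + lip_seminorm \<theta> X 1 f \<le> ennreal K + ennreal K" by (rule add_mono)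
  also have "\<dots> < \<infinity>" by simp
  finally show "f \<in> Fb \<theta> X" using lip_on_continuous[OF K assms] by (simp add: Fb_def)
qed

text \<open>The Perron data in real form. The locale is used with \<open>M = A\<close>,
  \<open>U = UNIV\<close> for the perturbed operators and with a component \<open>U\<close> for the
  limit. The eigenvalue equation is imposed on all of \<open>X\<close>, so it also determines
  \<open>h\<close> outside the space of \<open>M\<close>.\<close>

locale rpf = potential \<theta> A p C q
  for \<theta> and A :: "'s::{countable,discrete_topology} \<Rightarrow> 's \<Rightarrow> bool" and p C q +
  fixes M :: "'s \<Rightarrow> 's \<Rightarrow> bool" and h :: "(nat \<Rightarrow> 's) \<Rightarrow> real" and \<nu> :: "(nat \<Rightarrow> 's) measure"
    and l :: real and U :: "'s set"
  assumes M_le: "M \<le> A" and M_U: "M a b \<Longrightarrow> a \<in> U \<and> b \<in> U"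
    and p_pos: "\<omega> \<in> shift_space A \<Longrightarrow> M (\<omega> 0) (\<omega> (Suc 0)) \<Longrightarrow> 0 < p \<omega>"
    and irr: "a \<in> U \<Longrightarrow> b \<in> U \<Longrightarrow> M\<^sup>*\<^sup>* a b"
    and h_nonneg: "\<omega> \<in> shift_space A \<Longrightarrow> 0 \<le> h \<omega>"
    and h_lip: "\<exists>K. lip_on \<theta> (shift_space A) K h"
    and h_eigen: "\<omega> \<in> shift_space A \<Longrightarrow> transfer M p h \<omega> = l * h \<omega>"
    and l_nonneg: "0 \<le> l"
    and sets_nu: "sets \<nu> = sets (restrict_space borel (shift_space A))"
    and nu_X: "emeasure \<nu> (shift_space A) = 1"
    and nu_supp: "AE \<omega> in \<nu>. \<omega> \<in> shift_space M"
    and dual: "lip_on \<theta> (shift_space A) K f \<Longrightarrow> (\<integral>\<omega>. transfer M p f \<omega> \<partial>\<nu>) = l * (\<integral>\<omega>. f \<omega> \<partial>\<nu>)"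
    and nu_h: "(\<integral>\<omega>. h \<omega> \<partial>\<nu>) = 1"
begin

abbreviation L where "L \<equiv> transfer M p"
abbreviation XM where "XM \<equiv> shift_space M"

section \<open>Positivity and distortion of the Perron data\<close>

lemma XM_X: "\<omega> \<in> XM \<Longrightarrow> \<omega> \<in> X"
  using shift_space_mono[OF M_le] by blast

lemma XM_U: "\<omega> \<in> XM \<Longrightarrow> \<omega> i \<in> U"
  using M_U by (auto simp: shift_space_def)

lemma space_nu: "space \<nu> = X"
  using sets_eq_imp_space_eq[OF sets_nu] by (simp add: space_restrict_space)

lemma finite_nu: "finite_measure \<nu>"
  by (rule finite_measureI) (simp add: space_nu nu_X)

lemma measure_nu [simp]: "measure \<nu> (space \<nu>) = 1"
  by (simp add: space_nu measure_def nu_X)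

lemma lip_measurable: "lip K f \<Longrightarrow> f \<in> borel_measurable \<nu>"
  using borel_measurable_continuous_on_restrict[OF lip_on_continuous[OF _ theta]] measurable_cong_sets[OF sets_nu refl]
  by blast

lemma lip_integrable: "lip K f \<Longrightarrow> integrable \<nu> f"
  by (rule finite_measure.integrable_const_bound[OF finite_nu, of _ K])
    (auto simp: lip_on_def space_nu lip_measurable)

lemma lip_integral_nonneg: "lip K f \<Longrightarrow> (\<And>\<omega>. \<omega> \<in> X \<Longrightarrow> 0 \<le> f \<omega>) \<Longrightarrow> 0 \<le> (\<integral>\<omega>. f \<omega> \<partial>\<nu>)"
  by (rule integral_nonneg_AE) (auto simp: space_nu intro!: AE_I2)

lemma lip_integral_mono:
  "lip K f \<Longrightarrow> lip J g \<Longrightarrow> (\<And>\<omega>. \<omega> \<in> X \<Longrightarrow> f \<omega> \<le> g \<omega>) \<Longrightarrow> (\<integral>\<omega>. f \<omega> \<partial>\<nu>) \<le> (\<integral>\<omega>. g \<omega> \<partial>\<nu>)"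
  by (rule integral_mono) (auto simp: space_nu intro: lip_integrable)

lemma lip_integral_pos:
  assumes "lip K f" "lip J g" "\<And>\<omega>. \<omega> \<in> X \<Longrightarrow> 0 \<le> f \<omega>" "\<And>\<omega>. \<omega> \<in> X \<Longrightarrow> 0 \<le> g \<omega>"
    "\<And>\<omega>. \<omega> \<in> X \<Longrightarrow> 0 < g \<omega> \<Longrightarrow> 0 < f \<omega>" "0 < (\<integral>\<omega>. g \<omega> \<partial>\<nu>)"
  shows "0 < (\<integral>\<omega>. f \<omega> \<partial>\<nu>)"
proof (rule ccontr)
  assume "\<not> ?thesis"
  then have "(\<integral>\<omega>. f \<omega> \<partial>\<nu>) = 0" using lip_integral_nonneg[OF assms(1,3)] by simp
  then have "AE \<omega> in \<nu>. f \<omega> = 0"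
    by (subst (asm) integral_nonneg_eq_0_iff_AE[OF lip_integrable[OF assms(1)]])
      (auto simp: space_nu assms(3) intro!: AE_I2)
  moreover have "AE \<omega> in \<nu>. \<omega> \<in> X" by (rule AE_I2) (simp add: space_nu)
  ultimately have "AE \<omega> in \<nu>. g \<omega> = 0"
    by eventually_elim (use assms(4,5) in \<open>metis less_eq_real_def less_irrefl\<close>)
  then have "(\<integral>\<omega>. g \<omega> \<partial>\<nu>) = (\<integral>\<omega>. 0 \<partial>\<nu>)" by (intro integral_cong_AE) (auto intro: lip_measurable[OF assms(2)])
  then show False using assms(6) by simp
qed

lemma dual_iter: "lip K f \<Longrightarrow> (\<integral>\<omega>. (L ^^ n) f \<omega> \<partial>\<nu>) = l ^ n * (\<integral>\<omega>. f \<omega> \<partial>\<nu>)"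
proof (induction n)
  case (Suc n)
  obtain K' where "lip K' ((L ^^ n) f)" using lip_iter[OF M_le Suc.prems] by blast
  from dual[OF this] Suc show ?case by simp
qed auto

lemma integral_iter_one: "(\<integral>\<omega>. (L ^^ n) (\<lambda>_. 1) \<omega> \<partial>\<nu>) = l ^ n"
  using dual_iter[OF lip_on_const[OF theta(1)], of n "1::real"] by simp

lemma h_bdd: "bdd h"
  using h_lip lip_bdd by blast

lemma h_iter: "\<omega> \<in> X \<Longrightarrow> (L ^^ n) h \<omega> = l ^ n * h \<omega>"
proof (induction n arbitrary: \<omega>)
  case (Suc n)
  have "(L ^^ Suc n) h \<omega> = L (\<lambda>\<omega>. l ^ n * h \<omega>) \<omega>"
    using Suc by (auto intro!: transfer_cong M_le)
  then show ?case using Suc.prems by (simp add: transfer_cmult h_eigen)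
qed auto

lemma XM_nonempty: "\<exists>\<omega>\<in>XM. 0 < h \<omega>"
proof (rule ccontr)
  assume *: "\<not> ?thesis"
  obtain K where K: "lip K h" using h_lip by blast
  have "AE \<omega> in \<nu>. \<omega> \<in> X" by (rule AE_I2) (simp add: space_nu)
  with nu_supp have "AE \<omega> in \<nu>. h \<omega> = 0"
    by eventually_elim (use * h_nonneg in \<open>meson not_less order_antisym\<close>)
  then have "(\<integral>\<omega>. h \<omega> \<partial>\<nu>) = (\<integral>\<omega>. 0 \<partial>\<nu>)" by (intro integral_cong_AE) (auto intro: lip_measurable[OF K])
  then show False using nu_h by simp
qed

lemma l_pos: "0 < l"
proof -
  obtain \<omega> where \<omega>: "\<omega> \<in> XM" "0 < h \<omega>" using XM_nonempty by blast
  let ?\<upsilon> = "shift \<omega>"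
  have \<upsilon>: "?\<upsilon> \<in> X" using XM_X[OF shift_in_shift_space[OF \<omega>(1)]] .
  have "0 < p \<omega> * h \<omega>" using \<omega> XM_X p_pos by (auto simp: shift_space_def)
  also have "\<dots> \<le> L h ?\<upsilon>"
    using transfer_ge_term[OF M_le h_bdd h_nonneg \<upsilon>, of "\<omega> 0"] shift_space_0[OF \<omega>(1)] by simp
  also have "\<dots> = l * h ?\<upsilon>" by (rule h_eigen[OF \<upsilon>])
  finally show ?thesis using l_nonneg by (cases "l = 0") auto
qed

text \<open>Some state has mass because \<nu> lives on \<open>XM\<close>. Positivity travels
  backwards along an edge from \<open>c\<close> to \<open>d\<close>: by duality the mass of
  \<open>c\<close> is \<open>1 / l\<close> times the integral of \<open>L (state_ind c)\<close>,
  which is positive at points starting with \<open>d\<close>.\<close>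

lemma state_mass_pos:
  assumes "a \<in> U"
  shows "0 < (\<integral>\<omega>. state_ind a \<omega> \<partial>\<nu>)"
proof -
  have "\<exists>b\<in>U. 0 < (\<integral>\<omega>. state_ind b \<omega> \<partial>\<nu>)"
  proof (rule ccontr)
    assume *: "\<not> ?thesis"
    have "AE \<omega> in \<nu>. b \<in> U \<longrightarrow> \<omega> 0 \<noteq> b" for b
    proof (cases "b \<in> U")
      case True
      then have "(\<integral>\<omega>. state_ind b \<omega> \<partial>\<nu>) = 0"
        using * lip_integral_nonneg[OF state_ind_lip state_ind_nonneg, of b] by (simp add: order.antisym not_less)
      then have "AE \<omega> in \<nu>. state_ind b \<omega> = 0"
        by (subst (asm) integral_nonneg_eq_0_iff_AE[OF lip_integrable[OF state_ind_lip]])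
          (auto simp: state_ind_def)
      then show ?thesis by eventually_elim (auto simp: state_ind_def split: if_splits)
    qed auto
    then have "AE \<omega> in \<nu>. \<forall>b. b \<in> U \<longrightarrow> \<omega> 0 \<noteq> b" by (subst AE_all_countable) auto
    with nu_supp have "AE \<omega> in \<nu>. False" by eventually_elim (use XM_U in blast)
    then have "emeasure \<nu> (space \<nu>) = 0" by (simp add: AE_iff_measurable[OF sets.top])
    then show False by (simp add: space_nu nu_X)
  qed
  then obtain b where b: "b \<in> U" "0 < (\<integral>\<omega>. state_ind b \<omega> \<partial>\<nu>)" by blast
  show ?thesis
    using irr[OF assms b(1)]
  proof (induction rule: converse_rtranclp_induct)
    case base then show ?case by (rule b)
  next
    case (step c d)
    obtain K where K: "lip K (L (state_ind c))" using lip_transfer[OF M_le state_ind_lip] by blast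
    have "0 < (\<integral>\<omega>. L (state_ind c) \<omega> \<partial>\<nu>)"
    proof (rule lip_integral_pos[OF K state_ind_lip _ _ _ step.IH])
      fix \<omega> assume \<omega>: "\<omega> \<in> X" "0 < state_ind d \<omega>"
      then have 0: "M c (\<omega> 0)" using step.hyps by (auto simp: state_ind_def split: if_splits)
      then have cX: "case_nat c \<omega> \<in> X" by (rule Cons_in_X[OF M_le \<omega>(1)])
      have "0 < p (case_nat c \<omega>) * state_ind c (case_nat c \<omega>)"
        using p_pos[OF cX] 0 by (simp add: state_ind_def)
      also have "\<dots> \<le> L (state_ind c) \<omega>"
        by (rule transfer_ge_term[OF M_le state_ind_bdd _ \<omega>(1) 0]) (simp add: state_ind_def)
      finally show "0 < L (state_ind c) \<omega>" .
    qed (auto intro!: transfer_nonneg M_le simp: state_ind_def)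
    also have "\<dots> = l * (\<integral>\<omega>. state_ind c \<omega> \<partial>\<nu>)" by (rule dual[OF state_ind_lip])
    finally show ?case using l_pos by (simp add: zero_less_mult_iff)
  qed
qed

lemma state_in_XM: assumes "a \<in> U" shows "\<exists>\<omega>\<in>XM. \<omega> 0 = a"
proof -
  obtain \<omega>0 where \<omega>0: "\<omega>0 \<in> XM" using XM_nonempty by blast
  show ?thesis
    using irr[OF assms XM_U[OF \<omega>0, of 0]]
  proof (induction rule: converse_rtranclp_induct)
    case base then show ?case using \<omega>0 by blast
  next
    case (step a b)
    then obtain \<xi> where \<xi>: "\<xi> \<in> XM" "\<xi> 0 = b" by blast
    then have "case_nat a \<xi> \<in> XM" using step.hyps by (intro Cons_in_shift_space) auto
    then show ?case by (intro bexI[of _ "case_nat a \<xi>"]) auto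
  qed
qed

text \<open>Letters are prepended one at a time by duality. Hence a nonnegative Lipschitz function
  with integral 0 must vanish on \<open>XM\<close>.\<close>

lemma cylinder_mass_pos:
  assumes "\<omega> \<in> XM"
  shows "0 < (\<integral>\<upsilon>. ind (Suc n) \<omega> \<upsilon> \<partial>\<nu>)"
  using assms
proof (induction n arbitrary: \<omega>)
  case 0
  have "ind (Suc 0) \<omega> = state_ind (\<omega> 0)" by (auto simp: ind_def state_ind_def)
  then show ?case using state_mass_pos XM_U[OF 0] by simp
next
  case (Suc n)
  let ?f = "ind (Suc (Suc n)) \<omega>"
  obtain K where K: "lip K (L ?f)" using lip_transfer[OF M_le ind_lip] by blast
  have "0 < (\<integral>\<upsilon>. L ?f \<upsilon> \<partial>\<nu>)"
  proof (rule lip_integral_pos[OF K ind_lip _ _ _ Suc.IH[OF shift_in_shift_space[OF Suc.prems]]])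
    fix \<upsilon> assume \<upsilon>: "\<upsilon> \<in> X" "0 < ind (Suc n) (shift \<omega>) \<upsilon>"
    then have ag: "agree (Suc n) (shift \<omega>) \<upsilon>" by (auto simp: ind_def split: if_splits)
    have 0: "M (\<omega> 0) (\<upsilon> 0)" using shift_space_0[OF Suc.prems] agree_zeroth[OF ag] by simp
    have cX: "case_nat (\<omega> 0) \<upsilon> \<in> X" by (rule Cons_in_X[OF M_le \<upsilon>(1) 0])
    have "agree (Suc (Suc n)) (case_nat (\<omega> 0) (shift \<omega>)) (case_nat (\<omega> 0) \<upsilon>)" by (rule agree_Cons[OF ag])
    then have "0 < p (case_nat (\<omega> 0) \<upsilon>) * ?f (case_nat (\<omega> 0) \<upsilon>)"
      using p_pos[OF cX] 0 by (simp add: ind_def)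
    also have "\<dots> \<le> L ?f \<upsilon>"
      by (rule transfer_ge_term[OF M_le ind_bdd ind_range(1) \<upsilon>(1) 0])
    finally show "0 < L ?f \<upsilon>" .
  qed (auto intro!: transfer_nonneg M_le simp: ind_def)
  also have "\<dots> = l * (\<integral>\<upsilon>. ?f \<upsilon> \<partial>\<nu>)" by (rule dual[OF ind_lip])
  finally show ?case using l_pos by (simp add: zero_less_mult_iff)
qed

lemma cone_iter_one: "cone 1 c0 ((L ^^ n) (\<lambda>_. 1))"
  by (rule cone_iter_1) (auto simp: M_le c0_nonneg intro: cone_const)

text \<open>The iterate of 1 has integral \<open>l ^ n\<close> and bounded distortion, so its value
  at a point is comparable to its average over the cylinder of the first letter.\<close>

lemma iter_one_le:
  assumes "\<omega> \<in> X" "\<omega> 0 \<in> U"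
  shows "(L ^^ n) (\<lambda>_. 1) \<omega> * (\<integral>\<upsilon>. state_ind (\<omega> 0) \<upsilon> \<partial>\<nu>) \<le> exp c0 * l ^ n"
proof -
  let ?g = "(L ^^ n) (\<lambda>_. 1)"
  have 1: "lip (norm (1::real)) (\<lambda>_. 1)" by (rule lip_on_const[OF theta(1)])
  obtain K where K: "lip K ?g" using lip_iter[OF M_le 1] by blast
  have "?g \<omega> * (\<integral>\<upsilon>. state_ind (\<omega> 0) \<upsilon> \<partial>\<nu>) = (\<integral>\<upsilon>. ?g \<omega> * state_ind (\<omega> 0) \<upsilon> \<partial>\<nu>)" by simp
  also have "\<dots> \<le> (\<integral>\<upsilon>. exp c0 * ?g \<upsilon> \<partial>\<nu>)"
  proof (rule lip_integral_mono[OF lip_on_cmult[OF state_ind_lip theta(1)] lip_on_cmult[OF K theta(1)]])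
    fix \<upsilon> assume "\<upsilon> \<in> X"
    then show "?g \<omega> * state_ind (\<omega> 0) \<upsilon> \<le> exp c0 * ?g \<upsilon>"
      using cone_le'[OF cone_iter_one c0_nonneg assms(1), of \<upsilon> n] cone_nonneg[OF cone_iter_one, of \<upsilon> n]
      by (auto simp: state_ind_def)
  qed
  also have "\<dots> = exp c0 * l ^ n" using dual_iter[OF 1, of n] by simp
  finally show ?thesis .
qed

lemma h_outside: "\<omega> \<in> X \<Longrightarrow> \<omega> 0 \<notin> U \<Longrightarrow> h \<omega> = 0"
proof -
  assume \<omega>: "\<omega> \<in> X" "\<omega> 0 \<notin> U"
  then have "{a. M a (\<omega> 0)} = {}" using M_U by auto
  then have "L h \<omega> = 0" by (simp add: transfer_def)
  then show "h \<omega> = 0" using h_eigen[OF \<omega>(1)] l_pos by simp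
qed

text \<open>The Lipschitz constant of \<open>h\<close> is not controlled, but \<open>h\<close> is
  its own normalised iterate: under iteration the additive error shrinks like \<theta>^n, while the
  multiplicative one stays governed by \<open>c0\<close>. The resulting distortion constant does not
  depend on \<open>h\<close>, which makes it uniform in \<epsilon>.\<close>

lemma h_cone: "cone 1 c0 h"
  unfolding cone_on_def
proof safe
  fix k \<omega> \<upsilon> assume k: "1 \<le> k" and X: "\<omega> \<in> X" "\<upsilon> \<in> X" and ag: "agree k \<omega> \<upsilon>"
  have 0: "\<omega> 0 = \<upsilon> 0" using agree_zeroth[OF ag k] .
  obtain K where K: "lip K h" using h_lip by blast
  have K0: "0 \<le> K" using lip_onD[OF K X(1)] by (meson norm_ge_zero order_trans)
  show "h \<omega> \<le> exp (c0 * \<theta> ^ k) * h \<upsilon>"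
  proof (cases "\<upsilon> 0 \<in> U")
    case False
    then show ?thesis using h_outside X 0 by simp
  next
    case True
    \<comment> \<open>The additive error after \<open>n\<close> applications; the factor \<theta>^k
      of the comparison is kept separate.\<close>
    define G where "G n \<upsilon> = K * \<theta> ^ n * (L ^^ n) (\<lambda>_. 1) \<upsilon>" for n \<upsilon>
    have G_bdd: "bdd (G n)" for n
      unfolding G_def by (intro bdd_cmult iter_bdd M_le bdd_const)
    have iter1: "0 \<le> (L ^^ n) (\<lambda>_. 1) \<upsilon>" if "\<upsilon> \<in> X" for n \<upsilon>
      using cone_nonneg[OF cone_iter_one that] .
    have step: "(L ^^ n) h \<omega> \<le> exp (c0 * \<theta> ^ k) * ((L ^^ n) h \<upsilon> + \<theta> ^ k * G n \<upsilon>)"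
      if "1 \<le> k" "\<omega> \<in> X" "\<upsilon> \<in> X" "agree k \<omega> \<upsilon>" for n k \<omega> \<upsilon>
      using that
    proof (induction n arbitrary: k \<omega> \<upsilon>)
      case 0
      have "h \<omega> \<le> h \<upsilon> + \<theta> ^ k * K" using lip_onD2[OF K 0] by (simp add: mult.commute)
      also have "\<dots> \<le> exp (c0 * \<theta> ^ k) * (h \<upsilon> + \<theta> ^ k * K)"
      proof -
        have "0 \<le> h \<upsilon> + \<theta> ^ k * K" using theta h_nonneg[OF 0(3)] K0 by simp
        moreover have "1 \<le> exp (c0 * \<theta> ^ k)" using c0_nonneg theta by simp
        ultimately show ?thesis using mult_right_mono by fastforce
      qed
      finally show ?case by (simp add: G_def)
    next
      case (Suc n)
      have "transfer M p ((L ^^ n) h) \<omega> \<le> exp (c0 * \<theta> ^ k) *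
         (transfer M p ((L ^^ n) h) \<upsilon> + \<theta> ^ Suc k * transfer M p (G n) \<upsilon>)"
      proof (rule transfer_dist[OF M_le iter_bdd[OF M_le h_bdd] G_bdd order_refl Suc.prems(1)])
        fix \<omega> \<upsilon> assume *: "\<omega> \<in> X" "\<upsilon> \<in> X" "agree (Suc k) \<omega> \<upsilon>"
        show "(L ^^ n) h \<omega> \<le> exp (c0 * \<theta> ^ Suc k) * ((L ^^ n) h \<upsilon> + \<theta> ^ Suc k * G n \<upsilon>)"
          by (rule Suc.IH[OF _ *]) simp
      next
        fix \<upsilon> assume *: "\<upsilon> \<in> X"
        show "0 \<le> (L ^^ n) h \<upsilon> + \<theta> ^ Suc k * G n \<upsilon>"
          unfolding G_def using K0 theta iter1[OF *] h_nonneg l_nonneg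
          by (simp add: h_iter[OF *] *)
      qed (use Suc.prems in auto)
      also have "transfer M p (G n) \<upsilon> = K * \<theta> ^ n * (L ^^ Suc n) (\<lambda>_. 1) \<upsilon>"
        unfolding G_def by (simp add: transfer_cmult)
      also have "\<theta> ^ Suc k * \<dots> = \<theta> ^ k * G (Suc n) \<upsilon>" by (simp add: G_def)
      finally show ?case by simp
    qed
    \<comment> \<open>The mass \<open>m\<close> of the state bounds the iterate of 1 by
      \<open>exp c0 / m * l ^ n\<close>, so after division by \<open>l ^ n\<close> the error is of
      order \<theta>^n.\<close>
    define m where "m = (\<integral>\<xi>. state_ind (\<upsilon> 0) \<xi> \<partial>\<nu>)"
    have m: "0 < m" unfolding m_def by (rule state_mass_pos[OF True])
    have "h \<omega> \<le> exp (c0 * \<theta> ^ k) * (h \<upsilon> + \<theta> ^ k * (K * (exp c0 / m) * \<theta> ^ n))" for n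
    proof -
      have ln: "0 < l ^ n" using l_pos by simp
      have "(L ^^ n) (\<lambda>_. 1) \<upsilon> \<le> exp c0 / m * l ^ n"
        using iter_one_le[OF X(2) True, of n] m by (simp add: m_def field_simps)
      then have "G n \<upsilon> \<le> K * \<theta> ^ n * (exp c0 / m * l ^ n)"
        unfolding G_def using K0 theta by (intro mult_left_mono) auto
      then have "h \<upsilon> * l ^ n + \<theta> ^ k * G n \<upsilon> \<le> h \<upsilon> * l ^ n + \<theta> ^ k * (K * \<theta> ^ n * (exp c0 / m * l ^ n))"
        using theta by (intro add_left_mono mult_left_mono) auto
      also have "\<dots> = (h \<upsilon> + \<theta> ^ k * (K * (exp c0 / m) * \<theta> ^ n)) * l ^ n"
        by (simp add: algebra_simps)
      finally have up: "exp (c0 * \<theta> ^ k) * (h \<upsilon> * l ^ n + \<theta> ^ k * G n \<upsilon>) \<le>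
         exp (c0 * \<theta> ^ k) * ((h \<upsilon> + \<theta> ^ k * (K * (exp c0 / m) * \<theta> ^ n)) * l ^ n)"
        by (intro mult_left_mono) auto
      have "h \<omega> * l ^ n \<le> exp (c0 * \<theta> ^ k) * (h \<upsilon> * l ^ n + \<theta> ^ k * G n \<upsilon>)"
        using step[OF k X ag, of n] by (simp add: h_iter X mult.commute)
      from order_trans[OF this up]
      have "h \<omega> * l ^ n \<le> (exp (c0 * \<theta> ^ k) * (h \<upsilon> + \<theta> ^ k * (K * (exp c0 / m) * \<theta> ^ n))) * l ^ n"
        by (simp only: mult.assoc)
      then show ?thesis using ln by (rule mult_right_le_imp_le)
    qed
    moreover have "(\<lambda>n. exp (c0 * \<theta> ^ k) * (h \<upsilon> + \<theta> ^ k * (K * (exp c0 / m) * \<theta> ^ n)))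
       \<longlonglongrightarrow> exp (c0 * \<theta> ^ k) * (h \<upsilon> + \<theta> ^ k * (K * (exp c0 / m) * 0))"
      using theta by (intro tendsto_intros LIMSEQ_power_zero) auto
    ultimately show ?thesis by (intro LIMSEQ_le_const[where X = "\<lambda>n. exp (c0 * \<theta> ^ k) * (h \<upsilon> + \<theta> ^ k * (K * (exp c0 / m) * \<theta> ^ n))"]) auto
  qed
qed (rule h_nonneg)

text \<open>Positivity spreads forwards along edges through the eigenvalue equation, and within a
  state by bounded distortion.\<close>

lemma h_pos:
  assumes "\<omega> \<in> X" "\<omega> 0 \<in> U"
  shows "0 < h \<omega>"
proof -
  obtain \<omega>0 where \<omega>0: "\<omega>0 \<in> XM" "0 < h \<omega>0" using XM_nonempty by blast
  have "M\<^sup>*\<^sup>* (\<omega>0 0) (\<omega> 0)" using irr XM_U[OF \<omega>0(1)] assms by blast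
  then have "\<forall>\<upsilon>\<in>X. \<upsilon> 0 = \<omega> 0 \<longrightarrow> 0 < h \<upsilon>"
  proof (induction rule: rtranclp_induct)
    case base
    show ?case
    proof safe
      fix \<upsilon> assume "\<upsilon> \<in> X" "\<upsilon> 0 = \<omega>0 0"
      then have "h \<omega>0 \<le> exp c0 * h \<upsilon>"
        using cone_le'[OF h_cone c0_nonneg, of \<omega>0 \<upsilon>] XM_X[OF \<omega>0(1)] by simp
      then show "0 < h \<upsilon>" using \<omega>0(2) by (smt (verit) exp_gt_zero zero_less_mult_iff)
    qed
  next
    case (step b c)
    show ?case
    proof safe
      fix \<upsilon> assume \<upsilon>: "\<upsilon> \<in> X" "c = \<upsilon> 0"
      then have cX: "case_nat b \<upsilon> \<in> X" using Cons_in_X[OF M_le \<upsilon>(1)] step.hyps by simp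
      then have "0 < p (case_nat b \<upsilon>) * h (case_nat b \<upsilon>)"
        using p_pos[OF cX] step \<upsilon> by simp
      also have "\<dots> \<le> L h \<upsilon>"
        using step.hyps \<upsilon> by (intro transfer_ge_term M_le h_bdd h_nonneg) auto
      also have "\<dots> = l * h \<upsilon>" using \<upsilon> h_eigen by simp
      finally show "0 < h \<upsilon>" using l_pos by (simp add: zero_less_mult_iff)
    qed
  qed
  then show ?thesis using assms by blast
qed

end

section \<open>Superharmonic functions, tightness and recurrence\<close>

text \<open>If m of the numbers are 1, this reads m \<le> 1 + m(m - 1)/2.\<close>

lemma sum_le_one_plus_pairs:
  fixes x :: "nat \<Rightarrow> real"
  assumes "\<And>i. x i = 0 \<or> x i = 1"
  shows "(\<Sum>i<n. x i) \<le> 1 + (\<Sum>i<n. \<Sum>j<i. x j * x i)"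
proof (induction n)
  case (Suc n)
  have nn: "0 \<le> x i" for i using assms[of i] by auto
  show ?case
  proof (cases "x n = 0")
    case False
    then have 1: "x n = 1" using assms by blast
    have "0 \<le> (\<Sum>i<n. \<Sum>j<i. x j * x i)" by (intro sum_nonneg mult_nonneg_nonneg nn)
    then show ?thesis by (simp add: 1)
  qed (use Suc in simp)
qed auto

context rpf
begin

section \<open>Shift invariance of the Perron measure\<close>

abbreviation E :: "((nat \<Rightarrow> 's) \<Rightarrow> real) \<Rightarrow> real" where
  "E f \<equiv> (\<integral>\<omega>. h \<omega> * f \<omega> \<partial>\<nu>)"

lemma lip_h_mult: "lip K f \<Longrightarrow> \<exists>J. lip J (\<lambda>\<omega>. h \<omega> * f \<omega>)"
  using h_lip lip_on_mult theta by blast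

lemma integrable_h: "lip K f \<Longrightarrow> integrable \<nu> (\<lambda>\<omega>. h \<omega> * f \<omega>)"
  using lip_h_mult lip_integrable by blast

lemma E_mono:
  assumes "lip K f" "lip J g" "\<And>\<omega>. \<omega> \<in> X \<Longrightarrow> f \<omega> \<le> g \<omega>"
  shows "E f \<le> E g"
  by (rule integral_mono) (auto simp: space_nu assms h_nonneg mult_left_mono integrable_h[OF assms(1)] integrable_h[OF assms(2)])

text \<open>\<open>L\<close> maps the product of \<open>h\<close> and \<open>f (shift _)\<close> to
  \<open>l\<close> times the product of \<open>h\<close> and \<open>f\<close>; duality then gives
  invariance.\<close>

lemma E_shift:
  assumes "lip K f"
  shows "E (\<lambda>\<omega>. f (shift \<omega>)) = E f"
proof -
  obtain J where J: "lip J (\<lambda>\<omega>. h \<omega> * f (shift \<omega>))"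
    using lip_h_mult[OF lip_on_shift[OF assms theta]] by blast
  have "l * E (\<lambda>\<omega>. f (shift \<omega>)) = (\<integral>\<omega>. L (\<lambda>\<omega>. h \<omega> * f (shift \<omega>)) \<omega> \<partial>\<nu>)" by (rule dual[OF J, symmetric])
  also have "\<dots> = (\<integral>\<omega>. l * (h \<omega> * f \<omega>) \<partial>\<nu>)"
  proof (rule Bochner_Integration.integral_cong[OF refl])
    fix \<omega> assume "\<omega> \<in> space \<nu>"
    then have "L h \<omega> = l * h \<omega>" using h_eigen by (simp add: space_nu)
    then show "L (\<lambda>\<omega>. h \<omega> * f (shift \<omega>)) \<omega> = l * (h \<omega> * f \<omega>)"
      using transfer_shift[of M f h \<omega>] by (simp add: mult.commute)
  qed
  also have "\<dots> = l * E f" by simp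
  finally show ?thesis using l_pos by simp
qed

lemma lip_shift_funpow: "lip K f \<Longrightarrow> \<exists>J. lip J (\<lambda>\<omega>. f ((shift ^^ n) \<omega>))"
proof (induction n)
  case (Suc n)
  then obtain J where "lip J (\<lambda>\<omega>. f ((shift ^^ n) \<omega>))" by blast
  from lip_on_shift[OF this theta] show ?case by (simp add: funpow_swap1) blast
qed auto

lemma E_shift_funpow: "lip K f \<Longrightarrow> E (\<lambda>\<omega>. f ((shift ^^ n) \<omega>)) = E f"
proof (induction n)
  case (Suc n)
  obtain J where "lip J (\<lambda>\<omega>. f ((shift ^^ n) \<omega>))" using lip_shift_funpow[OF Suc.prems] by blast
  from E_shift[OF this] Suc show ?case by (simp add: funpow_swap1)
qed auto

lemma iter_shift: "(L ^^ n) (\<lambda>\<omega>. g ((shift ^^ n) \<omega>) * f \<omega>) \<omega> = g \<omega> * (L ^^ n) f \<omega>"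
proof (induction n arbitrary: g \<omega>)
  case (Suc n)
  have "(L ^^ n) (\<lambda>\<omega>. g ((shift ^^ Suc n) \<omega>) * f \<omega>) = (\<lambda>\<omega>. g (shift \<omega>) * (L ^^ n) f \<omega>)"
    using Suc[of "\<lambda>\<omega>. g (shift \<omega>)"] by auto
  then show ?case by (simp add: transfer_shift)
qed auto

text \<open>The size of \<open>F\<close> is not controlled and the sum defining \<open>L F\<close>
  is not known to converge, hence the hypothesis on finite sums. The truncation at
  \<open>K * h\<close> is bounded and still superharmonic, so by duality it is harmonic on the
  support \<open>XM\<close>. Taking for \<open>K\<close> the ratio \<open>F / h\<close> at \<omega>
  makes the truncation tight there and forces the same ratio at every preimage; iterated preimages
  are dense in \<open>XM\<close> by irreducibility, and the ratio is continuous.\<close>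

lemma superharmonic_proportional:
  assumes cone: "cone 1 c F" and c: "c0 \<le> c"
    and super: "\<And>\<omega> T. \<omega> \<in> X \<Longrightarrow> finite T \<Longrightarrow> (\<And>a. a \<in> T \<Longrightarrow> M a (\<omega> 0)) \<Longrightarrow>
      (\<Sum>a\<in>T. p (case_nat a \<omega>) * F (case_nat a \<omega>)) \<le> l * F \<omega>"
  shows "\<exists>t\<ge>0. \<forall>\<omega>\<in>XM. F \<omega> = t * h \<omega>"
proof -
  have c_nonneg: "0 \<le> c" using c c0_nonneg by simp
  have hc: "cone 1 c h" using cone_weaken[OF h_cone _ c] by simp
  have F_nonneg: "0 \<le> F \<omega>" if "\<omega> \<in> X" for \<omega> using cone_nonneg[OF cone that] .
  have hpos: "0 < h \<omega>" if "\<omega> \<in> XM" for \<omega> using h_pos XM_X XM_U that by blast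
  define R where "R \<omega> = F \<omega> / h \<omega>" for \<omega>
  have R_eq: "F \<omega> = R \<omega> * h \<omega>" "0 \<le> R \<omega>" if "\<omega> \<in> XM" for \<omega>
    using hpos[OF that] F_nonneg XM_X[OF that] by (auto simp: R_def)
  have harm: "l * min (F \<omega>) (K * h \<omega>) = L (\<lambda>\<omega>. min (F \<omega>) (K * h \<omega>)) \<omega>" if "0 \<le> K" "\<omega> \<in> XM" for K \<omega>
  proof -
    define G where "G = (\<lambda>\<omega>. min (F \<omega>) (K * h \<omega>))"
    have Gc: "cone 1 c G" unfolding G_def by (intro cone_min cone cone_cmult hc that)
    have Kh: "bdd (\<lambda>\<omega>. K * h \<omega>)" by (intro bdd_cmult h_bdd)
    have Gb: "bdd G"
      by (rule bdd_le[OF Kh]) (use F_nonneg h_nonneg that in \<open>auto simp: G_def\<close>)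
    obtain J where J: "lip J G" using cone_bdd_lip[OF Gc c_nonneg Gb] by blast
    obtain J' where J': "lip J' (L G)" using lip_transfer[OF M_le J] by blast
    have lJ: "lip (2 * (\<bar>l\<bar> * J)) (\<lambda>\<omega>. l * G \<omega>)" using lip_on_cmult[OF J theta(1)] .
    define D where "D = (\<lambda>\<omega>. l * G \<omega> + (-1) * L G \<omega>)"
    have D: "lip (2 * (\<bar>l\<bar> * J) + 2 * (\<bar>-1\<bar> * J')) D"
      unfolding D_def by (intro lip_on_add lJ lip_on_cmult J' theta)
    have G_nonneg: "0 \<le> G \<omega>" if "\<omega> \<in> X" for \<omega> using cone_nonneg[OF Gc that] .
    have LG: "L G \<omega> \<le> l * G \<omega>" if w: "\<omega> \<in> X" for \<omega>
    proof -
      have "L G \<omega> \<le> L (\<lambda>\<omega>. K * h \<omega>) \<omega>"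
        by (rule transfer_mono[OF M_le Gb Kh _ w]) (simp add: G_def)
      also have "\<dots> = l * (K * h \<omega>)" using h_eigen[OF w] by (simp add: transfer_cmult)
      finally have 1: "L G \<omega> \<le> l * (K * h \<omega>)" .
      have 2: "L G \<omega> \<le> l * F \<omega>"
        unfolding transfer_def
      proof (rule infsum_le_finite_sums[OF transfer_summable[OF M_le Gb w]])
        fix T assume T: "finite T" "T \<subseteq> {a. M a (\<omega> 0)}"
        have "(\<Sum>a\<in>T. p (case_nat a \<omega>) * G (case_nat a \<omega>)) \<le> (\<Sum>a\<in>T. p (case_nat a \<omega>) * F (case_nat a \<omega>))"
        proof (rule sum_mono)
          fix a assume "a \<in> T"
          then have "case_nat a \<omega> \<in> X" using T Cons_in_X[OF M_le w, of a] by auto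
          then show "p (case_nat a \<omega>) * G (case_nat a \<omega>) \<le> p (case_nat a \<omega>) * F (case_nat a \<omega>)"
            using p_nonneg by (intro mult_left_mono) (auto simp: G_def)
        qed
        also have "\<dots> \<le> l * F \<omega>" by (rule super[OF w]) (use T in auto)
        finally show "(\<Sum>a\<in>T. p (case_nat a \<omega>) * G (case_nat a \<omega>)) \<le> l * F \<omega>" .
      qed
      show ?thesis using 1 2 by (simp add: G_def min_def)
    qed
    have D_nonneg: "0 \<le> D \<omega>" if "\<omega> \<in> X" for \<omega> using LG[OF that] by (simp add: D_def)
    \<comment> \<open>\<open>D\<close> is nonnegative with integral 0; were it positive at \<omega>,
      it would be positive on a cylinder around \<omega>, which has positive mass.\<close>
    have "D \<omega> = 0"
    proof (rule ccontr)
      assume "D \<omega> \<noteq> 0"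
      then have pos: "0 < D \<omega>" using D_nonneg XM_X that by force
      let ?J = "2 * (\<bar>l\<bar> * J) + 2 * (\<bar>-1\<bar> * J')"
      have "(\<lambda>k. ?J * \<theta> ^ k) \<longlonglongrightarrow> ?J * 0"
        using theta by (intro tendsto_mult tendsto_const LIMSEQ_power_zero) auto
      then have "\<forall>\<^sub>F k in sequentially. ?J * \<theta> ^ k < D \<omega>" using pos by (intro order_tendstoD) auto
      then have "\<exists>k. ?J * \<theta> ^ k < D \<omega> \<and> 1 \<le> k"
        by (intro eventually_happens'[OF sequentially_bot] eventually_conj eventually_ge_at_top)
      then obtain k where k: "?J * \<theta> ^ Suc k < D \<omega>" by (metis Suc_le_D One_nat_def)
      have "0 < (\<integral>\<omega>. D \<omega> \<partial>\<nu>)"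
      proof (rule lip_integral_pos[OF D ind_lip D_nonneg ind_range(1) _ cylinder_mass_pos[OF that(2)]])
        fix \<upsilon> assume u: "\<upsilon> \<in> X" "0 < ind (Suc k) \<omega> \<upsilon>"
        then have "agree (Suc k) \<omega> \<upsilon>" by (auto simp: ind_def split: if_splits)
        then have "norm (D \<omega> - D \<upsilon>) \<le> ?J * \<theta> ^ Suc k"
          by (intro lip_onD2[OF D] u XM_X that) auto
        then show "0 < D \<upsilon>" using k by auto
      qed
      moreover have "(\<integral>\<omega>. D \<omega> \<partial>\<nu>) = l * (\<integral>\<omega>. G \<omega> \<partial>\<nu>) - (\<integral>\<omega>. L G \<omega> \<partial>\<nu>)"
        unfolding D_def using lip_integrable[OF J] lip_integrable[OF J'] by simp
      ultimately show False using dual[OF J] by simp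
    qed
    then show ?thesis by (simp add: D_def G_def)
  qed
  have pre: "R (case_nat a \<omega>) = R \<omega>" if w: "\<omega> \<in> XM" and a: "M a (\<omega> 0)" for \<omega> a
  proof -
    define K where "K = R \<omega>"
    have K: "0 \<le> K" "F \<omega> = K * h \<omega>" using R_eq[OF w] by (auto simp: K_def)
    define G where "G = (\<lambda>\<omega>. min (F \<omega>) (K * h \<omega>))"
    have wX: "\<omega> \<in> X" by (rule XM_X[OF w])
    have Kh: "bdd (\<lambda>\<omega>. K * h \<omega>)" by (intro bdd_cmult h_bdd)
    have Gb: "bdd G"
      by (rule bdd_le[OF Kh]) (use F_nonneg h_nonneg K in \<open>auto simp: G_def\<close>)
    have aw: "case_nat a \<omega> \<in> X" "case_nat a \<omega> \<in> XM"
      using Cons_in_X[OF M_le wX a] Cons_in_shift_space[of \<omega> M a, OF w a] by auto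
    have ppos: "0 < p (case_nat a \<omega>)" using p_pos[OF aw(1)] a by simp
    have Lh: "L (\<lambda>\<omega>. K * h \<omega>) \<omega> = l * (K * h \<omega>)" using h_eigen[OF wX] by (simp add: transfer_cmult)
    have LG: "L G \<omega> = l * (K * h \<omega>)" using harm[OF K(1) w] K(2) by (simp add: G_def)
    \<comment> \<open>The truncation is at most \<open>K * h\<close>, and their images under
      \<open>L\<close> coincide at \<omega>; so they agree in every term, that is, \<open>F\<close>
      is at least \<open>K * h\<close> at each preimage.\<close>
    have ge: "K * h (case_nat b \<omega>) \<le> F (case_nat b \<omega>)" if b: "M b (\<omega> 0)" for b
    proof -
      have bw: "case_nat b \<omega> \<in> X" using Cons_in_X[OF M_le wX b] .
      have "p (case_nat b \<omega>) * (K * h (case_nat b \<omega>) - G (case_nat b \<omega>)) \<le> L (\<lambda>\<omega>. K * h \<omega> - G \<omega>) \<omega>"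
        by (rule transfer_ge_term[OF M_le bdd_diff[OF Kh Gb] _ wX b]) (simp add: G_def)
      also have "\<dots> = 0" using transfer_diff[OF M_le Kh Gb wX] Lh LG by simp
      finally show ?thesis
        using p_pos[OF bw] b by (simp add: mult_le_0_iff G_def min_def split: if_splits)
    qed
    have "F (case_nat a \<omega>) \<le> K * h (case_nat a \<omega>)"
    proof (rule ccontr)
      \<comment> \<open>The excess at \<open>a\<close> is a fixed gain in every finite sum
        containing \<open>a\<close>; superharmonicity of \<open>F\<close> would then push the image
        of \<open>K * h\<close> below its known value.\<close>
      define d where "d = p (case_nat a \<omega>) * (F (case_nat a \<omega>) - K * h (case_nat a \<omega>))"
      assume "\<not> ?thesis"
      then have d: "0 < d" using ppos by (simp add: d_def)
      have "L (\<lambda>\<omega>. K * h \<omega>) \<omega> \<le> l * (K * h \<omega>) - d"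
        unfolding transfer_def
      proof (rule infsum_le_finite_sums[OF transfer_summable[OF M_le Kh wX]])
        fix T assume T: "finite T" "T \<subseteq> {a. M a (\<omega> 0)}"
        let ?T = "insert a T"
        have X: "case_nat b \<omega> \<in> X" if "b \<in> ?T" for b using that T a Cons_in_X[OF M_le wX, of b] by auto
        have "(\<Sum>b\<in>T. p (case_nat b \<omega>) * (K * h (case_nat b \<omega>))) \<le> (\<Sum>b\<in>?T. p (case_nat b \<omega>) * (K * h (case_nat b \<omega>)))"
          using T X K(1) p_nonneg h_nonneg by (intro sum_mono2) auto
        also have "\<dots> + d \<le> (\<Sum>b\<in>?T. p (case_nat b \<omega>) * F (case_nat b \<omega>))"
        proof -
          have "(\<Sum>b\<in>T - {a}. p (case_nat b \<omega>) * (K * h (case_nat b \<omega>))) \<le> (\<Sum>b\<in>T - {a}. p (case_nat b \<omega>) * F (case_nat b \<omega>))"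
            using T X p_nonneg ge by (intro sum_mono mult_left_mono) auto
          then show ?thesis using T(1) by (simp add: sum.insert_remove d_def algebra_simps)
        qed
        also have "\<dots> \<le> l * F \<omega>" by (rule super[OF wX]) (use T a in auto)
        finally show "(\<Sum>b\<in>T. p (case_nat b \<omega>) * (K * h (case_nat b \<omega>))) \<le> l * (K * h \<omega>) - d" using K(2) by simp
      qed
      then show False using Lh d by simp
    qed
    then have "F (case_nat a \<omega>) = K * h (case_nat a \<omega>)" using ge[OF a] by (rule antisym)
    then show ?thesis using hpos[OF aw(2)] by (simp add: R_def[of "case_nat a \<omega>"] K_def)
  qed
  have start: "\<exists>\<xi>\<in>XM. \<xi> 0 = b \<and> R \<xi> = R \<omega>" if w: "\<omega> \<in> XM" and b: "b \<in> U" for \<omega> b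
    using irr[OF b XM_U[OF w, of 0]]
  proof (induction rule: converse_rtranclp_induct)
    case base then show ?case using w by blast
  next
    case (step a b)
    then obtain \<xi> where \<xi>: "\<xi> \<in> XM" "\<xi> 0 = b" "R \<xi> = R \<omega>" by blast
    have a: "M a (\<xi> 0)" using step.hyps \<xi> by simp
    then show ?case
      using \<xi> pre[OF \<xi>(1) a] Cons_in_shift_space[of \<xi> M a, OF \<xi>(1) a] by (intro bexI[of _ "case_nat a \<xi>"]) auto
  qed
  \<comment> \<open>Irreducibility provides a point starting with the right letter and having the
    same ratio; the preceding letters of \<upsilon> are then prepended one by one, which preserves
    the ratio.\<close>
  have dense: "\<exists>\<xi>\<in>XM. agree (Suc k) \<upsilon> \<xi> \<and> R \<xi> = R \<omega>" if w: "\<omega> \<in> XM" and u: "\<upsilon> \<in> XM" for \<omega> \<upsilon> k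
    using u
  proof (induction k arbitrary: \<upsilon>)
    case 0
    obtain \<xi> where "\<xi> \<in> XM" "\<xi> 0 = \<upsilon> 0" "R \<xi> = R \<omega>" using start[OF w XM_U[OF 0, of 0]] by blast
    then show ?case by (intro bexI[of _ \<xi>]) auto
  next
    case (Suc k)
    obtain \<xi> where \<xi>: "\<xi> \<in> XM" "agree (Suc k) (shift \<upsilon>) \<xi>" "R \<xi> = R \<omega>"
      using Suc.IH[OF shift_in_shift_space[OF Suc.prems]] by blast
    have a: "M (\<upsilon> 0) (\<xi> 0)" using shift_space_0[OF Suc.prems] agree_zeroth[OF \<xi>(2)] by simp
    have "agree (Suc (Suc k)) (case_nat (\<upsilon> 0) (shift \<upsilon>)) (case_nat (\<upsilon> 0) \<xi>)" by (rule agree_Cons[OF \<xi>(2)])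
    then show ?case
      using \<xi> pre[OF \<xi>(1) a] Cons_in_shift_space[of \<xi> M "\<upsilon> 0", OF \<xi>(1) a]
      by (intro bexI[of _ "case_nat (\<upsilon> 0) \<xi>"]) auto
  qed
  have R_le: "R \<upsilon> \<le> R \<omega>" if w: "\<omega> \<in> XM" and u: "\<upsilon> \<in> XM" for \<omega> \<upsilon>
  proof -
    have le: "R \<upsilon> \<le> exp ((c + c0) * \<theta> ^ k) * R \<omega>" if k1: "1 \<le> k" for k
    proof -
      obtain j where j: "k = Suc j" using k1 by (cases k) auto
      obtain \<xi> where \<xi>: "\<xi> \<in> XM" "agree k \<upsilon> \<xi>" "R \<xi> = R \<omega>" using dense[OF w u, of j] j by auto
      note X = XM_X[OF u] XM_X[OF \<xi>(1)]
      have "R \<upsilon> * h \<upsilon> = F \<upsilon>" using R_eq[OF u] by simp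
      also have "\<dots> \<le> exp (c * \<theta> ^ k) * F \<xi>" by (rule cone_le[OF cone that X \<xi>(2)])
      also have "F \<xi> = R \<omega> * h \<xi>" using R_eq[OF \<xi>(1)] \<xi>(3) by simp
      also have "exp (c * \<theta> ^ k) * (R \<omega> * h \<xi>) \<le> exp (c * \<theta> ^ k) * (R \<omega> * (exp (c0 * \<theta> ^ k) * h \<upsilon>))"
        using R_eq[OF w] by (intro mult_left_mono cone_le[OF h_cone that X(2,1) agree_sym[OF \<xi>(2)]]) auto
      also have "\<dots> = (exp ((c + c0) * \<theta> ^ k) * R \<omega>) * h \<upsilon>"
        by (simp add: distrib_right exp_add)
      finally show ?thesis using hpos[OF u] by simp
    qed
    have "(\<lambda>k. exp ((c + c0) * \<theta> ^ k) * R \<omega>) \<longlonglongrightarrow> exp ((c + c0) * 0) * R \<omega>"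
      using theta by (intro tendsto_intros LIMSEQ_power_zero) auto
    then have "R \<upsilon> \<le> exp ((c + c0) * 0) * R \<omega>"
      by (rule LIMSEQ_le_const) (use le in blast)
    then show ?thesis by simp
  qed
  obtain \<omega>0 where \<omega>0: "\<omega>0 \<in> XM" using XM_nonempty by blast
  show ?thesis
  proof (intro exI[of _ "R \<omega>0"] conjI ballI)
    show "0 \<le> R \<omega>0" using R_eq[OF \<omega>0] by simp
    fix \<omega> assume w: "\<omega> \<in> XM"
    have "R \<omega> = R \<omega>0" using R_le[OF w \<omega>0] R_le[OF \<omega>0 w] by simp
    then show "F \<omega> = R \<omega>0 * h \<omega>" using R_eq[OF w] by simp
  qed
qed

section \<open>Occupation times and recurrence\<close>

definition outside :: "'s set \<Rightarrow> (nat \<Rightarrow> 's) \<Rightarrow> real" where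
  "outside Q \<omega> = (if \<omega> 0 \<in> Q then 0 else 1)"

lemma outside_lip: "lip (2 / \<theta>) (outside Q)"
  using lip_on_locally_const[of X "outside Q" 1 \<theta> 1] theta by (auto simp: outside_def)

text \<open>An exponential moment bound: the occupation time of \<open>S - Q\<close> up to time \<open>n\<close>, weighted by \<open>t\<close>,
  has expectation at most a constant times \<open>(D / l)\<^sup>n\<close>, since \<open>D\<close> bounds the tilted transfer operator.\<close>

lemma tightness:
  assumes t: "1 < t" and s: "(\<lambda>a. q a * (if a \<in> Q then 1 else t)) summable_on UNIV"
    and D: "(\<Sum>\<^sub>\<infinity>a. q a * (if a \<in> Q then 1 else t)) \<le> D"
  shows "E (outside Q) * ln t \<le> ln (D / l)"
proof -
  define \<tau> where "\<tau> a = (if a \<in> Q then 1 else t)" for a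
  \<comment> \<open>This is \<open>t\<close> to the number of visits outside \<open>Q\<close> before
    time \<open>n\<close>.\<close>
  define V where "V n \<omega> = (\<Prod>i<n. \<tau> (\<omega> i))" for n and \<omega> :: "nat \<Rightarrow> 's"
  have tau: "1 \<le> \<tau> a" "\<tau> a \<le> t" for a using t by (auto simp: \<tau>_def)
  have tau_nz: "\<tau> a \<noteq> 0" for a using tau(1)[of a] by auto
  have V1: "1 \<le> V n \<omega>" for n \<omega> unfolding V_def by (intro prod_ge_1 tau)
  have Vt: "V n \<omega> \<le> t ^ n" for n \<omega>
    unfolding V_def using prod_mono[of "{..<n}" "\<lambda>i. \<tau> (\<omega> i)" "\<lambda>_. t"] tau order_trans[OF zero_le_one tau(1)]
    by auto
  have VSuc: "V (Suc n) \<omega> = V n (shift \<omega>) * \<tau> (\<omega> 0)" for n \<omega>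
    unfolding V_def prod.lessThan_Suc_shift by (simp add: shift_def mult.commute)
  have Vlip: "lip (2 * t ^ n / \<theta> ^ n) (V n)" for n
  proof (rule lip_on_locally_const)
    fix \<omega> show "norm (V n \<omega>) \<le> t ^ n" using V1[of n \<omega>] Vt[of n \<omega>] by simp
  next
    fix \<omega> \<upsilon> :: "nat \<Rightarrow> 's" assume "agree n \<omega> \<upsilon>"
    then show "V n \<omega> = V n \<upsilon>" unfolding V_def by (intro prod.cong) (auto simp: agree_def)
  qed (use theta in auto)
  have one: "lip (norm (1::real)) (\<lambda>_. 1)" by (rule lip_on_const[OF theta(1)])
  have Ltau: "\<bar>L (\<lambda>\<omega>. \<tau> (\<omega> 0)) \<omega>\<bar> \<le> D" if "\<omega> \<in> X" for \<omega>
  proof -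
    have "\<bar>L (\<lambda>\<omega>. \<tau> (\<omega> 0)) \<omega>\<bar> \<le> (\<Sum>\<^sub>\<infinity>a\<in>{a. M a (\<omega> 0)}. q a * \<tau> a)"
    proof (rule transfer_le_states[OF M_le _ that])
      show "bdd (\<lambda>\<omega>. \<tau> (\<omega> 0))" by (rule bddI[of _ t]) (use tau order_trans[OF zero_le_one tau(1)] in auto)
      show "(\<lambda>a. q a * \<tau> a) summable_on UNIV" using s by (simp add: \<tau>_def)
    qed (use order_trans[OF zero_le_one tau(1)] in auto)
    also have "\<dots> \<le> (\<Sum>\<^sub>\<infinity>a. q a * \<tau> a)"
      using s q_nonneg order_trans[OF zero_le_one tau(1)]
      by (intro infsum_mono_neutral) (auto simp: \<tau>_def[symmetric] intro: summable_on_subset_banach)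
    finally show ?thesis using D by (simp add: \<tau>_def)
  qed
  have D_pos: "0 < D"
  proof -
    obtain \<omega> where \<omega>: "\<omega> \<in> X" "0 < h \<omega>" using XM_nonempty XM_X by blast
    obtain J where J: "lip J (L (\<lambda>_. 1))" using lip_transfer[OF M_le one] by blast
    have "l = (\<integral>\<omega>. L (\<lambda>_. 1) \<omega> \<partial>\<nu>)" using dual[OF one] by simp
    also have "\<dots> \<le> (\<integral>\<omega>. D \<partial>\<nu>)"
    proof (rule lip_integral_mono[OF J lip_on_const[OF theta(1)]])
      fix \<omega> assume w: "\<omega> \<in> X"
      have "L (\<lambda>_. 1) \<omega> \<le> L (\<lambda>\<omega>. \<tau> (\<omega> 0)) \<omega>"
      proof (rule transfer_mono[OF M_le bdd_const _ _ w])
        show "bdd (\<lambda>\<omega>. \<tau> (\<omega> 0))" by (rule bddI[of _ t]) (use tau order_trans[OF zero_le_one tau(1)] in auto)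
      qed (rule tau)
      then show "L (\<lambda>_. 1) \<omega> \<le> D" using Ltau[OF w] by simp
    qed
    finally show ?thesis using l_pos by simp
  qed
  have moment: "(\<integral>\<omega>. V n \<omega> \<partial>\<nu>) \<le> (D / l) ^ n" for n
  proof (induction n)
    case 0 then show ?case by (simp add: V_def)
  next
    case (Suc n)
    obtain J where J: "lip J (L (V (Suc n)))" using lip_transfer[OF M_le Vlip] by blast
    have "l * (\<integral>\<omega>. V (Suc n) \<omega> \<partial>\<nu>) = (\<integral>\<omega>. L (V (Suc n)) \<omega> \<partial>\<nu>)" by (rule dual[OF Vlip, symmetric])
    also have "\<dots> \<le> (\<integral>\<omega>. D * V n \<omega> \<partial>\<nu>)"
    proof (rule lip_integral_mono[OF J lip_on_cmult[OF Vlip theta(1)]])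
      fix \<omega> assume w: "\<omega> \<in> X"
      have "L (V (Suc n)) \<omega> = L (\<lambda>\<omega>. V n (shift \<omega>) * \<tau> (\<omega> 0)) \<omega>" by (simp add: VSuc[abs_def] fun_eq_iff)
      also have "\<dots> = V n \<omega> * L (\<lambda>\<omega>. \<tau> (\<omega> 0)) \<omega>" by (rule transfer_shift)
      also have "\<dots> \<le> V n \<omega> * D" using Ltau[OF w] V1[of n \<omega>] by (intro mult_left_mono) auto
      finally show "L (V (Suc n)) \<omega> \<le> D * V n \<omega>" by (simp add: mult.commute)
    qed
    also have "\<dots> = D * (\<integral>\<omega>. V n \<omega> \<partial>\<nu>)" by simp
    also have "\<dots> \<le> D * (D / l) ^ n" using D_pos Suc by (intro mult_left_mono) auto
    finally show ?case using l_pos by (simp add: field_simps)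
  qed
  obtain H0 where H0: "lip H0 h" using h_lip by blast
  define H where "H = \<bar>H0\<bar> + 1"
  have H: "0 < H" "\<And>\<omega>. \<omega> \<in> X \<Longrightarrow> h \<omega> \<le> H" using lip_onD[OF H0] by (force simp: H_def)+
  have lnV: "ln (V n \<omega>) = ln t * (\<Sum>i<n. outside Q ((shift ^^ i) \<omega>))" for n \<omega>
  proof -
    have "ln (V n \<omega>) = (\<Sum>i<n. ln (\<tau> (\<omega> i)))"
      unfolding V_def by (rule ln_prod) (use tau_nz less_le_trans[OF zero_less_one tau(1)] in auto)
    also have "\<dots> = (\<Sum>i<n. ln t * outside Q ((shift ^^ i) \<omega>))"
      by (intro sum.cong) (auto simp: \<tau>_def outside_def funpow_shift)
    finally show ?thesis by (simp add: sum_distrib_left)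
  qed
  have main: "real n * (ln t * E (outside Q)) \<le> ln H + real n * ln (D / l)" for n
  proof -
    \<comment> \<open>\<open>K\<close> bounds the Perron expectation of \<open>V n\<close>;
      estimating the logarithm by its tangent at this value amounts to Jensen's inequality.\<close>
    define K where "K = H * (D / l) ^ n"
    have K: "0 < K" using H D_pos l_pos by (simp add: K_def)
    have int_i: "integrable \<nu> (\<lambda>\<omega>. h \<omega> * outside Q ((shift ^^ i) \<omega>))" for i
      using lip_shift_funpow[OF outside_lip] integrable_h by blast
    have int_V: "integrable \<nu> (\<lambda>\<omega>. h \<omega> * V n \<omega>)" by (rule integrable_h[OF Vlip])
    have int_h: "integrable \<nu> h" by (rule lip_integrable[OF H0])
    have "real n * (ln t * E (outside Q)) = ln t * (\<Sum>i<n. E (outside Q))" by simp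
    also have "\<dots> = ln t * (\<Sum>i<n. E (\<lambda>\<omega>. outside Q ((shift ^^ i) \<omega>)))"
      by (simp add: E_shift_funpow[OF outside_lip])
    also have "\<dots> = (\<integral>\<omega>. ln t * (\<Sum>i<n. h \<omega> * outside Q ((shift ^^ i) \<omega>)) \<partial>\<nu>)"
      using int_i by (simp add: Bochner_Integration.integral_sum)
    also have "\<dots> \<le> (\<integral>\<omega>. (ln K - 1) * h \<omega> + (1 / K) * (h \<omega> * V n \<omega>) \<partial>\<nu>)"
    proof (rule integral_mono)
      fix \<omega> assume "\<omega> \<in> space \<nu>"
      then have w: "\<omega> \<in> X" by (simp add: space_nu)
      have "ln (V n \<omega> / K) \<le> V n \<omega> / K - 1" using K V1[of n \<omega>] by (intro ln_le_minus_one) auto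
      then have "ln (V n \<omega>) \<le> ln K - 1 + V n \<omega> / K" using K V1[of n \<omega>] by (simp add: ln_div)
      then have "h \<omega> * ln (V n \<omega>) \<le> h \<omega> * (ln K - 1 + V n \<omega> / K)" by (intro mult_left_mono h_nonneg[OF w])
      then show "ln t * (\<Sum>i<n. h \<omega> * outside Q ((shift ^^ i) \<omega>)) \<le> (ln K - 1) * h \<omega> + 1 / K * (h \<omega> * V n \<omega>)"
        by (simp add: lnV sum_distrib_left[symmetric] algebra_simps)
    qed (use int_i int_V int_h in auto)
    also have "\<dots> = (ln K - 1) + (1 / K) * (\<integral>\<omega>. h \<omega> * V n \<omega> \<partial>\<nu>)"
      using int_V int_h nu_h by simp
    also have "(\<integral>\<omega>. h \<omega> * V n \<omega> \<partial>\<nu>) \<le> (\<integral>\<omega>. H * V n \<omega> \<partial>\<nu>)"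
    proof (rule integral_mono[OF int_V lip_integrable[OF lip_on_cmult[OF Vlip theta(1)]]])
      fix \<omega> assume "\<omega> \<in> space \<nu>"
      then show "h \<omega> * V n \<omega> \<le> H * V n \<omega>"
        using H(2)[of \<omega>] V1[of n \<omega>] by (intro mult_right_mono) (auto simp: space_nu)
    qed
    also have "\<dots> = H * (\<integral>\<omega>. V n \<omega> \<partial>\<nu>)" by simp
    also have "\<dots> \<le> K" unfolding K_def using H by (intro mult_left_mono moment) auto
    finally have "real n * (ln t * E (outside Q)) \<le> ln K - 1 + 1 / K * K"
      using K by (simp add: divide_right_mono)
    also have "\<dots> = ln H + real n * ln (D / l)"
      using K H D_pos l_pos by (simp add: K_def ln_mult ln_realpow)
    finally show ?thesis .
  qed
  \<comment> \<open>By invariance the expected occupation time is exactly linear in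
    \<open>n\<close>, so division by \<open>n\<close> removes the constant
    \<open>ln H\<close>.\<close>
  have "ln t * E (outside Q) \<le> ln H / real n + ln (D / l)" if "1 \<le> n" for n
    using main[of n] that by (simp add: field_simps)
  moreover have "(\<lambda>n. ln H / real n + ln (D / l)) \<longlonglongrightarrow> 0 + ln (D / l)"
    by (intro tendsto_add lim_const_over_n tendsto_const)
  ultimately have "ln t * E (outside Q) \<le> 0 + ln (D / l)"
    by (intro LIMSEQ_le_const[where X = "\<lambda>n. ln H / real n + ln (D / l)"]) auto
  then show ?thesis by (simp add: mult.commute)
qed

text \<open>Duality takes the shifted indicator out of the iterate, leaving the iterate of
  \<open>h * ind k y\<close> over the cylinder of \<open>y\<close>. Three comparisons cost
  \<open>exp c0\<close> each: \<open>h\<close> to \<open>h y\<close>, \<open>h y\<close> back to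
  \<open>h \<omega>\<close>, and the iterate at \<omega> to the iterate at \<open>y\<close>. The
  last one uses \<open>k \<le> j\<close>, by which the iterate is in the cone of index 1.\<close>

lemma return_bound:
  assumes y: "y \<in> X" and k: "1 \<le> k" "k \<le> j"
  shows "E (\<lambda>\<omega>. ind k y \<omega> * ind k y ((shift ^^ j) \<omega>)) \<le> exp (3 * c0) * ((L ^^ j) (ind k y) y / l ^ j)"
proof -
  let ?i = "ind k y"
  obtain J1 where J1: "lip J1 (\<lambda>\<omega>. h \<omega> * ?i \<omega>)" using lip_h_mult[OF ind_lip] by blast
  obtain J2 where J2: "lip J2 (\<lambda>\<omega>. ?i ((shift ^^ j) \<omega>))" using lip_shift_funpow[OF ind_lip] by blast
  have J3: "lip (2 * (J2 * J1)) (\<lambda>\<omega>. ?i ((shift ^^ j) \<omega>) * (h \<omega> * ?i \<omega>))"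
    by (rule lip_on_mult[OF J2 J1 theta(1)])
  obtain J4 where J4: "lip J4 ((L ^^ j) (\<lambda>\<omega>. h \<omega> * ?i \<omega>))" using lip_iter[OF M_le J1] by blast
  have hi: "bdd (\<lambda>\<omega>. h \<omega> * ?i \<omega>)" by (rule lip_bdd[OF J1])
  have cj: "cone 1 c0 ((L ^^ j) ?i)"
    using k ind_cone[of k y] by (intro cone_iter[OF M_le ind_bdd order_refl, of "k - 1"]) auto
  have Lj: "0 \<le> (L ^^ j) ?i \<omega>" if "\<omega> \<in> X" for \<omega> using cone_nonneg[OF cj that] .
  let ?R = "exp (3 * c0) * (L ^^ j) ?i y"
  have "l ^ j * E (\<lambda>\<omega>. ?i \<omega> * ?i ((shift ^^ j) \<omega>)) = l ^ j * (\<integral>\<omega>. ?i ((shift ^^ j) \<omega>) * (h \<omega> * ?i \<omega>) \<partial>\<nu>)"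
    by (simp add: mult_ac)
  also have "\<dots> = (\<integral>\<omega>. (L ^^ j) (\<lambda>\<omega>. ?i ((shift ^^ j) \<omega>) * (h \<omega> * ?i \<omega>)) \<omega> \<partial>\<nu>)"
    by (rule dual_iter[OF J3, symmetric])
  also have "\<dots> = (\<integral>\<omega>. ?i \<omega> * (L ^^ j) (\<lambda>\<omega>. h \<omega> * ?i \<omega>) \<omega> \<partial>\<nu>)"
    by (intro Bochner_Integration.integral_cong refl iter_shift)
  also have "\<dots> \<le> (\<integral>\<omega>. ?R * h \<omega> \<partial>\<nu>)"
  proof (rule integral_mono)
    show "integrable \<nu> (\<lambda>\<omega>. ?i \<omega> * (L ^^ j) (\<lambda>\<omega>. h \<omega> * ?i \<omega>) \<omega>)"
      by (rule lip_integrable[OF lip_on_mult[OF ind_lip J4 theta(1)]])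
    show "integrable \<nu> (\<lambda>\<omega>. ?R * h \<omega>)" using h_lip lip_integrable by simp blast
    fix \<omega> assume "\<omega> \<in> space \<nu>"
    then have w: "\<omega> \<in> X" by (simp add: space_nu)
    show "?i \<omega> * (L ^^ j) (\<lambda>\<omega>. h \<omega> * ?i \<omega>) \<omega> \<le> ?R * h \<omega>"
    proof (cases "agree k y \<omega>")
      case True
      have 0: "y 0 = \<omega> 0" using agree_zeroth[OF True k(1)] .
      have "(L ^^ j) (\<lambda>\<omega>. h \<omega> * ?i \<omega>) \<omega> \<le> (L ^^ j) (\<lambda>\<omega>. (exp c0 * h y) * ?i \<omega>) \<omega>"
      proof (rule iter_mono[OF M_le hi bdd_cmult[OF ind_bdd] _ w])
        fix \<xi> assume "\<xi> \<in> X"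
        then show "h \<xi> * ?i \<xi> \<le> exp c0 * h y * ?i \<xi>"
          using cone_le'[OF h_cone c0_nonneg, of \<xi> y] y k(1) agree_zeroth[of k y \<xi>] by (auto simp: ind_def)
      qed
      also have "\<dots> = (exp c0 * h y) * (L ^^ j) ?i \<omega>" by (rule iter_cmult)
      also have "\<dots> \<le> (exp c0 * (exp c0 * h \<omega>)) * (exp c0 * (L ^^ j) ?i y)"
        using w y 0 h_nonneg Lj
        by (intro mult_mono mult_left_mono cone_le'[OF h_cone c0_nonneg] cone_le'[OF cj c0_nonneg]) auto
      also have "\<dots> = ?R * h \<omega>" using exp_add[of c0 "c0 + c0"] exp_add[of c0 c0] by simp
      finally show ?thesis using True by (simp add: ind_def)
    qed (use h_nonneg[OF w] Lj[OF y] in \<open>simp add: ind_def\<close>)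
  qed
  also have "\<dots> = ?R" using nu_h by simp
  finally show ?thesis using l_pos by (simp add: field_simps)
qed

text \<open>A second order inclusion-exclusion bound for the preimages of one cylinder under
  multiples of the \<open>s\<close>-fold shift: these \<open>N\<close> sets have equal measure by
  invariance, and their pairwise intersections have measure at most \<open>d\<close>.\<close>

lemma union_bound:
  assumes s: "1 \<le> s" and d: "0 \<le> d"
    and le: "\<And>i. 1 \<le> i \<Longrightarrow> i \<le> N \<Longrightarrow> E (\<lambda>\<omega>. ind k y \<omega> * ind k y ((shift ^^ (i * s)) \<omega>)) \<le> d"
  shows "real N * E (ind k y) \<le> 1 + real N * (real N * d)"
proof -
  let ?x = "\<lambda>i \<omega>. ind k y ((shift ^^ (i * s)) \<omega>)"
  have x: "\<exists>J. lip J (?x i)" for i using lip_shift_funpow[OF ind_lip] by blast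
  have int1: "integrable \<nu> (\<lambda>\<omega>. h \<omega> * ?x i \<omega>)" for i using x integrable_h by blast
  have int2: "integrable \<nu> (\<lambda>\<omega>. h \<omega> * (?x j \<omega> * ?x i \<omega>))" for i j
    using x lip_on_mult[OF _ _ theta(1)] integrable_h by blast
  have int_h: "integrable \<nu> h" using h_lip lip_integrable by blast
  have pair: "E (\<lambda>\<omega>. ?x j \<omega> * ?x i \<omega>) \<le> d" if "j < i" "i < N" for i j
  proof -
    obtain J where J: "lip J (\<lambda>\<omega>. ind k y \<omega> * ?x (i - j) \<omega>)"
      using x lip_on_mult[OF ind_lip _ theta(1)] by blast
    have "i * s = (i - j) * s + j * s" using that by (simp add: add_mult_distrib[symmetric])
    then have "?x i \<omega> = ?x (i - j) ((shift ^^ (j * s)) \<omega>)" for \<omega> by (simp only: funpow_add comp_def)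
    then have "E (\<lambda>\<omega>. ?x j \<omega> * ?x i \<omega>) = E (\<lambda>\<omega>. ind k y \<omega> * ?x (i - j) \<omega>)"
      using E_shift_funpow[OF J, of "j * s"] by simp
    also have "\<dots> \<le> d" using that by (intro le) auto
    finally show ?thesis .
  qed
  have "real N * E (ind k y) = (\<Sum>i<N. E (?x i))" by (simp add: E_shift_funpow[OF ind_lip])
  also have "\<dots> = (\<integral>\<omega>. (\<Sum>i<N. h \<omega> * ?x i \<omega>) \<partial>\<nu>)"
    using int1 by (simp add: Bochner_Integration.integral_sum)
  also have "\<dots> \<le> (\<integral>\<omega>. h \<omega> + (\<Sum>i<N. \<Sum>j<i. h \<omega> * (?x j \<omega> * ?x i \<omega>)) \<partial>\<nu>)"
  proof (rule integral_mono)
    fix \<omega> assume "\<omega> \<in> space \<nu>"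
    then have w: "0 \<le> h \<omega>" by (simp add: space_nu h_nonneg)
    have "(\<Sum>i<N. ?x i \<omega>) \<le> 1 + (\<Sum>i<N. \<Sum>j<i. ?x j \<omega> * ?x i \<omega>)"
      by (rule sum_le_one_plus_pairs) (auto simp: ind_def)
    then have "h \<omega> * (\<Sum>i<N. ?x i \<omega>) \<le> h \<omega> * (1 + (\<Sum>i<N. \<Sum>j<i. ?x j \<omega> * ?x i \<omega>))"
      by (rule mult_left_mono[OF _ w])
    then show "(\<Sum>i<N. h \<omega> * ?x i \<omega>) \<le> h \<omega> + (\<Sum>i<N. \<Sum>j<i. h \<omega> * (?x j \<omega> * ?x i \<omega>))"
      by (simp add: sum_distrib_left distrib_left)
  qed (use int1 int2 int_h in auto)
  also have "\<dots> = 1 + (\<Sum>i<N. \<Sum>j<i. E (\<lambda>\<omega>. ?x j \<omega> * ?x i \<omega>))"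
    using int2 int_h nu_h by (simp add: Bochner_Integration.integral_sum)
  also have "\<dots> \<le> 1 + (\<Sum>i<N. \<Sum>j<N. d)"
  proof (intro add_left_mono sum_mono)
    fix i assume i: "i \<in> {..<N}"
    have "(\<Sum>j<i. E (\<lambda>\<omega>. ?x j \<omega> * ?x i \<omega>)) \<le> (\<Sum>j<i. d)" using pair i by (intro sum_mono) auto
    also have "\<dots> \<le> (\<Sum>j<N. d)" using i d by (intro sum_mono2) auto
    finally show "(\<Sum>j<i. E (\<lambda>\<omega>. ?x j \<omega> * ?x i \<omega>)) \<le> (\<Sum>j<N. d)" .
  qed
  also have "\<dots> = 1 + real N * (real N * d)" by simp
  finally show ?thesis .
qed

end

section \<open>Growth rates and loops; convergence of the eigenvalues\<close>

text \<open>With \<open>s = (1 + d) * r\<close>, Bernoulli's inequality lets the powers of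
  \<open>1 + d\<close> dominate the linear factor.\<close>

lemma poly_geometric_bound:
  fixes r s :: real
  assumes "0 < r" "r < s"
  shows "\<exists>K>0. \<forall>n. real (Suc n) * r ^ n \<le> K * s ^ n"
proof -
  define d where "d = s / r - 1"
  have d: "0 < d" using assms by (simp add: d_def)
  have sr: "s = (1 + d) * r" using assms by (simp add: d_def)
  have "real (Suc n) * r ^ n \<le> (1 + 1 / d) * s ^ n" for n
  proof -
    have "real (Suc n) \<le> (1 + 1 / d) * (1 + real n * d)" using d by (simp add: field_simps)
    also have "\<dots> \<le> (1 + 1 / d) * (1 + d) ^ n"
      using d Bernoulli_inequality[of d n] by (intro mult_left_mono) auto
    finally have "real (Suc n) * r ^ n \<le> (1 + 1 / d) * (1 + d) ^ n * r ^ n"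
      using assms by (intro mult_right_mono) auto
    then show ?thesis by (simp add: sr power_mult_distrib mult.assoc)
  qed
  then show ?thesis using d by (intro exI[of _ "1 + 1 / d"]) (auto simp: add_pos_pos)
qed

lemma summable_tail:
  fixes q :: "'a \<Rightarrow> real"
  assumes "q summable_on UNIV" "\<And>a. 0 \<le> q a" "0 < e"
  shows "\<exists>F. finite F \<and> (\<Sum>\<^sub>\<infinity>a\<in>-F. q a) \<le> e"
proof -
  have "(q has_sum infsum q UNIV) UNIV" by (rule has_sum_infsum[OF assms(1)])
  then have "\<forall>\<^sub>F F in finite_subsets_at_top UNIV. dist (sum q F) (infsum q UNIV) < e"
    using assms(3) unfolding has_sum_def by (rule tendstoD)
  then obtain F where F: "finite F" "dist (sum q F) (infsum q UNIV) < e"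
    unfolding eventually_finite_subsets_at_top by blast
  have "infsum q (UNIV - F) = infsum q UNIV - infsum q F"
    by (rule infsum_Diff[OF assms(1)]) (use F in auto)
  then show ?thesis using F by (intro exI[of _ F]) (auto simp: Compl_eq_Diff_UNIV dist_real_def)
qed

text \<open>The indicator of the state is below a multiple of \<open>h\<close>, and iterating
  \<open>h\<close> gives exactly \<open>l ^ k\<close>. Read backwards, a single large loop sum
  bounds the eigenvalue from below, with a constant independent of \<epsilon>.\<close>

lemma (in rpf) loop_le:
  assumes "x \<in> X" "x 0 = a" "a \<in> U"
  shows "(L ^^ k) (state_ind a) x \<le> exp c0 * l ^ k"
proof -
  have "h x * (L ^^ k) (state_ind a) x = (L ^^ k) (\<lambda>\<omega>. h x * state_ind a \<omega>) x" by (rule iter_cmult[symmetric])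
  also have "\<dots> \<le> (L ^^ k) (\<lambda>\<omega>. exp c0 * h \<omega>) x"
  proof (rule iter_mono[OF M_le bdd_cmult[OF state_ind_bdd] bdd_cmult[OF h_bdd] _ assms(1)])
    fix \<omega> assume "\<omega> \<in> X"
    then show "h x * state_ind a \<omega> \<le> exp c0 * h \<omega>"
      using cone_le'[OF h_cone c0_nonneg assms(1), of \<omega>] assms(2) h_nonneg by (auto simp: state_ind_def)
  qed
  also have "\<dots> = h x * (exp c0 * l ^ k)" using h_iter[OF assms(1), of k] by (simp add: iter_cmult)
  finally show ?thesis using h_pos[of x] assms by simp
qed

context potential
begin

text \<open>Only the prepended letter is confined to \<open>T\<close>; the point itself may start
  anywhere, so bounds can be taken over all of \<open>X\<close>.\<close>

definition restrict_to :: "'s set \<Rightarrow> 's \<Rightarrow> 's \<Rightarrow> bool" where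
  "restrict_to T a b \<longleftrightarrow> A a b \<and> a \<in> T"

lemma restrict_to_le: "restrict_to T \<le> A"
  by (auto simp: restrict_to_def le_fun_def)

lemma restrict_to_UNIV: "restrict_to UNIV = A"
  by (auto simp: restrict_to_def fun_eq_iff)

lemma transfer_insert:
  assumes "a \<notin> T" "bdd f" "\<omega> \<in> X"
  shows "transfer (restrict_to (insert a T)) p f \<omega> = transfer (restrict_to T) p f \<omega> +
    (if A a (\<omega> 0) then p (case_nat a \<omega>) * f (case_nat a \<omega>) else 0)"
proof (cases "A a (\<omega> 0)")
  case True
  then have "{b. restrict_to (insert a T) b (\<omega> 0)} = insert a {b. restrict_to T b (\<omega> 0)}"
    by (auto simp: restrict_to_def)
  then show ?thesis
    using True assms(1) transfer_summable[OF restrict_to_le assms(2,3), of T]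
    by (simp add: transfer_def infsum_insert restrict_to_def)
next
  case False
  then have "{b. restrict_to (insert a T) b (\<omega> 0)} = {b. restrict_to T b (\<omega> 0)}"
    by (auto simp: restrict_to_def)
  then show ?thesis using False by (simp add: transfer_def)
qed

text \<open>Removing the state \<open>a\<close>: a word is cut at its first and last visit to \<open>a\<close>, so that the growth rate
  over \<open>T \<union> {a}\<close> is the larger one of the rate over \<open>T\<close> and of that of the loops at \<open>a\<close>.\<close>

lemma growth_insert:
  assumes r: "0 < \<rho>" "\<rho> < \<rho>'" and aT: "a \<notin> T" and x: "x \<in> X" "x 0 = a"
    and T: "\<And>r. \<rho> < r \<Longrightarrow> r \<in> growth (restrict_to T)"
    and loops: "\<And>k. (transfer A p ^^ k) (state_ind a) x \<le> K2 * \<rho> ^ k"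
  shows "\<rho>' \<in> growth (restrict_to (insert a T))"
proof -
  \<comment> \<open>Three equal gaps: \<open>\<rho>1\<close> is a rate over \<open>T\<close>, and
    each of the two cuts is a convolution of geometric sequences, whose polynomial factor is
    absorbed in passing to \<open>\<rho>2\<close> and to \<open>\<rho>'\<close>.\<close>
  define e where "e = (\<rho>' - \<rho>) / 3"
  define \<rho>1 where "\<rho>1 = \<rho> + e"
  define \<rho>2 where "\<rho>2 = \<rho> + 2 * e"
  have e: "0 < e" "\<rho>' = \<rho> + 3 * e" using r by (auto simp: e_def field_simps)
  have r12: "0 < \<rho>1" "\<rho> < \<rho>1" "\<rho>1 < \<rho>2" "\<rho>2 < \<rho>'" "0 < \<rho>2"
    using r(1) e by (auto simp: \<rho>1_def \<rho>2_def)
  let ?T = "transfer (restrict_to T) p" and ?I = "transfer (restrict_to (insert a T)) p" and ?A = "transfer A p"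
  note le = restrict_to_le
  obtain K1 where K1: "0 < K1" "\<And>k \<omega>. \<omega> \<in> X \<Longrightarrow> (?T ^^ k) (\<lambda>_. 1) \<omega> \<le> K1 * \<rho>1 ^ k"
    using growthD[OF T[OF r12(2)]] by blast
  have bT: "bdd ((?T ^^ m) (\<lambda>_. 1))" for m by (intro iter_bdd le bdd_const)
  have bA: "bdd ((?A ^^ m) (state_ind a))" for m by (intro iter_bdd state_ind_bdd) auto
  have nnT: "0 \<le> (?T ^^ m) (\<lambda>_. 1) \<omega>" if "\<omega> \<in> X" for m \<omega>
    using iter_nonneg[OF le, of "\<lambda>_. 1" \<omega>] that by simp
  have nnA: "0 \<le> (?A ^^ m) (state_ind a) \<omega>" if "\<omega> \<in> X" for m \<omega>
    by (rule iter_nonneg[OF order_refl state_ind_nonneg that])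
  have K2: "0 \<le> K2" using loops[of 0] x by (simp add: state_ind_def)
  \<comment> \<open>Cut at the first visit to \<open>a\<close>: the part before it avoids
    \<open>a\<close> and is bounded by the rate over \<open>T\<close>; the rest is a path from
    \<open>a\<close> to the point, on which the restriction is given up.\<close>
  have tele: "(?I ^^ j) ((?T ^^ m) (\<lambda>_. 1)) \<omega> \<le>
      (?T ^^ (j + m)) (\<lambda>_. 1) \<omega> + (\<Sum>i<j. K1 * \<rho>1 ^ (m + i) * (?A ^^ (j - i)) (state_ind a) \<omega>)"
    if "\<omega> \<in> X" for j m \<omega>
    using that
  proof (induction j arbitrary: m)
    case (Suc j)
    let ?g = "(?T ^^ m) (\<lambda>_. 1)"
    let ?b = "\<lambda>\<omega>. K1 * \<rho>1 ^ m * ?A (state_ind a) \<omega>"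
    have b: "bdd ?b" using bA[of 1] by (intro bdd_cmult) simp
    have "(?I ^^ Suc j) ?g \<omega> = (?I ^^ j) (?I ?g) \<omega>" by (simp add: funpow_swap1)
    also have "\<dots> \<le> (?I ^^ j) (\<lambda>\<omega>. (?T ^^ Suc m) (\<lambda>_. 1) \<omega> + ?b \<omega>) \<omega>"
    proof (rule iter_mono[OF le transfer_bdd[OF le bT] bdd_add[OF bT b] _ Suc.prems])
      fix \<upsilon> assume u: "\<upsilon> \<in> X"
      have "(if A a (\<upsilon> 0) then p (case_nat a \<upsilon>) * ?g (case_nat a \<upsilon>) else 0) \<le> ?b \<upsilon>"
      proof (cases "A a (\<upsilon> 0)")
        case True
        have c: "case_nat a \<upsilon> \<in> X" by (rule Cons_in_shift_space[OF u True])
        have "p (case_nat a \<upsilon>) * ?g (case_nat a \<upsilon>) \<le> p (case_nat a \<upsilon>) * (K1 * \<rho>1 ^ m)"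
          by (intro mult_left_mono K1 c p_nonneg)
        also have "\<dots> = K1 * \<rho>1 ^ m * (p (case_nat a \<upsilon>) * state_ind a (case_nat a \<upsilon>))"
          by (simp add: state_ind_def)
        also have "\<dots> \<le> ?b \<upsilon>"
          using K1(1) r12(1) by (intro mult_left_mono transfer_ge_term state_ind_bdd state_ind_nonneg u True) auto
        finally show ?thesis using True by simp
      next
        case False
        then show ?thesis using nnA[OF u, of 1] K1(1) r12(1) by simp
      qed
      then show "?I ?g \<upsilon> \<le> (?T ^^ Suc m) (\<lambda>_. 1) \<upsilon> + ?b \<upsilon>"
        using transfer_insert[OF aT bT u] by simp
    qed
    also have "\<dots> = (?I ^^ j) ((?T ^^ Suc m) (\<lambda>_. 1)) \<omega> + K1 * \<rho>1 ^ m * (?I ^^ j) (?A (state_ind a)) \<omega>"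
      by (subst iter_add[OF le bT b Suc.prems]) (simp add: iter_cmult)
    also have "(?I ^^ j) (?A (state_ind a)) \<omega> \<le> (?A ^^ j) (?A (state_ind a)) \<omega>"
      using bA[of 1] nnA[of _ 1] by (intro iter_mono_matrix[OF le order_refl _ _ Suc.prems]) auto
    also have "(?A ^^ j) (?A (state_ind a)) \<omega> = (?A ^^ Suc j) (state_ind a) \<omega>" by (simp add: funpow_swap1)
    also have "(?I ^^ j) ((?T ^^ Suc m) (\<lambda>_. 1)) \<omega> \<le> (?T ^^ (j + Suc m)) (\<lambda>_. 1) \<omega> +
       (\<Sum>i<j. K1 * \<rho>1 ^ (Suc m + i) * (?A ^^ (j - i)) (state_ind a) \<omega>)"
      by (rule Suc.IH[OF Suc.prems])
    finally have "(?I ^^ Suc j) ?g \<omega> \<le> (?T ^^ (j + Suc m)) (\<lambda>_. 1) \<omega> +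
       (\<Sum>i<j. K1 * \<rho>1 ^ (Suc m + i) * (?A ^^ (j - i)) (state_ind a) \<omega>) + K1 * \<rho>1 ^ m * (?A ^^ Suc j) (state_ind a) \<omega>"
      using K1(1) r12(1) by (simp add: mult_left_mono)
    also have "\<dots> = (?T ^^ (Suc j + m)) (\<lambda>_. 1) \<omega> +
      (\<Sum>i<Suc j. K1 * \<rho>1 ^ (m + i) * (?A ^^ (Suc j - i)) (state_ind a) \<omega>)"
      by (subst sum.lessThan_Suc_shift) simp
    finally show ?case .
  qed auto
  obtain K3 where K3: "0 < K3" "\<And>n. real (Suc n) * \<rho>1 ^ n \<le> K3 * \<rho>2 ^ n"
    using poly_geometric_bound[OF r12(1,3)] by blast
  \<comment> \<open>At \<open>x\<close>, which starts with \<open>a\<close>, the rest of the path is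
    a loop.\<close>
  have at_x: "(?I ^^ n) (\<lambda>_. 1) x \<le> K1 * (1 + K2) * K3 * \<rho>2 ^ n" for n
  proof -
    have "(?I ^^ n) (\<lambda>_. 1) x \<le> (?T ^^ n) (\<lambda>_. 1) x + (\<Sum>i<n. K1 * \<rho>1 ^ i * (?A ^^ (n - i)) (state_ind a) x)"
      using tele[OF x(1), of n 0] by simp
    also have "\<dots> \<le> K1 * \<rho>1 ^ n + (\<Sum>i<n. K1 * \<rho>1 ^ i * (K2 * \<rho>1 ^ (n - i)))"
    proof (intro add_mono K1 x sum_mono mult_left_mono)
      fix i
      have "(?A ^^ (n - i)) (state_ind a) x \<le> K2 * \<rho> ^ (n - i)" by (rule loops)
      also have "\<dots> \<le> K2 * \<rho>1 ^ (n - i)" using K2 r r12 by (intro mult_left_mono power_mono) auto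
      finally show "(?A ^^ (n - i)) (state_ind a) x \<le> K2 * \<rho>1 ^ (n - i)" .
    qed (use K1 r12 in auto)
    also have "(\<Sum>i<n. K1 * \<rho>1 ^ i * (K2 * \<rho>1 ^ (n - i))) = (\<Sum>i<n. K1 * K2 * \<rho>1 ^ n)"
      by (intro sum.cong) (auto simp: power_add[symmetric] mult_ac)
    also have "K1 * \<rho>1 ^ n + \<dots> = K1 * (1 + real n * K2) * \<rho>1 ^ n" by (simp add: algebra_simps)
    also have "\<dots> \<le> K1 * ((1 + K2) * real (Suc n)) * \<rho>1 ^ n"
      using K1 K2 r12 by (intro mult_right_mono mult_left_mono) (auto simp: algebra_simps)
    also have "\<dots> = K1 * (1 + K2) * (real (Suc n) * \<rho>1 ^ n)" by (simp add: mult_ac)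
    also have "\<dots> \<le> K1 * (1 + K2) * (K3 * \<rho>2 ^ n)" using K1 K2 by (intro mult_left_mono K3) auto
    finally show ?thesis by (simp add: mult_ac)
  qed
  \<comment> \<open>The summand 1 starts the induction; the other one pays for crossing the last
    visit to \<open>a\<close>, where distortion replaces the point by \<open>x\<close>.\<close>
  define K4 where "K4 = 1 + q a * (exp c0 * (K1 * (1 + K2) * K3)) / \<rho>2"
  have K4: "1 \<le> K4" "q a * (exp c0 * (K1 * (1 + K2) * K3)) \<le> K4 * \<rho>2"
    using K1(1) K2 K3(1) r12 q_nonneg[of a] by (auto simp: K4_def field_simps)
  have cI: "cone 1 c0 ((?I ^^ n) (\<lambda>_. 1))" for n
    by (rule cone_iter_1) (auto simp: le c0_nonneg intro: cone_const)
  \<comment> \<open>Cut at the last visit to \<open>a\<close>: the letters after it lie in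
    \<open>T\<close>, and the word before it is counted at a point starting with
    \<open>a\<close>.\<close>
  have up: "(?I ^^ n) (\<lambda>_. 1) \<omega> \<le> (\<Sum>i\<le>n. K4 * \<rho>2 ^ (n - i) * (?T ^^ i) (\<lambda>_. 1) \<omega>)" if "\<omega> \<in> X" for n \<omega>
    using that
  proof (induction n arbitrary: \<omega>)
    case 0 then show ?case using K4 by simp
  next
    case (Suc n)
    let ?S = "\<lambda>n \<omega>. \<Sum>i\<le>n. K4 * \<rho>2 ^ (n - i) * (?T ^^ i) (\<lambda>_. 1) \<omega>"
    have bI: "bdd ((?I ^^ n) (\<lambda>_. 1))" by (intro iter_bdd le bdd_const)
    have lin: "bdd (\<lambda>\<omega>. \<Sum>i\<in>N. c i * (?T ^^ i) (\<lambda>_. 1) \<omega>) \<and>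
       ?T (\<lambda>\<omega>. \<Sum>i\<in>N. c i * (?T ^^ i) (\<lambda>_. 1) \<omega>) \<omega> = (\<Sum>i\<in>N. c i * (?T ^^ Suc i) (\<lambda>_. 1) \<omega>)" if "finite N" for N c
      using that
    proof (induction N rule: finite_induct)
      case empty then show ?case by (simp add: transfer_def)
    next
      case (insert i N)
      then show ?case
        by (simp add: bdd_add bdd_cmult bT transfer_add[OF le bdd_cmult[OF bT] _ Suc.prems] transfer_cmult)
    qed
    have "(?I ^^ Suc n) (\<lambda>_. 1) \<omega> = ?T ((?I ^^ n) (\<lambda>_. 1)) \<omega> +
      (if A a (\<omega> 0) then p (case_nat a \<omega>) * (?I ^^ n) (\<lambda>_. 1) (case_nat a \<omega>) else 0)"
      using transfer_insert[OF aT bI Suc.prems] by simp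
    also have "\<dots> \<le> ?T (?S n) \<omega> + K4 * \<rho>2 ^ Suc n"
    proof (rule add_mono)
      show "?T ((?I ^^ n) (\<lambda>_. 1)) \<omega> \<le> ?T (?S n) \<omega>"
        using lin[of "{..n}" "\<lambda>i. K4 * \<rho>2 ^ (n - i)"] Suc by (intro transfer_mono[OF le bI]) auto
      show "(if A a (\<omega> 0) then p (case_nat a \<omega>) * (?I ^^ n) (\<lambda>_. 1) (case_nat a \<omega>) else 0) \<le> K4 * \<rho>2 ^ Suc n"
      proof (cases "A a (\<omega> 0)")
        case True
        have c: "case_nat a \<omega> \<in> X" by (rule Cons_in_shift_space[OF Suc.prems True])
        have "(?I ^^ n) (\<lambda>_. 1) (case_nat a \<omega>) \<le> exp c0 * (?I ^^ n) (\<lambda>_. 1) x"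
          by (rule cone_le'[OF cI c0_nonneg c x(1)]) (simp add: x)
        also have "\<dots> \<le> exp c0 * (K1 * (1 + K2) * K3 * \<rho>2 ^ n)" by (intro mult_left_mono at_x) auto
        finally have "p (case_nat a \<omega>) * (?I ^^ n) (\<lambda>_. 1) (case_nat a \<omega>) \<le>
            q a * (exp c0 * (K1 * (1 + K2) * K3 * \<rho>2 ^ n))"
          using p_le[OF c] q_nonneg cone_nonneg[OF cI c] by (intro mult_mono) auto
        also have "\<dots> = q a * (exp c0 * (K1 * (1 + K2) * K3)) * \<rho>2 ^ n" by (simp add: mult_ac)
        also have "\<dots> \<le> K4 * \<rho>2 * \<rho>2 ^ n" using K4(2) r12 by (intro mult_right_mono) auto
        finally show ?thesis using True by (simp add: mult_ac)
      qed (use K4 r12 in auto)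
    qed
    also have "?T (?S n) \<omega> = (\<Sum>i\<le>n. K4 * \<rho>2 ^ (n - i) * (?T ^^ Suc i) (\<lambda>_. 1) \<omega>)"
      using lin[of "{..n}" "\<lambda>i. K4 * \<rho>2 ^ (n - i)"] by simp
    also have "\<dots> + K4 * \<rho>2 ^ Suc n = ?S (Suc n) \<omega>"
      by (subst sum.atMost_Suc_shift) simp
    finally show ?case .
  qed
  obtain K5 where K5: "0 < K5" "\<And>n. real (Suc n) * \<rho>2 ^ n \<le> K5 * \<rho>' ^ n"
    using poly_geometric_bound[OF r12(5,4)] by blast
  show ?thesis
  proof (rule growthI)
    fix k \<omega> assume w: "\<omega> \<in> X"
    have "(?I ^^ k) (\<lambda>_. 1) \<omega> \<le> (\<Sum>i\<le>k. K4 * \<rho>2 ^ (k - i) * (?T ^^ i) (\<lambda>_. 1) \<omega>)" by (rule up[OF w])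
    also have "\<dots> \<le> (\<Sum>i\<le>k. K4 * \<rho>2 ^ (k - i) * (K1 * \<rho>2 ^ i))"
    proof (intro sum_mono mult_left_mono)
      fix i
      have "(?T ^^ i) (\<lambda>_. 1) \<omega> \<le> K1 * \<rho>1 ^ i" by (rule K1(2)[OF w])
      also have "\<dots> \<le> K1 * \<rho>2 ^ i" using K1 r12 by (intro mult_left_mono power_mono) auto
      finally show "(?T ^^ i) (\<lambda>_. 1) \<omega> \<le> K1 * \<rho>2 ^ i" .
    qed (use K4 r12 in auto)
    also have "\<dots> = (\<Sum>i\<le>k. K4 * K1 * \<rho>2 ^ k)"
      by (intro sum.cong) (auto simp: power_add[symmetric] mult_ac)
    also have "\<dots> = K4 * K1 * (real (Suc k) * \<rho>2 ^ k)" by simp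
    also have "\<dots> \<le> K4 * K1 * (K5 * \<rho>' ^ k)" using K4 K1 by (intro mult_left_mono K5) auto
    finally show "(?I ^^ k) (\<lambda>_. 1) \<omega> \<le> K4 * K1 * K5 * \<rho>' ^ k" by (simp add: mult_ac)
  qed (use r in auto)
qed

text \<open>Outside the finite set \<open>Q\<close> a single step already has norm at most \<rho>.
  The states of \<open>Q\<close> are put back one at a time; each insertion loses an arbitrarily
  small amount, so the induction keeps every rate above \<rho> rather than \<rho> itself.\<close>

lemma growth_from_loops:
  assumes r: "0 < \<rho>" "\<rho> < \<rho>'" and Q: "finite Q" "(\<Sum>\<^sub>\<infinity>a\<in>-Q. q a) \<le> \<rho>"
    and x: "\<And>a. a \<in> Q \<Longrightarrow> x a \<in> X \<and> x a 0 = a"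
    and loops: "\<And>a. a \<in> Q \<Longrightarrow> \<exists>K. \<forall>k. (transfer A p ^^ k) (state_ind a) (x a) \<le> K * \<rho> ^ k"
  shows "\<rho>' \<in> growth A"
proof -
  have base: "\<rho> \<in> growth (restrict_to (- Q))"
  proof (rule growth_one_step[OF restrict_to_le order_refl r(1)])
    fix \<omega> assume w: "\<omega> \<in> X"
    have "\<bar>transfer (restrict_to (- Q)) p (\<lambda>_. 1) \<omega>\<bar> \<le> (\<Sum>\<^sub>\<infinity>a\<in>{a. restrict_to (- Q) a (\<omega> 0)}. q a * 1)"
      by (rule transfer_le_states[OF restrict_to_le _ w]) (use q_summable in auto)
    also have "\<dots> \<le> (\<Sum>\<^sub>\<infinity>a\<in>-Q. q a)"
      using q_nonneg q_summable
      by (intro infsum_mono_neutral) (auto intro: summable_on_subset_banach simp: restrict_to_def)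
    finally show "(transfer (restrict_to (- Q)) p ^^ 1) (\<lambda>_. 1) \<omega> \<le> \<rho> ^ 1" using Q(2) by simp
  qed
  have "\<forall>r>\<rho>. r \<in> growth (restrict_to (- Q \<union> F))" if "finite F" "F \<subseteq> Q" for F
    using that
  proof (induction F rule: finite_induct)
    case empty
    then show ?case using growth_upward[OF base] by auto
  next
    case (insert a F)
    obtain K where K: "\<And>k. (transfer A p ^^ k) (state_ind a) (x a) \<le> K * \<rho> ^ k"
      using loops insert.prems by blast
    have "r \<in> growth (restrict_to (insert a (- Q \<union> F)))" if "\<rho> < r" for r
      by (rule growth_insert[OF r(1) that _ _ _ _ K]) (use insert x in auto)
    then show ?case by simp
  qed
  from this[OF Q(1) order_refl] show ?thesis using r by (simp add: restrict_to_UNIV)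
qed

end

text \<open>\<open>pn n\<close> stands for the exponential of a perturbed potential and \<Lambda>
  for the exponential of the limit pressure, which enters only through the set of growth rates.
  \<open>C\<close> and \<open>q\<close> do not depend on \<open>n\<close>.\<close>

locale perturbation = potential \<theta> A p C q
  for \<theta> and A :: "'s::{countable,discrete_topology} \<Rightarrow> 's \<Rightarrow> bool" and p C q +
  fixes pn :: "nat \<Rightarrow> (nat \<Rightarrow> 's) \<Rightarrow> real" and h :: "nat \<Rightarrow> (nat \<Rightarrow> 's) \<Rightarrow> real"
    and \<nu> :: "nat \<Rightarrow> (nat \<Rightarrow> 's) measure" and l :: "nat \<Rightarrow> real" and \<Lambda> :: real
  assumes rpf: "rpf \<theta> A (pn n) C q A (h n) (\<nu> n) (l n) UNIV"
    and pn_conv: "\<exists>s. s \<longlonglongrightarrow> 0 \<and> (\<forall>n. \<forall>\<omega>\<in>shift_space A. \<omega> 0 = a \<longrightarrow> \<bar>pn n \<omega> - p \<omega>\<bar> \<le> s n)"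
    and Lam_pos: "0 < \<Lambda>"
    and growth_above: "\<Lambda> < \<rho> \<Longrightarrow> \<rho> \<in> growth A"
    and growth_below: "0 < \<rho> \<Longrightarrow> \<rho> < \<Lambda> \<Longrightarrow> \<rho> \<notin> growth A"
begin

sublocale r: rpf \<theta> A "pn n" C q A "h n" "\<nu> n" "l n" UNIV for n
  by (rule rpf)

section \<open>Convergence of operators and eigenvalues, uniform tightness\<close>

abbreviation E :: "nat \<Rightarrow> ((nat \<Rightarrow> 's) \<Rightarrow> real) \<Rightarrow> real" where
  "E n f \<equiv> (\<integral>\<omega>. h n \<omega> * f \<omega> \<partial>\<nu> n)"

abbreviation Ln where "Ln n \<equiv> transfer A (pn n)"
abbreviation LA where "LA \<equiv> transfer A p"

text \<open>All but finitely many prepended letters contribute little by the tail of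
  \<open>q\<close>, uniformly in \<open>n\<close>; for the finitely many others the weights converge
  uniformly on each cylinder.\<close>

lemma transfer_conv:
  assumes "0 < d" "0 \<le> K"
  shows "\<forall>\<^sub>F n in sequentially. \<forall>f. \<forall>\<omega>\<in>X. (\<forall>\<upsilon>\<in>X. \<bar>f \<upsilon>\<bar> \<le> K) \<longrightarrow> \<bar>Ln n f \<omega> - LA f \<omega>\<bar> \<le> d"
proof -
  define e where "e = d / (K + 1) / 2"
  have e: "0 < e" using assms by (simp add: e_def)
  have "e + e = d / (K + 1)" unfolding e_def by (rule field_sum_of_halves)
  then have e2: "(e + e) * K \<le> d" using assms by (simp add: pos_divide_le_eq)
  obtain F where F: "finite F" "(\<Sum>\<^sub>\<infinity>a\<in>-F. q a) \<le> e"
    using summable_tail[OF q_summable q_nonneg e] by blast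
  have "\<forall>a. \<exists>s. s \<longlonglongrightarrow> 0 \<and> (\<forall>n. \<forall>\<omega>\<in>X. \<omega> 0 = a \<longrightarrow> \<bar>pn n \<omega> - p \<omega>\<bar> \<le> s n)"
    using pn_conv by blast
  then obtain s where s: "\<And>a. s a \<longlonglongrightarrow> 0"
    "\<And>a n \<omega>. \<omega> \<in> X \<Longrightarrow> \<omega> 0 = a \<Longrightarrow> \<bar>pn n \<omega> - p \<omega>\<bar> \<le> s a n" by metis
  have "(\<lambda>n. \<Sum>a\<in>F. \<bar>s a n\<bar>) \<longlonglongrightarrow> (\<Sum>a\<in>F. \<bar>0\<bar>)" by (intro tendsto_sum tendsto_rabs s)
  then have "\<forall>\<^sub>F n in sequentially. (\<Sum>a\<in>F. \<bar>s a n\<bar>) < e" using e by (intro order_tendstoD) auto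
  then show ?thesis
  proof eventually_elim
    case (elim n)
    show ?case
    proof (intro allI ballI impI)
      fix f \<omega> assume w: "\<omega> \<in> X" and f: "\<forall>\<upsilon>\<in>X. \<bar>f \<upsilon>\<bar> \<le> K"
      have bf: "bdd f" using f by (auto intro: bddI)
      let ?D = "{a. A a (\<omega> 0)}"
      \<comment> \<open>A majorant of the difference of the weights by the first letter; off
        \<open>F\<close> both weights lie between 0 and \<open>q a\<close>.\<close>
      define g where "g a = (if a \<in> F then \<bar>s a n\<bar> else q a)" for a
      have gF: "(g has_sum (\<Sum>a\<in>F. \<bar>s a n\<bar>)) F"
        using F(1) by (subst has_sum_cong[where g = "\<lambda>a. \<bar>s a n\<bar>"]) (auto simp: g_def intro: has_sum_finite)
      have gC: "(g has_sum (\<Sum>\<^sub>\<infinity>a\<in>-F. q a)) (- F)"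
        by (subst has_sum_cong[where g = q])
          (auto simp: g_def intro!: has_sum_infsum summable_on_subset_banach[OF q_summable])
      have g: "(g has_sum ((\<Sum>a\<in>F. \<bar>s a n\<bar>) + (\<Sum>\<^sub>\<infinity>a\<in>-F. q a))) UNIV"
        using has_sum_Un_disjoint[OF gF gC] by simp
      have g_nonneg: "0 \<le> g a" for a using q_nonneg by (simp add: g_def)
      have gs: "g summable_on ?D" by (rule summable_on_subset_banach[OF has_sum_imp_summable[OF g]]) simp
      have "infsum g ?D \<le> infsum g UNIV"
        using g gs g_nonneg by (intro infsum_mono_neutral) (auto simp: summable_on_def)
      also have "\<dots> \<le> e + e" using F(2) elim g by (simp add: infsumI)
      finally have gD: "infsum g ?D \<le> e + e" .
      have diff: "\<bar>pn n (case_nat a \<omega>) * f (case_nat a \<omega>) - p (case_nat a \<omega>) * f (case_nat a \<omega>)\<bar> \<le> g a * K"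
        if "a \<in> ?D" for a
      proof -
        have c: "case_nat a \<omega> \<in> X" using that by (intro Cons_in_shift_space w) simp
        have "\<bar>pn n (case_nat a \<omega>) - p (case_nat a \<omega>)\<bar> \<le> g a"
        proof (cases "a \<in> F")
          case True
          then show ?thesis using s(2)[OF c, of a n] by (simp add: g_def)
        next
          case False
          have "0 \<le> pn n (case_nat a \<omega>)" "pn n (case_nat a \<omega>) \<le> q a" "0 \<le> p (case_nat a \<omega>)" "p (case_nat a \<omega>) \<le> q a"
            using r.p_nonneg[OF c] r.p_le[OF c] p_nonneg[OF c] p_le[OF c] by auto
          then show ?thesis using False by (simp add: g_def abs_le_iff)
        qed
        then have "\<bar>pn n (case_nat a \<omega>) - p (case_nat a \<omega>)\<bar> * \<bar>f (case_nat a \<omega>)\<bar> \<le> g a * K"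
          using f c g_nonneg by (intro mult_mono) auto
        then show ?thesis by (simp add: abs_mult[symmetric] algebra_simps)
      qed
      have hn: "((\<lambda>a. pn n (case_nat a \<omega>) * f (case_nat a \<omega>)) has_sum Ln n f \<omega>) ?D"
        by (rule r.transfer_has_sum[OF order_refl _ w]) (use f in \<open>auto intro: r.bddI\<close>)
      have hp: "((\<lambda>a. p (case_nat a \<omega>) * f (case_nat a \<omega>)) has_sum LA f \<omega>) ?D"
        by (rule transfer_has_sum[OF order_refl bf w])
      have gK: "((\<lambda>a. g a * K) has_sum infsum g ?D * K) ?D"
        by (intro has_sum_cmult_left has_sum_infsum gs)
      have "Ln n f \<omega> \<le> LA f \<omega> + infsum g ?D * K"
        by (rule has_sum_mono[OF hn has_sum_add[OF hp gK]]) (use diff in fastforce)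
      moreover have "LA f \<omega> \<le> Ln n f \<omega> + infsum g ?D * K"
        by (rule has_sum_mono[OF hp has_sum_add[OF hn gK]]) (use diff in fastforce)
      moreover have "infsum g ?D * K \<le> (e + e) * K" using gD assms by (intro mult_right_mono) auto
      ultimately show "\<bar>Ln n f \<omega> - LA f \<omega>\<bar> \<le> d" using e2 by linarith
    qed
  qed
qed

lemma iter_conv:
  assumes f: "bdd f" and d: "0 < d"
  shows "\<forall>\<^sub>F n in sequentially. \<forall>\<omega>\<in>X. \<bar>(Ln n ^^ k) f \<omega> - (LA ^^ k) f \<omega>\<bar> \<le> d"
  using d
proof (induction k arbitrary: d)
  case (Suc k)
  obtain K where K: "0 \<le> K" "\<And>\<omega>. \<omega> \<in> X \<Longrightarrow> \<bar>(LA ^^ k) f \<omega>\<bar> \<le> K"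
    using bddE[OF iter_bdd[OF order_refl f]] by blast
  \<comment> \<open>The error of the previous iterate grows by at most the factor
    \<open>qsum\<close>; the other half of \<open>d\<close> is reserved for replacing the outermost
    operator.\<close>
  define e where "e = d / (2 * (qsum + 1))"
  have e: "0 < e" "qsum * e \<le> d / 2" using Suc.prems qsum_nonneg by (auto simp: e_def field_simps)
  have d2: "0 < d / 2" using Suc.prems by simp
  show ?case
    using Suc.IH[OF e(1)] transfer_conv[OF d2 K(1)]
  proof eventually_elim
    case (elim n)
    show ?case
    proof
      fix \<omega> assume w: "\<omega> \<in> X"
      have b1: "r.bdd ((Ln n ^^ k) f)" "r.bdd ((LA ^^ k) f)"
        using f iter_bdd[OF order_refl f, of k] r.iter_bdd[OF order_refl, of f k n] by (auto simp: r.bdd_def bdd_def)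
      have "\<bar>Ln n (\<lambda>\<omega>. (Ln n ^^ k) f \<omega> - (LA ^^ k) f \<omega>) \<omega>\<bar> \<le> qsum * e"
        using r.transfer_le[OF order_refl, of "\<lambda>\<omega>. (Ln n ^^ k) f \<omega> - (LA ^^ k) f \<omega>" e \<omega> n] elim(1) w
        by (simp add: r.qsum_def qsum_def)
      then have "\<bar>Ln n ((Ln n ^^ k) f) \<omega> - Ln n ((LA ^^ k) f) \<omega>\<bar> \<le> d / 2"
        using r.transfer_diff[OF order_refl b1 w] e(2) by simp
      moreover have "\<bar>Ln n ((LA ^^ k) f) \<omega> - LA ((LA ^^ k) f) \<omega>\<bar> \<le> d / 2"
        using elim(2) w K(2) by blast
      ultimately show "\<bar>(Ln n ^^ Suc k) f \<omega> - (LA ^^ Suc k) f \<omega>\<bar> \<le> d"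
        unfolding funpow.simps o_apply by linarith
    qed
  qed
qed auto

lemma iter_conv_at:
  assumes "bdd f" "\<omega> \<in> X"
  shows "(\<lambda>n. (Ln n ^^ k) f \<omega>) \<longlonglongrightarrow> (LA ^^ k) f \<omega>"
proof (rule tendstoI)
  fix e :: real assume "0 < e"
  then have "0 < e / 2" by simp
  from iter_conv[OF assms(1) this, of k] show "\<forall>\<^sub>F n in sequentially. dist ((Ln n ^^ k) f \<omega>) ((LA ^^ k) f \<omega>) < e"
    by eventually_elim (use assms(2) \<open>0 < e\<close> in \<open>auto simp: dist_real_def\<close>)
qed

lemma state_exists: "\<exists>\<omega>\<in>X. \<omega> 0 = a"
  using r.state_in_XM by blast

text \<open>Above: \<open>l n ^ k\<close> is the integral of the iterate of 1, and one
  \<open>k\<close> for which the limit iterate is below \<rho>^k suffices for all large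
  \<open>n\<close>. Below: if the loops at all states had rate at most \<rho>, then any larger
  number would be a growth rate, against \<open>growth_below\<close>; so at some state one loop sum
  exceeds \<open>exp c0 * \<rho> ^ k\<close>, and this strict inequality persists under
  perturbation.\<close>

lemma eigenvalue_tendsto: "l \<longlonglongrightarrow> \<Lambda>"
proof (rule order_tendstoI)
  fix \<rho> assume r: "\<Lambda> < \<rho>"
  define \<rho>1 where "\<rho>1 = (\<Lambda> + \<rho>) / 2"
  have r1: "\<Lambda> < \<rho>1" "\<rho>1 < \<rho>" "0 < \<rho>1" using r Lam_pos by (auto simp: \<rho>1_def)
  obtain K where K: "0 < K" "\<And>k \<omega>. \<omega> \<in> X \<Longrightarrow> (LA ^^ k) (\<lambda>_. 1) \<omega> \<le> K * \<rho>1 ^ k"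
    using growthD[OF growth_above[OF r1(1)]] by blast
  have "(\<lambda>k. K * (\<rho>1 / \<rho>) ^ k) \<longlonglongrightarrow> K * 0"
    using r1 by (intro tendsto_mult tendsto_const LIMSEQ_power_zero) auto
  then have "\<forall>\<^sub>F k in sequentially. K * (\<rho>1 / \<rho>) ^ k < 1" by (intro order_tendstoD) auto
  then have "\<exists>k. K * (\<rho>1 / \<rho>) ^ k < 1 \<and> 1 \<le> k"
    by (intro eventually_happens'[OF sequentially_bot] eventually_conj eventually_ge_at_top)
  then obtain k where k: "K * (\<rho>1 / \<rho>) ^ k < 1" "1 \<le> k" by blast
  then have k': "K * \<rho>1 ^ k < \<rho> ^ k" using r1 by (simp add: power_divide field_simps)
  define d where "d = (\<rho> ^ k - K * \<rho>1 ^ k) / 2"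
  have d: "0 < d" "K * \<rho>1 ^ k + d < \<rho> ^ k" using k' by (auto simp: d_def field_simps)
  show "\<forall>\<^sub>F n in sequentially. l n < \<rho>"
    using iter_conv[OF bdd_const[of 1] d(1), of k]
  proof eventually_elim
    case (elim n)
    obtain J where J: "lip J ((Ln n ^^ k) (\<lambda>_. 1))"
      using r.lip_iter[OF order_refl lip_on_const[OF theta(1)], of k n "1::real"] by blast
    have "l n ^ k = (\<integral>\<omega>. (Ln n ^^ k) (\<lambda>_. 1) \<omega> \<partial>\<nu> n)" by (rule r.integral_iter_one[symmetric])
    also have "\<dots> \<le> (\<integral>\<omega>. K * \<rho>1 ^ k + d \<partial>\<nu> n)"
    proof (rule r.lip_integral_mono[OF J lip_on_const[OF theta(1)]])
      fix \<omega> assume w: "\<omega> \<in> X"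
      then show "(Ln n ^^ k) (\<lambda>_. 1) \<omega> \<le> K * \<rho>1 ^ k + d" using elim K(2)[OF w, of k] by fastforce
    qed
    also have "\<dots> < \<rho> ^ k" using d(2) by simp
    finally show ?case by (rule power_less_imp_less_base) (use r Lam_pos in linarith)
  qed
next
  fix \<rho> assume r: "\<rho> < \<Lambda>"
  show "\<forall>\<^sub>F n in sequentially. \<rho> < l n"
  proof (cases "0 < \<rho>")
    case False
    then have "\<rho> < l n" for n using r.l_pos[of n] by linarith
    then show ?thesis by simp
  next
    case True
    define \<rho>1 where "\<rho>1 = (\<rho> + \<Lambda>) / 2"
    have r1: "\<rho> < \<rho>1" "\<rho>1 < \<Lambda>" using r by (auto simp: \<rho>1_def)
    obtain Q where Q: "finite Q" "(\<Sum>\<^sub>\<infinity>a\<in>-Q. q a) \<le> \<rho>" using summable_tail[OF q_summable q_nonneg True] by blast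
    obtain x where x: "\<And>a. x a \<in> X \<and> x a 0 = a" using state_exists by metis
    have "\<rho>1 \<notin> growth A" using growth_below True r1 by auto
    moreover have "\<rho>1 \<in> growth A" if "\<And>a. \<exists>K. \<forall>k. (LA ^^ k) (state_ind a) (x a) \<le> K * \<rho> ^ k"
      by (rule growth_from_loops[OF True r1(1) Q x that])
    ultimately obtain a where a: "\<And>K. \<exists>k. \<not> (LA ^^ k) (state_ind a) (x a) \<le> K * \<rho> ^ k"
      by (metis (no_types, lifting))
    obtain k where k: "exp c0 * \<rho> ^ k < (LA ^^ k) (state_ind a) (x a)"
      using a[of "exp c0"] by (auto simp: not_le)
    have "\<forall>\<^sub>F n in sequentially. exp c0 * \<rho> ^ k < (Ln n ^^ k) (state_ind a) (x a)"
      using iter_conv_at[OF state_ind_bdd, of "x a" k a] x k by (intro order_tendstoD) auto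
    then show ?thesis
    proof eventually_elim
      case (elim n)
      have "(Ln n ^^ k) (state_ind a) (x a) \<le> exp c0 * l n ^ k"
        using r.loop_le[of "x a" a k n] x[of a] by (simp add: r.c0_def c0_def)
      with elim have "\<rho> ^ k < l n ^ k" by (meson exp_gt_zero less_le_trans mult_less_cancel_left_pos)
      then show ?case by (rule power_less_imp_less_base) (rule r.l_nonneg)
    qed
  qed
qed

lemma uniform_tightness:
  assumes "0 < d"
  shows "\<exists>Q. finite Q \<and> (\<forall>\<^sub>F n in sequentially. E n (r.outside Q) \<le> d)"
proof -
  \<comment> \<open>\<open>B\<close> bounds the logarithm in the moment estimate once
    \<open>l n\<close> exceeds half of \<Lambda>. The weight is chosen with
    \<open>ln t = B / d\<close>, and \<open>Q\<close> so large that the tilted sum is at most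
    \<open>qsum + 1\<close>. The maximum with 1 keeps \<open>t > 1\<close>.\<close>
  define B where "B = max 1 (ln ((qsum + 1) / (\<Lambda> / 2)))"
  define t where "t = exp (B / d)"
  have B: "0 < B" by (auto simp: B_def)
  have t: "1 < t" "ln t = B / d" using B assms by (auto simp: t_def)
  obtain Q where Q: "finite Q" "(\<Sum>\<^sub>\<infinity>a\<in>-Q. q a) \<le> 1 / t"
    using summable_tail[OF q_summable q_nonneg, of "1 / t"] t by auto
  have s1: "((\<lambda>a. q a * (if a \<in> Q then 1 else t)) has_sum sum q Q) Q"
    using Q(1) by (subst has_sum_cong[where g = q]) (auto intro: has_sum_finite)
  have s2: "((\<lambda>a. q a * (if a \<in> Q then 1 else t)) has_sum (\<Sum>\<^sub>\<infinity>a\<in>-Q. q a) * t) (-Q)"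
    by (subst has_sum_cong[where g = "\<lambda>a. q a * t"])
      (auto intro!: has_sum_cmult_left has_sum_infsum summable_on_subset_banach[OF q_summable])
  have s: "((\<lambda>a. q a * (if a \<in> Q then 1 else t)) has_sum (sum q Q + (\<Sum>\<^sub>\<infinity>a\<in>-Q. q a) * t)) UNIV"
    using has_sum_Un_disjoint[OF s1 s2] by simp
  have "sum q Q \<le> qsum" unfolding qsum_def
    using Q q_nonneg q_summable by (intro finite_sum_le_infsum) auto
  moreover have "(\<Sum>\<^sub>\<infinity>a\<in>-Q. q a) * t \<le> 1" using Q(2) t by (simp add: field_simps)
  ultimately have D: "(\<Sum>\<^sub>\<infinity>a. q a * (if a \<in> Q then 1 else t)) \<le> qsum + 1"
    using infsumI[OF s] by simp
  have "\<forall>\<^sub>F n in sequentially. \<Lambda> / 2 < l n" using eigenvalue_tendsto Lam_pos by (intro order_tendstoD) auto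
  then have "\<forall>\<^sub>F n in sequentially. E n (r.outside Q) \<le> d"
  proof eventually_elim
    case (elim n)
    have "E n (r.outside Q) * ln t \<le> ln ((qsum + 1) / l n)"
      by (rule r.tightness[OF t(1) has_sum_imp_summable[OF s] D])
    also have "\<dots> \<le> ln ((qsum + 1) / (\<Lambda> / 2))"
    proof (subst ln_le_cancel_iff)
      show "(qsum + 1) / l n \<le> (qsum + 1) / (\<Lambda> / 2)"
        using elim Lam_pos qsum_nonneg r.l_pos[of n] by (intro divide_left_mono mult_pos_pos) linarith+
    qed (use Lam_pos qsum_nonneg r.l_pos[of n] in auto)
    also have "\<dots> \<le> B" by (simp add: B_def)
    finally show ?case using B assms by (simp add: t(2) field_simps)
  qed
  then show ?thesis using Q(1) by blast
qed

text \<open>Only the finitely many return times \<open>i * s\<close> with \<open>i \<le> N\<close>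
  matter, and at these the perturbed return weights are eventually as small as those of the limit.
  The second order bound then gives mass at most \<open>2 / N\<close>; the choice of
  \<open>d\<close> balances its two terms.\<close>

lemma cylinder_mass_tendsto_0:
  assumes y: "y \<in> X" and k: "1 \<le> k" and lim: "(\<lambda>j. (LA ^^ j) (ind k y) y / \<Lambda> ^ j) \<longlonglongrightarrow> 0"
  shows "(\<lambda>n. E n (ind k y)) \<longlonglongrightarrow> 0"
proof (rule tendstoI)
  fix e :: real assume e: "0 < e"
  obtain N where N: "2 / e < real N" "1 \<le> N" using reals_Archimedean2[of "2 / e"] e
    by (metis One_nat_def Suc_leI divide_pos_pos of_nat_0_less_iff order_less_trans zero_less_numeral)
  define d where "d = 1 / (real N * real N)"
  have d: "0 < d" using N by (simp add: d_def)
  have "(\<lambda>j. exp (3 * c0) * ((LA ^^ j) (ind k y) y / \<Lambda> ^ j)) \<longlonglongrightarrow> exp (3 * c0) * 0"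
    by (intro tendsto_mult tendsto_const lim)
  then have "\<forall>\<^sub>F j in sequentially. exp (3 * c0) * ((LA ^^ j) (ind k y) y / \<Lambda> ^ j) < d"
    using d by (intro order_tendstoD) auto
  then obtain s0 where s0: "\<And>j. s0 \<le> j \<Longrightarrow> exp (3 * c0) * ((LA ^^ j) (ind k y) y / \<Lambda> ^ j) < d"
    by (auto simp: eventually_sequentially)
  define s where "s = max s0 k"
  have s: "1 \<le> s" "k \<le> s" "s0 \<le> s" using k by (auto simp: s_def)
  have "\<forall>\<^sub>F n in sequentially. exp (3 * c0) * ((Ln n ^^ (i * s)) (ind k y) y / l n ^ (i * s)) < d"
    if "i \<in> {1..N}" for i
  proof -
    have "s0 \<le> i * s" using that s(3) mult_le_mono[of 1 i s0 s] by simp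
    then have "exp (3 * c0) * ((LA ^^ (i * s)) (ind k y) y / \<Lambda> ^ (i * s)) < d" by (rule s0)
    moreover have "(\<lambda>n. exp (3 * c0) * ((Ln n ^^ (i * s)) (ind k y) y / l n ^ (i * s)))
       \<longlonglongrightarrow> exp (3 * c0) * ((LA ^^ (i * s)) (ind k y) y / \<Lambda> ^ (i * s))"
      using Lam_pos by (intro tendsto_intros iter_conv_at ind_bdd y eigenvalue_tendsto) auto
    ultimately show ?thesis by (intro order_tendstoD)
  qed
  then have "\<forall>\<^sub>F n in sequentially. \<forall>i\<in>{1..N}. exp (3 * c0) * ((Ln n ^^ (i * s)) (ind k y) y / l n ^ (i * s)) < d"
    by (intro eventually_ball_finite) auto
  then show "\<forall>\<^sub>F n in sequentially. dist (E n (ind k y)) 0 < e"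
  proof eventually_elim
    case (elim n)
    have "real N * E n (ind k y) \<le> 1 + real N * (real N * d)"
    proof (rule r.union_bound[OF s(1) less_imp_le[OF d]])
      fix i assume i: "1 \<le> i" "i \<le> N"
      have "k \<le> i * s" using i s(2) mult_le_mono[of 1 i k s] by simp
      from r.return_bound[OF y k this, of n] elim i
      show "E n (\<lambda>\<omega>. ind k y \<omega> * ind k y ((shift ^^ (i * s)) \<omega>)) \<le> d"
        by (force simp: r.c0_def c0_def)
    qed
    also have "\<dots> = 2" using N by (simp add: d_def)
    finally have "E n (ind k y) \<le> 2 / real N" using N by (simp add: field_simps)
    also have "\<dots> < e" using N e by (simp add: field_simps)
    finally have "E n (ind k y) < e" .
    moreover have "0 \<le> E n (ind k y)"
      using r.E_mono[OF lip_on_const[OF theta(1)] r.ind_lip, of 0 k y n] ind_range(1)[of k y] by simp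
    ultimately show ?case by simp
  qed
qed

end

section \<open>Convergence of eigenfunctions and Cesaro means\<close>

lemma subsequence_principle:
  fixes X :: "nat \<Rightarrow> real"
  assumes "\<And>r. strict_mono (r :: nat \<Rightarrow> nat) \<Longrightarrow> \<exists>s. strict_mono (s :: nat \<Rightarrow> nat) \<and> (\<lambda>n. X (r (s n))) \<longlonglongrightarrow> L"
  shows "X \<longlonglongrightarrow> L"
proof (rule ccontr)
  assume "\<not> X \<longlonglongrightarrow> L"
  then obtain e where e: "0 < e" "\<not> (\<forall>\<^sub>F n in sequentially. dist (X n) L < e)" by (auto simp: tendsto_iff)
  have "infinite {n. \<not> dist (X n) L < e}"
  proof
    assume "finite {n. \<not> dist (X n) L < e}"
    then have "\<forall>\<^sub>F n in cofinite. dist (X n) L < e" by (simp add: eventually_cofinite)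
    then show False using e(2) by (simp add: cofinite_eq_sequentially)
  qed
  then obtain r where r: "strict_mono (r :: nat \<Rightarrow> nat)" "\<And>n. \<not> dist (X (r n)) L < e"
    using infinite_enumerate by blast
  obtain s where "(\<lambda>n. X (r (s n))) \<longlonglongrightarrow> L" using assms[OF r(1)] by blast
  then have "\<forall>\<^sub>F n in sequentially. dist (X (r (s n))) L < e" using e(1) by (rule tendstoD)
  then show False using r(2) by simp
qed

lemma diagonal_convergent:
  fixes F :: "nat \<Rightarrow> 'i::countable \<Rightarrow> real"
  assumes "\<And>i. Bseq (\<lambda>n. F n i)"
  shows "\<exists>r. strict_mono (r :: nat \<Rightarrow> nat) \<and> (\<forall>i. convergent (\<lambda>n. F (r n) i))"
proof -
  define P where "P k s = convergent (\<lambda>n. F (s n) (from_nat k))" for k and s :: "nat \<Rightarrow> nat"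
  interpret subseqs P
  proof
    fix k and s :: "nat \<Rightarrow> nat" assume "strict_mono s"
    have "bounded (range (\<lambda>n. F (s n) (from_nat k)))"
      using Bseq_subseq[OF assms[of "from_nat k"], of s] by (simp add: Bseq_eq_bounded)
    then obtain l r where "strict_mono (r :: nat \<Rightarrow> nat)" "((\<lambda>n. F (s n) (from_nat k)) \<circ> r) \<longlonglongrightarrow> l"
      using bounded_imp_convergent_subsequence by blast
    then show "\<exists>r'. strict_mono r' \<and> P k (s \<circ> r')"
      by (intro exI[of _ r]) (auto simp: P_def convergent_def o_def)
  qed
  have "P k (diagseq \<circ> (+) (Suc k))" for k
  proof (rule diagseq_holds)
    fix r s :: "nat \<Rightarrow> nat" and n assume "strict_mono r" "P n s"
    then show "P n (s \<circ> r)"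
      using convergent_subseq_convergent[of "\<lambda>k. F (s k) (from_nat n)" r] by (simp add: P_def o_def)
  qed
  moreover have "diagseq \<circ> (+) (Suc k) = (\<lambda>n. diagseq (n + Suc k))" for k
    by (auto simp: fun_eq_iff add.commute)
  ultimately have "convergent (\<lambda>n. F (diagseq (n + Suc k)) (from_nat k))" for k
    unfolding P_def by metis
  then have "convergent (\<lambda>n. F (diagseq n) (from_nat k))" for k
    by (rule convergent_ignore_initial_segment[THEN iffD1])
  then have "convergent (\<lambda>n. F (diagseq n) i)" for i using from_nat_to_nat[of i] by metis
  then show ?thesis using subseq_diagseq by blast
qed

text \<open>Averages are taken because a component may be periodic, in which case the normalised
  iterates need not converge.\<close>

definition cesaro ::
  "('s \<Rightarrow> 's \<Rightarrow> bool) \<Rightarrow> ((nat \<Rightarrow> 's) \<Rightarrow> real) \<Rightarrow> real \<Rightarrow> ((nat \<Rightarrow> 's) \<Rightarrow> real) \<Rightarrow> nat \<Rightarrow> (nat \<Rightarrow> 's) \<Rightarrow> real" where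
  "cesaro M p l w N \<omega> = (\<Sum>j\<le>N. (transfer M p ^^ j) w \<omega> / l ^ j) / real (Suc N)"

context potential
begin

lemma exp_theta_tendsto: "(\<lambda>k. exp (c * \<theta> ^ k) - 1) \<longlonglongrightarrow> 0"
proof -
  have "(\<lambda>k. exp (c * \<theta> ^ k) - 1) \<longlonglongrightarrow> exp (c * 0) - 1"
    using theta by (intro tendsto_intros LIMSEQ_power_zero) auto
  then show ?thesis by simp
qed

lemma exists_small:
  assumes "0 < d" shows "\<exists>k\<ge>1. exp (c * \<theta> ^ k) - 1 < d"
proof -
  have "\<forall>\<^sub>F k in sequentially. exp (c * \<theta> ^ k) - 1 < d"
    using exp_theta_tendsto assms by (rule order_tendstoD)
  then have "\<exists>k. exp (c * \<theta> ^ k) - 1 < d \<and> 1 \<le> k"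
    by (intro eventually_happens'[OF sequentially_bot] eventually_conj eventually_ge_at_top)
  then show ?thesis by blast
qed

lemma cone_diff_le:
  assumes "cone 1 c F" "0 \<le> c" "1 \<le> k" "\<omega> \<in> X" "\<upsilon> \<in> X" "agree k \<omega> \<upsilon>" "F \<omega> \<le> B"
  shows "\<bar>F \<omega> - F \<upsilon>\<bar> \<le> (exp (c * \<theta> ^ k) - 1) * (exp c * B)"
proof -
  have 0: "0 \<le> F \<omega>" "0 \<le> F \<upsilon>" using assms cone_nonneg by blast+
  have e: "0 \<le> exp (c * \<theta> ^ k) - 1" using assms(2) theta by simp
  have "1 \<le> exp c" using assms(2) by simp
  then have B: "B \<le> exp c * B" using 0 assms(7) by (simp add: mult_le_cancel_right1)
  have u: "F \<upsilon> \<le> exp c * B"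
  proof -
    have "F \<upsilon> \<le> exp c * F \<omega>"
      using agree_zeroth[OF assms(6,3)] by (intro cone_le'[OF assms(1,2,5,4)]) simp
    also have "\<dots> \<le> exp c * B" using assms(7) by simp
    finally show ?thesis .
  qed
  have "F \<omega> - F \<upsilon> \<le> (exp (c * \<theta> ^ k) - 1) * F \<upsilon>"
    using cone_le[OF assms(1,3-6)] by (simp add: algebra_simps)
  also have "\<dots> \<le> (exp (c * \<theta> ^ k) - 1) * (exp c * B)" using e u by (rule mult_left_mono[rotated])
  finally have 1: "F \<omega> - F \<upsilon> \<le> (exp (c * \<theta> ^ k) - 1) * (exp c * B)" .
  have "F \<upsilon> - F \<omega> \<le> (exp (c * \<theta> ^ k) - 1) * F \<omega>"
    using cone_le[OF assms(1,3,5,4) agree_sym[OF assms(6)]] by (simp add: algebra_simps)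
  also have "\<dots> \<le> (exp (c * \<theta> ^ k) - 1) * (exp c * B)" using e B assms(7) by (intro mult_left_mono) auto
  finally show ?thesis using 1 by (simp add: abs_le_iff)
qed

text \<open>One sample point for each finite word, hence countably many, and dense in
  \<open>X\<close>; for a word without a point the value is arbitrary.\<close>

definition point :: "'s list \<Rightarrow> nat \<Rightarrow> 's" where
  "point w = (SOME \<omega>. \<omega> \<in> X \<and> agree (length w) \<omega> ((!) w))"

lemma point_prefix:
  assumes "\<omega> \<in> X"
  shows "point (map \<omega> [0..<k]) \<in> X" "agree k \<omega> (point (map \<omega> [0..<k]))"
proof -
  have *: "agree (length (map \<omega> [0..<k])) \<omega> ((!) (map \<omega> [0..<k]))" by (simp add: agree_def)
  have "point (map \<omega> [0..<k]) \<in> X \<and>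
     agree (length (map \<omega> [0..<k])) (point (map \<omega> [0..<k])) ((!) (map \<omega> [0..<k]))"
    unfolding point_def
    by (rule someI[where P = "\<lambda>\<upsilon>. \<upsilon> \<in> X \<and> agree (length (map \<omega> [0..<k])) \<upsilon> ((!) (map \<omega> [0..<k]))"
          and x = \<omega>]) (intro conjI assms *)
  with * show "point (map \<omega> [0..<k]) \<in> X" "agree k \<omega> (point (map \<omega> [0..<k]))"
    by (auto simp: agree_def)
qed

text \<open>Arzela-Ascoli for the cone: a diagonal sequence converges at the sample points, and
  bounded distortion carries convergence to every point. Boundedness at each single point is enough,
  since distortion compares with the value at that point.\<close>

lemma cone_subsequence:
  assumes cone: "\<And>n. cone 1 c (F n)" and c: "0 \<le> c" and B: "\<And>\<omega>. \<omega> \<in> X \<Longrightarrow> Bseq (\<lambda>n. F n \<omega>)"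
  shows "\<exists>s G. strict_mono (s :: nat \<Rightarrow> nat) \<and> cone 1 c G \<and> (\<forall>\<omega>\<in>X. (\<lambda>n. F (s n) \<omega>) \<longlonglongrightarrow> G \<omega>)"
proof -
  define H where "H n w = (if point w \<in> X then F n (point w) else 0)" for n w
  have "Bseq (\<lambda>n. H n w)" for w
    using B[of "point w"] by (cases "point w \<in> X") (simp_all add: H_def)
  then obtain s where s: "strict_mono (s :: nat \<Rightarrow> nat)" "\<And>w. convergent (\<lambda>n. H (s n) w)"
    using diagonal_convergent[of H] by blast
  have conv: "convergent (\<lambda>n. F (s n) \<omega>)" if w: "\<omega> \<in> X" for \<omega>
  proof -
    obtain b where b: "0 < b" "\<And>n. norm (F n \<omega>) \<le> b" using B[OF w] by (auto simp: Bseq_def)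
    have "Cauchy (\<lambda>n. F (s n) \<omega>)"
    proof (rule metric_CauchyI)
      fix e :: real assume e: "0 < e"
      have "0 < e / (4 * (exp c * b))" using e b by simp
      then obtain k where k: "1 \<le> k" "exp (c * \<theta> ^ k) - 1 < e / (4 * (exp c * b))" using exists_small by blast
      let ?z = "point (map \<omega> [0..<k])"
      note z = point_prefix[OF w, of k]
      have near: "\<bar>F n \<omega> - F n ?z\<bar> \<le> e / 4" for n
      proof -
        have "\<bar>F n \<omega> - F n ?z\<bar> \<le> (exp (c * \<theta> ^ k) - 1) * (exp c * b)"
          using b(2)[of n] by (intro cone_diff_le[OF cone c k(1) w z]) auto
        also have "\<dots> \<le> e / (4 * (exp c * b)) * (exp c * b)"
          using k b by (intro mult_right_mono) auto
        also have "\<dots> = e / 4" using b by (simp add: field_simps)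
        finally show ?thesis .
      qed
      have "Cauchy (\<lambda>n. F (s n) ?z)"
        using s(2)[of "map \<omega> [0..<k]"] z(1) by (simp add: H_def convergent_Cauchy)
      then obtain N where N: "\<And>m n. N \<le> m \<Longrightarrow> N \<le> n \<Longrightarrow> dist (F (s m) ?z) (F (s n) ?z) < e / 2"
        using e by (meson half_gt_zero metric_CauchyD)
      show "\<exists>N. \<forall>m\<ge>N. \<forall>n\<ge>N. dist (F (s m) \<omega>) (F (s n) \<omega>) < e"
      proof (intro exI allI impI)
        fix m n assume "N \<le> m" "N \<le> n"
        from N[OF this] near[of "s m"] near[of "s n"] show "dist (F (s m) \<omega>) (F (s n) \<omega>) < e"
          unfolding dist_real_def by linarith
      qed
    qed
    then show ?thesis by (rule Cauchy_convergent)
  qed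
  define G where "G \<omega> = lim (\<lambda>n. F (s n) \<omega>)" for \<omega>
  have G: "(\<lambda>n. F (s n) \<omega>) \<longlonglongrightarrow> G \<omega>" if "\<omega> \<in> X" for \<omega>
    unfolding G_def using conv[OF that] by (simp add: convergent_LIMSEQ_iff)
  have "cone 1 c G"
    unfolding cone_on_def
  proof safe
    fix \<omega> assume w: "\<omega> \<in> X"
    show "0 \<le> G \<omega>" by (rule LIMSEQ_le_const[OF G[OF w]]) (use cone_nonneg[OF cone w] in auto)
  next
    fix k \<omega> \<upsilon> assume *: "1 \<le> k" "\<omega> \<in> X" "\<upsilon> \<in> X" "agree k \<omega> \<upsilon>"
    show "G \<omega> \<le> exp (c * \<theta> ^ k) * G \<upsilon>"
      by (rule LIMSEQ_le[OF G[OF *(2)] tendsto_mult[OF tendsto_const G[OF *(3)]]])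
        (use cone_le[OF cone *] in auto)
  qed
  then show ?thesis using s(1) G by blast
qed

end

context rpf
begin

context
  fixes f :: "(nat \<Rightarrow> 's) \<Rightarrow> real" and K :: real
  assumes f_cone: "cone 1 1 f" and f_le: "\<And>\<omega>. \<omega> \<in> X \<Longrightarrow> f \<omega> \<le> K"
begin

abbreviation "hf \<equiv> (\<lambda>\<omega>. h \<omega> * f \<omega>)"
abbreviation "ces \<equiv> cesaro M p l hf"

lemma hf_cone: "cone 1 (c0 + 1) hf"
  by (rule cone_mult[OF h_cone f_cone])

lemma hf_le: "\<omega> \<in> X \<Longrightarrow> hf \<omega> \<le> K * h \<omega>"
  using f_le h_nonneg by (simp add: mult.commute mult_right_mono)

lemma hf_bdd: "bdd hf"
  by (rule bdd_le[OF bdd_cmult[OF h_bdd, of K]]) (use hf_le cone_nonneg[OF hf_cone] in auto)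

lemma hf_lip: "\<exists>J. lip J hf"
  using c0_nonneg by (intro cone_bdd_lip[OF hf_cone _ hf_bdd]) simp

lemma iter_hf_cone: "cone 1 (c0 + 1) ((L ^^ j) hf)"
  by (rule cone_iter_1[OF M_le hf_bdd _ hf_cone]) simp

lemma iter_hf_le: "\<omega> \<in> X \<Longrightarrow> (L ^^ j) hf \<omega> \<le> K * (l ^ j * h \<omega>)"
proof -
  assume w: "\<omega> \<in> X"
  have "(L ^^ j) (\<lambda>\<omega>. h \<omega> * f \<omega>) \<omega> \<le> (L ^^ j) (\<lambda>\<omega>. K * h \<omega>) \<omega>"
    by (rule iter_mono[OF M_le hf_bdd bdd_cmult[OF h_bdd] hf_le w])
  also have "\<dots> = K * (l ^ j * h \<omega>)" by (simp add: iter_cmult h_iter[OF w])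
  finally show ?thesis .
qed

lemma cesaro_cone: "cone 1 (c0 + 1) (ces N)"
proof -
  have "cone 1 (c0 + 1) (\<lambda>\<omega>. (1 / real (Suc N)) * (\<Sum>j\<le>N. (1 / l ^ j) * (L ^^ j) hf \<omega>))"
    using c0_nonneg l_pos by (intro cone_cmult cone_sum iter_hf_cone) auto
  then show ?thesis by (simp add: cesaro_def[abs_def])
qed

lemma cesaro_le: assumes "\<omega> \<in> X" shows "ces N \<omega> \<le> K * h \<omega>"
proof -
  have "(\<Sum>j\<le>N. (L ^^ j) hf \<omega> / l ^ j) \<le> (\<Sum>j\<le>N. K * h \<omega>)"
    using iter_hf_le[OF assms] l_pos by (intro sum_mono) (simp add: pos_divide_le_eq mult_ac)
  then show ?thesis by (simp add: cesaro_def pos_divide_le_eq mult.commute)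
qed

lemma cesaro_lip: "\<exists>J. lip J (ces N)"
proof (rule cone_bdd_lip[OF cesaro_cone])
  show "bdd (ces N)"
    by (rule bdd_le[OF bdd_cmult[OF h_bdd, of K]]) (use cesaro_le cone_nonneg[OF cesaro_cone] in auto)
qed (use c0_nonneg in auto)

lemma cesaro_integral: "(\<integral>\<omega>. ces N \<omega> \<partial>\<nu>) = E f"
proof -
  obtain J where J: "lip J hf" using hf_lip by blast
  have int: "integrable \<nu> ((L ^^ j) hf)" for j using lip_iter[OF M_le J] lip_integrable by blast
  have "(\<integral>\<omega>. ces N \<omega> \<partial>\<nu>) = (\<Sum>j\<le>N. (\<integral>\<omega>. (L ^^ j) hf \<omega> \<partial>\<nu>) / l ^ j) / real (Suc N)"
    unfolding cesaro_def using int by (simp add: Bochner_Integration.integral_sum)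
  also have "\<dots> = (\<Sum>j\<le>N. E f) / real (Suc N)"
    using l_pos by (simp add: dual_iter[OF J])
  finally show ?thesis by (simp del: of_nat_Suc)
qed

text \<open>Applying \<open>L / l\<close> shifts the average by one index; only the two boundary
  terms differ, and the new one is at most \<open>K * h\<close>. So the means are superharmonic up
  to an error of order 1/N.\<close>

lemma transfer_cesaro:
  assumes "\<omega> \<in> X"
  shows "L (ces N) \<omega> \<le> l * ces N \<omega> + l * K * h \<omega> / real (Suc N)"
proof -
  have b: "bdd ((L ^^ j) hf)" for j by (rule iter_bdd[OF M_le hf_bdd])
  have lin: "bdd (\<lambda>\<omega>. \<Sum>j\<in>I. c j * (L ^^ j) hf \<omega>) \<and>
     L (\<lambda>\<omega>. \<Sum>j\<in>I. c j * (L ^^ j) hf \<omega>) \<omega> = (\<Sum>j\<in>I. c j * (L ^^ Suc j) hf \<omega>)" if "finite I" for I c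
    using that
  proof (induction I rule: finite_induct)
    case empty then show ?case by (simp add: transfer_def)
  next
    case (insert i I)
    then show ?case
      by (simp add: bdd_add bdd_cmult b transfer_add[OF M_le bdd_cmult[OF b] _ assms] transfer_cmult)
  qed
  have ces_eq: "ces N = (\<lambda>\<omega>. \<Sum>j\<in>{..N}. (1 / l ^ j / real (Suc N)) * (L ^^ j) hf \<omega>)"
    by (simp add: cesaro_def sum_divide_distrib fun_eq_iff)
  have "L (ces N) \<omega> = (\<Sum>j\<le>N. (1 / l ^ j / real (Suc N)) * (L ^^ Suc j) hf \<omega>)"
    unfolding ces_eq using lin[of "{..N}" "\<lambda>j. 1 / l ^ j / real (Suc N)"] by blast
  also have "\<dots> = l / real (Suc N) * (\<Sum>j\<le>N. (L ^^ Suc j) hf \<omega> / l ^ Suc j)"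
    using l_pos by (simp add: sum_distrib_left field_simps del: of_nat_Suc)
  also have "(\<Sum>j\<le>N. (L ^^ Suc j) hf \<omega> / l ^ Suc j) = (\<Sum>j\<le>Suc N. (L ^^ j) hf \<omega> / l ^ j) - hf \<omega>"
    by (subst sum.atMost_Suc_shift) simp
  also have "\<dots> \<le> (\<Sum>j\<le>N. (L ^^ j) hf \<omega> / l ^ j) + K * h \<omega>"
  proof -
    have "(L ^^ Suc N) hf \<omega> / l ^ Suc N \<le> K * h \<omega>"
      using iter_hf_le[OF assms, of "Suc N"] l_pos
      by (simp add: pos_divide_le_eq mult_ac del: funpow.simps power_Suc)
    then show ?thesis using cone_nonneg[OF hf_cone assms] by (simp only: sum.atMost_Suc)
  qed
  finally have "L (ces N) \<omega> \<le> l / real (Suc N) * ((\<Sum>j\<le>N. (L ^^ j) hf \<omega> / l ^ j) + K * h \<omega>)"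
    using l_pos by (simp add: mult_left_mono divide_right_mono del: of_nat_Suc)
  then show ?thesis using l_pos by (simp add: cesaro_def distrib_left add_divide_distrib del: of_nat_Suc)
qed

text \<open>Every subsequence has a limit point in the cone, which is superharmonic and hence equals
  \<open>t * h\<close> on \<open>XM\<close>. Domination by \<open>K * h\<close> preserves the
  integral, which identifies \<open>t\<close>.\<close>

lemma cesaro_tendsto:
  assumes "\<omega>1 \<in> XM"
  shows "(\<lambda>N. ces N \<omega>1) \<longlonglongrightarrow> E f * h \<omega>1"
proof (rule subsequence_principle)
  fix r :: "nat \<Rightarrow> nat" assume r: "strict_mono r"
  have "\<exists>s G. strict_mono (s :: nat \<Rightarrow> nat) \<and> cone 1 (c0 + 1) G \<and> (\<forall>\<omega>\<in>X. (\<lambda>n. ces (r (s n)) \<omega>) \<longlonglongrightarrow> G \<omega>)"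
  proof (rule cone_subsequence)
    fix \<omega> assume w: "\<omega> \<in> X"
    show "Bseq (\<lambda>n. ces (r n) \<omega>)"
      by (rule BseqI'[of _ "K * h \<omega>"]) (use cesaro_le[OF w] cone_nonneg[OF cesaro_cone w] in auto)
  qed (use cesaro_cone c0_nonneg in auto)
  then obtain s G where s: "strict_mono (s :: nat \<Rightarrow> nat)" and Gc: "cone 1 (c0 + 1) G"
    and G: "\<And>\<omega>. \<omega> \<in> X \<Longrightarrow> (\<lambda>n. ces (r (s n)) \<omega>) \<longlonglongrightarrow> G \<omega>" by blast
  have rs: "strict_mono (\<lambda>n. r (s n))" using r s by (auto simp: strict_mono_def)
  have "\<exists>t\<ge>0. \<forall>\<omega>\<in>XM. G \<omega> = t * h \<omega>"
  proof (rule superharmonic_proportional[OF Gc])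
    fix \<omega> T assume w: "\<omega> \<in> X" and T: "finite T" "\<And>a. a \<in> T \<Longrightarrow> M a (\<omega> 0)"
    have X: "case_nat a \<omega> \<in> X" if "a \<in> T" for a by (rule Cons_in_X[OF M_le w T(2)[OF that]])
    show "(\<Sum>a\<in>T. p (case_nat a \<omega>) * G (case_nat a \<omega>)) \<le> l * G \<omega>"
    proof (rule LIMSEQ_le)
      show "(\<lambda>n. \<Sum>a\<in>T. p (case_nat a \<omega>) * ces (r (s n)) (case_nat a \<omega>)) \<longlonglongrightarrow>
          (\<Sum>a\<in>T. p (case_nat a \<omega>) * G (case_nat a \<omega>))"
        using X by (intro tendsto_intros G)
      have "(\<lambda>N. l * K * h \<omega> / real (Suc N)) \<longlonglongrightarrow> 0"
        by (rule LIMSEQ_Suc[OF lim_const_over_n])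
      from LIMSEQ_subseq_LIMSEQ[OF this rs]
      have "(\<lambda>n. l * K * h \<omega> / real (Suc (r (s n)))) \<longlonglongrightarrow> 0" by (simp add: o_def)
      then have "(\<lambda>n. l * ces (r (s n)) \<omega> + l * K * h \<omega> / real (Suc (r (s n)))) \<longlonglongrightarrow> l * G \<omega> + 0"
        by (intro tendsto_intros G w)
      then show "(\<lambda>n. l * ces (r (s n)) \<omega> + l * K * h \<omega> / real (Suc (r (s n)))) \<longlonglongrightarrow> l * G \<omega>" by simp
      have "(\<Sum>a\<in>T. p (case_nat a \<omega>) * ces N (case_nat a \<omega>)) \<le> l * ces N \<omega> + l * K * h \<omega> / real (Suc N)" for N
      proof -
        obtain J where "lip J (ces N)" using cesaro_lip by blast
        then have "(\<Sum>a\<in>T. p (case_nat a \<omega>) * ces N (case_nat a \<omega>)) \<le> L (ces N) \<omega>"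
          using cone_nonneg[OF cesaro_cone] by (intro transfer_sum_le[OF M_le lip_bdd _ w T]) auto
        then show ?thesis using transfer_cesaro[OF w, of N] by linarith
      qed
      then show "\<exists>N. \<forall>n\<ge>N. (\<Sum>a\<in>T. p (case_nat a \<omega>) * ces (r (s n)) (case_nat a \<omega>))
          \<le> l * ces (r (s n)) \<omega> + l * K * h \<omega> / real (Suc (r (s n)))" by blast
    qed
  qed simp
  then obtain t where t: "\<And>\<omega>. \<omega> \<in> XM \<Longrightarrow> G \<omega> = t * h \<omega>" by blast
  have Gb: "bdd G"
  proof (rule bdd_le[OF bdd_cmult[OF h_bdd, of K]])
    fix \<omega> assume w: "\<omega> \<in> X"
    have "G \<omega> \<le> K * h \<omega>" by (rule LIMSEQ_le_const2[OF G[OF w]]) (use cesaro_le[OF w] in auto)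
    then show "\<bar>G \<omega>\<bar> \<le> K * h \<omega>" using cone_nonneg[OF Gc w] by simp
  qed
  obtain J where J: "lip J G" using cone_bdd_lip[OF Gc _ Gb] c0_nonneg by auto
  have "(\<lambda>n. \<integral>\<omega>. ces (r (s n)) \<omega> \<partial>\<nu>) \<longlonglongrightarrow> (\<integral>\<omega>. G \<omega> \<partial>\<nu>)"
  proof (rule integral_dominated_convergence)
    show "G \<in> borel_measurable \<nu>" by (rule lip_measurable[OF J])
    show "ces (r (s n)) \<in> borel_measurable \<nu>" for n using cesaro_lip lip_measurable by blast
    show "integrable \<nu> (\<lambda>\<omega>. K * h \<omega>)" using h_lip lip_integrable by simp blast
    show "AE \<omega> in \<nu>. (\<lambda>n. ces (r (s n)) \<omega>) \<longlonglongrightarrow> G \<omega>" by (rule AE_I2) (simp add: space_nu G)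
    show "AE \<omega> in \<nu>. norm (ces (r (s n)) \<omega>) \<le> K * h \<omega>" for n
      by (rule AE_I2) (use cesaro_le cone_nonneg[OF cesaro_cone] in \<open>simp add: space_nu\<close>)
  qed
  then have "(\<integral>\<omega>. G \<omega> \<partial>\<nu>) = E f" by (simp add: cesaro_integral LIMSEQ_const_iff)
  moreover have "(\<integral>\<omega>. G \<omega> \<partial>\<nu>) = (\<integral>\<omega>. t * h \<omega> \<partial>\<nu>)"
  proof (rule integral_cong_AE)
    show "AE \<omega> in \<nu>. G \<omega> = t * h \<omega>" using nu_supp by eventually_elim (rule t)
    show "(\<lambda>\<omega>. t * h \<omega>) \<in> borel_measurable \<nu>" using h_lip lip_measurable by auto
  qed (rule lip_measurable[OF J])
  ultimately have "t = E f" using nu_h by simp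
  then show "\<exists>s. strict_mono s \<and> (\<lambda>n. ces (r (s n)) \<omega>1) \<longlonglongrightarrow> E f * h \<omega>1"
    using s G[OF XM_X[OF assms]] t[OF assms] by (intro exI[of _ s]) auto
qed

end

end

locale perturbation_class = perturbation \<theta> A p C q pn h \<nu> l \<Lambda> + u: rpf \<theta> A p C q M g \<kappa> \<Lambda> U
  for \<theta> and A :: "'s::{countable,discrete_topology} \<Rightarrow> 's \<Rightarrow> bool" and p C q pn h \<nu> l \<Lambda> M g \<kappa> U
begin

section \<open>Perturbed eigenfunctions over a component of maximal rate\<close>

abbreviation LU where "LU \<equiv> transfer M p"
abbreviation XU where "XU \<equiv> shift_space M"

lemma pn_tendsto: "\<omega> \<in> X \<Longrightarrow> (\<lambda>n. pn n \<omega>) \<longlonglongrightarrow> p \<omega>"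
proof -
  assume w: "\<omega> \<in> X"
  obtain s where s: "s \<longlonglongrightarrow> 0" "\<And>n. \<bar>pn n \<omega> - p \<omega>\<bar> \<le> s n" using pn_conv[of "\<omega> 0"] w by blast
  have "(\<lambda>n. pn n \<omega> - p \<omega>) \<longlonglongrightarrow> 0"
    by (rule Lim_null_comparison[OF _ s(1)]) (use s(2) in auto)
  then show ?thesis by (simp add: LIM_zero_iff)
qed

text \<open>A chain of comparisons along edges of \<open>M\<close>: one preimage term of the
  eigenvalue equation bounds \<open>h n\<close> over \<open>b\<close> by its value one step further.
  Eventually \<open>pn n\<close> exceeds half of \<open>p\<close> and \<open>l n\<close> is below
  twice \<Lambda>, whence the factor 4.\<close>

lemma h_eventually_le:
  assumes x0: "x0 \<in> X" "x0 0 \<in> U" and b: "b \<in> U"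
  shows "\<exists>K. \<forall>\<^sub>F n in sequentially. \<forall>\<omega>\<in>X. \<omega> 0 = b \<longrightarrow> h n \<omega> \<le> K * h n x0"
  using u.irr[OF b x0(2)]
proof (induction rule: converse_rtranclp_induct)
  case base
  have "h n \<omega> \<le> exp c0 * h n x0" if "\<omega> \<in> X" "\<omega> 0 = x0 0" for n \<omega>
    by (rule cone_le'[OF r.h_cone c0_nonneg that(1) x0(1) that(2)])
  then show ?case by (intro exI[of _ "exp c0"] always_eventually) auto
next
  case (step b d)
  obtain K where K: "\<forall>\<^sub>F n in sequentially. \<forall>\<omega>\<in>X. \<omega> 0 = d \<longrightarrow> h n \<omega> \<le> K * h n x0" using step.IH by blast
  have dU: "d \<in> U" using u.M_U step.hyps by blast
  obtain z where z: "z \<in> XU" "z 0 = d" using u.state_in_XM[OF dU] by blast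
  have zX: "z \<in> X" by (rule u.XM_X[OF z(1)])
  have bd: "A b (z 0)" "M b (z 0)" using step.hyps z u.M_le by (auto simp: le_fun_def)
  let ?y = "case_nat b z"
  have yX: "?y \<in> X" by (rule Cons_in_shift_space[of z A b, OF zX bd(1)])
  have py: "0 < p ?y" using u.p_pos[OF yX] bd by simp
  have e1: "\<forall>\<^sub>F n in sequentially. p ?y / 2 < pn n ?y"
    using pn_tendsto[OF yX] py by (intro order_tendstoD) auto
  have e2: "\<forall>\<^sub>F n in sequentially. l n < 2 * \<Lambda>"
    using eigenvalue_tendsto Lam_pos by (intro order_tendstoD) auto
  show ?case
  proof (intro exI)
    show "\<forall>\<^sub>F n in sequentially. \<forall>\<omega>\<in>X. \<omega> 0 = b \<longrightarrow> h n \<omega> \<le> (exp c0 * (4 * \<Lambda> / p ?y * K)) * h n x0"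
      using K e1 e2
    proof eventually_elim
      case (elim n)
      show ?case
      proof (intro ballI impI)
        fix \<omega> assume w: "\<omega> \<in> X" "\<omega> 0 = b"
        have hy: "0 \<le> h n ?y" "0 \<le> h n z" using r.h_nonneg yX zX by blast+
        have "p ?y / 2 * h n ?y \<le> pn n ?y * h n ?y" using elim(2) hy by (intro mult_right_mono) auto
        also have "\<dots> \<le> Ln n (h n) z"
          by (rule r.transfer_ge_term[OF order_refl r.h_bdd r.h_nonneg zX bd(1)])
        also have "\<dots> = l n * h n z" by (rule r.h_eigen[OF zX])
        also have "\<dots> \<le> (2 * \<Lambda>) * h n z" using elim(3) hy by (intro mult_right_mono) auto
        also have "\<dots> \<le> (2 * \<Lambda>) * (K * h n x0)" using elim(1) zX z(2) Lam_pos by (intro mult_left_mono) auto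
        finally have "h n ?y \<le> 4 * \<Lambda> / p ?y * K * h n x0" using py by (simp add: field_simps)
        moreover have "h n \<omega> \<le> exp c0 * h n ?y"
          by (rule cone_le'[OF r.h_cone c0_nonneg w(1) yX]) (simp add: w(2))
        ultimately have "h n \<omega> \<le> exp c0 * (4 * \<Lambda> / p ?y * K * h n x0)"
          by (meson exp_ge_zero mult_left_mono order_trans)
        then show "h n \<omega> \<le> (exp c0 * (4 * \<Lambda> / p ?y * K)) * h n x0" by (simp add: mult_ac)
      qed
    qed
  qed
qed

text \<open>Transitions outside \<open>M\<close> only add nonnegative terms to the eigenvalue
  equation, so in the limit the normalised eigenfunctions become superharmonic for the component.
  Their limit points are therefore multiples of \<open>g\<close>, and the value 1 at
  \<open>x0\<close> fixes the multiple.\<close>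

lemma h_ratio:
  assumes x0: "x0 \<in> XU" and w1: "\<omega>1 \<in> XU"
  shows "(\<lambda>n. h n \<omega>1 / h n x0) \<longlonglongrightarrow> g \<omega>1 / g x0"
proof (rule subsequence_principle)
  fix r :: "nat \<Rightarrow> nat" assume r: "strict_mono r"
  have x0X: "x0 \<in> X" "x0 0 \<in> U" using u.XM_X[OF x0] u.XM_U[OF x0] by auto
  have hx0: "0 < h n x0" for n by (rule r.h_pos[OF x0X(1)]) simp
  \<comment> \<open>The bound on the quotient is available only over \<open>U\<close>; values
    elsewhere do not enter the inequality over \<open>U\<close> and are set to 0.\<close>
  define F where "F n \<omega> = (if \<omega> 0 \<in> U then h n \<omega> / h n x0 else 0)" for n \<omega>
  have Fc: "cone 1 c0 (F n)" for n
    unfolding cone_on_def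
  proof safe
    fix \<omega> assume "\<omega> \<in> X" then show "0 \<le> F n \<omega>" using r.h_nonneg hx0[of n] by (auto simp: F_def)
  next
    fix k \<omega> \<upsilon> assume *: "1 \<le> k" "\<omega> \<in> X" "\<upsilon> \<in> X" "agree k \<omega> \<upsilon>"
    have "\<omega> 0 = \<upsilon> 0" by (rule agree_zeroth[OF *(4,1)])
    then show "F n \<omega> \<le> exp (c0 * \<theta> ^ k) * F n \<upsilon>"
      using cone_le[OF r.h_cone *, of n] hx0[of n] by (simp add: F_def divide_right_mono)
  qed
  have FB: "Bseq (\<lambda>n. F (r n) \<omega>)" if w: "\<omega> \<in> X" for \<omega>
  proof (cases "\<omega> 0 \<in> U")
    case True
    obtain K where "\<forall>\<^sub>F n in sequentially. \<forall>\<upsilon>\<in>X. \<upsilon> 0 = \<omega> 0 \<longrightarrow> h n \<upsilon> \<le> K * h n x0"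
      using h_eventually_le[OF x0X True] by blast
    then have "\<forall>\<^sub>F n in sequentially. norm (F n \<omega>) \<le> K"
    proof eventually_elim
      case (elim n)
      then have "h n \<omega> \<le> K * h n x0" using w by blast
      then show ?case using True hx0[of n] r.h_nonneg[OF w, of n] by (simp add: F_def pos_divide_le_eq)
    qed
    then have "Bseq (\<lambda>n. F n \<omega>)" by (rule BfunI)
    then show ?thesis by (rule Bseq_subseq)
  qed (simp add: F_def)
  have "\<exists>s G. strict_mono (s :: nat \<Rightarrow> nat) \<and> cone 1 c0 G \<and> (\<forall>\<omega>\<in>X. (\<lambda>n. F (r (s n)) \<omega>) \<longlonglongrightarrow> G \<omega>)"
    by (rule cone_subsequence[OF Fc c0_nonneg FB])
  then obtain s G where s: "strict_mono (s :: nat \<Rightarrow> nat)" and Gc: "cone 1 c0 G"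
    and G: "\<And>\<omega>. \<omega> \<in> X \<Longrightarrow> (\<lambda>n. F (r (s n)) \<omega>) \<longlonglongrightarrow> G \<omega>" by blast
  have rs: "strict_mono (\<lambda>n. r (s n))" using r s by (auto simp: strict_mono_def)
  have "\<exists>t\<ge>0. \<forall>\<omega>\<in>XU. G \<omega> = t * g \<omega>"
  proof (rule u.superharmonic_proportional[OF Gc])
    fix \<omega> T assume w: "\<omega> \<in> X" and T: "finite T" "\<And>a. a \<in> T \<Longrightarrow> M a (\<omega> 0)"
    show "(\<Sum>a\<in>T. p (case_nat a \<omega>) * G (case_nat a \<omega>)) \<le> \<Lambda> * G \<omega>"
    proof (cases "T = {}")
      case True
      then show ?thesis using cone_nonneg[OF Gc w] Lam_pos by simp
    next
      case False
      then have wU: "\<omega> 0 \<in> U" using T u.M_U by blast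
      have X: "case_nat a \<omega> \<in> X" if "a \<in> T" for a by (rule Cons_in_X[OF u.M_le w T(2)[OF that]])
      have le: "(\<Sum>a\<in>T. pn n (case_nat a \<omega>) * F n (case_nat a \<omega>)) \<le> l n * F n \<omega>" for n
      proof -
        have TA: "A a (\<omega> 0)" if "a \<in> T" for a using T(2)[OF that] u.M_le by (auto simp: le_fun_def)
        have "(\<Sum>a\<in>T. pn n (case_nat a \<omega>) * F n (case_nat a \<omega>)) =
            (\<Sum>a\<in>T. pn n (case_nat a \<omega>) * h n (case_nat a \<omega>)) / h n x0"
          unfolding sum_divide_distrib using T(2) u.M_U by (intro sum.cong) (auto simp: F_def)
        also have "\<dots> \<le> Ln n (h n) \<omega> / h n x0"
          by (intro divide_right_mono r.transfer_sum_le[OF order_refl r.h_bdd r.h_nonneg w T(1) TA] less_imp_le[OF hx0])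
        also have "\<dots> = l n * F n \<omega>" using wU r.h_eigen[OF w, of n] by (simp add: F_def)
        finally show ?thesis .
      qed
      show ?thesis
      proof (rule LIMSEQ_le)
        show "(\<lambda>n. \<Sum>a\<in>T. pn (r (s n)) (case_nat a \<omega>) * F (r (s n)) (case_nat a \<omega>)) \<longlonglongrightarrow>
            (\<Sum>a\<in>T. p (case_nat a \<omega>) * G (case_nat a \<omega>))"
          using LIMSEQ_subseq_LIMSEQ[OF pn_tendsto rs] X by (intro tendsto_sum tendsto_mult G) (auto simp: o_def)
        show "(\<lambda>n. l (r (s n)) * F (r (s n)) \<omega>) \<longlonglongrightarrow> \<Lambda> * G \<omega>"
          using LIMSEQ_subseq_LIMSEQ[OF eigenvalue_tendsto rs] by (intro tendsto_mult G w) (simp add: o_def)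
      qed (use le in blast)
    qed
  qed simp
  then obtain t where t: "\<And>\<omega>. \<omega> \<in> XU \<Longrightarrow> G \<omega> = t * g \<omega>" by blast
  have gx0: "0 < g x0" by (rule u.h_pos[OF x0X])
  have "F n x0 = 1" for n using hx0[of n] x0X by (simp add: F_def)
  then have "G x0 = 1" using G[OF x0X(1)] by (simp add: LIMSEQ_const_iff)
  then have "t = 1 / g x0" using t[OF x0] gx0 by (simp add: field_simps)
  moreover have "F n \<omega>1 = h n \<omega>1 / h n x0" for n using u.XM_U[OF w1] by (simp add: F_def)
  ultimately show "\<exists>s. strict_mono s \<and> (\<lambda>n. h (r (s n)) \<omega>1 / h (r (s n)) x0) \<longlonglongrightarrow> g \<omega>1 / g x0"
    using s G[OF u.XM_X[OF w1]] t[OF w1] by (intro exI[of _ s]) auto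
qed

text \<open>This says that \<open>fl\<close> is at most the lower limit of \<open>f n\<close> at
  each point of \<open>XU\<close>.\<close>

definition lower_limit :: "(nat \<Rightarrow> (nat \<Rightarrow> 's) \<Rightarrow> real) \<Rightarrow> ((nat \<Rightarrow> 's) \<Rightarrow> real) \<Rightarrow> bool" where
  "lower_limit f fl \<longleftrightarrow> (\<forall>\<omega>\<in>XU. \<forall>y<fl \<omega>. \<forall>\<^sub>F n in sequentially. y < f n \<omega>)"

text \<open>Fatou's lemma for the sum over preimages: finitely many terms already exceed
  \<open>y\<close>, and each of them has a lower limit. Transitions of \<open>A\<close> outside
  \<open>M\<close> are dropped as nonnegative.\<close>

lemma lower_limit_transfer:
  assumes f: "\<And>n. bdd (f n)" "\<And>n \<omega>. \<omega> \<in> X \<Longrightarrow> 0 \<le> f n \<omega>" and fl: "bdd fl" "\<And>\<omega>. \<omega> \<in> X \<Longrightarrow> 0 \<le> fl \<omega>"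
    and lower: "lower_limit f fl"
  shows "lower_limit (\<lambda>n. Ln n (f n)) (LU fl)"
  unfolding lower_limit_def
proof (intro ballI allI impI)
  fix \<omega> y assume w: "\<omega> \<in> XU" and y: "y < LU fl \<omega>"
  have wX: "\<omega> \<in> X" by (rule u.XM_X[OF w])
  let ?D = "{a. M a (\<omega> 0)}"
  have "\<exists>T. finite T \<and> T \<subseteq> ?D \<and> y < (\<Sum>a\<in>T. p (case_nat a \<omega>) * fl (case_nat a \<omega>))"
  proof (rule ccontr)
    assume *: "\<not> ?thesis"
    have "LU fl \<omega> \<le> y" unfolding transfer_def
      by (rule infsum_le_finite_sums[OF transfer_summable[OF u.M_le fl(1) wX]]) (use * in \<open>auto simp: not_less\<close>)
    then show False using y by simp
  qed
  then obtain T where T: "finite T" "T \<subseteq> ?D" "y < (\<Sum>a\<in>T. p (case_nat a \<omega>) * fl (case_nat a \<omega>))" by blast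
  let ?S = "\<Sum>a\<in>T. p (case_nat a \<omega>) * fl (case_nat a \<omega>)"
  \<comment> \<open>The slack is shared among the terms of \<open>T\<close>; adding 1 to the
    cardinality covers the empty set and keeps the total strictly smaller.\<close>
  define e where "e = (?S - y) / (real (card T) + 1)"
  have e: "0 < e" using T(3) by (simp add: e_def)
  have card_e: "real (card T) * e < ?S - y" using T(3) by (simp add: e_def field_simps)
  have term_lower: "\<forall>\<^sub>F n in sequentially. p (case_nat a \<omega>) * fl (case_nat a \<omega>) - e \<le> pn n (case_nat a \<omega>) * f n (case_nat a \<omega>)"
    if a: "a \<in> T" for a
  proof -
    let ?x = "case_nat a \<omega>"
    have xU: "?x \<in> XU" using T(2) a w by (intro Cons_in_shift_space) auto
    have xX: "?x \<in> X" by (rule u.XM_X[OF xU])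
    have px: "0 < p ?x" using u.p_pos[OF xX] T(2) a by auto
    show ?thesis
    proof (cases "p ?x * fl ?x - e < 0")
      case True
      then have "p ?x * fl ?x - e \<le> pn n ?x * f n ?x" for n
        using mult_nonneg_nonneg[OF r.p_nonneg[OF xX, of n] f(2)[OF xX, of n]] by linarith
      then show ?thesis by simp
    next
      case False
      define z where "z = fl ?x - e / (2 * p ?x)"
      have z: "z < fl ?x" "p ?x * z = p ?x * fl ?x - e / 2" using px e by (auto simp: z_def field_simps)
      have "p ?x * fl ?x - e < p ?x * z" using z(2) e by simp
      moreover have "(\<lambda>n. pn n ?x * z) \<longlonglongrightarrow> p ?x * z" by (intro tendsto_intros pn_tendsto xX)
      ultimately have "\<forall>\<^sub>F n in sequentially. p ?x * fl ?x - e < pn n ?x * z" by (intro order_tendstoD)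
      moreover have "\<forall>\<^sub>F n in sequentially. z < f n ?x" using lower xU z(1) by (auto simp: lower_limit_def)
      ultimately show ?thesis
      proof eventually_elim
        case (elim n)
        have "pn n ?x * z \<le> pn n ?x * f n ?x" using elim(2) r.p_nonneg[OF xX, of n] by (intro mult_left_mono) auto
        then show ?case using elim(1) by linarith
      qed
    qed
  qed
  have "\<forall>\<^sub>F n in sequentially. \<forall>a\<in>T. p (case_nat a \<omega>) * fl (case_nat a \<omega>) - e \<le> pn n (case_nat a \<omega>) * f n (case_nat a \<omega>)"
    using T(1) term_lower by (intro eventually_ball_finite) auto
  then show "\<forall>\<^sub>F n in sequentially. y < Ln n (f n) \<omega>"
  proof eventually_elim
    case (elim n)
    have "y < ?S - real (card T) * e" using card_e by simp
    also have "\<dots> = (\<Sum>a\<in>T. p (case_nat a \<omega>) * fl (case_nat a \<omega>) - e)" by (simp add: sum_subtractf)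
    also have "\<dots> \<le> (\<Sum>a\<in>T. pn n (case_nat a \<omega>) * f n (case_nat a \<omega>))" using elim by (intro sum_mono) auto
    also have "\<dots> \<le> Ln n (f n) \<omega>"
      using T u.M_le by (intro r.transfer_sum_le[OF order_refl f(1) f(2) wX T(1)]) (auto simp: le_fun_def)
    finally show ?case .
  qed
qed

lemma lower_limit_iter:
  assumes f: "\<And>n. bdd (f n)" "\<And>n \<omega>. \<omega> \<in> X \<Longrightarrow> 0 \<le> f n \<omega>" and fl: "bdd fl" "\<And>\<omega>. \<omega> \<in> X \<Longrightarrow> 0 \<le> fl \<omega>"
    and lower: "lower_limit f fl"
  shows "lower_limit (\<lambda>n. (Ln n ^^ j) (f n)) ((LU ^^ j) fl)"
proof (induction j)
  case (Suc j)
  have "lower_limit (\<lambda>n. Ln n ((Ln n ^^ j) (f n))) (LU ((LU ^^ j) fl))"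
    by (rule lower_limit_transfer[OF _ _ _ _ Suc])
      (auto intro!: r.iter_bdd r.iter_nonneg iter_bdd iter_nonneg u.M_le f fl)
  then show ?case by simp
qed (use lower in simp)

text \<open>Fatou's lemma gives lower bounds for both \<open>f\<close> and \<open>K - f\<close>; their sum is an eigenfunction,
  so no mass is lost and both bounds are limits.\<close>

lemma iter_ratio_tendsto:
  assumes f: "bdd f" "\<And>\<omega>. \<omega> \<in> X \<Longrightarrow> 0 \<le> f \<omega>" "\<And>\<omega>. \<omega> \<in> X \<Longrightarrow> f \<omega> \<le> K" and x: "x \<in> XU"
  shows "(\<lambda>n. (Ln n ^^ j) (\<lambda>\<omega>. h n \<omega> * f \<omega>) x / h n x) \<longlonglongrightarrow> (LU ^^ j) (\<lambda>\<omega>. g \<omega> * f \<omega>) x / g x"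
proof -
  have xX: "x \<in> X" by (rule u.XM_X[OF x])
  have hx: "0 < h n x" for n by (rule r.h_pos[OF xX]) simp
  have gx: "0 < g x" by (rule u.h_pos[OF xX u.XM_U[OF x]])
  have lower: "lower_limit (\<lambda>n. (Ln n ^^ j) (\<lambda>\<omega>. h n \<omega> / h n x * e \<omega>)) ((LU ^^ j) (\<lambda>\<omega>. g \<omega> / g x * e \<omega>))"
    if e: "bdd e" "\<And>\<omega>. \<omega> \<in> X \<Longrightarrow> 0 \<le> e \<omega>" for e
  proof (rule lower_limit_iter)
    show "bdd (\<lambda>\<omega>. h n \<omega> / h n x * e \<omega>)" for n
      using bdd_cmult[OF bdd_mult[OF r.h_bdd e(1)], of "1 / h n x" n] by simp
    show "bdd (\<lambda>\<omega>. g \<omega> / g x * e \<omega>)"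
      using bdd_cmult[OF bdd_mult[OF u.h_bdd e(1)], of "1 / g x"] by simp
    show "lower_limit (\<lambda>n \<omega>. h n \<omega> / h n x * e \<omega>) (\<lambda>\<omega>. g \<omega> / g x * e \<omega>)"
      unfolding lower_limit_def
    proof (intro ballI allI impI)
      fix \<omega> y assume w: "\<omega> \<in> XU" "y < g \<omega> / g x * e \<omega>"
      have "(\<lambda>n. h n \<omega> / h n x * e \<omega>) \<longlonglongrightarrow> g \<omega> / g x * e \<omega>"
        by (intro tendsto_mult h_ratio x w tendsto_const)
      then show "\<forall>\<^sub>F n in sequentially. y < h n \<omega> / h n x * e \<omega>" using w(2) by (rule order_tendstoD)
    qed
  qed (use r.h_nonneg u.h_nonneg hx gx e in \<open>auto intro!: mult_nonneg_nonneg divide_nonneg_pos\<close>)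
  define a where "a n = (Ln n ^^ j) (\<lambda>\<omega>. h n \<omega> / h n x * f \<omega>) x" for n
  define b where "b n = (Ln n ^^ j) (\<lambda>\<omega>. h n \<omega> / h n x * (K - f \<omega>)) x" for n
  define al where "al = (LU ^^ j) (\<lambda>\<omega>. g \<omega> / g x * f \<omega>) x"
  define bl where "bl = (LU ^^ j) (\<lambda>\<omega>. g \<omega> / g x * (K - f \<omega>)) x"
  have bd: "bdd (\<lambda>\<omega>. K - f \<omega>)" by (intro bdd_diff f bdd_const)
  have la: "\<forall>\<^sub>F n in sequentially. y < a n" if "y < al" for y
    using lower[OF f(1,2)] x that by (auto simp: lower_limit_def a_def al_def)
  have lb: "\<forall>\<^sub>F n in sequentially. y < b n" if "y < bl" for y
    using lower[OF bd] f(3) x that by (auto simp: lower_limit_def b_def bl_def)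
  have ab: "a n + b n = K * l n ^ j" for n
  proof -
    have "b n = (Ln n ^^ j) (\<lambda>\<omega>. (K / h n x) * h n \<omega> - h n \<omega> / h n x * f \<omega>) x"
      unfolding b_def by (intro r.iter_cong[OF order_refl _ xX]) (simp add: algebra_simps diff_divide_distrib)
    also have "\<dots> = (Ln n ^^ j) (\<lambda>\<omega>. (K / h n x) * h n \<omega>) x - (Ln n ^^ j) (\<lambda>\<omega>. h n \<omega> / h n x * f \<omega>) x"
    proof (rule r.iter_diff[OF order_refl _ _ xX])
      show "bdd (\<lambda>\<omega>. (K / h n x) * h n \<omega>)" by (intro bdd_cmult r.h_bdd)
      show "bdd (\<lambda>\<omega>. h n \<omega> / h n x * f \<omega>)"
        using bdd_cmult[OF bdd_mult[OF r.h_bdd f(1)], of "1 / h n x" n] by simp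
    qed
    also have "\<dots> = (K / h n x) * (l n ^ j * h n x) - a n"
      by (simp only: r.iter_cmult r.h_iter[OF xX] a_def)
    finally show ?thesis using hx[of n] by simp
  qed
  have abl: "al + bl = K * \<Lambda> ^ j"
  proof -
    have "bl = (LU ^^ j) (\<lambda>\<omega>. (K / g x) * g \<omega> - g \<omega> / g x * f \<omega>) x"
      unfolding bl_def by (intro iter_cong[OF u.M_le _ xX]) (simp add: algebra_simps diff_divide_distrib)
    also have "\<dots> = (LU ^^ j) (\<lambda>\<omega>. (K / g x) * g \<omega>) x - (LU ^^ j) (\<lambda>\<omega>. g \<omega> / g x * f \<omega>) x"
    proof (rule iter_diff[OF u.M_le _ _ xX])
      show "bdd (\<lambda>\<omega>. (K / g x) * g \<omega>)" by (intro bdd_cmult u.h_bdd)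
      show "bdd (\<lambda>\<omega>. g \<omega> / g x * f \<omega>)"
        using bdd_cmult[OF bdd_mult[OF u.h_bdd f(1)], of "1 / g x"] by simp
    qed
    also have "\<dots> = (K / g x) * (\<Lambda> ^ j * g x) - al"
      by (simp only: iter_cmult u.h_iter[OF xX] al_def)
    finally show ?thesis using gx by simp
  qed
  have "a \<longlonglongrightarrow> al"
  proof (rule order_tendstoI)
    fix y assume y: "al < y"
    define e where "e = (y - al) / 2"
    have e: "0 < e" using y by (simp add: e_def)
    have "(\<lambda>n. K * l n ^ j) \<longlonglongrightarrow> K * \<Lambda> ^ j" by (intro tendsto_intros eigenvalue_tendsto)
    then have "\<forall>\<^sub>F n in sequentially. K * l n ^ j < K * \<Lambda> ^ j + e" using e by (intro order_tendstoD) auto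
    moreover have "\<forall>\<^sub>F n in sequentially. bl - e < b n" using e by (intro lb) simp
    ultimately show "\<forall>\<^sub>F n in sequentially. a n < y"
    proof eventually_elim
      case (elim n)
      have "2 * e = y - al" by (simp add: e_def)
      then show ?case using elim ab[of n] abl by linarith
    qed
  qed (rule la)
  moreover have "a = (\<lambda>n. (Ln n ^^ j) (\<lambda>\<omega>. h n \<omega> * f \<omega>) x / h n x)"
  proof
    fix n
    have "(\<lambda>\<omega>. h n \<omega> / h n x * f \<omega>) = (\<lambda>\<omega>. (1 / h n x) * (h n \<omega> * f \<omega>))" by auto
    then have "a n = (1 / h n x) * (Ln n ^^ j) (\<lambda>\<omega>. h n \<omega> * f \<omega>) x" by (simp only: a_def r.iter_cmult)
    then show "a n = (Ln n ^^ j) (\<lambda>\<omega>. h n \<omega> * f \<omega>) x / h n x" by simp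
  qed
  moreover have "al = (LU ^^ j) (\<lambda>\<omega>. g \<omega> * f \<omega>) x / g x"
  proof -
    have "(\<lambda>\<omega>. g \<omega> / g x * f \<omega>) = (\<lambda>\<omega>. (1 / g x) * (g \<omega> * f \<omega>))" by auto
    then have "al = (1 / g x) * (LU ^^ j) (\<lambda>\<omega>. g \<omega> * f \<omega>) x" by (simp only: al_def iter_cmult)
    then show ?thesis by simp
  qed
  ultimately show ?thesis by simp
qed

lemma cesaro_ratio_tendsto:
  assumes f: "bdd f" "\<And>\<omega>. \<omega> \<in> X \<Longrightarrow> 0 \<le> f \<omega>" "\<And>\<omega>. \<omega> \<in> X \<Longrightarrow> f \<omega> \<le> K" and x: "x \<in> XU"
  shows "(\<lambda>n. cesaro A (pn n) (l n) (\<lambda>\<omega>. h n \<omega> * f \<omega>) N x / h n x)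
     \<longlonglongrightarrow> cesaro M p \<Lambda> (\<lambda>\<omega>. g \<omega> * f \<omega>) N x / g x"
proof -
  have "(\<lambda>n. (\<Sum>j\<le>N. ((Ln n ^^ j) (\<lambda>\<omega>. h n \<omega> * f \<omega>) x / h n x) / l n ^ j) / real (Suc N))
    \<longlonglongrightarrow> (\<Sum>j\<le>N. ((LU ^^ j) (\<lambda>\<omega>. g \<omega> * f \<omega>) x / g x) / \<Lambda> ^ j) / real (Suc N)"
    using Lam_pos by (intro tendsto_intros iter_ratio_tendsto[OF f x] eigenvalue_tendsto) auto
  then show ?thesis by (simp add: cesaro_def sum_divide_distrib mult_ac del: of_nat_Suc)
qed

end

section \<open>Asymptotics of the perturbed measures\<close>

text \<open>\<open>dichotomy\<close> is the combinatorial input: a cylinder either contains a point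
  of the space of some component, or its normalised return weight tends to 0.\<close>

locale perturbation_family = perturbation \<theta> A p C q pn h \<nu> l \<Lambda>
  for \<theta> and A :: "'s::{countable,discrete_topology} \<Rightarrow> 's \<Rightarrow> bool" and p C q pn h \<nu> l \<Lambda> +
  fixes \<U> :: "'s set set" and M :: "'s set \<Rightarrow> 's \<Rightarrow> 's \<Rightarrow> bool"
    and g :: "'s set \<Rightarrow> (nat \<Rightarrow> 's) \<Rightarrow> real" and \<kappa> :: "'s set \<Rightarrow> (nat \<Rightarrow> 's) measure"
  assumes finite_family: "finite \<U>"
    and rpf_family: "U \<in> \<U> \<Longrightarrow> rpf \<theta> A p C q (M U) (g U) (\<kappa> U) \<Lambda> U"
    and disjoint_family: "U \<in> \<U> \<Longrightarrow> V \<in> \<U> \<Longrightarrow> a \<in> U \<Longrightarrow> a \<in> V \<Longrightarrow> U = V"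
    and dichotomy: "y \<in> shift_space A \<Longrightarrow> 1 \<le> k \<Longrightarrow>
      (\<exists>U\<in>\<U>. \<exists>z\<in>shift_space (M U). agree k y z) \<or>
      (\<lambda>j. (transfer A p ^^ j) (ind k y) y / \<Lambda> ^ j) \<longlonglongrightarrow> 0"
begin

lemma perturbation_class_family:
  "U \<in> \<U> \<Longrightarrow> perturbation_class \<theta> A p C q pn h \<nu> l \<Lambda> (M U) (g U) (\<kappa> U) U"
  using perturbation_axioms rpf_family by (intro perturbation_class.intro)

abbreviation EU :: "'s set \<Rightarrow> ((nat \<Rightarrow> 's) \<Rightarrow> real) \<Rightarrow> real" where
  "EU U f \<equiv> (\<integral>\<omega>. g U \<omega> * f \<omega> \<partial>\<kappa> U)"

definition mass :: "nat \<Rightarrow> 's set \<Rightarrow> real" where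
  "mass n U = E n (\<lambda>\<omega>. if \<omega> 0 \<in> U then 1 else 0)"

lemma ind_set_lip: "\<exists>J. lip J (\<lambda>\<omega>. if \<omega> 0 \<in> U then 1 else 0)"
proof -
  have "lip (2 * 1 / \<theta> ^ 1) (\<lambda>\<omega>. if \<omega> 0 \<in> U then 1 else 0)"
    by (rule lip_on_locally_const) (simp_all add: theta)
  then show ?thesis by blast
qed

lemma mass_range: "0 \<le> mass n U" "mass n U \<le> 1"
proof -
  obtain J where J: "lip J (\<lambda>\<omega>. if \<omega> 0 \<in> U then 1 else 0)" using ind_set_lip by blast
  show "0 \<le> mass n U"
    using r.E_mono[OF lip_on_const[OF theta(1)] J, of 0 n] by (simp add: mass_def)
  show "mass n U \<le> 1"
    using r.E_mono[OF J lip_on_const[OF theta(1)], of 1 n] r.nu_h[of n] by (simp add: mass_def)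
qed

text \<open>Duality replaces \<open>f\<close> by a Cesaro mean divided by \<open>h n\<close>, whose
  distortion is bounded uniformly in \<open>n\<close>. On a cylinder meeting a component this
  quotient is close to \<open>EU U f\<close> by convergence at one point there; all other points lie
  in finitely many cylinders of vanishing mass or leave a finite set of states within
  \<open>k\<close> steps. The choices of \<open>k\<close>, \<open>Q\<close> and \<open>N\<close>
  precede the limit in \<open>n\<close>.\<close>

lemma E_tendsto_cone:
  assumes f: "cone 1 1 f" and f_le: "\<And>\<omega>. \<omega> \<in> X \<Longrightarrow> f \<omega> \<le> K" and K: "0 < K"
  shows "(\<lambda>n. E n f - (\<Sum>U\<in>\<U>. mass n U * EU U f)) \<longlonglongrightarrow> 0"
proof (rule tendstoI)
  fix e :: real assume e: "0 < e"
  \<comment> \<open>The total error at the end is \<open>d * (K + 2) + K * (2 * d)\<close>, that is,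
    \<open>d * (3 * K + 2)\<close>.\<close>
  define d where "d = e / 2 / (3 * K + 2)"
  have d: "0 < d" using e K by (simp add: d_def)
  have "3 * K + 2 \<noteq> 0" using K by simp
  then have "d * (3 * K + 2) = e / 2" unfolding d_def by (rule nonzero_eq_divide_eq[THEN iffD1, OF _ refl])
  then have d_e: "d * (3 * K + 2) < e" using e by simp
  have f0: "0 \<le> f \<omega>" if "\<omega> \<in> X" for \<omega> using cone_nonneg[OF f that] .
  have f_bdd: "bdd f" by (rule bddI[of _ K]) (use f0 f_le in auto)
  obtain J0 where f_lip: "lip J0 f" using cone_bdd_lip[OF f _ f_bdd] by auto
  \<comment> \<open>Distortion of the quotient: \<open>c0 + 1\<close> from the Cesaro mean and
    \<open>c0\<close> from \<open>h n\<close>.\<close>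
  define c where "c = c0 + 1 + c0"
  obtain k where k: "1 \<le> k" "exp (c * \<theta> ^ k) - 1 < d" using exists_small[OF d] by blast
  \<comment> \<open>Each of the first \<open>k\<close> letters may lie outside \<open>Q\<close>; by
    invariance these events together have probability at most \<open>d\<close>.\<close>
  obtain Q where Q: "finite Q" "\<forall>\<^sub>F n in sequentially. E n (r.outside Q) \<le> d / real k"
    using uniform_tightness[of "d / real k"] d k(1) by auto
  define W where "W = (\<lambda>\<omega>. map \<omega> [0..<k]) ` {\<omega> \<in> X. \<forall>i<k. \<omega> i \<in> Q}"
  have "W \<subseteq> {w. set w \<subseteq> Q \<and> length w = k}" by (auto simp: W_def)
  then have finW: "finite W" by (rule finite_subset) (rule finite_lists_length_eq[OF Q(1)])
  have pW: "point w \<in> X" if "w \<in> W" for w using that point_prefix(1) by (auto simp: W_def)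
  define Good where "Good = {w \<in> W. \<exists>U\<in>\<U>. \<exists>z\<in>shift_space (M U). agree k (point w) z}"
  define Bad where "Bad = W - Good"
  have fin: "finite Good" "finite Bad" using finW by (auto simp: Good_def Bad_def)
  have "\<forall>w\<in>Good. \<exists>U z. U \<in> \<U> \<and> z \<in> shift_space (M U) \<and> agree k (point w) z" by (auto simp: Good_def)
  then obtain V z where V: "\<And>w. w \<in> Good \<Longrightarrow> V w \<in> \<U>" and z: "\<And>w. w \<in> Good \<Longrightarrow> z w \<in> shift_space (M (V w))"
    "\<And>w. w \<in> Good \<Longrightarrow> agree k (point w) (z w)" by metis
  have zX: "z w \<in> X" and zV: "z w 0 \<in> V w" and gz: "0 < g (V w) (z w)" if "w \<in> Good" for w
    using rpf.XM_X[OF rpf_family z(1)] rpf.XM_U[OF rpf_family z(1)] rpf.h_pos[OF rpf_family] V that by blast+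
  have bad: "\<forall>\<^sub>F n in sequentially. \<forall>w\<in>Bad. E n (ind k (point w)) < d / (real (card Bad) + 1)"
  proof (rule eventually_ball_finite[OF fin(2)], rule ballI)
    fix w assume w: "w \<in> Bad"
    then have X: "point w \<in> X" using pW by (auto simp: Bad_def)
    have "(\<lambda>j. (LA ^^ j) (ind k (point w)) (point w) / \<Lambda> ^ j) \<longlonglongrightarrow> 0"
      using dichotomy[OF X k(1)] w by (auto simp: Bad_def Good_def)
    then have "(\<lambda>n. E n (ind k (point w))) \<longlonglongrightarrow> 0" by (rule cylinder_mass_tendsto_0[OF X k(1)])
    then show "\<forall>\<^sub>F n in sequentially. E n (ind k (point w)) < d / (real (card Bad) + 1)"
      using d by (intro order_tendstoD) auto
  qed
  define ces where "ces n N = cesaro A (pn n) (l n) (\<lambda>\<omega>. h n \<omega> * f \<omega>) N" for n N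
  define cesU where "cesU U N = cesaro (M U) p \<Lambda> (\<lambda>\<omega>. g U \<omega> * f \<omega>) N" for U N
  have "\<forall>\<^sub>F N in sequentially. \<forall>w\<in>Good. \<bar>cesU (V w) N (z w) / g (V w) (z w) - EU (V w) f\<bar> < d"
  proof (rule eventually_ball_finite[OF fin(1)], rule ballI)
    fix w assume w: "w \<in> Good"
    have "(\<lambda>N. cesU (V w) N (z w) / g (V w) (z w)) \<longlonglongrightarrow> EU (V w) f * g (V w) (z w) / g (V w) (z w)"
      unfolding cesU_def using gz[OF w]
      by (intro tendsto_divide tendsto_const rpf.cesaro_tendsto[OF rpf_family[OF V[OF w]] f f_le z(1)[OF w]]) auto
    then have "(\<lambda>N. cesU (V w) N (z w) / g (V w) (z w)) \<longlonglongrightarrow> EU (V w) f" using gz[OF w] by simp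
    from tendstoD[OF this d]
    show "\<forall>\<^sub>F N in sequentially. \<bar>cesU (V w) N (z w) / g (V w) (z w) - EU (V w) f\<bar> < d"
      by (simp add: dist_real_def)
  qed
  \<comment> \<open>\<open>N\<close> is chosen from the limit components alone, so it stays fixed
    when \<open>n\<close> varies.\<close>
  then obtain N where N: "\<And>w. w \<in> Good \<Longrightarrow> \<bar>cesU (V w) N (z w) / g (V w) (z w) - EU (V w) f\<bar> < d"
    using eventually_happens'[OF sequentially_bot] by blast
  have good: "\<forall>\<^sub>F n in sequentially. \<forall>w\<in>Good. \<bar>ces n N (z w) / h n (z w) - cesU (V w) N (z w) / g (V w) (z w)\<bar> < d"
  proof (rule eventually_ball_finite[OF fin(1)], rule ballI)
    fix w assume w: "w \<in> Good"
    have "(\<lambda>n. ces n N (z w) / h n (z w)) \<longlonglongrightarrow> cesU (V w) N (z w) / g (V w) (z w)"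
      unfolding ces_def cesU_def
      by (rule perturbation_class.cesaro_ratio_tendsto[OF perturbation_class_family[OF V[OF w]] f_bdd f0 f_le z(1)[OF w]])
    from tendstoD[OF this d]
    show "\<forall>\<^sub>F n in sequentially. \<bar>ces n N (z w) / h n (z w) - cesU (V w) N (z w) / g (V w) (z w)\<bar> < d"
      by (simp add: dist_real_def)
  qed
  \<comment> \<open>The step function to which the quotient is compared; its expectation under the
    perturbed measure is the sum of \<open>mass n U * EU U f\<close>.\<close>
  define \<Phi> where "\<Phi> \<omega> = (\<Sum>U\<in>\<U>. (if \<omega> 0 \<in> U then 1 else 0) * EU U f)" for \<omega> :: "nat \<Rightarrow> 's"
  have \<Phi>_in: "\<Phi> \<omega> = EU U f" if "U \<in> \<U>" "\<omega> 0 \<in> U" for \<omega> U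
  proof -
    have "\<Phi> \<omega> = (\<Sum>U'\<in>\<U>. if U' = U then EU U f else 0)"
      unfolding \<Phi>_def using disjoint_family that by (intro sum.cong) auto
    also have "\<dots> = EU U f" using finite_family that by simp
    finally show ?thesis .
  qed
  have \<Phi>_out: "\<Phi> \<omega> = 0" if "\<And>U. U \<in> \<U> \<Longrightarrow> \<omega> 0 \<notin> U" for \<omega>
    unfolding \<Phi>_def by (rule sum.neutral) (use that in auto)
  have EU_range: "0 \<le> EU U f" "EU U f \<le> K" if "U \<in> \<U>" for U
  proof -
    show "0 \<le> EU U f"
      using rpf.E_mono[OF rpf_family[OF that] lip_on_const[OF theta(1)] f_lip f0] by simp
    have "EU U f \<le> EU U (\<lambda>_. K)"
      by (rule rpf.E_mono[OF rpf_family[OF that] f_lip lip_on_const[OF theta(1)] f_le])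
    then show "EU U f \<le> K" using rpf.nu_h[OF rpf_family[OF that]] by simp
  qed
  have \<Phi>_range: "0 \<le> \<Phi> \<omega>" "\<Phi> \<omega> \<le> K" for \<omega>
  proof -
    have "0 \<le> \<Phi> \<omega> \<and> \<Phi> \<omega> \<le> K"
    proof (cases "\<exists>U\<in>\<U>. \<omega> 0 \<in> U")
      case True
      then obtain U where U: "U \<in> \<U>" "\<omega> 0 \<in> U" by blast
      then have "\<Phi> \<omega> = EU U f" by (rule \<Phi>_in)
      then show ?thesis using EU_range[OF U(1)] by simp
    next
      case False
      then have "\<Phi> \<omega> = 0" by (intro \<Phi>_out) blast
      then show ?thesis using K by simp
    qed
    then show "0 \<le> \<Phi> \<omega>" "\<Phi> \<omega> \<le> K" by auto
  qed
  have \<Phi>_lip: "\<exists>J. lip J \<Phi>"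
  proof -
    have "lip (2 * K / \<theta> ^ 1) \<Phi>"
      by (rule lip_on_locally_const) (use \<Phi>_range theta in \<open>auto simp: \<Phi>_def\<close>)
    then show ?thesis by blast
  qed
  \<comment> \<open>\<open>R\<close> majorises the indicator of the points outside the good
    cylinders and has expectation at most \<open>2 * d\<close> for large \<open>n\<close>.\<close>
  define R where "R \<omega> = (\<Sum>w\<in>Bad. ind k (point w) \<omega>) + (\<Sum>i<k. r.outside Q ((shift ^^ i) \<omega>))" for \<omega>
  have R_nonneg: "0 \<le> R \<omega>" for \<omega>
    unfolding R_def by (intro add_nonneg_nonneg sum_nonneg ind_range) (simp add: r.outside_def)
  have R_ge: "1 \<le> R \<omega>" if X: "\<omega> \<in> X" and not_good: "map \<omega> [0..<k] \<notin> Good" for \<omega>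
  proof (cases "\<forall>i<k. \<omega> i \<in> Q")
    case True
    then have w: "map \<omega> [0..<k] \<in> Bad" using X not_good by (auto simp: Bad_def W_def)
    have "agree k (point (map \<omega> [0..<k])) \<omega>" using point_prefix(2)[OF X] agree_sym by blast
    then have "1 = ind k (point (map \<omega> [0..<k])) \<omega>" by (simp add: ind_def)
    also have "\<dots> \<le> (\<Sum>w\<in>Bad. ind k (point w) \<omega>)"
      using w fin(2) ind_range(1) by (intro member_le_sum) auto
    also have "\<dots> \<le> R \<omega>" unfolding R_def by (simp add: sum_nonneg r.outside_def)
    finally show ?thesis .
  next
    case False
    then obtain i where i: "i < k" "\<omega> i \<notin> Q" by blast
    then have "1 = r.outside Q ((shift ^^ i) \<omega>)" by (simp add: r.outside_def funpow_shift)
    also have "\<dots> \<le> (\<Sum>i<k. r.outside Q ((shift ^^ i) \<omega>))"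
      using i by (intro member_le_sum) (auto simp: r.outside_def)
    also have "\<dots> \<le> R \<omega>" unfolding R_def by (simp add: sum_nonneg ind_range)
    finally show ?thesis .
  qed
  show "\<forall>\<^sub>F n in sequentially. dist (E n f - (\<Sum>U\<in>\<U>. mass n U * EU U f)) 0 < e"
    using Q(2) bad good
  proof eventually_elim
    case (elim n)
    have hpos: "0 < h n \<omega>" if "\<omega> \<in> X" for \<omega> by (rule r.h_pos[OF that]) simp
    have ces_cone: "cone 1 (c0 + 1) (ces n N)" unfolding ces_def by (rule r.cesaro_cone[OF f]) (rule f_le)
    have ces_le: "ces n N \<omega> \<le> K * h n \<omega>" if "\<omega> \<in> X" for \<omega>
      unfolding ces_def by (rule r.cesaro_le[OF f _ that]) (rule f_le)
    have ces0: "0 \<le> ces n N \<omega>" if "\<omega> \<in> X" for \<omega> using cone_nonneg[OF ces_cone that] by simp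
    have ratio_le: "ces n N \<omega> / h n \<omega> \<le> exp (c * \<theta> ^ k) * (ces n N \<upsilon> / h n \<upsilon>)"
      if X: "\<omega> \<in> X" "\<upsilon> \<in> X" "agree k \<omega> \<upsilon>" for \<omega> \<upsilon>
    proof -
      have "ces n N \<omega> * h n \<upsilon> \<le> (exp ((c0 + 1) * \<theta> ^ k) * ces n N \<upsilon>) * (exp (c0 * \<theta> ^ k) * h n \<omega>)"
        using cone_le[OF ces_cone k(1) X] cone_le[OF r.h_cone k(1) X(2,1) agree_sym[OF X(3)], of n]
          ces0[OF X(1)] ces0[OF X(2)] hpos[OF X(2)] by (intro mult_mono) auto
      also have "\<dots> = exp (c * \<theta> ^ k) * ces n N \<upsilon> * h n \<omega>"
      proof -
        have "exp (c * \<theta> ^ k) = exp ((c0 + 1) * \<theta> ^ k) * exp (c0 * \<theta> ^ k)"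
          unfolding c_def by (subst exp_add[symmetric]) (simp add: algebra_simps)
        then show ?thesis by (simp only: mult_ac)
      qed
      finally show ?thesis using hpos[OF X(1)] hpos[OF X(2)] by (simp add: field_simps)
    qed
    have ratio_range: "0 \<le> ces n N \<omega> / h n \<omega>" "ces n N \<omega> / h n \<omega> \<le> K" if "\<omega> \<in> X" for \<omega>
      using ces0[OF that] ces_le[OF that] hpos[OF that] by (auto simp: pos_divide_le_eq)
    have c_nonneg: "0 \<le> c" using c0_nonneg by (simp add: c_def)
    have exp0: "0 \<le> exp (c * \<theta> ^ k) - 1" using c_nonneg theta by simp
    have ratio_diff: "ces n N \<omega> / h n \<omega> - ces n N \<upsilon> / h n \<upsilon> \<le> d * K"
      if X: "\<omega> \<in> X" "\<upsilon> \<in> X" "agree k \<omega> \<upsilon>" for \<omega> \<upsilon>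
    proof -
      have "ces n N \<omega> / h n \<omega> - ces n N \<upsilon> / h n \<upsilon> \<le> (exp (c * \<theta> ^ k) - 1) * (ces n N \<upsilon> / h n \<upsilon>)"
        using ratio_le[OF X] by (simp only: left_diff_distrib mult_1)
      also have "\<dots> \<le> d * K" using k(2) exp0 ratio_range[OF X(2)] d by (intro mult_mono) auto
      finally show ?thesis .
    qed
    have pointwise: "\<bar>ces n N \<omega> - h n \<omega> * \<Phi> \<omega>\<bar> \<le> h n \<omega> * (d * (K + 2) + K * R \<omega>)" if X: "\<omega> \<in> X" for \<omega>
    proof -
      let ?\<rho> = "ces n N \<omega> / h n \<omega>"
      have "\<bar>?\<rho> - \<Phi> \<omega>\<bar> \<le> d * (K + 2) + K * R \<omega>"
      proof (cases "map \<omega> [0..<k] \<in> Good")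
        case True
        let ?w = "map \<omega> [0..<k]"
        have ag: "agree k \<omega> (z ?w)" using point_prefix(2)[OF X] z(2)[OF True] by (rule agree_trans)
        have "\<omega> 0 \<in> V ?w" using zV[OF True] agree_zeroth[OF ag k(1)] by simp
        then have "\<Phi> \<omega> = EU (V ?w) f" by (rule \<Phi>_in[OF V[OF True]])
        moreover have "\<bar>?\<rho> - ces n N (z ?w) / h n (z ?w)\<bar> \<le> d * K"
          using ratio_diff[OF X zX[OF True] ag] ratio_diff[OF zX[OF True] X agree_sym[OF ag]] by linarith
        moreover have "d * (K + 2) = d * K + d + d" by (simp add: algebra_simps)
        moreover have "0 \<le> K * R \<omega>" using K R_nonneg by simp
        ultimately show ?thesis using N[OF True] elim(3) True by fastforce
      next
        case False
        have "\<bar>?\<rho> - \<Phi> \<omega>\<bar> \<le> K * 1" using ratio_range[OF X] \<Phi>_range[of \<omega>] by linarith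
        also have "\<dots> \<le> K * R \<omega>" using R_ge[OF X False] K by (intro mult_left_mono) auto
        also have "\<dots> \<le> d * (K + 2) + K * R \<omega>" using d K by simp
        finally show ?thesis .
      qed
      then have "h n \<omega> * \<bar>?\<rho> - \<Phi> \<omega>\<bar> \<le> h n \<omega> * (d * (K + 2) + K * R \<omega>)"
        using hpos[OF X] by (intro mult_left_mono) auto
      moreover have "h n \<omega> * \<bar>?\<rho> - \<Phi> \<omega>\<bar> = \<bar>h n \<omega> * (?\<rho> - \<Phi> \<omega>)\<bar>" using hpos[OF X] by (simp add: abs_mult)
      moreover have "h n \<omega> * (?\<rho> - \<Phi> \<omega>) = ces n N \<omega> - h n \<omega> * \<Phi> \<omega>" using hpos[OF X] by (simp add: right_diff_distrib)
      ultimately show ?thesis by simp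
    qed
    have int_h: "integrable (\<nu> n) (h n)" using r.h_lip r.lip_integrable by blast
    have int_ces: "integrable (\<nu> n) (ces n N)"
    proof -
      obtain J where "lip J (ces n N)"
        unfolding ces_def using r.cesaro_lip[OF f f_le] by blast
      then show ?thesis by (rule r.lip_integrable)
    qed
    have int_\<Phi>: "integrable (\<nu> n) (\<lambda>\<omega>. h n \<omega> * \<Phi> \<omega>)" using \<Phi>_lip r.integrable_h by blast
    have int_ind: "integrable (\<nu> n) (\<lambda>\<omega>. h n \<omega> * ind k y \<omega>)" for y by (rule r.integrable_h[OF r.ind_lip])
    have int_out: "integrable (\<nu> n) (\<lambda>\<omega>. h n \<omega> * r.outside Q ((shift ^^ i) \<omega>))" for i
      using r.lip_shift_funpow[OF r.outside_lip] r.integrable_h by blast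
    have int_mass: "integrable (\<nu> n) (\<lambda>\<omega>. h n \<omega> * (if \<omega> 0 \<in> U then 1 else 0))" for U
      using ind_set_lip r.integrable_h by blast
    have R_eq: "h n \<omega> * R \<omega> = (\<Sum>w\<in>Bad. h n \<omega> * ind k (point w) \<omega>) + (\<Sum>i<k. h n \<omega> * r.outside Q ((shift ^^ i) \<omega>))" for \<omega>
      by (simp add: R_def distrib_left sum_distrib_left)
    have int_R: "integrable (\<nu> n) (\<lambda>\<omega>. h n \<omega> * R \<omega>)"
      unfolding R_eq using int_ind int_out by auto
    have "E n R = (\<Sum>w\<in>Bad. E n (ind k (point w))) + (\<Sum>i<k. E n (\<lambda>\<omega>. r.outside Q ((shift ^^ i) \<omega>)))"
      unfolding R_eq using int_ind int_out by (simp add: Bochner_Integration.integral_sum)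
    also have "\<dots> \<le> (\<Sum>w\<in>Bad. d / (real (card Bad) + 1)) + (\<Sum>i<k. d / real k)"
    proof (intro add_mono sum_mono)
      fix i show "E n (\<lambda>\<omega>. r.outside Q ((shift ^^ i) \<omega>)) \<le> d / real k"
        using r.E_shift_funpow[OF r.outside_lip, of n Q i] elim(1) by simp
    qed (use elim(2) in \<open>auto intro: less_imp_le\<close>)
    also have "\<dots> \<le> d + d" using d k(1) by (intro add_mono) (auto simp: field_simps)
    finally have ER: "E n R \<le> 2 * d" by simp
    have mass_eq: "(\<Sum>U\<in>\<U>. mass n U * EU U f) = (\<integral>\<omega>. h n \<omega> * \<Phi> \<omega> \<partial>\<nu> n)"
    proof -
      have "(\<integral>\<omega>. h n \<omega> * \<Phi> \<omega> \<partial>\<nu> n) = (\<integral>\<omega>. (\<Sum>U\<in>\<U>. (h n \<omega> * (if \<omega> 0 \<in> U then 1 else 0)) * EU U f) \<partial>\<nu> n)"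
        unfolding \<Phi>_def by (simp add: sum_distrib_left mult.assoc)
      also have "\<dots> = (\<Sum>U\<in>\<U>. mass n U * EU U f)"
        using int_mass by (simp add: Bochner_Integration.integral_sum mass_def)
      finally show ?thesis by simp
    qed
    have Ef: "E n f = (\<integral>\<omega>. ces n N \<omega> \<partial>\<nu> n)"
      unfolding ces_def by (rule sym, rule r.cesaro_integral[OF f]) (rule f_le)
    have "\<bar>E n f - (\<Sum>U\<in>\<U>. mass n U * EU U f)\<bar> = \<bar>\<integral>\<omega>. ces n N \<omega> - h n \<omega> * \<Phi> \<omega> \<partial>\<nu> n\<bar>"
      unfolding mass_eq Ef using int_ces int_\<Phi> by simp
    also have "\<dots> \<le> (\<integral>\<omega>. \<bar>ces n N \<omega> - h n \<omega> * \<Phi> \<omega>\<bar> \<partial>\<nu> n)" by (rule integral_abs_bound)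
    also have "\<dots> \<le> (\<integral>\<omega>. d * (K + 2) * h n \<omega> + K * (h n \<omega> * R \<omega>) \<partial>\<nu> n)"
    proof (rule integral_mono)
      fix \<omega> assume "\<omega> \<in> space (\<nu> n)"
      then have "\<omega> \<in> X" by (simp add: r.space_nu)
      from pointwise[OF this]
      show "\<bar>ces n N \<omega> - h n \<omega> * \<Phi> \<omega>\<bar> \<le> d * (K + 2) * h n \<omega> + K * (h n \<omega> * R \<omega>)"
        by (simp add: algebra_simps)
    qed (use int_ces int_\<Phi> int_h int_R in auto)
    also have "\<dots> = d * (K + 2) + K * E n R" using int_h int_R r.nu_h[of n] by simp
    also have "\<dots> \<le> d * (K + 2) + K * (2 * d)" using ER K by simp
    also have "\<dots> = d * (3 * K + 2)" by (simp add: algebra_simps)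
    finally show ?case using d_e by (simp add: dist_real_def)
  qed
qed

text \<open>The constant 1 has expectation 1 under all measures involved, so the components exhaust
  the total mass asymptotically.\<close>

lemma mass_total: "(\<lambda>n. \<Sum>U\<in>\<U>. mass n U) \<longlonglongrightarrow> 1"
proof -
  have "(\<lambda>n. E n (\<lambda>_. 1) - (\<Sum>U\<in>\<U>. mass n U * EU U (\<lambda>_. 1))) \<longlonglongrightarrow> 0"
    by (rule E_tendsto_cone[of _ 1]) (auto intro: cone_const)
  moreover have "EU U (\<lambda>_. 1) = 1" if "U \<in> \<U>" for U using rpf.nu_h[OF rpf_family[OF that]] by simp
  ultimately have "(\<lambda>n. 1 - (\<Sum>U\<in>\<U>. mass n U)) \<longlonglongrightarrow> 0" using r.nu_h by simp
  from tendsto_diff[OF tendsto_const[of 1] this] show ?thesis by simp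
qed

text \<open>The shift by \<open>2 * J\<close> moves \<open>f\<close> into the cone; undoing it
  leaves \<open>2 * J\<close> times the missing mass, which vanishes by
  \<open>mass_total\<close>.\<close>

lemma E_tendsto_lip:
  assumes f: "lip K f"
  shows "(\<lambda>n. E n f - (\<Sum>U\<in>\<U>. mass n U * EU U f)) \<longlonglongrightarrow> 0"
proof -
  define J where "J = \<bar>K\<bar> + 1"
  have J: "lip J f" "0 < J" using lip_on_mono[OF f, of J] theta by (auto simp: J_def)
  let ?f = "\<lambda>\<omega>. f \<omega> + 2 * J"
  have "(\<lambda>n. E n ?f - (\<Sum>U\<in>\<U>. mass n U * EU U ?f)) \<longlonglongrightarrow> 0"
  proof (rule E_tendsto_cone[OF lip_cone[OF J]])
    show "f \<omega> + 2 * J \<le> 3 * J" if "\<omega> \<in> X" for \<omega> using lip_onD[OF J(1) that] by simp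
  qed (use J in auto)
  moreover have "E n ?f = E n f + 2 * J" for n
    using r.integrable_h[OF f, of n] r.h_lip r.lip_integrable r.nu_h[of n]
    by (subst distrib_left, subst Bochner_Integration.integral_add) (auto intro: r.integrable_h[OF lip_on_const[OF theta(1)]])
  moreover have "EU U ?f = EU U f + 2 * J" if "U \<in> \<U>" for U
    using rpf.integrable_h[OF rpf_family[OF that] f] rpf.integrable_h[OF rpf_family[OF that] lip_on_const[OF theta(1)]]
      rpf.nu_h[OF rpf_family[OF that]]
    by (subst distrib_left, subst Bochner_Integration.integral_add) auto
  ultimately have "(\<lambda>n. E n f + 2 * J - (\<Sum>U\<in>\<U>. mass n U * (EU U f + 2 * J))) \<longlonglongrightarrow> 0" by simp
  then have "(\<lambda>n. (E n f - (\<Sum>U\<in>\<U>. mass n U * EU U f)) + 2 * J * (1 - (\<Sum>U\<in>\<U>. mass n U))) \<longlonglongrightarrow> 0"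
    by (simp add: distrib_left sum.distrib sum_distrib_left algebra_simps)
  from tendsto_diff[OF this tendsto_mult[OF tendsto_const[of "2 * J"] tendsto_diff[OF tendsto_const[of 1] mass_total]]]
  show ?thesis by simp
qed

text \<open>The finitely many masses lie in [0, 1], so a common subsequence converges;
  \<open>t\<close> numbers the components only to fit the countable index type of the diagonal
  argument.\<close>

lemma convergence:
  "\<exists>r \<delta>. strict_mono (r :: nat \<Rightarrow> nat) \<and> (\<Sum>U\<in>\<U>. \<delta> U) = 1 \<and>
    (\<forall>K f. lip K f \<longrightarrow> (\<lambda>n. E (r n) f) \<longlonglongrightarrow> (\<Sum>U\<in>\<U>. \<delta> U * EU U f))"
proof -
  obtain t :: "'s set \<Rightarrow> nat" where t: "inj_on t \<U>" using finite_imp_inj_to_nat_seg[OF finite_family] by blast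
  define F where "F n i = mass n (the_inv_into \<U> t i)" for n i
  have "Bseq (\<lambda>n. F n i)" for i
    by (rule BseqI'[of _ 1]) (use mass_range in \<open>auto simp: F_def\<close>)
  then obtain r where r: "strict_mono (r :: nat \<Rightarrow> nat)" "\<And>i. convergent (\<lambda>n. F (r n) i)"
    using diagonal_convergent[of F] by blast
  define \<delta> where "\<delta> U = lim (\<lambda>n. mass (r n) U)" for U
  have \<delta>: "(\<lambda>n. mass (r n) U) \<longlonglongrightarrow> \<delta> U" if "U \<in> \<U>" for U
  proof -
    have "convergent (\<lambda>n. mass (r n) U)"
      using r(2)[of "t U"] by (simp add: F_def the_inv_into_f_f[OF t that])
    then show ?thesis unfolding \<delta>_def by (simp add: convergent_LIMSEQ_iff)
  qed
  have "(\<lambda>n. \<Sum>U\<in>\<U>. mass (r n) U) \<longlonglongrightarrow> (\<Sum>U\<in>\<U>. \<delta> U)" by (intro tendsto_sum \<delta>)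
  moreover have "(\<lambda>n. \<Sum>U\<in>\<U>. mass (r n) U) \<longlonglongrightarrow> 1"
    using LIMSEQ_subseq_LIMSEQ[OF mass_total r(1)] by (simp add: o_def)
  ultimately have "(\<Sum>U\<in>\<U>. \<delta> U) = 1" by (rule LIMSEQ_unique)
  moreover have "(\<lambda>n. E (r n) f) \<longlonglongrightarrow> (\<Sum>U\<in>\<U>. \<delta> U * EU U f)" if "lip K f" for K f
  proof -
    have "(\<lambda>n. E (r n) f - (\<Sum>U\<in>\<U>. mass (r n) U * EU U f)) \<longlonglongrightarrow> 0"
      using LIMSEQ_subseq_LIMSEQ[OF E_tendsto_lip[OF that] r(1)] by (simp add: o_def)
    moreover have "(\<lambda>n. \<Sum>U\<in>\<U>. mass (r n) U * EU U f) \<longlonglongrightarrow> (\<Sum>U\<in>\<U>. \<delta> U * EU U f)"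
      by (intro tendsto_sum tendsto_mult \<delta> tendsto_const)
    ultimately have "(\<lambda>n. (E (r n) f - (\<Sum>U\<in>\<U>. mass (r n) U * EU U f)) + (\<Sum>U\<in>\<U>. mass (r n) U * EU U f))
       \<longlonglongrightarrow> 0 + (\<Sum>U\<in>\<U>. \<delta> U * EU U f)" by (rule tendsto_add)
    then show ?thesis by simp
  qed
  ultimately show ?thesis using r(1) by blast
qed

end

section \<open>Components\<close>

lemma successively_imp_rtranclp:
  "successively P w \<Longrightarrow> w \<noteq> [] \<Longrightarrow> P\<^sup>*\<^sup>* (hd w) (last w)"
proof (induction w rule: induct_list012)
  case (3 x y zs)
  then have "P x y" "P\<^sup>*\<^sup>* y (last (y # zs))" by auto
  then show ?case by (auto intro: converse_rtranclp_into_rtranclp)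
qed auto

lemma path_iff_tranclp: "(\<exists>w. successively P (a # w @ [b])) \<longleftrightarrow> P\<^sup>+\<^sup>+ a b"
proof
  assume "\<exists>w. successively P (a # w @ [b])"
  then obtain w where w: "successively P (a # w @ [b])" by blast
  then show "P\<^sup>+\<^sup>+ a b"
  proof (cases w)
    case (Cons x xs)
    then have "P a x" "P\<^sup>*\<^sup>* x b" using w successively_imp_rtranclp[of P "x # xs @ [b]"] by auto
    then show ?thesis by (rule rtranclp_into_tranclp2)
  qed auto
next
  assume "P\<^sup>+\<^sup>+ a b"
  then show "\<exists>w. successively P (a # w @ [b])"
  proof (induction rule: converse_tranclp_induct)
    case (base y)
    then show ?case by (intro exI[of _ "[]"]) auto
  next
    case (step y z)
    then obtain w where "successively P (z # w @ [b])" by blast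
    then show ?case using step.hyps by (intro exI[of _ "z # w"]) auto
  qed
qed

lemma communicating_iff: "(a, b) \<in> communicating B \<longleftrightarrow> B\<^sup>*\<^sup>* a b \<and> B\<^sup>*\<^sup>* b a"
proof -
  have "(a, b) \<in> communicating B \<longleftrightarrow> a = b \<or> B\<^sup>+\<^sup>+ a b \<and> B\<^sup>+\<^sup>+ b a"
    unfolding communicating_def path_iff_tranclp[symmetric] by auto
  then show ?thesis by (metis rtranclpD rtranclp.rtrancl_refl tranclp_into_rtranclp)
qed

text \<open>Every state on a path between two members communicates with both, so the path never
  leaves the class.\<close>

lemma component_irreducible:
  assumes U: "U \<in> UNIV // communicating B" and a: "a \<in> U" and b: "b \<in> U"
  shows "(submatrix_on B U)\<^sup>*\<^sup>* a b"
proof -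
  obtain c where c: "U = communicating B `` {c}" using U by (auto elim: quotientE)
  have mem: "x \<in> U \<longleftrightarrow> B\<^sup>*\<^sup>* c x \<and> B\<^sup>*\<^sup>* x c" for x by (simp add: c communicating_iff)
  have "B\<^sup>*\<^sup>* a b" using a b mem by (meson rtranclp_trans)
  then show ?thesis using a
  proof (induction rule: converse_rtranclp_induct)
    case (step x y)
    have "y \<in> U"
      using step b mem by (meson rtranclp.rtrancl_into_rtrancl rtranclp_trans)
    then have "submatrix_on B U x y" using step by (auto simp: submatrix_on_def)
    then show ?case using step.IH[OF \<open>y \<in> U\<close>] by (rule converse_rtranclp_into_rtranclp)
  qed auto
qed

lemma component_eq:
  assumes "U \<in> UNIV // communicating B" "a \<in> U"
  shows "U = communicating B `` {a}"
proof -
  obtain c where c: "U = communicating B `` {c}" using assms(1) by (auto elim: quotientE)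
  then have "B\<^sup>*\<^sup>* c a" "B\<^sup>*\<^sup>* a c" using assms(2) by (auto simp: communicating_iff)
  then show ?thesis unfolding c by (auto simp: communicating_iff intro: rtranclp_trans)
qed

lemma B_matrix_le: "B_matrix A \<phi> \<le> A"
proof -
  have "A i j" if "B_matrix A \<phi> i j" for i j
  proof -
    obtain \<omega> where "\<omega> \<in> cylinder A [i, j]" using \<open>B_matrix A \<phi> i j\<close> by (auto simp: B_matrix_def)
    then have "A (\<omega> 0) (\<omega> (Suc 0))" "\<omega> 0 = i" "\<omega> (Suc 0) = j"
      by (auto simp: cylinder_def shift_space_def less_Suc_eq)
    then show ?thesis by simp
  qed
  then show ?thesis by (auto simp: le_fun_def)
qed

lemma submatrix_on_le: "submatrix_on B U \<le> B"
  by (auto simp: submatrix_on_def le_fun_def)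

lemma mem_cylinder_pair:
  "\<upsilon> \<in> cylinder A [\<omega> 0, \<omega> (Suc 0)] \<longleftrightarrow> \<upsilon> \<in> shift_space A \<and> agree 2 \<omega> \<upsilon>"
  by (auto simp: cylinder_def agree_def numeral_2_eq_2 less_Suc_eq)

text \<open>The pressure of a subshift refers to its own cylinders, so its description by growth
  rates has to be applied with the subshift as ambient space.\<close>

lemma (in potential) restrict_space_potential:
  assumes "M \<le> A" shows "potential \<theta> M p C q"
proof unfold_locales
  note X = subsetD[OF shift_space_mono[OF assms]]
  show "0 \<le> p \<omega>" "p \<omega> \<le> q (\<omega> 0)" if "\<omega> \<in> shift_space M" for \<omega>
    using p_nonneg p_le X[OF that] by auto
  show "p \<omega> \<le> exp (C * \<theta> ^ k) * p \<upsilon>"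
    if "\<omega> \<in> shift_space M" "\<upsilon> \<in> shift_space M" "2 \<le> k" "agree k \<omega> \<upsilon>" for \<omega> \<upsilon> k
    by (rule p_dist[OF X[OF that(1)] X[OF that(2)] that(3,4)])
qed (use theta C_nonneg q_nonneg q_summable in auto)

lemma (in rpf) integral_density_complex:
  fixes f :: "(nat \<Rightarrow> 's) \<Rightarrow> complex"
  assumes f: "lip_on \<theta> X K f"
  shows "\<exists>J. lip J (\<lambda>\<omega>. Re (f \<omega>))" "\<exists>J. lip J (\<lambda>\<omega>. Im (f \<omega>))"
    "(LINT \<omega>|density \<nu> (\<lambda>\<omega>. ennreal (h \<omega>)). f \<omega>) =
       of_real (E (\<lambda>\<omega>. Re (f \<omega>))) + \<i> * of_real (E (\<lambda>\<omega>. Im (f \<omega>)))"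
proof -
  have re: "lip K (\<lambda>\<omega>. Re (f \<omega>))" and im: "lip K (\<lambda>\<omega>. Im (f \<omega>))"
    using f unfolding lip_on_def
    by (metis abs_Re_le_cmod abs_Im_le_cmod minus_complex.sel real_norm_def order_trans)+
  then show "\<exists>J. lip J (\<lambda>\<omega>. Re (f \<omega>))" "\<exists>J. lip J (\<lambda>\<omega>. Im (f \<omega>))" by auto
  have f_meas: "f \<in> borel_measurable \<nu>"
    using borel_measurable_continuous_on_restrict[OF lip_on_continuous[OF f theta]]
      measurable_cong_sets[OF sets_nu refl] by blast
  have h_meas: "h \<in> borel_measurable \<nu>" using h_lip lip_measurable by blast
  have h0: "AE \<omega> in \<nu>. 0 \<le> h \<omega>" by (rule AE_I2) (simp add: space_nu h_nonneg)
  note ir = integrable_h[OF re] and ii = integrable_h[OF im]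
  have "(LINT \<omega>|density \<nu> (\<lambda>\<omega>. ennreal (h \<omega>)). f \<omega>) = (LINT \<omega>|\<nu>. h \<omega> *\<^sub>R f \<omega>)"
    by (rule integral_density[OF f_meas h_meas h0])
  also have "\<dots> = (LINT \<omega>|\<nu>. of_real (h \<omega> * Re (f \<omega>)) + \<i> * of_real (h \<omega> * Im (f \<omega>)))"
    by (intro Bochner_Integration.integral_cong refl) (simp add: complex_eq_iff)
  also have "\<dots> = (LINT \<omega>|\<nu>. of_real (h \<omega> * Re (f \<omega>))) + (LINT \<omega>|\<nu>. \<i> * of_real (h \<omega> * Im (f \<omega>)))"
    using ir ii by (intro Bochner_Integration.integral_add integrable_mult_right integrable_of_real)
  also have "(LINT \<omega>|\<nu>. \<i> * of_real (h \<omega> * Im (f \<omega>))) = \<i> * (LINT \<omega>|\<nu>. of_real (h \<omega> * Im (f \<omega>)))"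
    by (rule integral_mult_right_zero)
  finally show "(LINT \<omega>|density \<nu> (\<lambda>\<omega>. ennreal (h \<omega>)). f \<omega>) =
       of_real (E (\<lambda>\<omega>. Re (f \<omega>))) + \<i> * of_real (E (\<lambda>\<omega>. Im (f \<omega>)))"
    by (simp only: integral_complex_of_real)
qed

text \<open>For real functions the complex operator has real values, so the eigenvalue and dual
  equations can be read off as real ones.\<close>

lemma (in potential) rpf_of_RPF_measure:
  assumes M: "M \<le> A" "\<And>a b. M a b \<Longrightarrow> a \<in> U \<and> b \<in> U" "\<And>a b. a \<in> U \<Longrightarrow> b \<in> U \<Longrightarrow> M\<^sup>*\<^sup>* a b"
    and pos: "\<And>\<omega>. \<omega> \<in> X \<Longrightarrow> M (\<omega> 0) (\<omega> (Suc 0)) \<Longrightarrow> 0 < p \<omega>"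
    and p: "\<And>\<omega>. \<omega> \<in> X \<Longrightarrow> enn2real (eexp (\<psi> \<omega>)) = p \<omega>"
    and RPF: "is_RPF_measure \<theta> A M \<psi> \<mu>"
  shows "\<exists>h \<nu>. rpf \<theta> A p C q M h \<nu> (enn2real (eexp (pressure M \<psi>))) U \<and> \<mu> = density \<nu> (\<lambda>\<omega>. ennreal (h \<omega>))"
proof -
  let ?l = "enn2real (eexp (pressure M \<psi>))"
  obtain h \<nu> where h0: "\<forall>\<omega>\<in>X. 0 \<le> h \<omega>" and hF: "(\<lambda>\<omega>. complex_of_real (h \<omega>)) \<in> Fb \<theta> X"
    and eig: "\<forall>\<omega>\<in>X. ruelle_op M \<psi> (\<lambda>\<omega>. complex_of_real (h \<omega>)) \<omega> = of_real ?l * of_real (h \<omega>)"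
    and sets: "sets \<nu> = sets (restrict_space borel X)" and tot: "emeasure \<nu> X = 1"
    and supp: "AE \<omega> in \<nu>. \<omega> \<in> shift_space M"
    and dual: "\<forall>f\<in>Fb \<theta> X. (LINT \<omega>|\<nu>. ruelle_op M \<psi> f \<omega>) = of_real ?l * (LINT \<omega>|\<nu>. f \<omega>)"
    and nu_h: "(LINT \<omega>|\<nu>. h \<omega>) = 1" and mu: "\<mu> = density \<nu> (\<lambda>\<omega>. ennreal (h \<omega>))"
    using RPF unfolding is_RPF_measure_def Let_def by blast
  have space: "space \<nu> = X" using sets_eq_imp_space_eq[OF sets] by (simp add: space_restrict_space)
  have ruelle: "ruelle_op M \<psi> (\<lambda>\<omega>. complex_of_real (f \<omega>)) \<omega> = of_real (transfer M p f \<omega>)"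
    if f: "bdd f" and w: "\<omega> \<in> X" for f \<omega>
  proof -
    have "ruelle_op M \<psi> (\<lambda>\<omega>. complex_of_real (f \<omega>)) \<omega> =
        (\<Sum>\<^sub>\<infinity>a\<in>{a. M a (\<omega> 0)}. of_real (p (case_nat a \<omega>) * f (case_nat a \<omega>)))"
      unfolding ruelle_op_def
      by (rule infsum_cong) (use Cons_in_X[OF M(1) w] p in auto)
    also have "\<dots> = of_real (transfer M p f \<omega>)"
      by (rule infsumI[OF has_sum_of_real[OF transfer_has_sum[OF M(1) f w]]])
    finally show ?thesis .
  qed
  have of_real_lip: "lip_on \<theta> X K (\<lambda>\<omega>. complex_of_real (f \<omega>)) \<longleftrightarrow> lip K f" for K f
    by (simp add: lip_on_def flip: of_real_diff)
  obtain K where K: "lip K h" using hF of_real_lip by (auto simp: Fb_iff_lip[OF theta])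
  have "rpf \<theta> A p C q M h \<nu> ?l U"
  proof unfold_locales
    show "transfer M p h \<omega> = ?l * h \<omega>" if "\<omega> \<in> X" for \<omega>
      using eig that ruelle[OF lip_bdd[OF K] that] by (metis of_real_eq_iff of_real_mult)
    show "(\<integral>\<omega>. transfer M p f \<omega> \<partial>\<nu>) = ?l * (\<integral>\<omega>. f \<omega> \<partial>\<nu>)" if f: "lip_on \<theta> X J f" for J f
    proof -
      have "(\<lambda>\<omega>. complex_of_real (f \<omega>)) \<in> Fb \<theta> X" using f of_real_lip by (auto simp: Fb_iff_lip[OF theta])
      then have "(LINT \<omega>|\<nu>. ruelle_op M \<psi> (\<lambda>\<omega>. complex_of_real (f \<omega>)) \<omega>) = of_real ?l * (LINT \<omega>|\<nu>. complex_of_real (f \<omega>))"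
        using dual by blast
      moreover have "(LINT \<omega>|\<nu>. ruelle_op M \<psi> (\<lambda>\<omega>. complex_of_real (f \<omega>)) \<omega>) = (LINT \<omega>|\<nu>. complex_of_real (transfer M p f \<omega>))"
        by (rule Bochner_Integration.integral_cong[OF refl]) (simp add: space ruelle[OF lip_bdd[OF f]])
      ultimately have "complex_of_real (\<integral>\<omega>. transfer M p f \<omega> \<partial>\<nu>) = of_real (?l * (\<integral>\<omega>. f \<omega> \<partial>\<nu>))"
        by (simp add: integral_complex_of_real)
      then show ?thesis by (simp only: of_real_eq_iff)
    qed
  qed (use M pos h0 K sets tot supp nu_h in auto)
  then show ?thesis using mu by blast
qed

context potential
begin

lemma pressure_growth:
  assumes \<phi>: "\<And>\<omega>. \<omega> \<in> X \<Longrightarrow> \<phi> \<omega> \<noteq> \<infinity>" "\<And>\<omega>. \<omega> \<in> X \<Longrightarrow> eexp (\<phi> \<omega>) = ennreal (p \<omega>)"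
    and P: "pressure A \<phi> = ereal P"
  shows "exp P < \<rho> \<Longrightarrow> \<rho> \<in> growth A" "0 < \<rho> \<Longrightarrow> \<rho> < exp P \<Longrightarrow> \<rho> \<notin> growth A"
proof -
  have eq: "ereal P = (INF \<rho>\<in>growth A. ereal (ln \<rho>))"
    unfolding P[symmetric] by (rule pressure_eq) (simp_all add: \<phi>)
  {
    assume r: "exp P < \<rho>"
    then have r0: "0 < \<rho>" by (meson exp_gt_zero less_trans)
    then have "P < ln \<rho>" using r ln_less_cancel_iff[of "exp P" \<rho>] by simp
    then have "(INF \<rho>\<in>growth A. ereal (ln \<rho>)) < ereal (ln \<rho>)" by (simp add: eq[symmetric])
    then obtain \<rho>' where \<rho>': "\<rho>' \<in> growth A" "ln \<rho>' < ln \<rho>" by (auto simp: INF_less_iff)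
    then have "\<rho>' < \<rho>" using r0 by (simp add: growth_def)
    then show "\<rho> \<in> growth A" using growth_upward[OF \<rho>'(1)] by simp
  next
    assume r: "0 < \<rho>" "\<rho> < exp P"
    show "\<rho> \<notin> growth A"
    proof
      assume "\<rho> \<in> growth A"
      then have "ereal P \<le> ereal (ln \<rho>)" unfolding eq by (rule INF_lower)
      then have "exp P \<le> \<rho>" using r(1) by (simp add: ln_ge_iff)
      then show False using r by simp
    qed
  }
qed

end

text \<open>A word of positive weight that starts at \<open>c\<close> and arrives in the class
  \<open>U\<close> of \<open>c\<close> never leaves \<open>U\<close>: its states are reachable from
  \<open>c\<close> and lead back. So loops at \<open>c\<close> see only the component.\<close>

lemma (in potential) iter_state_ind_component:
  assumes B: "\<And>\<omega>. \<omega> \<in> X \<Longrightarrow> 0 < p \<omega> \<Longrightarrow> B (\<omega> 0) (\<omega> (Suc 0))" and BA: "B \<le> A"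
    and U: "U = communicating B `` {c}" and x: "x \<in> X" "x 0 \<in> U"
  shows "(transfer A p ^^ i) (state_ind c) x = (transfer (submatrix_on B U) p ^^ i) (state_ind c) x"
  using x
proof (induction i arbitrary: x)
  case (Suc i)
  let ?g = "(transfer A p ^^ i) (state_ind c)" and ?g' = "(transfer (submatrix_on B U) p ^^ i) (state_ind c)"
  have mem: "a \<in> U \<longleftrightarrow> B\<^sup>*\<^sup>* c a \<and> B\<^sup>*\<^sup>* a c" for a by (simp add: U communicating_iff)
  have reach: "B\<^sup>*\<^sup>* c (y 0)" if y: "y \<in> X" "?g y \<noteq> 0" for y
  proof -
    have "0 \<le> ?g y" by (rule iter_nonneg[OF order_refl state_ind_nonneg y(1)])
    then have "0 < ?g y" using y(2) by simp
    then obtain \<upsilon> where \<upsilon>: "\<upsilon> \<in> X" "(shift ^^ i) \<upsilon> = y" "0 < state_ind c \<upsilon>"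
      "\<forall>j<i. 0 < p ((shift ^^ j) \<upsilon>) \<and> A (\<upsilon> j) (\<upsilon> (Suc j))"
      using iter_pos_path[where f = "state_ind c", OF order_refl state_ind_nonneg y(1)] by blast
    have "B\<^sup>*\<^sup>* (\<upsilon> 0) (\<upsilon> j)" if "j \<le> i" for j
      using that
    proof (induction j)
      case (Suc j)
      have "B ((shift ^^ j) \<upsilon> 0) ((shift ^^ j) \<upsilon> (Suc 0))"
        using \<upsilon>(1,4) Suc.prems by (intro B shift_funpow_in) auto
      then show ?case using Suc by (auto simp: funpow_shift intro: rtranclp.rtrancl_into_rtrancl)
    qed auto
    moreover have "\<upsilon> i = y 0" using arg_cong[OF \<upsilon>(2), of "\<lambda>\<xi>. \<xi> 0"] by (simp add: funpow_shift)
    moreover have "\<upsilon> 0 = c" using \<upsilon>(3) by (auto simp: state_ind_def split: if_splits)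
    ultimately show ?thesis by (metis order_refl)
  qed
  have "(\<Sum>\<^sub>\<infinity>a\<in>{a. A a (x 0)}. p (case_nat a x) * ?g (case_nat a x)) =
      (\<Sum>\<^sub>\<infinity>a\<in>{a. submatrix_on B U a (x 0)}. p (case_nat a x) * ?g' (case_nat a x))"
  proof (rule infsum_cong_neutral)
    fix a assume a: "a \<in> {a. A a (x 0)} - {a. submatrix_on B U a (x 0)}"
    then have X: "case_nat a x \<in> X" by (intro Cons_in_shift_space Suc.prems) auto
    show "p (case_nat a x) * ?g (case_nat a x) = 0"
    proof (rule ccontr)
      assume nz: "p (case_nat a x) * ?g (case_nat a x) \<noteq> 0"
      then have "0 < p (case_nat a x)" using p_nonneg[OF X] by simp
      then have "B a (x 0)" using B[OF X] by simp
      moreover have "B\<^sup>*\<^sup>* c a" using reach[OF X] nz by simp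
      moreover have "B\<^sup>*\<^sup>* a c"
        using \<open>B a (x 0)\<close> Suc.prems(2) mem by (meson converse_rtranclp_into_rtranclp)
      ultimately have "submatrix_on B U a (x 0)" using Suc.prems(2) mem by (auto simp: submatrix_on_def)
      then show False using a by simp
    qed
  next
    fix a assume a: "a \<in> {a. submatrix_on B U a (x 0)} - {a. A a (x 0)}"
    then show "p (case_nat a x) * ?g' (case_nat a x) = 0"
      using BA by (auto simp: submatrix_on_def le_fun_def)
  next
    fix a assume a: "a \<in> {a. A a (x 0)} \<inter> {a. submatrix_on B U a (x 0)}"
    then have "case_nat a x \<in> X" "case_nat a x 0 \<in> U"
      by (auto intro: Cons_in_shift_space Suc.prems simp: submatrix_on_def)
    then show "p (case_nat a x) * ?g (case_nat a x) = p (case_nat a x) * ?g' (case_nat a x)"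
      by (simp add: Suc.IH)
  qed
  then have "transfer A p ?g x = transfer (submatrix_on B U) p ?g' x"
    by (simp only: transfer_def[of A p ?g x] transfer_def[of "submatrix_on B U" p ?g' x])
  then show ?case by simp
qed auto

locale limit_potential = potential \<theta> A p C q
  for \<theta> and A :: "'s::{countable,discrete_topology} \<Rightarrow> 's \<Rightarrow> bool" and p C q +
  fixes \<phi> :: "(nat \<Rightarrow> 's) \<Rightarrow> ereal" and P :: real
  assumes phi_fin: "\<omega> \<in> shift_space A \<Longrightarrow> \<phi> \<omega> \<noteq> \<infinity>"
    and eexp_phi: "\<omega> \<in> shift_space A \<Longrightarrow> eexp (\<phi> \<omega>) = ennreal (p \<omega>)"
    and pressure_P: "pressure A \<phi> = ereal P"
begin

section \<open>Components of maximal pressure\<close>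

abbreviation B where "B \<equiv> B_matrix A \<phi>"
abbreviation BU where "BU U \<equiv> submatrix_on B U"

lemma BU_le: "BU U \<le> A"
  using submatrix_on_le[of B U] B_matrix_le[of A \<phi>] by (rule order_trans)

lemma p_pos_iff: "\<omega> \<in> X \<Longrightarrow> 0 < p \<omega> \<longleftrightarrow> \<bar>\<phi> \<omega>\<bar> \<noteq> \<infinity>"
proof -
  assume w: "\<omega> \<in> X"
  show ?thesis
  proof (cases "\<phi> \<omega>")
    case (real x)
    then have "ennreal (p \<omega>) = ennreal (exp x)" using eexp_phi[OF w] by simp
    then have "p \<omega> = exp x" using p_nonneg[OF w] by simp
    then show ?thesis using real by simp
  next
    case MInf
    then have "ennreal (p \<omega>) = 0" using eexp_phi[OF w] by (simp add: eexp_def)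
    then have "p \<omega> \<le> 0" by (simp add: ennreal_eq_0_iff)
    then show ?thesis using MInf by simp
  qed (use phi_fin[OF w] in auto)
qed

text \<open>By bounded distortion with two agreeing letters, \<open>p\<close> is positive at one
  point of a two letter cylinder exactly if it is positive at all of them.\<close>

lemma B_iff: "\<omega> \<in> X \<Longrightarrow> B (\<omega> 0) (\<omega> (Suc 0)) \<longleftrightarrow> 0 < p \<omega>"
proof
  assume w: "\<omega> \<in> X" and "B (\<omega> 0) (\<omega> (Suc 0))"
  then have "\<bar>\<phi> \<omega>\<bar> \<noteq> \<infinity>" unfolding B_matrix_def using mem_cylinder_pair[of \<omega> A \<omega>] by simp
  then show "0 < p \<omega>" using p_pos_iff[OF w] by simp
next
  assume w: "\<omega> \<in> X" and pw: "0 < p \<omega>"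
  have "\<bar>\<phi> \<upsilon>\<bar> \<noteq> \<infinity>" if "\<upsilon> \<in> cylinder A [\<omega> 0, \<omega> (Suc 0)]" for \<upsilon>
  proof -
    have u: "\<upsilon> \<in> X" "agree 2 \<omega> \<upsilon>" using that mem_cylinder_pair by auto
    have "p \<omega> \<le> exp (C * \<theta> ^ 2) * p \<upsilon>" by (rule p_dist[OF w u(1) order_refl u(2)])
    then have "0 < exp (C * \<theta> ^ 2) * p \<upsilon>" using pw by linarith
    then have "0 < p \<upsilon>" by (simp add: zero_less_mult_iff)
    then show ?thesis using p_pos_iff[OF u(1)] by simp
  qed
  moreover have "\<omega> \<in> cylinder A [\<omega> 0, \<omega> (Suc 0)]" using mem_cylinder_pair[of \<omega> A \<omega>] w by simp
  then have "cylinder A [\<omega> 0, \<omega> (Suc 0)] \<noteq> {}" by (metis empty_iff)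
  ultimately show "B (\<omega> 0) (\<omega> (Suc 0))" by (simp add: B_matrix_def)
qed

lemma component_pressure:
  "pressure (BU U) \<phi> = (INF \<rho>\<in>potential.growth (BU U) p (BU U). ereal (ln \<rho>))"
proof (rule potential.pressure_eq[OF restrict_space_potential[OF BU_le]])
  fix \<omega> assume "\<omega> \<in> shift_space (BU U)"
  then have "\<omega> \<in> X" using shift_space_mono[OF BU_le] by (rule subsetD[rotated])
  then show "\<phi> \<omega> \<noteq> \<infinity>" "eexp (\<phi> \<omega>) = ennreal (p \<omega>)" by (rule phi_fin, rule eexp_phi)
qed

text \<open>The operator of the component is dominated by that of \<open>A\<close>, so every rate
  for \<open>A\<close> is a rate for the component.\<close>

lemma component_pressure_le: "pressure (BU U) \<phi> \<le> ereal P"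
proof -
  have "growth A \<subseteq> potential.growth (BU U) p (BU U)"
  proof
    fix \<rho> assume "\<rho> \<in> growth A"
    then obtain K where K: "0 < \<rho>" "\<And>k \<omega>. \<omega> \<in> X \<Longrightarrow> (transfer A p ^^ k) (\<lambda>_. 1) \<omega> \<le> K * \<rho> ^ k"
      by (auto simp: growth_def)
    show "\<rho> \<in> potential.growth (BU U) p (BU U)"
    proof (rule potential.growthI[OF restrict_space_potential[OF BU_le] K(1)])
      fix k \<omega> assume "\<omega> \<in> shift_space (BU U)"
      then have w: "\<omega> \<in> X" using shift_space_mono[OF BU_le] by blast
      have "(transfer (BU U) p ^^ k) (\<lambda>_. 1) \<omega> \<le> (transfer A p ^^ k) (\<lambda>_. 1) \<omega>"
        by (rule iter_mono_matrix[OF BU_le order_refl bdd_const _ w]) simp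
      then show "(transfer (BU U) p ^^ k) (\<lambda>_. 1) \<omega> \<le> K * \<rho> ^ k" using K(2)[OF w, of k] by linarith
    qed
  qed
  moreover have "ereal P = (INF \<rho>\<in>growth A. ereal (ln \<rho>))"
    unfolding pressure_P[symmetric] by (rule pressure_eq) (simp_all add: phi_fin eexp_phi)
  ultimately show ?thesis unfolding component_pressure by (auto intro: INF_superset_mono)
qed

text \<open>A component avoiding \<open>Q\<close> has one-step norm at most half of
  \<open>exp P\<close>, hence smaller pressure. For finite \<open>Q\<close> this leaves only
  finitely many candidates.\<close>

lemma max_component_meets:
  assumes Q: "(\<Sum>\<^sub>\<infinity>a\<in>-Q. q a) \<le> exp P / 2" and U: "U \<in> max_components A \<phi>"
  shows "U \<inter> Q \<noteq> {}"
proof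
  assume disj: "U \<inter> Q = {}"
  interpret u: potential \<theta> "BU U" p C q by (rule restrict_space_potential[OF BU_le])
  have "exp P / 2 \<in> u.growth (BU U)"
  proof (rule u.growth_one_step[OF order_refl order_refl])
    fix \<omega> assume w: "\<omega> \<in> shift_space (BU U)"
    have "\<bar>transfer (BU U) p (\<lambda>_. 1) \<omega>\<bar> \<le> (\<Sum>\<^sub>\<infinity>a\<in>{a. BU U a (\<omega> 0)}. q a * 1)"
      by (rule u.transfer_le_states[OF order_refl _ w]) (use q_summable in auto)
    also have "\<dots> \<le> (\<Sum>\<^sub>\<infinity>a\<in>-Q. q a)"
      using q_nonneg q_summable disj
      by (intro infsum_mono_neutral) (auto intro: summable_on_subset_banach simp: submatrix_on_def)
    finally show "(transfer (BU U) p ^^ 1) (\<lambda>_. 1) \<omega> \<le> (exp P / 2) ^ 1" using Q by simp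
  qed simp
  then have "pressure (BU U) \<phi> \<le> ereal (ln (exp P / 2))"
    unfolding component_pressure by (rule INF_lower)
  then have "P \<le> ln (exp P / 2)" using U pressure_P by (simp add: max_components_def)
  also have "\<dots> < P" by (simp add: ln_div)
  finally show False by simp
qed

lemma max_component_class: "U \<in> max_components A \<phi> \<Longrightarrow> U \<in> UNIV // communicating B"
  by (simp add: max_components_def)

lemma finite_max_components: "finite (max_components A \<phi>)"
proof -
  obtain Q where Q: "finite Q" "(\<Sum>\<^sub>\<infinity>a\<in>-Q. q a) \<le> exp P / 2"
    using summable_tail[OF q_summable q_nonneg, of "exp P / 2"] by auto
  have "max_components A \<phi> \<subseteq> (\<lambda>a. communicating B `` {a}) ` Q"
    using max_component_meets[OF Q(2)] component_eq[OF max_component_class] by fastforce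
  then show ?thesis using Q(1) finite_surj by blast
qed

lemma max_components_disjoint:
  "U \<in> max_components A \<phi> \<Longrightarrow> V \<in> max_components A \<phi> \<Longrightarrow> a \<in> U \<Longrightarrow> a \<in> V \<Longrightarrow> U = V"
  using component_eq[OF max_component_class] by metis

text \<open>If the normalised return weight does not tend to 0, some return path of length at least
  \<open>k\<close> has positive weight. Repeating it gives a periodic point in the component of its
  first state; and the loops at this state stay inside the component, so the rate of the component
  is at least that of the whole system.\<close>

lemma return_dichotomy:
  assumes y: "y \<in> X" and k: "1 \<le> k"
  shows "(\<exists>U\<in>max_components A \<phi>. \<exists>z\<in>shift_space (BU U). agree k y z) \<or>
      (\<lambda>j. (transfer A p ^^ j) (ind k y) y / exp P ^ j) \<longlonglongrightarrow> 0"
proof (rule disjCI)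
  assume "\<not> (\<lambda>j. (transfer A p ^^ j) (ind k y) y / exp P ^ j) \<longlonglongrightarrow> 0"
  then obtain d where d: "0 < d" "\<not> (\<forall>\<^sub>F j in sequentially. dist ((transfer A p ^^ j) (ind k y) y / exp P ^ j) 0 < d)"
    by (auto simp: tendsto_iff)
  have ind0: "0 \<le> (transfer A p ^^ j) (ind k y) y" for j
    by (rule iter_nonneg[OF order_refl ind_range(1) y])
  have freq: "\<exists>j\<ge>j0. d * exp P ^ j \<le> (transfer A p ^^ j) (ind k y) y" for j0
  proof -
    obtain j where "j0 \<le> j" "\<not> (transfer A p ^^ j) (ind k y) y / exp P ^ j < d"
      using d(2) ind0 by (auto simp: eventually_sequentially)
    then show ?thesis by (intro exI[of _ j]) (simp add: field_simps)
  qed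
  obtain j where j: "k \<le> j" "d * exp P ^ j \<le> (transfer A p ^^ j) (ind k y) y" using freq by blast
  have "0 < d * exp P ^ j" using d(1) by simp
  then have "0 < (transfer A p ^^ j) (ind k y) y" using j(2) by linarith
  then obtain \<upsilon> where \<upsilon>: "\<upsilon> \<in> X" "(shift ^^ j) \<upsilon> = y" "0 < ind k y \<upsilon>"
    "\<forall>i<j. 0 < p ((shift ^^ i) \<upsilon>) \<and> A (\<upsilon> i) (\<upsilon> (Suc i))"
    using iter_pos_path[where f = "ind k y", OF order_refl ind_range(1) y] by blast
  define c where "c = y 0"
  define U where "U = communicating B `` {c}"
  have mem: "a \<in> U \<longleftrightarrow> B\<^sup>*\<^sup>* c a \<and> B\<^sup>*\<^sup>* a c" for a by (simp add: U_def communicating_iff)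
  have ag: "agree k y \<upsilon>" using \<upsilon>(3) by (auto simp: ind_def split: if_splits)
  have v0: "\<upsilon> 0 = c" using agree_zeroth[OF ag k] by (simp add: c_def)
  have vj: "\<upsilon> j = c" using arg_cong[OF \<upsilon>(2), of "\<lambda>\<xi>. \<xi> 0"] by (simp add: funpow_shift c_def)
  have edge: "B (\<upsilon> i) (\<upsilon> (Suc i))" if "i < j" for i
    using B_iff[OF shift_funpow_in[OF \<upsilon>(1), of i]] \<upsilon>(4) that by (simp add: funpow_shift)
  have forward: "B\<^sup>*\<^sup>* c (\<upsilon> i)" if "i \<le> j" for i
    using that
  proof (induction i)
    case (Suc i)
    then have "B\<^sup>*\<^sup>* c (\<upsilon> i)" "B (\<upsilon> i) (\<upsilon> (Suc i))" using edge by simp_all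
    then show ?case by (rule rtranclp.rtrancl_into_rtrancl)
  qed (simp add: v0)
  have backward': "B\<^sup>*\<^sup>* (\<upsilon> (j - i)) c" if "i \<le> j" for i
    using that
  proof (induction i)
    case (Suc i)
    then have "B (\<upsilon> (j - Suc i)) (\<upsilon> (j - i))" using edge[of "j - Suc i"] by (simp add: Suc_diff_Suc)
    moreover have "B\<^sup>*\<^sup>* (\<upsilon> (j - i)) c" using Suc by simp
    ultimately show ?case by (rule converse_rtranclp_into_rtranclp)
  qed (simp add: vj)
  have backward: "B\<^sup>*\<^sup>* (\<upsilon> i) c" if "i \<le> j" for i using backward'[of "j - i"] that by simp
  have inU: "\<upsilon> i \<in> U" if "i \<le> j" for i using forward[OF that] backward[OF that] mem by blast
  have j0: "0 < j" using j k by simp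
  \<comment> \<open>The periodic repetition of the return path; \<open>k \<le> j\<close> ensures
    agreement with \<open>y\<close> on the first \<open>k\<close> letters.\<close>
  define z where "z i = \<upsilon> (i mod j)" for i
  have zU: "z \<in> shift_space (BU U)"
    unfolding shift_space_def
  proof (intro CollectI allI)
    fix i
    have lt: "i mod j < j" using j0 by simp
    have "z (Suc i) = \<upsilon> (Suc (i mod j))"
      unfolding z_def by (simp add: mod_Suc v0 vj)
    then have "B (z i) (z (Suc i))" "z i \<in> U" "z (Suc i) \<in> U"
      using edge[OF lt] inU[of "i mod j"] inU[of "Suc (i mod j)"] lt by (auto simp: z_def)
    then show "BU U (z i) (z (Suc i))" by (simp add: submatrix_on_def)
  qed
  have ag_z: "agree k y z" using ag j(1) by (auto simp: agree_def z_def)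
  have zX: "z \<in> X" using zU shift_space_mono[OF BU_le] by blast
  have z0: "z 0 = c" using v0 by (simp add: z_def)
  have cone_s: "cone 1 c0 ((transfer A p ^^ i) (state_ind c))" for i
  proof -
    have "cone 1 c0 (ind 1 y)" by (rule ind_cone)
    moreover have "ind 1 y = state_ind c" by (auto simp: ind_def state_ind_def c_def)
    ultimately show ?thesis by (intro cone_iter_1 state_ind_bdd) auto
  qed
  \<comment> \<open>A rate of the component below \<open>exp P\<close> would make the normalised
    return weight decay geometrically, against the lower bound \<open>d\<close> attained infinitely
    often.\<close>
  have "exp P \<le> \<rho>" if \<rho>: "\<rho> \<in> potential.growth (BU U) p (BU U)" for \<rho>
  proof (rule ccontr)
    assume lt: "\<not> exp P \<le> \<rho>"
    obtain K where K: "0 < \<rho>" "0 < K"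
      "\<And>i \<omega>. \<omega> \<in> shift_space (BU U) \<Longrightarrow> (transfer (BU U) p ^^ i) (\<lambda>_. 1) \<omega> \<le> K * \<rho> ^ i"
      by (rule potential.growthE[OF restrict_space_potential[OF BU_le] \<rho>]) blast
    have up: "(transfer A p ^^ i) (ind k y) y \<le> exp c0 * K * \<rho> ^ i" for i
    proof -
      have "(transfer A p ^^ i) (ind k y) y \<le> (transfer A p ^^ i) (state_ind c) y"
      proof (rule iter_mono[OF order_refl ind_bdd state_ind_bdd _ y])
        fix \<omega> show "ind k y \<omega> \<le> state_ind c \<omega>"
          using agree_zeroth[OF _ k, of y \<omega>] by (auto simp: ind_def state_ind_def c_def)
      qed
      also have "\<dots> \<le> exp c0 * (transfer A p ^^ i) (state_ind c) z"
        by (rule cone_le'[OF cone_s c0_nonneg y zX]) (simp add: z0 c_def)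
      also have "(transfer A p ^^ i) (state_ind c) z = (transfer (BU U) p ^^ i) (state_ind c) z"
        by (rule iter_state_ind_component[OF _ B_matrix_le U_def zX]) (use B_iff inU[of 0] in \<open>auto simp: z0 v0\<close>)
      also have "\<dots> \<le> (transfer (BU U) p ^^ i) (\<lambda>_. 1) z"
        by (rule iter_mono[OF BU_le state_ind_bdd bdd_const _ zX]) (simp add: state_ind_def)
      also have "\<dots> \<le> K * \<rho> ^ i" by (rule K(3)[OF zU])
      finally show ?thesis by simp
    qed
    have "(\<lambda>i. exp c0 * K * (\<rho> / exp P) ^ i) \<longlonglongrightarrow> exp c0 * K * 0"
      using lt K by (intro tendsto_mult tendsto_const LIMSEQ_power_zero) (auto simp: field_simps)
    then have "\<forall>\<^sub>F i in sequentially. exp c0 * K * (\<rho> / exp P) ^ i < d"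
      using d(1) by (intro order_tendstoD) auto
    then obtain i0 where i0: "\<And>i. i0 \<le> i \<Longrightarrow> exp c0 * K * (\<rho> / exp P) ^ i < d"
      by (auto simp: eventually_sequentially)
    obtain i where i: "i0 \<le> i" "d * exp P ^ i \<le> (transfer A p ^^ i) (ind k y) y" using freq by blast
    have "d * exp P ^ i \<le> exp c0 * K * \<rho> ^ i" using i(2) up[of i] by linarith
    then have "d \<le> exp c0 * K * (\<rho> / exp P) ^ i" by (simp add: power_divide field_simps)
    then show False using i0[OF i(1)] by simp
  qed
  then have "ereal P \<le> pressure (BU U) \<phi>"
    unfolding component_pressure
    by (intro INF_greatest) (auto simp: ln_ge_iff potential.growth_def[OF restrict_space_potential[OF BU_le]])
  then have "pressure (BU U) \<phi> = pressure A \<phi>" using component_pressure_le pressure_P by (simp add: antisym)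
  moreover have "U \<in> UNIV // communicating B" unfolding U_def by (rule quotientI) simp
  ultimately have "U \<in> max_components A \<phi>" by (simp add: max_components_def)
  then show "\<exists>U\<in>max_components A \<phi>. \<exists>z\<in>shift_space (BU U). agree k y z" using zU ag_z by blast
qed

end

section \<open>Translation of the conditions (A.1) and (A.2)\<close>

lemma summable_on_of_infsum_ennreal:
  fixes z :: "'a \<Rightarrow> ennreal"
  assumes "infsum z UNIV < \<infinity>"
  shows "(\<lambda>a. enn2real (z a)) summable_on UNIV" "z a = ennreal (enn2real (z a))"
proof -
  have sum_le: "sum z F \<le> infsum z UNIV" if "finite F" for F
    by (subst nonneg_infsum_complete, simp, rule SUP_upper) (use that in auto)
  have fin: "z a < \<infinity>" for a using sum_le[of "{a}"] assms by (simp add: le_less_trans)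
  show eq: "z a = ennreal (enn2real (z a))" for a using fin[of a] by (simp add: less_top)
  show "(\<lambda>a. enn2real (z a)) summable_on UNIV"
  proof (rule nonneg_bdd_above_summable_on)
    show "bdd_above (sum (\<lambda>a. enn2real (z a)) ` {F. F \<subseteq> UNIV \<and> finite F})"
    proof (rule bdd_aboveI2)
      fix F :: "'a set" assume F: "F \<in> {F. F \<subseteq> UNIV \<and> finite F}"
      have "ennreal (sum (\<lambda>a. enn2real (z a)) F) = sum z F"
        using eq by (subst sum_ennreal[symmetric]) auto
      also have "\<dots> \<le> infsum z UNIV" using F by (intro sum_le) auto
      also have "\<dots> = ennreal (enn2real (infsum z UNIV))" using assms by (simp add: less_top)
      finally show "sum (\<lambda>a. enn2real (z a)) F \<le> enn2real (infsum z UNIV)" by (simp add: ennreal_le_iff)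
    qed
  qed simp
qed

text \<open>The exponentiated form is the one that passes to the limit where \<phi> is minus
  infinity.\<close>

lemma cond_A1_bound:
  assumes "cond_A1 \<theta> A \<phi>e" "0 < \<theta>" "\<theta> < 1"
  shows "\<exists>C\<ge>0. \<forall>e\<in>{0<..<1}. \<forall>\<omega>\<in>shift_space A. \<forall>\<upsilon>\<in>shift_space A. \<forall>k\<ge>2. agree k \<omega> \<upsilon> \<longrightarrow>
    exp (\<phi>e e \<omega>) \<le> exp (C * \<theta> ^ k) * exp (\<phi>e e \<upsilon>)"
proof -
  define z where "z = (SUP \<epsilon>\<in>{0<..<1}. lip_seminorm \<theta> (shift_space A) 2 (\<phi>e \<epsilon>))"
  have z: "z = ennreal (enn2real z)" using assms(1) by (simp add: cond_A1_def z_def less_top)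
  show ?thesis
  proof (intro exI[of _ "enn2real z"] conjI ballI allI impI)
    fix e :: real and \<omega> \<upsilon> and k :: nat
    assume *: "e \<in> {0<..<1}" "\<omega> \<in> shift_space A" "\<upsilon> \<in> shift_space A" "2 \<le> k" "agree k \<omega> \<upsilon>"
    have "lip_seminorm \<theta> (shift_space A) 2 (\<phi>e e) \<le> z" unfolding z_def by (rule SUP_upper[OF *(1)])
    then have "norm (\<phi>e e \<omega> - \<phi>e e \<upsilon>) \<le> enn2real z * \<theta> ^ k"
      using z by (intro lip_seminorm_bound[OF assms(2,3) _ _ *(2-5)]) auto
    then have "\<phi>e e \<omega> \<le> enn2real z * \<theta> ^ k + \<phi>e e \<upsilon>" by (simp add: abs_le_iff)
    then show "exp (\<phi>e e \<omega>) \<le> exp (enn2real z * \<theta> ^ k) * exp (\<phi>e e \<upsilon>)" by (simp add: exp_add[symmetric])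
  qed simp
qed

theorem theorem1p1:
  fixes A :: "'s::{countable,discrete_topology} \<Rightarrow> 's \<Rightarrow> bool"
    and \<theta> :: real
    and \<phi>e :: "real \<Rightarrow> (nat \<Rightarrow> 's) \<Rightarrow> real"
    and \<phi> :: "(nat \<Rightarrow> 's) \<Rightarrow> ereal"
    and \<mu> :: "real \<Rightarrow> (nat \<Rightarrow> 's) measure"
    and \<mu>U :: "'s set \<Rightarrow> (nat \<Rightarrow> 's) measure"
    and \<epsilon> :: "nat \<Rightarrow> real"
  assumes "irreducible_matrix A"
    and "0 < \<theta>" and "\<theta> < 1"
    and "cond_A1 \<theta> A \<phi>e" and "cond_A2 A \<phi>e" and "cond_A3 A \<phi>e \<phi>"
    and "\<And>e. e \<in> {0<..<1} \<Longrightarrow> is_RPF_measure \<theta> A A (\<lambda>\<omega>. ereal (\<phi>e e \<omega>)) (\<mu> e)"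
    and "\<And>U. U \<in> max_components A \<phi> \<Longrightarrow>
           is_RPF_measure \<theta> A (submatrix_on (B_matrix A \<phi>) U) \<phi> (\<mu>U U)"
    and "\<And>n. \<epsilon> n \<in> {0<..<1}" and "\<epsilon> \<longlonglongrightarrow> 0"
  shows "finite (max_components A \<phi>) \<and>
    (\<exists>(r :: nat \<Rightarrow> nat) (\<delta> :: 's set \<Rightarrow> real).
       strict_mono r \<and>
       (\<Sum>U\<in>max_components A \<phi>. \<delta> U) \<le> 1 \<and>
       (\<forall>f\<in>Fb0 \<theta> (shift_space A).
          (\<lambda>n. LINT \<omega>|\<mu> (\<epsilon> (r n)). f \<omega>)
            \<longlonglongrightarrow> (\<Sum>U\<in>max_components A \<phi>. of_real (\<delta> U) * (LINT \<omega>|\<mu>U U. f \<omega>))))"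
proof -
  note irr = assms(1) and theta = assms(2,3) and A1 = assms(4) and A2 = assms(5) and A3 = assms(6)
    and RPF = assms(7) and RPF_U = assms(8) and eps = assms(9,10)
  let ?X = "shift_space A" and ?B = "B_matrix A \<phi>"
  obtain C where C: "0 \<le> C" and dist: "\<And>e \<omega> \<upsilon> k. e \<in> {0<..<1} \<Longrightarrow> \<omega> \<in> ?X \<Longrightarrow> \<upsilon> \<in> ?X \<Longrightarrow> 2 \<le> k \<Longrightarrow>
      agree k \<omega> \<upsilon> \<Longrightarrow> exp (\<phi>e e \<omega>) \<le> exp (C * \<theta> ^ k) * exp (\<phi>e e \<upsilon>)"
    using cond_A1_bound[OF A1 theta] by blast
  define Z where "Z a = eexp (SUP \<epsilon>\<in>{0<..<1}. SUP \<omega>\<in>cylinder A [a]. ereal (\<phi>e \<epsilon> \<omega>))" for a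
  have Z: "infsum Z UNIV < \<infinity>" using A2 unfolding cond_A2_def Z_def[abs_def] .
  define q where "q a = enn2real (Z a)" for a
  have q_sum: "q summable_on UNIV" and Zq: "\<And>a. Z a = ennreal (q a)" and q0: "\<And>a. 0 \<le> q a"
    using summable_on_of_infsum_ennreal[OF Z] by (auto simp: q_def[abs_def])
  have cyl: "\<omega> \<in> cylinder A [\<omega> 0]" if "\<omega> \<in> ?X" for \<omega> using that by (simp add: cylinder_def)
  have le_q: "exp (\<phi>e e \<omega>) \<le> q (\<omega> 0)" if e: "e \<in> {0<..<1}" and w: "\<omega> \<in> ?X" for e \<omega>
  proof -
    have "ereal (\<phi>e e \<omega>) \<le> (SUP \<epsilon>\<in>{0<..<1}. SUP \<upsilon>\<in>cylinder A [\<omega> 0]. ereal (\<phi>e \<epsilon> \<upsilon>))"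
      by (rule SUP_upper2[OF e], rule SUP_upper[OF cyl[OF w]])
    from eexp_mono[OF this] have "ennreal (exp (\<phi>e e \<omega>)) \<le> ennreal (q (\<omega> 0))"
      using Zq[of "\<omega> 0"] by (simp add: Z_def)
    then show ?thesis using q0 by (simp add: ennreal_le_iff)
  qed
  define p where "p \<omega> = enn2real (eexp (\<phi> \<omega>))" for \<omega>
  have phi_fin: "\<phi> \<omega> \<noteq> \<infinity>" if "\<omega> \<in> ?X" for \<omega> using A3 that by (auto simp: cond_A3_def)
  have eexp_phi: "eexp (\<phi> \<omega>) = ennreal (p \<omega>)" if "\<omega> \<in> ?X" for \<omega>
    using phi_fin[OF that] by (cases "\<phi> \<omega>") (auto simp: p_def eexp_def)
  define S where "S n a = (SUP \<omega>\<in>cylinder A [a]. ennreal \<bar>exp (\<phi>e (\<epsilon> n) \<omega>) - p \<omega>\<bar>)" for n a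
  have eps0: "filterlim \<epsilon> (at_right 0) sequentially"
    unfolding filterlim_at using eps by (auto intro!: always_eventually simp: less_imp_neq[symmetric])
  have S: "(\<lambda>n. S n a) \<longlonglongrightarrow> 0" for a
  proof -
    have "((\<lambda>e. SUP \<omega>\<in>cylinder A [a]. ennreal \<bar>exp (\<phi>e e \<omega>) - p \<omega>\<bar>) \<longlongrightarrow> 0) (at_right 0)"
      using A3 unfolding cond_A3_def p_def by blast
    from filterlim_compose[OF this eps0] show ?thesis by (simp add: S_def)
  qed
  have S_ge: "ennreal \<bar>exp (\<phi>e (\<epsilon> n) \<omega>) - p \<omega>\<bar> \<le> S n (\<omega> 0)" if "\<omega> \<in> ?X" for n \<omega>
    unfolding S_def by (rule SUP_upper[OF cyl[OF that]])
  \<comment> \<open>Pointwise convergence carries both the majorant and the distortion bound from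
    the perturbed exponentials to \<open>p\<close>.\<close>
  have p_lim: "(\<lambda>n. exp (\<phi>e (\<epsilon> n) \<omega>)) \<longlonglongrightarrow> p \<omega>" if w: "\<omega> \<in> ?X" for \<omega>
  proof -
    have "(\<lambda>n. ennreal \<bar>exp (\<phi>e (\<epsilon> n) \<omega>) - p \<omega>\<bar>) \<longlonglongrightarrow> 0"
      by (rule tendsto_sandwich[OF _ _ tendsto_const S[of "\<omega> 0"]]) (use S_ge[OF w] in auto)
    then have "(\<lambda>n. ennreal \<bar>exp (\<phi>e (\<epsilon> n) \<omega>) - p \<omega>\<bar>) \<longlonglongrightarrow> ennreal 0" by simp
    then have "(\<lambda>n. \<bar>exp (\<phi>e (\<epsilon> n) \<omega>) - p \<omega>\<bar>) \<longlonglongrightarrow> 0" by (rule tendsto_ennrealD) auto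
    then show ?thesis by (simp add: tendsto_rabs_zero_iff LIM_zero_iff)
  qed
  have p0: "0 \<le> p \<omega>" for \<omega> by (simp add: p_def)
  have p_q: "p \<omega> \<le> q (\<omega> 0)" if w: "\<omega> \<in> ?X" for \<omega>
    by (rule LIMSEQ_le_const2[OF p_lim[OF w]]) (use le_q[OF eps(1) w] in blast)
  have "potential \<theta> A p C q"
  proof unfold_locales
    show "p \<omega> \<le> exp (C * \<theta> ^ k) * p \<upsilon>" if "\<omega> \<in> ?X" "\<upsilon> \<in> ?X" "2 \<le> k" "agree k \<omega> \<upsilon>" for \<omega> \<upsilon> k
      by (rule LIMSEQ_le[OF p_lim[OF that(1)] tendsto_mult[OF tendsto_const p_lim[OF that(2)]]])
        (use dist[OF eps(1) that] in blast)
  qed (use theta C p0 p_q q0 q_sum in auto)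
  then interpret potential \<theta> A p C q .
  have pot_e: "potential \<theta> A (\<lambda>\<omega>. exp (\<phi>e e \<omega>)) C q" if "e \<in> {0<..<1}" for e
    by unfold_locales (use theta C q0 q_sum le_q[OF that] dist[OF that] in auto)
  obtain P where P: "pressure A \<phi> = ereal P" using A3 by (auto simp: cond_A3_def)
  interpret limit_potential \<theta> A p C q \<phi> P
    by unfold_locales (simp_all add: phi_fin eexp_phi P)
  have irr_A: "A\<^sup>*\<^sup>* a b" for a b
    using irr successively_imp_rtranclp[of A] unfolding irreducible_matrix_def by metis
  have "\<exists>h \<nu>. rpf \<theta> A (\<lambda>\<omega>. exp (\<phi>e e \<omega>)) C q A h \<nu> (enn2real (eexp (pressure A (\<lambda>\<omega>. ereal (\<phi>e e \<omega>))))) UNIV \<and>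
      \<mu> e = density \<nu> (\<lambda>\<omega>. ennreal (h \<omega>))" if e: "e \<in> {0<..<1}" for e
    by (rule potential.rpf_of_RPF_measure[OF pot_e[OF e] order_refl _ _ _ _ RPF[OF e]]) (auto simp: irr_A)
  then have "\<forall>n. \<exists>h \<nu>. rpf \<theta> A (\<lambda>\<omega>. exp (\<phi>e (\<epsilon> n) \<omega>)) C q A h \<nu>
      (enn2real (eexp (pressure A (\<lambda>\<omega>. ereal (\<phi>e (\<epsilon> n) \<omega>))))) UNIV \<and>
      \<mu> (\<epsilon> n) = density \<nu> (\<lambda>\<omega>. ennreal (h \<omega>))" using eps(1) by blast
  then obtain h \<nu> where h: "\<And>n. rpf \<theta> A (\<lambda>\<omega>. exp (\<phi>e (\<epsilon> n) \<omega>)) C q A (h n) (\<nu> n)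
      (enn2real (eexp (pressure A (\<lambda>\<omega>. ereal (\<phi>e (\<epsilon> n) \<omega>))))) UNIV"
    and mu: "\<And>n. \<mu> (\<epsilon> n) = density (\<nu> n) (\<lambda>\<omega>. ennreal (h n \<omega>))" by metis
  have "\<exists>g \<kappa>. rpf \<theta> A p C q (BU U) g \<kappa> (exp P) U \<and> \<mu>U U = density \<kappa> (\<lambda>\<omega>. ennreal (g \<omega>))"
    if U: "U \<in> max_components A \<phi>" for U
  proof -
    \<comment> \<open>Maximality of \<open>U\<close> means that its eigenvalue is
      \<open>exp P\<close>, the value shared by all maximal components.\<close>
    have "enn2real (eexp (pressure (BU U) \<phi>)) = exp P" using U P by (simp add: max_components_def)
    moreover have "\<exists>g \<kappa>. rpf \<theta> A p C q (BU U) g \<kappa> (enn2real (eexp (pressure (BU U) \<phi>))) U \<and>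
        \<mu>U U = density \<kappa> (\<lambda>\<omega>. ennreal (g \<omega>))"
    proof (rule rpf_of_RPF_measure[OF BU_le _ _ _ _ RPF_U[OF U]])
      show "(BU U)\<^sup>*\<^sup>* a b" if "a \<in> U" "b \<in> U" for a b
        by (rule component_irreducible[OF max_component_class[OF U] that])
      show "0 < p \<omega>" if "\<omega> \<in> ?X" "BU U (\<omega> 0) (\<omega> (Suc 0))" for \<omega>
        using B_iff[OF that(1)] that(2) by (simp add: submatrix_on_def)
    qed (auto simp: submatrix_on_def p_def)
    ultimately show ?thesis by simp
  qed
  then obtain g \<kappa> where g: "\<And>U. U \<in> max_components A \<phi> \<Longrightarrow> rpf \<theta> A p C q (BU U) (g U) (\<kappa> U) (exp P) U"
    and muU: "\<And>U. U \<in> max_components A \<phi> \<Longrightarrow> \<mu>U U = density (\<kappa> U) (\<lambda>\<omega>. ennreal (g U \<omega>))" by metis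
  \<comment> \<open>The suprema in (A.3) are extended reals; domination by \<open>q a\<close> makes
    them finite, so they serve as real error bounds uniform over the cylinder of
    \<open>a\<close>.\<close>
  have conv: "\<exists>s. s \<longlonglongrightarrow> 0 \<and> (\<forall>n. \<forall>\<omega>\<in>?X. \<omega> 0 = a \<longrightarrow> \<bar>exp (\<phi>e (\<epsilon> n) \<omega>) - p \<omega>\<bar> \<le> s n)" for a
  proof -
    have fin: "S n a \<le> ennreal (q a)" for n
      unfolding S_def
    proof (rule SUP_least)
      fix \<omega> assume "\<omega> \<in> cylinder A [a]"
      then have w: "\<omega> \<in> ?X" "\<omega> 0 = a" by (auto simp: cylinder_def)
      have "\<bar>exp (\<phi>e (\<epsilon> n) \<omega>) - p \<omega>\<bar> \<le> q a"
        using le_q[OF eps(1) w(1), of n] p_q[OF w(1)] p0[of \<omega>] exp_gt_zero[of "\<phi>e (\<epsilon> n) \<omega>"]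
        unfolding w(2) by linarith
      then show "ennreal \<bar>exp (\<phi>e (\<epsilon> n) \<omega>) - p \<omega>\<bar> \<le> ennreal (q a)" by (rule ennreal_leI)
    qed
    have eq: "S n a = ennreal (enn2real (S n a))" for n
    proof -
      have "S n a < top" using fin[of n] by (rule le_less_trans) simp
      then show ?thesis by simp
    qed
    have "(\<lambda>n. enn2real (S n a)) \<longlonglongrightarrow> 0"
      using S[of a] by (intro tendsto_enn2real) auto
    moreover have "\<bar>exp (\<phi>e (\<epsilon> n) \<omega>) - p \<omega>\<bar> \<le> enn2real (S n a)" if "\<omega> \<in> ?X" "\<omega> 0 = a" for n \<omega>
    proof -
      have "ennreal \<bar>exp (\<phi>e (\<epsilon> n) \<omega>) - p \<omega>\<bar> \<le> ennreal (enn2real (S n a))"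
        using S_ge[OF that(1), of n] that(2) eq[of n] by simp
      then show ?thesis by (simp add: ennreal_le_iff)
    qed
    ultimately show ?thesis by (intro exI[of _ "\<lambda>n. enn2real (S n a)"]) auto
  qed
  interpret f: perturbation_family \<theta> A p C q "\<lambda>n \<omega>. exp (\<phi>e (\<epsilon> n) \<omega>)" h \<nu>
    "\<lambda>n. enn2real (eexp (pressure A (\<lambda>\<omega>. ereal (\<phi>e (\<epsilon> n) \<omega>))))" "exp P" "max_components A \<phi>" BU g \<kappa>
  proof (intro perturbation_family.intro perturbation.intro perturbation_axioms.intro
      perturbation_family_axioms.intro)
    show "potential \<theta> A p C q" by (rule potential_axioms)
    show "\<rho> \<in> growth A" if "exp P < \<rho>" for \<rho>
      by (rule pressure_growth(1)[OF _ _ P that]) (simp_all add: phi_fin eexp_phi)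
    show "\<rho> \<notin> growth A" if "0 < \<rho>" "\<rho> < exp P" for \<rho>
      by (rule pressure_growth(2)[OF _ _ P that]) (simp_all add: phi_fin eexp_phi)
  qed (fact h conv finite_max_components g max_components_disjoint return_dichotomy | simp)+
  obtain r \<delta> where r: "strict_mono (r :: nat \<Rightarrow> nat)" and \<delta>: "(\<Sum>U\<in>max_components A \<phi>. \<delta> U) = 1"
    and lim: "\<And>K f. lip K f \<Longrightarrow> (\<lambda>n. \<integral>\<omega>. h (r n) \<omega> * f \<omega> \<partial>\<nu> (r n)) \<longlonglongrightarrow>
      (\<Sum>U\<in>max_components A \<phi>. \<delta> U * (\<integral>\<omega>. g U \<omega> * f \<omega> \<partial>\<kappa> U))"
    using f.convergence by blast
  have "(\<lambda>n. LINT \<omega>|\<mu> (\<epsilon> (r n)). f \<omega>)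
      \<longlonglongrightarrow> (\<Sum>U\<in>max_components A \<phi>. of_real (\<delta> U) * (LINT \<omega>|\<mu>U U. f \<omega>))" if f: "f \<in> Fb0 \<theta> ?X" for f
  proof -
    obtain K where K: "lip_on \<theta> ?X K f" using f by (auto simp: Fb0_def Fb_iff_lip[OF theta])
    \<comment> \<open>Real and imaginary parts are treated separately, with the same subsequence and
      the same weights.\<close>
    obtain J where J: "lip J (\<lambda>\<omega>. Re (f \<omega>))" using rpf.integral_density_complex(1)[OF h K] by blast
    obtain J' where J': "lip J' (\<lambda>\<omega>. Im (f \<omega>))" using rpf.integral_density_complex(2)[OF h K] by blast
    note int_n = rpf.integral_density_complex(3)[OF h K, folded mu]
    have int_U: "(LINT \<omega>|\<mu>U U. f \<omega>) = of_real (\<integral>\<omega>. g U \<omega> * Re (f \<omega>) \<partial>\<kappa> U) + \<i> * of_real (\<integral>\<omega>. g U \<omega> * Im (f \<omega>) \<partial>\<kappa> U)"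
      if "U \<in> max_components A \<phi>" for U
      using rpf.integral_density_complex(3)[OF g[OF that] K] muU[OF that] by simp
    have "(\<Sum>U\<in>max_components A \<phi>. complex_of_real (\<delta> U) * (LINT \<omega>|\<mu>U U. f \<omega>)) =
      of_real (\<Sum>U\<in>max_components A \<phi>. \<delta> U * (\<integral>\<omega>. g U \<omega> * Re (f \<omega>) \<partial>\<kappa> U)) +
      \<i> * of_real (\<Sum>U\<in>max_components A \<phi>. \<delta> U * (\<integral>\<omega>. g U \<omega> * Im (f \<omega>) \<partial>\<kappa> U))"
      by (simp add: int_U distrib_left sum.distrib sum_distrib_left mult.left_commute)
    moreover have "(\<lambda>n. LINT \<omega>|\<mu> (\<epsilon> (r n)). f \<omega>) \<longlonglongrightarrow>
      of_real (\<Sum>U\<in>max_components A \<phi>. \<delta> U * (\<integral>\<omega>. g U \<omega> * Re (f \<omega>) \<partial>\<kappa> U)) +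
      \<i> * of_real (\<Sum>U\<in>max_components A \<phi>. \<delta> U * (\<integral>\<omega>. g U \<omega> * Im (f \<omega>) \<partial>\<kappa> U))"
      unfolding int_n by (intro tendsto_intros lim[OF J] lim[OF J'])
    ultimately show ?thesis by simp
  qed
  then show ?thesis using r \<delta> finite_max_components by (intro conjI exI[of _ r] exI[of _ \<delta>] ballI) auto
qed

end
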